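(* Let $0<M_1<M_2$ and $R_2>R_1>2M_2$, and use the notation of the context. The following statements hold. (i) The $L^1$-relaxation of $\mathcal I$ is $\mathcal J$, i.e. $\mathcal I_{\mathrm{rel}}[u]=\mathcal J[u]$ for every $u\in\mathcal A_{BV}$. Moreover $$\min_{u\in\mathcal A_{BV}}\mathcal J[u]=\inf_{u\in\mathcal A_\infty}\mathcal I[u]=\lambda_*.$$ The unique minimizer of $\mathcal J$ on $\mathcal A_{BV}$ is $u_*$ (up to a.e. equality), and no $u\in\mathcal A_\infty$ attains the infimum of $\mathcal I$. (ii) If $u_n\in\mathcal A_\infty$ and $\mathcal I[u_n]\to\lambda_*$, then $u_n\to u_*$ in $L^1(\mathbb R)$, $$(u_n')_+\,dr\xrightarrow{\,w^*\,}H_*\delta_a,\qquad (u_n')_-\,dr\xrightarrow{\,w^*\,}H_*\delta_{R_2},$$ and the convergence $u_n\to u_*$ is strict in $BV$ (i.e. also $|Du_n|(\mathbb R)\to|Du_*|(\mathbb R)$). (iii) There is a constant $C$ depending only on $M_1,M_2,R_1,R_2$ such that for every $u\in\mathcal A_{BV}$ with $\delta[u]:=\mathcal J[u]-\lambda_*\le 1$: if $a=x_0$, then $$\|u-u_*\|_{L^1}+\|F_u-F_*\|_{L^\infty}+\|F_u^{-1}-F_*^{-1}\|_{L^\infty}\le C\sqrt{\delta[u]},$$ and if $a=R_1>x_0$, then the same left-hand side is at most $C\,\delta[u]$. Both exponents ($1/2$ and $1$, respectively) are optimal, in that they cannot be replaced by a larger power of $\delta[u]$. (iv) Fix $M_1,M_2,R_2$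 and let $R_1$ vary in $(2M_2,R_2)$. The sharp value $R_1\mapsto\inf_{u\in\mathcal A_\infty(R_1,R_2)}\mathcal I[u]$ undergoes a transition at $R_1=x_0$: the optimal rising radius $a$ equals the point $x_0$ for $R_1\le x_0$ and equals $R_1$ for $R_1>x_0$. If $R_1$ is fixed and $R_2-R_1=L\downarrow 0$, then $$\lambda_*=\frac{R_1^{3/2}}{\sqrt{R_1-2M_1}}\,\frac1L+O(1).$$ The case $R_1\le x_0$ (interior phase) can occur only if $x_0>2M_2$; since $x_0<7M_1/3$, this requires $\Delta M/M_1<1/6$. If $\Delta M/M_1\ge 1/6$, then always $a=R_1>x_0$, so that only the linear stability regime in (iii) occurs. (v) For every sequence $u_n\in\mathcal A_\infty$ with $\mathcal I[u_n]\to\lambda_*$, the coefficients of the metrics $g_{u_n}$ converge uniformly to those of the single locally Lipschitz metric $g_*$ (independent of the sequence), and $G[g_{u_n}]\to G[g_*]$ as tensor distributions. With $\beta:=\Delta M\,H_*$, the nonzero mixed components of the limit are $$G^t{}_t[g_*]=G^r{}_r[g_*]=-2\beta\mathbf 1_{(a,R_2)},$$ $$G^\theta{}_\theta[g_*]=G^\phi{}_\phi[g_*]=-2\beta\mathbf 1_{(a,R_2)}-\beta a\,\delta_a+\beta R_2\,\delta_{R_2}.$$ In particular no $\delta'$ term occurs. (vi) The two Dirac terms in (v) are exactly the Israel surface tensors of $g_*$ at $r=a$ and $r=R_2$: the singular part of $G[g_*]$ equals $8\pi\left(S_a\,\delta_{\Sigma_a}+S_{R_2}\,\delta_{\Sigma_{R_2}}\right)$.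 Both layers have zero surface density, i.e. $S_a=\operatorname{diag}(0,p_a,p_a)$ and $S_{R_2}=\operatorname{diag}(0,p_{R_2},p_{R_2})$, with tangential pressures $$p_a=-\frac{\beta a}{8\pi\sqrt{1-2M_1/a}},\qquad p_{R_2}=\frac{\beta R_2}{8\pi\sqrt{1-2M_2/R_2}}.$$ For every sequence $u_n\in\mathcal A_\infty$ with $\mathcal I[u_n]\to\lambda_*$, the negative tangential NEC measures $\Xi_{u_n}$ converge weak-$*$ to a (positive multiple of a) Dirac measure at $a$, and $$4\pi a^2(-p_a)=\frac{\Delta M}{2}\lambda_*.$$
   Context: Parameters: $0<M_1<M_2$, $\Delta M:=M_2-M_1$, $R_2>R_1>2M_2$. For real $x$: $x_+=\max\{x,0\}$, $x_-=\max\{-x,0\}$. Smooth class: $\mathcal A_\infty=\mathcal A_\infty(R_1,R_2)$ is the set of $u\in C^\infty(\mathbb R)$ with $u\ge0$, $\operatorname{supp}u\subset(R_1,R_2)$, $\int_{R_1}^{R_2}r^2u(r)\,dr=1$. $BV$ class: $\mathcal A_{BV}$ is the set of $u\in BV(\mathbb R)$ (i.e. $u\in L^1(\mathbb R)$ whose distributional derivative $Du$ is a finite signed Radon measure) with $u\ge0$ a.e., $u=0$ a.e. on $\mathbb R\setminus[R_1,R_2]$, and $\int_{R_1}^{R_2}r^2u\,dr=1$. $Du=(Du)^+-(Du)^-$ is the Jordan decomposition. For $u$ in either class: $P_u(r)=\int_{R_1}^r s^2u(s)\,ds$ on $[R_1,R_2]$, extended by $0$ for $r\le R_1$ and $1$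 for $r\ge R_2$; $m_u=M_1+\Delta M\,P_u$; $F_u(r)=1-2m_u(r)/r$ (note $F_u\ge 1-2M_2/R_1>0$ on $[R_1,R_2]$); $g_u=-F_u\,dt^2+F_u^{-1}dr^2+r^2d\Omega^2$ (units $G=c=1$). $L^\infty$ norms of $F_u-F_*$, $F_u^{-1}-F_*^{-1}$ are over $[R_1,R_2]$. Functionals: $\mathcal I[u]=\int_{R_1}^{R_2}\frac{r^3(u'(r))_+}{\sqrt{F_u(r)}}\,dr$ for $u\in\mathcal A_\infty$; $\mathcal J[u]=\int_{[R_1,R_2]}\frac{r^3}{\sqrt{F_u(r)}}\,d(Du)^+(r)$ for $u\in\mathcal A_{BV}$. For $u\in\mathcal A_{BV}$, $\mathcal I_{\mathrm{rel}}[u]:=\inf\{\liminf_n\mathcal I[u_n]: u_n\in\mathcal A_\infty,\ u_n\to u\text{ in }L^1(\mathbb R)\}$ (with value $+\infty$ if no such sequence exists). Optimizer: $A(r)=\frac{R_2^3-r^3}{3}$, $q(r)=\frac{r^{7/2}}{\sqrt{r-2M_1}}$, $\Psi(r)=q(r)/A(r)$. There is a unique $x_0\in(2M_1,7M_1/3)$ with $M_1x_0^3+3R_2^3x_0-7M_1R_2^3=0$ (it depends only on $M_1,R_2$). Put $a=\max\{R_1,x_0\}$, $\lambda_*=\Psi(a)$, $H_*=1/A(a)$, $u_*=H_*\mathbf 1_{(a,R_2)}$, and $P_*=P_{u_*}$, $m_*=m_{u_*}$, $F_*=F_{u_*}$, $g_*=g_{u_*}$. The radius $a$, where $u_*$ jumps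 up, is called the optimal rising radius. Weak-$*$ convergence of measures is tested against continuous (compactly supported) functions of $r$. Einstein tensors: all metrics are considered in the chart $(t,r,\theta,\phi)$ with $r$ in an open interval containing $[R_1,R_2]$ on which $r>2M_1$; outside $[R_1,R_2]$ all $F_u$ coincide with the Schwarzschild functions of mass $M_1$ (inside) and $M_2$ (outside). For a metric $-F\,dt^2+F^{-1}dr^2+r^2d\Omega^2$ the mixed Einstein tensor is diagonal with $G^t{}_t=G^r{}_r=\frac{rF'+F-1}{r^2}$ and $G^\theta{}_\theta=G^\phi{}_\phi=\frac12F''+\frac{F'}{r}$, the derivatives being taken in the sense of distributions when $F$ is only locally Lipschitz. Convergence as tensor distributions means that each mixed component converges in $\mathcal D'$ on every compact coordinate cylinder; components depend on $r$ only and are paired with test functions using the coordinate measure $dt\,dr\,d\theta\,d\phi$. $\delta_c$ denotes the Dirac measure at $r=c$ with respect to $dr$. Israel layers: $\Sigma_c$ is the timelike hypersurface $r=c$, with unit normal $n=\sqrt F\,\partial_r$ (toward increasing $r$) and proper time $d\tau=\sqrt{F(c)}\,dt$; $K_{AB}=e_A{}^\mu e_B{}^\nu\nabla_\mu n_\nu$ in the tangent directions $(\tau,\theta,\phi)$; $[Q]=Q_+-Q_-$ is the jump across $\Sigma_c$; the Israel surface tensor is $(S_c)^A{}_B=-\frac1{8\pi}([K^A{}_B]-\delta^A{}_B[K])$, with $S_c=\operatorname{diag}(-\sigma,p,p)$, $\sigma$ the surface density and $p$ the tangential pressure. It is regarded as a spacetime tensor with vanishing components in the $r$ direction. $\delta_{\Sigma_c}$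 is defined by $\int\varphi\,\delta_{\Sigma_c}\,dV_g=\int_{\Sigma_c}\varphi\,dV_{\Sigma_c}$, so $\delta_{\Sigma_c}=\sqrt{F(c)}\,\delta_c$. Negative tangential NEC measure: for $u\in\mathcal A_\infty$, $\Xi_u$ is the positive measure on $[R_1,R_2]$ with $d\Xi_u=\frac{\Delta M}{2}\frac{r^3(u')_+}{\sqrt{F_u}}\,dr$. (This is $[-(\rho+p_t)]_+\,dV$, with $\rho+p_t=-\frac{\Delta M}{8\pi}ru'$ and $dV=4\pi r^2F_u^{-1/2}dr$.) *)

theory Defs
  imports "HOL-Probability.Probability" "HOL-Library.Landau_Symbols"
begin

section \<open>Smooth functions, test functions, distributions\<close>

primrec Ck :: "nat \<Rightarrow> ('a::euclidean_space \<Rightarrow> real) \<Rightarrow> bool" where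
  "Ck 0 f \<longleftrightarrow> continuous_on UNIV f"
| "Ck (Suc k) f \<longleftrightarrow> (\<forall>x. f differentiable (at x)) \<and> (\<forall>v. Ck k (\<lambda>x. frechet_derivative f (at x) v))"

definition smooth :: "('a::euclidean_space \<Rightarrow> real) \<Rightarrow> bool" where
  "smooth f \<longleftrightarrow> (\<forall>k. Ck k f)"

definition supp :: "('a::topological_space \<Rightarrow> real) \<Rightarrow> 'a set" where
  "supp f = closure {x. f x \<noteq> 0}"

definition test_fun :: "'a::euclidean_space set \<Rightarrow> ('a \<Rightarrow> real) \<Rightarrow> bool" where
  "test_fun U \<phi> \<longleftrightarrow> smooth \<phi> \<and> compact (supp \<phi>) \<and> supp \<phi> \<subseteq> U"

text \<open>Distributions are represented by their action on test functions; only their values on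
  test functions of the open set under consideration are meaningful.\<close>

type_synonym 'a distrib = "('a \<Rightarrow> real) \<Rightarrow> real"

definition fun_distrib :: "('a::euclidean_space \<Rightarrow> real) \<Rightarrow> 'a distrib" where
  "fun_distrib f \<phi> = (LINT x|lborel. f x * \<phi> x)"

definition mult_distrib :: "('a \<Rightarrow> real) \<Rightarrow> 'a distrib \<Rightarrow> 'a distrib" where
  "mult_distrib h T \<phi> = T (\<lambda>x. h x * \<phi> x)"

definition regular_distrib :: "'a::euclidean_space set \<Rightarrow> 'a distrib \<Rightarrow> bool" where
  "regular_distrib U T \<longleftrightarrow>
     (\<exists>f. (\<forall>K. compact K \<and> K \<subseteq> U \<longrightarrow> set_integrable lborel K f) \<and>
          (\<forall>\<phi>. test_fun U \<phi> \<longrightarrow> T \<phi> = fun_distrib f \<phi>))"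

definition radon_on :: "'a::euclidean_space set \<Rightarrow> 'a measure \<Rightarrow> bool" where
  "radon_on U \<mu> \<longleftrightarrow> sets \<mu> = sets borel \<and> (\<forall>K. compact K \<and> K \<subseteq> U \<longrightarrow> emeasure \<mu> K < \<infinity>)"

definition singular_distrib :: "'a::euclidean_space set \<Rightarrow> 'a distrib \<Rightarrow> bool" where
  "singular_distrib U T \<longleftrightarrow>
     (\<exists>\<mu> \<nu> Z. radon_on U \<mu> \<and> radon_on U \<nu> \<and> Z \<in> null_sets lborel \<and>
        emeasure \<mu> (U - Z) = 0 \<and> emeasure \<nu> (U - Z) = 0 \<and>
        (\<forall>\<phi>. test_fun U \<phi> \<longrightarrow> T \<phi> = (LINT x|\<mu>. \<phi> x) - (LINT x|\<nu>. \<phi> x)))"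

text \<open>\<open>S\<close> is the singular part of \<open>T\<close> in the Lebesgue decomposition of \<open>T\<close> as a signed Radon
  measure on \<open>U\<close>.\<close>

definition has_singular_part :: "'a::euclidean_space set \<Rightarrow> 'a distrib \<Rightarrow> 'a distrib \<Rightarrow> bool" where
  "has_singular_part U T S \<longleftrightarrow> singular_distrib U S \<and> regular_distrib U (\<lambda>\<phi>. T \<phi> - S \<phi>)"


section \<open>Functions of bounded variation, convergence notions\<close>

definition L1_dist :: "(real \<Rightarrow> real) \<Rightarrow> (real \<Rightarrow> real) \<Rightarrow> real" where
  "L1_dist u v = (LINT x|lborel. \<bar>u x - v x\<bar>)"

definition L1_conv :: "(nat \<Rightarrow> real \<Rightarrow> real) \<Rightarrow> (real \<Rightarrow> real) \<Rightarrow> bool" where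
  "L1_conv us u \<longleftrightarrow> (\<lambda>n. L1_dist (us n) u) \<longlonglongrightarrow> 0"

definition Linf_norm :: "real set \<Rightarrow> (real \<Rightarrow> real) \<Rightarrow> real" where
  "Linf_norm S f = Inf {c. 0 \<le> c \<and> (AE x in lborel. x \<in> S \<longrightarrow> \<bar>f x\<bar> \<le> c)}"

text \<open>The distributional derivative of \<open>u\<close> is the finite signed measure \<open>\<mu> - \<nu>\<close>.\<close>

definition has_Du :: "(real \<Rightarrow> real) \<Rightarrow> real measure \<Rightarrow> real measure \<Rightarrow> bool" where
  "has_Du u \<mu> \<nu> \<longleftrightarrow>
     sets \<mu> = sets borel \<and> sets \<nu> = sets borel \<and> finite_measure \<mu> \<and> finite_measure \<nu> \<and>
     (\<forall>\<phi>. test_fun UNIV \<phi> \<longrightarrow>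
        (LINT x|lborel. u x * deriv \<phi> x) = - ((LINT x|\<mu>. \<phi> x) - (LINT x|\<nu>. \<phi> x)))"

definition BV :: "(real \<Rightarrow> real) set" where
  "BV = {u. integrable lborel u \<and> (\<exists>\<mu> \<nu>. has_Du u \<mu> \<nu>)}"

definition mutually_singular :: "real measure \<Rightarrow> real measure \<Rightarrow> bool" where
  "mutually_singular \<mu> \<nu> \<longleftrightarrow> (\<exists>Z\<in>sets borel. emeasure \<mu> Z = 0 \<and> emeasure \<nu> (- Z) = 0)"

text \<open>The two parts of the Jordan decomposition of \<open>Du\<close>; well defined for \<open>u \<in> BV\<close>.\<close>

definition Du_pos :: "(real \<Rightarrow> real) \<Rightarrow> real measure" where
  "Du_pos u = (THE \<mu>. \<exists>\<nu>. has_Du u \<mu> \<nu> \<and> mutually_singular \<mu> \<nu>)"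

definition Du_neg :: "(real \<Rightarrow> real) \<Rightarrow> real measure" where
  "Du_neg u = (THE \<nu>. \<exists>\<mu>. has_Du u \<mu> \<nu> \<and> mutually_singular \<mu> \<nu>)"

definition total_variation :: "(real \<Rightarrow> real) \<Rightarrow> real" where
  "total_variation u = measure (Du_pos u) UNIV + measure (Du_neg u) UNIV"

definition strict_BV_conv :: "(nat \<Rightarrow> real \<Rightarrow> real) \<Rightarrow> (real \<Rightarrow> real) \<Rightarrow> bool" where
  "strict_BV_conv us u \<longleftrightarrow>
     L1_conv us u \<and> (\<lambda>n. total_variation (us n)) \<longlonglongrightarrow> total_variation u"

definition weak_star :: "(nat \<Rightarrow> real measure) \<Rightarrow> real measure \<Rightarrow> bool" where
  "weak_star \<mu>s \<mu> \<longleftrightarrow>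
     (\<forall>f. continuous_on UNIV f \<and> compact (supp f) \<longrightarrow>
        (\<lambda>n. LINT x|\<mu>s n. f x) \<longlonglongrightarrow> (LINT x|\<mu>. f x))"

definition dirac :: "real \<Rightarrow> real \<Rightarrow> real measure" where
  "dirac h c = scale_measure (ennreal h) (return borel c)"

abbreviation pos_part :: "real \<Rightarrow> real" where "pos_part x \<equiv> max x 0"
abbreviation neg_part :: "real \<Rightarrow> real" where "neg_part x \<equiv> max (- x) 0"

definition pos_deriv_measure :: "(real \<Rightarrow> real) \<Rightarrow> real measure" where
  "pos_deriv_measure u = density lborel (\<lambda>r. ennreal (pos_part (deriv u r)))"

definition neg_deriv_measure :: "(real \<Rightarrow> real) \<Rightarrow> real measure" where
  "neg_deriv_measure u = density lborel (\<lambda>r. ennreal (neg_part (deriv u r)))"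


section \<open>Admissible classes and functionals\<close>

definition A_smooth :: "real \<Rightarrow> real \<Rightarrow> (real \<Rightarrow> real) set" where
  "A_smooth R1 R2 = {u. smooth u \<and> (\<forall>r. 0 \<le> u r) \<and> supp u \<subseteq> {R1<..<R2} \<and>
     (LINT r:{R1..R2}|lborel. r^2 * u r) = 1}"

definition A_BV :: "real \<Rightarrow> real \<Rightarrow> (real \<Rightarrow> real) set" where
  "A_BV R1 R2 = {u. u \<in> BV \<and> (AE r in lborel. 0 \<le> u r) \<and>
     (AE r in lborel. r \<notin> {R1..R2} \<longrightarrow> u r = 0) \<and>
     (LINT r:{R1..R2}|lborel. r^2 * u r) = 1}"

definition enclosed :: "real \<Rightarrow> real \<Rightarrow> (real \<Rightarrow> real) \<Rightarrow> real \<Rightarrow> real" where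
  "enclosed R1 R2 u r =
     (if r \<le> R1 then 0 else if R2 \<le> r then 1 else (LINT s:{R1..r}|lborel. s^2 * u s))"

definition mass :: "real \<Rightarrow> real \<Rightarrow> real \<Rightarrow> real \<Rightarrow> (real \<Rightarrow> real) \<Rightarrow> real \<Rightarrow> real" where
  "mass M1 M2 R1 R2 u r = M1 + (M2 - M1) * enclosed R1 R2 u r"

definition lapse :: "real \<Rightarrow> real \<Rightarrow> real \<Rightarrow> real \<Rightarrow> (real \<Rightarrow> real) \<Rightarrow> real \<Rightarrow> real" where
  "lapse M1 M2 R1 R2 u r = 1 - 2 * mass M1 M2 R1 R2 u r / r"

definition I_fun :: "real \<Rightarrow> real \<Rightarrow> real \<Rightarrow> real \<Rightarrow> (real \<Rightarrow> real) \<Rightarrow> real" where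
  "I_fun M1 M2 R1 R2 u =
     (LINT r:{R1..R2}|lborel. r^3 * pos_part (deriv u r) / sqrt (lapse M1 M2 R1 R2 u r))"

definition J_fun :: "real \<Rightarrow> real \<Rightarrow> real \<Rightarrow> real \<Rightarrow> (real \<Rightarrow> real) \<Rightarrow> real" where
  "J_fun M1 M2 R1 R2 u =
     (LINT r:{R1..R2}|Du_pos u. r^3 / sqrt (lapse M1 M2 R1 R2 u r))"

definition I_rel :: "real \<Rightarrow> real \<Rightarrow> real \<Rightarrow> real \<Rightarrow> (real \<Rightarrow> real) \<Rightarrow> ereal" where
  "I_rel M1 M2 R1 R2 u =
     Inf {liminf (\<lambda>n. ereal (I_fun M1 M2 R1 R2 (us n))) | us.
            (\<forall>n. us n \<in> A_smooth R1 R2) \<and> L1_conv us u}"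

text \<open>The measure \<open>\<Xi>\<^sub>u\<close> on \<open>[R1, R2]\<close>, regarded as a measure on the line.\<close>

definition NEC_measure :: "real \<Rightarrow> real \<Rightarrow> real \<Rightarrow> real \<Rightarrow> (real \<Rightarrow> real) \<Rightarrow> real measure" where
  "NEC_measure M1 M2 R1 R2 u = density lborel (\<lambda>r. ennreal (indicator {R1..R2} r *
     ((M2 - M1) / 2 * (r^3 * pos_part (deriv u r) / sqrt (lapse M1 M2 R1 R2 u r)))))"


section \<open>The optimizer\<close>

definition A_weight :: "real \<Rightarrow> real \<Rightarrow> real" where
  "A_weight R2 r = (R2^3 - r^3) / 3"

definition q_weight :: "real \<Rightarrow> real \<Rightarrow> real" where
  "q_weight M1 r = r powr (7/2) / sqrt (r - 2 * M1)"

definition Psi :: "real \<Rightarrow> real \<Rightarrow> real \<Rightarrow> real" where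
  "Psi M1 R2 r = q_weight M1 r / A_weight R2 r"

definition x0 :: "real \<Rightarrow> real \<Rightarrow> real" where
  "x0 M1 R2 = (THE x. 2 * M1 < x \<and> x < 7 * M1 / 3 \<and> M1 * x^3 + 3 * R2^3 * x - 7 * M1 * R2^3 = 0)"

lemma x0_ex1:
  fixes M1 R2 :: real
  assumes "0 < M1" "2 * M1 < R2"
  shows "\<exists>!x. 2 * M1 < x \<and> x < 7 * M1 / 3 \<and> M1 * x^3 + 3 * R2^3 * x - 7 * M1 * R2^3 = 0"
proof -
  let ?f = "\<lambda>x. M1 * x^3 + 3 * R2^3 * x - 7 * M1 * R2^3"
  have R: "0 < R2^3" using assms by simp
  have mono: "?f x < ?f y" if "0 < x" "x < y" for x y
  proof -
    have "x^3 < y^3" using that by (intro power_strict_mono) auto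
    then have "M1 * x^3 < M1 * y^3" using assms by simp
    moreover have "3 * R2^3 * x < 3 * R2^3 * y" using that R by simp
    ultimately show ?thesis by simp
  qed
  have "(2 * M1)^3 < R2^3" using assms by (intro power_strict_mono) auto
  then have "M1 * (8 * M1^3 - R2^3) < 0" using assms by (simp add: mult_pos_neg power_mult_distrib)
  then have lo: "?f (2 * M1) < 0" by (simp add: algebra_simps power_mult_distrib)
  have hi: "?f (7 * M1 / 3) > 0" using assms R by simp
  have "continuous_on {2 * M1..7 * M1 / 3} ?f" by (intro continuous_intros)
  then obtain x where x: "2 * M1 \<le> x" "x \<le> 7 * M1 / 3" "?f x = 0"
    using IVT'[of ?f "2 * M1" 0 "7 * M1 / 3"] lo hi assms by auto
  have "x \<noteq> 2 * M1" using x(3) lo by (metis less_irrefl)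
  moreover have "x \<noteq> 7 * M1 / 3" using x(3) hi by (metis less_irrefl)
  ultimately have "2 * M1 < x \<and> x < 7 * M1 / 3 \<and> ?f x = 0" using x by auto
  moreover have "y = x" if "2 * M1 < y" "?f y = 0" for y
    using mono[of x y] mono[of y x] x that assms by (cases x y rule: linorder_cases) auto
  ultimately show ?thesis by blast
qed

definition rising_radius :: "real \<Rightarrow> real \<Rightarrow> real \<Rightarrow> real" where
  "rising_radius M1 R1 R2 = max R1 (x0 M1 R2)"

definition lambda_star :: "real \<Rightarrow> real \<Rightarrow> real \<Rightarrow> real" where
  "lambda_star M1 R1 R2 = Psi M1 R2 (rising_radius M1 R1 R2)"

definition H_star :: "real \<Rightarrow> real \<Rightarrow> real \<Rightarrow> real" where
  "H_star M1 R1 R2 = 1 / A_weight R2 (rising_radius M1 R1 R2)"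

definition u_star :: "real \<Rightarrow> real \<Rightarrow> real \<Rightarrow> real \<Rightarrow> real" where
  "u_star M1 R1 R2 r = H_star M1 R1 R2 * indicator {rising_radius M1 R1 R2<..<R2} r"

definition lapse_star :: "real \<Rightarrow> real \<Rightarrow> real \<Rightarrow> real \<Rightarrow> real \<Rightarrow> real" where
  "lapse_star M1 M2 R1 R2 = lapse M1 M2 R1 R2 (u_star M1 R1 R2)"

definition deficit :: "real \<Rightarrow> real \<Rightarrow> real \<Rightarrow> real \<Rightarrow> (real \<Rightarrow> real) \<Rightarrow> real" where
  "deficit M1 M2 R1 R2 u = J_fun M1 M2 R1 R2 u - lambda_star M1 R1 R2"

definition deviation :: "real \<Rightarrow> real \<Rightarrow> real \<Rightarrow> real \<Rightarrow> (real \<Rightarrow> real) \<Rightarrow> real" where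
  "deviation M1 M2 R1 R2 u =
     L1_dist u (u_star M1 R1 R2)
     + Linf_norm {R1..R2} (\<lambda>r. lapse M1 M2 R1 R2 u r - lapse_star M1 M2 R1 R2 r)
     + Linf_norm {R1..R2} (\<lambda>r. inverse (lapse M1 M2 R1 R2 u r) - inverse (lapse_star M1 M2 R1 R2 r))"


section \<open>Metrics and Einstein tensor in the chart \<open>(t, r, \<theta>, \<phi>)\<close>\<close>

type_synonym event = "real \<times> real \<times> real \<times> real"

datatype coord = Ct | Cr | Cth | Cph

lemma UNIV_coord: "(UNIV :: coord set) = {Ct, Cr, Cth, Cph}"
  by (auto intro: coord.exhaust)

definition chart :: "real set \<Rightarrow> event set" where
  "chart I = UNIV \<times> I \<times> {0<..<pi} \<times> {0<..<2 * pi}"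

abbreviation rad :: "event \<Rightarrow> real" where "rad x \<equiv> fst (snd x)"
abbreviation polar :: "event \<Rightarrow> real" where "polar x \<equiv> fst (snd (snd x))"

fun coord_vec :: "coord \<Rightarrow> event" where
  "coord_vec Ct = (1, 0, 0, 0)"
| "coord_vec Cr = (0, 1, 0, 0)"
| "coord_vec Cth = (0, 0, 1, 0)"
| "coord_vec Cph = (0, 0, 0, 1)"

definition pd :: "coord \<Rightarrow> (event \<Rightarrow> real) \<Rightarrow> event \<Rightarrow> real" where
  "pd m f x = frechet_derivative f (at x) (coord_vec m)"

definition pd_distrib :: "coord \<Rightarrow> event distrib \<Rightarrow> event distrib" where
  "pd_distrib m T \<phi> = - T (pd m \<phi>)"

text \<open>The coefficients of \<open>-F dt\<^sup>2 + F\<^sup>-\<^sup>1 dr\<^sup>2 + r\<^sup>2 d\<Omega>\<^sup>2\<close>.\<close>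

definition shell_metric :: "(real \<Rightarrow> real) \<Rightarrow> event \<Rightarrow> coord \<Rightarrow> coord \<Rightarrow> real" where
  "shell_metric F x m n = (if m \<noteq> n then 0 else
     (case m of Ct \<Rightarrow> - F (rad x) | Cr \<Rightarrow> inverse (F (rad x))
        | Cth \<Rightarrow> (rad x)^2 | Cph \<Rightarrow> (rad x)^2 * (sin (polar x))^2))"

definition loc_lipschitz :: "event set \<Rightarrow> (event \<Rightarrow> real) \<Rightarrow> bool" where
  "loc_lipschitz U f \<longleftrightarrow> (\<forall>x\<in>U. \<exists>e>0. \<exists>L. L-lipschitz_on (U \<inter> ball x e) f)"

text \<open>Mixed Einstein tensor of \<open>-F dt\<^sup>2 + F\<^sup>-\<^sup>1 dr\<^sup>2 + r\<^sup>2 d\<Omega>\<^sup>2\<close>: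
  \<open>(r F' + F - 1) / r\<^sup>2\<close> for the \<open>t t\<close> and \<open>r r\<close> components and \<open>F'' / 2 + F' / r\<close> for the
  angular ones, with distributional derivatives.  The coefficients \<open>1 / r\<close> are harmless because
  test functions are supported in \<open>r > 0\<close>.\<close>

definition einstein :: "(real \<Rightarrow> real) \<Rightarrow> coord \<Rightarrow> coord \<Rightarrow> event distrib" where
  "einstein F m n =
     (let D = pd_distrib Cr; T = fun_distrib (\<lambda>x. F (rad x)) in
      if m \<noteq> n then (\<lambda>\<phi>. 0)
      else if m = Ct \<or> m = Cr then
        mult_distrib (\<lambda>x. 1 / (rad x)^2)
          (\<lambda>\<phi>. mult_distrib rad (D T) \<phi> + fun_distrib (\<lambda>x. F (rad x) - 1) \<phi>)
      else (\<lambda>\<phi>. 1/2 * D (D T) \<phi> + mult_distrib (\<lambda>x. 1 / rad x) (D T) \<phi>))"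

text \<open>The Dirac measure at \<open>r = c\<close> with respect to \<open>dr\<close>, as a distribution in all four
  coordinates.\<close>

definition delta_r :: "real \<Rightarrow> event distrib" where
  "delta_r c \<phi> = (LINT y|(lborel :: (real \<times> real \<times> real) measure). \<phi> (fst y, c, snd y))"


section \<open>Israel layers\<close>

text \<open>All (induced) metrics occurring below are diagonal.\<close>

definition inv_diag :: "(coord \<Rightarrow> coord \<Rightarrow> real) \<Rightarrow> coord \<Rightarrow> coord \<Rightarrow> real" where
  "inv_diag g m n = (if m = n then 1 / g m m else 0)"

definition christoffel :: "(event \<Rightarrow> coord \<Rightarrow> coord \<Rightarrow> real) \<Rightarrow> event \<Rightarrow> coord \<Rightarrow> coord \<Rightarrow> coord \<Rightarrow> real" where
  "christoffel g x l m n = 1/2 * (\<Sum>s\<in>UNIV. inv_diag (g x) l s *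
     (pd m (\<lambda>y. g y s n) x + pd n (\<lambda>y. g y s m) x - pd s (\<lambda>y. g y m n) x))"

definition normal_vec :: "(real \<Rightarrow> real) \<Rightarrow> event \<Rightarrow> coord \<Rightarrow> real" where
  "normal_vec F x m = (if m = Cr then sqrt (F (rad x)) else 0)"

definition normal_form :: "(real \<Rightarrow> real) \<Rightarrow> event \<Rightarrow> coord \<Rightarrow> real" where
  "normal_form F x n = (\<Sum>m\<in>UNIV. shell_metric F x n m * normal_vec F x m)"

definition nabla_normal :: "(real \<Rightarrow> real) \<Rightarrow> event \<Rightarrow> coord \<Rightarrow> coord \<Rightarrow> real" where
  "nabla_normal F x m n =
     pd m (\<lambda>y. normal_form F y n) x - (\<Sum>l\<in>UNIV. christoffel (shell_metric F) x l m n * normal_form F x l)"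

text \<open>Tangential indices of the hypersurfaces \<open>r = const\<close>; there \<open>Ct\<close> stands for the proper
  time \<open>\<tau>\<close>, with \<open>d\<tau> = \<surd>F dt\<close>.\<close>

definition tang :: "coord set" where
  "tang = {Ct, Cth, Cph}"

definition frame :: "(real \<Rightarrow> real) \<Rightarrow> real \<Rightarrow> coord \<Rightarrow> coord \<Rightarrow> real" where
  "frame F r A m = (if m \<noteq> A then 0 else if A = Ct then 1 / sqrt (F r) else 1)"

definition coframe :: "(real \<Rightarrow> real) \<Rightarrow> real \<Rightarrow> coord \<Rightarrow> coord \<Rightarrow> real" where
  "coframe F r A m = (if m \<noteq> A then 0 else if A = Ct then sqrt (F r) else 1)"

definition induced_metric :: "(real \<Rightarrow> real) \<Rightarrow> event \<Rightarrow> coord \<Rightarrow> coord \<Rightarrow> real" where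
  "induced_metric F x A B =
     (\<Sum>m\<in>UNIV. \<Sum>n\<in>UNIV. frame F (rad x) A m * frame F (rad x) B n * shell_metric F x m n)"

definition ext_curv :: "(real \<Rightarrow> real) \<Rightarrow> event \<Rightarrow> coord \<Rightarrow> coord \<Rightarrow> real" where
  "ext_curv F x A B =
     (\<Sum>m\<in>UNIV. \<Sum>n\<in>UNIV. frame F (rad x) A m * frame F (rad x) B n * nabla_normal F x m n)"

definition ext_curv_mixed :: "(real \<Rightarrow> real) \<Rightarrow> event \<Rightarrow> coord \<Rightarrow> coord \<Rightarrow> real" where
  "ext_curv_mixed F x A B = (\<Sum>C\<in>tang. inv_diag (induced_metric F x) A C * ext_curv F x C B)"

definition has_jump :: "(real \<Rightarrow> real) \<Rightarrow> real \<Rightarrow> real \<Rightarrow> bool" where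
  "has_jump Q c j \<longleftrightarrow>
     (\<exists>ql qr. (Q \<longlongrightarrow> ql) (at_left c) \<and> (Q \<longlongrightarrow> qr) (at_right c) \<and> j = qr - ql)"

text \<open>\<open>S\<close> is the Israel surface tensor \<open>S\<^sup>A\<^sub>B\<close> of the layer \<open>r = c\<close>; the one-sided values of the
  extrinsic curvature are obtained from the neighbouring hypersurfaces \<open>r = const\<close>.\<close>

definition is_israel_tensor :: "(real \<Rightarrow> real) \<Rightarrow> real \<Rightarrow> (coord \<Rightarrow> coord \<Rightarrow> real) \<Rightarrow> bool" where
  "is_israel_tensor F c S \<longleftrightarrow>
     (\<forall>A B. A \<notin> tang \<or> B \<notin> tang \<longrightarrow> S A B = 0) \<and>
     (\<forall>t \<theta> \<phi>. 0 < \<theta> \<and> \<theta> < pi \<longrightarrow>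
       (\<exists>J Jtr.
          (\<forall>A\<in>tang. \<forall>B\<in>tang. has_jump (\<lambda>r. ext_curv_mixed F (t, r, \<theta>, \<phi>) A B) c (J A B)) \<and>
          has_jump (\<lambda>r. \<Sum>A\<in>tang. ext_curv_mixed F (t, r, \<theta>, \<phi>) A A) c Jtr \<and>
          (\<forall>A\<in>tang. \<forall>B\<in>tang.
             S A B = - 1 / (8 * pi) * (J A B - (if A = B then 1 else 0) * Jtr))))"

text \<open>\<open>diag(-\<sigma>, p, p)\<close>\<close>

definition perfect_layer :: "real \<Rightarrow> real \<Rightarrow> coord \<Rightarrow> coord \<Rightarrow> real" where
  "perfect_layer \<sigma> p A B = (if A \<noteq> B then 0 else
     (case A of Ct \<Rightarrow> - \<sigma> | Cr \<Rightarrow> 0 | Cth \<Rightarrow> p | Cph \<Rightarrow> p))"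

definition spacetime_tensor :: "(real \<Rightarrow> real) \<Rightarrow> real \<Rightarrow> (coord \<Rightarrow> coord \<Rightarrow> real) \<Rightarrow> coord \<Rightarrow> coord \<Rightarrow> real" where
  "spacetime_tensor F c S m n =
     (\<Sum>A\<in>tang. \<Sum>B\<in>tang. frame F c A m * S A B * coframe F c B n)"

definition vol_density :: "(real \<Rightarrow> real) \<Rightarrow> event \<Rightarrow> real" where
  "vol_density F x = sqrt \<bar>\<Prod>m\<in>UNIV. shell_metric F x m m\<bar>"

definition surf_density :: "(real \<Rightarrow> real) \<Rightarrow> event \<Rightarrow> real" where
  "surf_density F x = sqrt \<bar>\<Prod>m\<in>tang. shell_metric F x m m\<bar>"

text \<open>\<open>\<integral> \<psi> \<delta>\<^sub>\<Sigma> dV\<^sub>g = \<integral>\<^sub>\<Sigma> \<psi> dV\<^sub>\<Sigma>\<close>; since distributions are paired using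
  \<open>dt dr d\<theta> d\<phi>\<close>, a test function \<open>\<phi>\<close> corresponds to \<open>\<psi> = \<phi> / vol_density\<close>.\<close>

definition delta_Sigma :: "(real \<Rightarrow> real) \<Rightarrow> real \<Rightarrow> event distrib" where
  "delta_Sigma F c \<phi> = (LINT y|(lborel :: (real \<times> real \<times> real) measure).
     \<phi> (fst y, c, snd y) / vol_density F (fst y, c, snd y) * surf_density F (fst y, c, snd y))"

end

theory Submission
  imports Defs
begin

text \<open>
  Let \<open>A r\<close> be the integral of \<open>s\<^sup>2\<close> over \<open>[r, R2]\<close>.  Integration by parts turns the constraint into
  \<open>\<integral> A dDu = 1\<close>, and since \<open>F\<^sub>u \<le> 1 - 2 M1 / r\<close> the weight of \<open>\<J>\<close> is at least \<open>q\<close>.  Hence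
  \<open>\<J> u - \<lambda> \<ge> \<integral> (q - \<lambda> A) d(Du)\<^sup>+ + \<lambda> \<integral> A d(Du)\<^sup>-\<close>.  For \<open>\<lambda> = q a / A a\<close> the gap \<open>q - \<lambda> A\<close> is
  nonnegative on \<open>[R1, R2]\<close> and vanishes only at \<open>a\<close>; as \<open>q\<close> is convex, it grows quadratically away
  from \<open>a\<close> if \<open>a = x0\<close> and linearly if \<open>a = R1 > x0\<close>.  So the deficit bounds \<open>\<integral> |r - a| d(Du)\<^sup>+\<close>
  (through its square root in the first case, by Cauchy-Schwarz) and \<open>\<integral> (R2 - r) d(Du)\<^sup>-\<close>.  These two
  moments control the \<open>L\<^sup>1\<close> distance to \<open>u\<^sub>*\<close>, which controls the distance of the lapse functions.
  The steps from \<open>a + t\<close> to \<open>R2\<close> show that the exponents are optimal.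

  The relaxation needs a lower bound, obtained by testing \<open>Du\<close> against cutoffs that almost separate
  \<open>(Du)\<^sup>+\<close> from \<open>(Du)\<^sup>-\<close>, and a recovery sequence, obtained by mollifying the image of \<open>Du\<close> under a
  contraction of \<open>[R1, R2]\<close> into its interior.

  In the Einstein tensor all derivatives fall on the test function, so uniform convergence of the
  lapse functions suffices in the limit.  The limit is computed on radial lines, where the mass
  function of \<open>u\<^sub>*\<close> is piecewise a cubic; its kinks at \<open>a\<close> and \<open>R2\<close> produce both the Dirac terms and
  the jumps of the extrinsic curvature.
\<close>


section \<open>Smooth functions\<close>

text \<open>The weight of \<J> depends on the unknown through the enclosed mass, so the problem is
  nonlinear. The bound by \<open>q\<close> discards that mass, and nothing is lost at the optimum:
  at its jump a single step has no enclosed mass yet, so the step from c to R2 has energy exactly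
  \<open>q c / A c\<close>. The best step therefore minimizes \<open>Psi\<close>, and \<lambda> is
  the largest multiplier with q \<ge> \<lambda> A on [R1, R2]. The cubic defining \<open>x0\<close>
  is, up to a positive factor, the numerator of the derivative of \<open>Psi\<close>.

  Quadratic growth of the gap is supplied by A alone, whose expansion at \<open>a\<close> is exact;
  convexity of q contributes the right sign.

  In the relaxation the weight varies along the sequence while the variations are uncontrolled. All
  lapses lie above the positive constant \<open>F0\<close> on r \<ge> R1, so lapses that are
  uniformly close, as they are for profiles close in L1, give weights comparable up to a factor near
  1.

  Signed measures are never formed: identities between them are rearranged into identities between
  sums of finite positive measures.\<close>

lemma Ck_SucD: "Ck (Suc k) f \<Longrightarrow> Ck k f"
proof (induction k arbitrary: f)
  case 0
  then show ?case
    by (auto simp: continuous_on_eq_continuous_at intro: differentiable_imp_continuous_within)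
next
  case (Suc k)
  then show ?case by (metis Ck.simps(2))
qed

lemma Ck_add:
  assumes "Ck k f" "Ck k g" shows "Ck k (\<lambda>x. f x + g x)"
  using assms
proof (induction k arbitrary: f g)
  case 0
  then show ?case by (auto intro: continuous_intros)
next
  case (Suc k)
  have d: "f differentiable (at x)" "g differentiable (at x)" for x using Suc.prems by auto
  have "frechet_derivative (\<lambda>x. f x + g x) (at x) v
      = frechet_derivative f (at x) v + frechet_derivative g (at x) v" for x v
    using frechet_derivative_at[OF has_derivative_add[OF frechet_derivative_works[THEN iffD1, OF d(1)] frechet_derivative_works[THEN iffD1, OF d(2)]]]
    by (simp add: fun_eq_iff)
  then show ?case using Suc d by (auto intro!: Suc.IH)
qed

lemma Ck_mult:
  assumes "Ck k f" "Ck k g" shows "Ck k (\<lambda>x. f x * g x)"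
  using assms
proof (induction k arbitrary: f g)
  case 0
  then show ?case by (auto intro: continuous_intros)
next
  case (Suc k)
  have d: "f differentiable (at x)" "g differentiable (at x)" for x using Suc.prems by auto
  have e: "frechet_derivative (\<lambda>x. f x * g x) (at x) v
      = f x * frechet_derivative g (at x) v + frechet_derivative f (at x) v * g x" for x v
    using frechet_derivative_at[OF has_derivative_mult[OF frechet_derivative_works[THEN iffD1, OF d(1)] frechet_derivative_works[THEN iffD1, OF d(2)]]]
    by (simp add: fun_eq_iff)
  have "Ck k f" "Ck k g" using Suc.prems Ck_SucD by blast+
  then show ?case using Suc.prems d unfolding Ck.simps e by (auto intro!: Ck_add Suc.IH)
qed

lemma smooth_mult: "smooth f \<Longrightarrow> smooth g \<Longrightarrow> smooth (\<lambda>x. f x * g x)"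
  by (simp add: smooth_def Ck_mult)

text \<open>\<open>Ck\<close> differentiates in arbitrary directions, and on the line a direction is
  just a number. Hence the induction runs over multiples \<open>D j x * c\<close>: passing to the
  derivative raises \<open>j\<close> and absorbs the direction into \<open>c\<close>.\<close>

lemma smoothI_derivs:
  fixes D :: "nat \<Rightarrow> real \<Rightarrow> real"
  assumes "\<And>k x. (D k has_real_derivative D (Suc k) x) (at x)"
  shows "smooth (D 0)"
proof -
  have "Ck k (\<lambda>x. D j x * c)" for k j c
  proof (induction k arbitrary: j c)
    case 0
    have "continuous_on UNIV (D j)"
      using assms by (meson DERIV_isCont continuous_at_imp_continuous_on)
    then show ?case by (auto intro: continuous_intros)
  next
    case (Suc k)
    have h: "((\<lambda>x. D j x * c) has_derivative (\<lambda>v. D (Suc j) x * (v * c))) (at x)" for x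
      using DERIV_cmult_right[OF assms[of j x], of c]
      unfolding has_field_derivative_def by (rule has_derivative_eq_rhs) (auto simp: mult_ac)
    have "frechet_derivative (\<lambda>x. D j x * c) (at x) v = D (Suc j) x * (v * c)" for x v
      using frechet_derivative_at[OF h] by metis
    moreover have "(\<lambda>x. D j x * c) differentiable (at x)" for x using h differentiable_def by blast
    ultimately show ?case using Suc by simp
  qed
  from this[of _ 0 1] show ?thesis by (simp add: smooth_def)
qed

lemma smooth_DERIV:
  assumes "smooth (f :: real \<Rightarrow> real)"
  shows "(f has_real_derivative deriv f x) (at x)"
proof -
  have "Ck (Suc 0) f" using assms by (simp add: smooth_def)
  then have "f differentiable (at x)" by simp
  then show ?thesis
    by (metis DERIV_imp_deriv real_differentiable_def)
qed

lemma smooth_deriv: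
  assumes "smooth (f :: real \<Rightarrow> real)"
  shows "smooth (deriv f)"
proof -
  have "deriv f x = frechet_derivative f (at x) 1" for x
    using frechet_derivative_at[OF smooth_DERIV[OF assms, of x, unfolded has_field_derivative_def]] by (metis mult.right_neutral)
  then have e: "deriv f = (\<lambda>x. frechet_derivative f (at x) 1)" by auto
  have "Ck (Suc k) f" for k using assms by (simp add: smooth_def)
  then have "Ck k (\<lambda>x. frechet_derivative f (at x) 1)" for k by simp
  then show ?thesis by (simp only: e smooth_def) simp
qed

lemma smooth_deriv_iter: "smooth (f :: real \<Rightarrow> real) \<Longrightarrow> smooth ((deriv ^^ k) f)"
  by (induction k) (auto intro: smooth_deriv)

lemma smooth_deriv_iter_DERIV:
  assumes "smooth (f :: real \<Rightarrow> real)"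
  shows "((deriv ^^ k) f has_real_derivative (deriv ^^ Suc k) f x) (at x)"
  using smooth_DERIV[OF smooth_deriv_iter[OF assms], of k x] by (simp only: funpow.simps o_apply)

lemma smooth_continuous: "smooth (f :: real \<Rightarrow> real) \<Longrightarrow> continuous_on S f"
  using DERIV_isCont[OF smooth_DERIV] by (simp add: continuous_at_imp_continuous_on)

lemma smooth_linear_combination:
  assumes "smooth (f :: real \<Rightarrow> real)" "smooth g"
  shows "smooth (\<lambda>x. a * f x + b * g x)"
proof -
  have "((\<lambda>x. a * (deriv ^^ k) f x + b * (deriv ^^ k) g x) has_real_derivative
      a * (deriv ^^ Suc k) f x + b * (deriv ^^ Suc k) g x) (at x)" for k x
    by (intro DERIV_add DERIV_cmult smooth_deriv_iter_DERIV assms)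
  from smoothI_derivs[of "\<lambda>k x. a * (deriv ^^ k) f x + b * (deriv ^^ k) g x", OF this] show ?thesis by simp
qed

lemma smooth_affine:
  assumes "smooth (f :: real \<Rightarrow> real)"
  shows "smooth (\<lambda>x. f (c * x + d))"
proof -
  have "((\<lambda>x. c ^ k * (deriv ^^ k) f (c * x + d)) has_real_derivative c ^ Suc k * (deriv ^^ Suc k) f (c * x + d)) (at x)" for k x
    by (rule derivative_eq_intros DERIV_chain2[OF smooth_deriv_iter_DERIV[OF assms]] refl | simp)+
  from smoothI_derivs[of "\<lambda>k x. c ^ k * (deriv ^^ k) f (c * x + d)", OF this] show ?thesis by simp
qed

lemma smooth_antiderivative:
  assumes "smooth (f :: real \<Rightarrow> real)" "\<And>x. (F has_real_derivative f x) (at x)"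
  shows "smooth F"
proof -
  let ?D = "\<lambda>k. case k of 0 \<Rightarrow> F | Suc j \<Rightarrow> (deriv ^^ j) f"
  have "(?D k has_real_derivative ?D (Suc k) x) (at x)" for k x
    using assms(2) smooth_deriv_iter_DERIV[OF assms(1)] by (cases k) (simp_all del: funpow.simps add: funpow_0)
  from smoothI_derivs[of ?D, OF this] show ?thesis by simp
qed

lemma poly_exp_neg_tendsto_0: "((\<lambda>y. poly p y * exp (- y)) \<longlongrightarrow> (0::real)) at_top"
proof -
  have "((\<lambda>y. \<Sum>i\<le>degree p. coeff p i * (y ^ i / exp y)) \<longlongrightarrow> (\<Sum>i\<le>degree p. coeff p i * 0)) at_top"
    by (intro tendsto_intros tendsto_power_div_exp_0)
  moreover have "(\<Sum>i\<le>degree p. coeff p i * (y ^ i / exp y)) = poly p y * exp (- y)" for y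
    by (simp add: poly_altdef sum_distrib_left exp_minus divide_inverse mult_ac)
  ultimately show ?thesis by simp
qed

text \<open>This class contains the function \<open>exp (- 1 / x)\<close> and is closed under differentiation, so no
  estimates of higher derivatives are needed for smoothness.\<close>

definition flat_exp :: "real poly \<Rightarrow> real \<Rightarrow> real" where
  "flat_exp p x = (if x > 0 then poly p (1 / x) * exp (- (1 / x)) else 0)"

text \<open>The new polynomial is read off from the chain rule: differentiating p(1/x) exp(-1/x)
  produces the factor 1/x^2 and p - p' at 1/x. At 0 the left-hand difference quotient is zero, and
  on the right exponential decay beats every polynomial in 1/x.\<close>

lemma flat_exp_DERIV:
  "(flat_exp p has_real_derivative flat_exp ([:0, 0, 1:] * (p - pderiv p)) x) (at x)"
proof -
  consider "x > 0" | "x < 0" | "x = 0" by linarith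
  then show ?thesis
  proof cases
    case 1
    have "((\<lambda>x. poly p (1 / x) * exp (- (1 / x))) has_real_derivative flat_exp ([:0, 0, 1:] * (p - pderiv p)) x) (at x)"
      using 1 by (auto intro!: derivative_eq_intros DERIV_chain2[OF poly_DERIV]
          simp: flat_exp_def field_simps power2_eq_square)
    then show ?thesis
      by (rule has_field_derivative_transform_within_open[of _ _ _ "{0<..}"]) (use 1 in \<open>auto simp: flat_exp_def\<close>)
  next
    case 2
    have "((\<lambda>x. 0) has_real_derivative flat_exp ([:0, 0, 1:] * (p - pderiv p)) x) (at x)"
      using 2 by (simp add: flat_exp_def)
    then show ?thesis
      by (rule has_field_derivative_transform_within_open[of _ _ _ "{..<0}"]) (use 2 in \<open>auto simp: flat_exp_def\<close>)
  next
    case 3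
    have "((\<lambda>y. flat_exp p y / y) \<longlongrightarrow> 0) (at_left 0)"
      by (rule tendsto_eventually) (auto simp: flat_exp_def eventually_at_left_field intro!: exI[of _ "-1"])
    moreover have "((\<lambda>y. flat_exp p y / y) \<longlongrightarrow> 0) (at_right 0)"
    proof -
      \<comment> \<open>\<open>pCons 0 p\<close> is p times the variable: it supplies the factor 1/x
        of the difference quotient at 0.\<close>
      have "((\<lambda>x. poly (pCons 0 p) (inverse x) * exp (- inverse x)) \<longlongrightarrow> 0) (at_right 0)"
        by (rule filterlim_compose[OF poly_exp_neg_tendsto_0 filterlim_inverse_at_top_right])
      moreover have "eventually (\<lambda>x. poly (pCons 0 p) (inverse x) * exp (- inverse x) = flat_exp p x / x) (at_right 0)"
        by (auto simp: flat_exp_def eventually_at_right_field field_simps intro!: exI[of _ 1])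
      ultimately show ?thesis by (rule Lim_transform_eventually)
    qed
    ultimately have "((\<lambda>y. flat_exp p y / y) \<longlongrightarrow> 0) (at 0)"
      using filterlim_split_at by blast
    then show ?thesis using 3 by (simp add: has_field_derivative_iff flat_exp_def)
  qed
qed

lemma flat_exp_smooth: "smooth (flat_exp p)"
proof -
  define T where "T p = [:0, 0, 1:] * (p - pderiv p)" for p :: "real poly"
  have "(flat_exp ((T ^^ k) p) has_real_derivative flat_exp ((T ^^ Suc k) p) x) (at x)" for k x
    using flat_exp_DERIV[of "(T ^^ k) p" x] by (simp only: funpow.simps o_apply T_def)
  from smoothI_derivs[of "\<lambda>k. flat_exp ((T ^^ k) p)", OF this] show ?thesis by (simp only: funpow_0)
qed

lemma flat_exp_1: "flat_exp 1 x = (if x > 0 then exp (- (1 / x)) else 0)"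
  by (simp add: flat_exp_def)

text \<open>A smooth approximation from below to the indicator of (a, b). The shift by 1 makes the
  product vanish within distance 1/n of the endpoints, so the support is a compact subset of the
  open interval; growing n drives the value in the interior to 1.\<close>

definition bump :: "real \<Rightarrow> real \<Rightarrow> real \<Rightarrow> real \<Rightarrow> real" where
  "bump n a b x = flat_exp 1 (n * (x - a) - 1) * flat_exp 1 (n * (b - x) - 1)"

lemma bump_smooth: "smooth (bump n a b)"
proof -
  have "smooth (\<lambda>x. flat_exp 1 (n * x + (- n * a - 1)) * flat_exp 1 ((- n) * x + (n * b - 1)))"
    by (intro smooth_mult smooth_affine flat_exp_smooth)
  moreover have "bump n a b = (\<lambda>x. flat_exp 1 (n * x + (- n * a - 1)) * flat_exp 1 ((- n) * x + (n * b - 1)))"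
    by (auto simp: bump_def algebra_simps)
  ultimately show ?thesis by simp
qed

lemma bump_nonneg: "0 \<le> bump n a b x"
  by (simp add: bump_def flat_exp_1)

lemma bump_le_1: "bump n a b x \<le> 1"
  unfolding bump_def by (intro mult_le_one) (simp_all add: flat_exp_1)

lemma bump_pos: "n * (x - a) > 1 \<Longrightarrow> n * (b - x) > 1 \<Longrightarrow> 0 < bump n a b x"
  by (simp add: bump_def flat_exp_1)

lemma bump_eq_0: "n > 0 \<Longrightarrow> x \<notin> {a + 1 / n..b - 1 / n} \<Longrightarrow> bump n a b x = 0"
proof -
  assume n: "n > 0" and "x \<notin> {a + 1 / n..b - 1 / n}"
  then have "x - a < 1 / n \<or> b - x < 1 / n" unfolding atLeastAtMost_iff by argo
  then have "n * (x - a) < 1 \<or> n * (b - x) < 1" using n by (simp add: pos_less_divide_eq mult.commute)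
  then show ?thesis by (auto simp: bump_def flat_exp_1)
qed

lemma bump_tendsto: "(\<lambda>n. bump (real (Suc n)) a b x) \<longlonglongrightarrow> indicator {a<..<b} x"
proof (cases "x \<in> {a<..<b}")
  case True
  have "(\<lambda>n. flat_exp 1 (real (Suc n) * c - 1)) \<longlonglongrightarrow> 1" if "c > 0" for c
  proof -
    have f: "filterlim (\<lambda>n. real (Suc n) * c - 1) at_top sequentially"
      using that by real_asymp
    have "((\<lambda>x. exp (- (1 / x))) \<longlongrightarrow> (1::real)) at_top" by real_asymp
    moreover have "eventually (\<lambda>x. exp (- (1 / x)) = flat_exp 1 x) at_top"
      using eventually_gt_at_top[of 0] by eventually_elim (simp add: flat_exp_1)
    ultimately have "(flat_exp 1 \<longlongrightarrow> 1) at_top" using tendsto_cong by fastforce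
    from filterlim_compose[OF this f] show ?thesis .
  qed
  from tendsto_mult[OF this[of "x - a"] this[of "b - x"]] True show ?thesis by (simp add: bump_def)
next
  case False
  then have "bump (real (Suc n)) a b x = 0" for n
  proof (intro bump_eq_0)
    have "1 / real (Suc n) > 0" by simp
    then show "x \<notin> {a + 1 / real (Suc n)..b - 1 / real (Suc n)}" using False unfolding atLeastAtMost_iff greaterThanLessThan_iff by argo
  qed simp
  then show ?thesis using False by simp
qed

lemma supp_subset: "closed S \<Longrightarrow> (\<And>x. x \<notin> S \<Longrightarrow> f x = 0) \<Longrightarrow> supp f \<subseteq> S"
  unfolding supp_def by (rule closure_minimal) auto

lemma notin_supp: "x \<notin> supp f \<Longrightarrow> f x = 0"
  unfolding supp_def using closure_subset[of "{x. f x \<noteq> 0}"] by auto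

lemma test_funI:
  fixes f :: "real \<Rightarrow> real"
  assumes "smooth f" "\<And>x. x \<notin> {a..b} \<Longrightarrow> f x = 0" "{a..b} \<subseteq> U"
  shows "test_fun U f"
proof -
  have "supp f \<subseteq> {a..b}" using assms by (intro supp_subset) auto
  moreover have "closed (supp f)" by (simp add: supp_def)
  ultimately show ?thesis using assms unfolding test_fun_def
    using compact_Int_closed[of "{a..b}" "supp f"] by (simp add: inf.absorb2)
qed

lemma test_fun_support:
  fixes f :: "real \<Rightarrow> real"
  assumes "compact (supp f)"
  obtains L where "0 < L" "\<And>x. x \<notin> {-L..L} \<Longrightarrow> f x = 0"
proof -
  from compact_imp_bounded[OF assms] obtain L where "0 < L" and L: "\<forall>x\<in>supp f. norm x \<le> L"
    unfolding bounded_pos by blast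
  have "f x = 0" if "x \<notin> {-L..L}" for x
  proof (rule notin_supp[of x f])
    show "x \<notin> supp f" using L that by (force simp: abs_le_iff)
  qed
  from that[OF \<open>0 < L\<close> this] show thesis .
qed

lemma bump_test_fun: "n > 0 \<Longrightarrow> {a<..<b} \<subseteq> U \<Longrightarrow> test_fun U (bump n a b)"
proof -
  assume n: "n > 0" and "{a<..<b} \<subseteq> U"
  have "1 / n > 0" using n by simp
  have "{a + 1 / n..b - 1 / n} \<subseteq> {a<..<b}"
  proof
    fix x assume "x \<in> {a + 1 / n..b - 1 / n}"
    with \<open>1 / n > 0\<close> show "x \<in> {a<..<b}" unfolding atLeastAtMost_iff greaterThanLessThan_iff by argo
  qed
  with \<open>{a<..<b} \<subseteq> U\<close> show ?thesis by (intro test_funI[OF bump_smooth bump_eq_0]) (use n in auto)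
qed

text \<open>The primitive is normalised to vanish left of the support and is constant to the right
  of it, with the integral of g as value. So a function of integral 0 has a compactly supported
  primitive, and a bump of integral 1 has a cutoff from 0 to 1 as primitive.\<close>

lemma ex_antiderivative:
  fixes g :: "real \<Rightarrow> real"
  assumes "continuous_on UNIV g" "\<And>x. x \<notin> {L..R} \<Longrightarrow> g x = 0" "L \<le> R"
  obtains G where "\<And>x. (G has_real_derivative g x) (at x)" "\<And>x. x \<le> L \<Longrightarrow> G x = 0"
    "\<And>x. R \<le> x \<Longrightarrow> G x = (LINT y|lborel. g y)"
proof -
  have "isCont g x" for x
    using assms(1) by (simp add: continuous_on_eq_continuous_at)
  then obtain F where
    F: "\<And>x::real. (F has_vector_derivative g x) (at x)"
    using einterval_antiderivative[of "-\<infinity>" "\<infinity>" g] by auto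
  define G where "G x = F x - F L" for x
  have G: "(G has_real_derivative g x) (at x)" for x
    unfolding G_def using F[of x] by (auto intro!: derivative_eq_intros simp: has_real_derivative_iff_has_vector_derivative)
  have const: "G x = G y" if "x \<le> y" "\<And>z. z \<in> {x<..<y} \<Longrightarrow> g z = 0" for x y
  proof (cases "x = y")
    case False
    have "G y = G x"
    proof (rule DERIV_isconst_end[of x y G])
      show "continuous_on {x..y} G"
        using G DERIV_isCont by (blast intro: continuous_at_imp_continuous_on)
      show "(G has_real_derivative 0) (at z)" if "x < z" "z < y" for z
        using G[of z] \<open>\<And>z. z \<in> {x<..<y} \<Longrightarrow> g z = 0\<close>[of z] that by simp
    qed (use that False in auto)
    then show ?thesis by simp
  qed auto
  show ?thesis
  proof (rule that[of G])
    show "(G has_real_derivative g x) (at x)" for x by (rule G)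
    show "G x = 0" if "x \<le> L" for x
      using const[of x L] that assms(2) by (auto simp: G_def)
    have "(LINT y|lborel. indicator {L..R} y *\<^sub>R g y) = F R - F L"
      using assms by (intro integral_FTC_atLeastAtMost[of L R F g])
        (auto intro: F has_vector_derivative_at_within continuous_on_subset)
    also have "(LINT y|lborel. indicator {L..R} y *\<^sub>R g y) = (LINT y|lborel. g y)"
      using assms(2) by (intro Bochner_Integration.integral_cong) (auto simp: indicator_def)
    finally show "G x = (LINT y|lborel. g y)" if "R \<le> x" for x
      using const[of R x] that assms(2) by (auto simp: G_def)
  qed
qed


section \<open>Finite measures and the Jordan decomposition\<close>

definition fin_borel :: "real measure \<Rightarrow> bool" where
  "fin_borel M \<longleftrightarrow> finite_measure M \<and> sets M = sets borel"

lemma fin_borelD: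
  assumes "fin_borel M"
  shows "finite_measure M" "sets M = sets borel" "space M = UNIV"
    "f \<in> borel_measurable borel \<Longrightarrow> f \<in> borel_measurable M"
  using assms sets_eq_imp_space_eq[of M borel] measurable_cong_sets[of M borel borel borel]
  by (auto simp: fin_borel_def)

lemma fin_borel_measurable:
  assumes "fin_borel M" "f \<in> borel_measurable borel"
  shows "f \<in> borel_measurable M"
  using fin_borelD(4)[OF assms] .

lemma fin_borel_integrable:
  fixes f :: "real \<Rightarrow> real"
  assumes "fin_borel M" "f \<in> borel_measurable borel" "AE x in M. \<bar>f x\<bar> \<le> B"
  shows "integrable M f"
proof -
  interpret finite_measure M using fin_borelD[OF assms(1)] by simp
  show ?thesis
    using assms by (intro integrable_const_bound[of _ B]) (auto intro: fin_borel_measurable)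
qed

lemma fin_borel_integrable_UNIV:
  fixes f :: "real \<Rightarrow> real"
  assumes "fin_borel M" "f \<in> borel_measurable borel" "\<And>x. \<bar>f x\<bar> \<le> B"
  shows "integrable M f"
  using assms by (intro fin_borel_integrable[of _ _ B]) auto

lemma continuous_compact_support_bounded:
  fixes f :: "real \<Rightarrow> real"
  assumes "continuous_on UNIV f" "\<And>x. x \<notin> {L..R} \<Longrightarrow> f x = 0"
  obtains B where "0 \<le> B" "\<And>x. \<bar>f x\<bar> \<le> B"
proof -
  have "compact (f ` {L..R})"
    using assms by (intro compact_continuous_image) (auto intro: continuous_on_subset)
  then obtain B where B: "0 < B" "\<forall>x\<in>{L..R}. \<bar>f x\<bar> \<le> B"
    using compact_imp_bounded[of "f ` {L..R}"] unfolding bounded_pos by auto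
  have "\<bar>f x\<bar> \<le> B" for x using B assms(2)[of x] by (cases "x \<in> {L..R}") auto
  then show ?thesis using that[of B] B by auto
qed

text \<open>The bumps converge boundedly to the indicator of the open interval. With two measures on
  each side, an identity of signed measures \<open>M1 - N1 = N2 - M2\<close> can be stated without
  subtraction.\<close>

lemma test_fun_interval_measure_eq:
  assumes "fin_borel M1" "fin_borel M2" "fin_borel N1" "fin_borel N2"
    and eq: "\<And>\<phi>. test_fun {a<..<b} \<phi> \<Longrightarrow>
      (LINT x|M1. \<phi> x) + (LINT x|M2. \<phi> x) = (LINT x|N1. \<phi> x) + (LINT x|N2. \<phi> x)"
  shows "measure M1 {a<..<b} + measure M2 {a<..<b} = measure N1 {a<..<b} + measure N2 {a<..<b}"
proof -
  have lim: "(\<lambda>n. LINT x|M. bump (real (Suc n)) a b x) \<longlonglongrightarrow> measure M {a<..<b}" if "fin_borel M" for M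
  proof -
    interpret finite_measure M using fin_borelD[OF that] by simp
    have [measurable]: "bump n a b \<in> borel_measurable M" for n
      by (intro fin_borel_measurable[OF that] borel_measurable_continuous_onI smooth_continuous bump_smooth)
    have "{a<..<b} \<in> sets M" using fin_borelD[OF that] by simp
    then have "(\<lambda>n. LINT x|M. bump (real (Suc n)) a b x) \<longlonglongrightarrow> (LINT x|M. indicator {a<..<b} x)"
      using bump_nonneg bump_le_1 bump_tendsto
      by (intro integral_dominated_convergence[where w="\<lambda>_. 1"]) auto
    then show ?thesis using fin_borelD(3)[OF that] by simp
  qed
  have "(\<lambda>n. (LINT x|M1. bump (real (Suc n)) a b x) + (LINT x|M2. bump (real (Suc n)) a b x))
     \<longlonglongrightarrow> measure M1 {a<..<b} + measure M2 {a<..<b}"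
    by (intro tendsto_add lim assms)
  moreover have "(\<lambda>n. (LINT x|M1. bump (real (Suc n)) a b x) + (LINT x|M2. bump (real (Suc n)) a b x))
     \<longlonglongrightarrow> measure N1 {a<..<b} + measure N2 {a<..<b}"
    by (subst eq, simp add: bump_test_fun, intro tendsto_add lim assms)
  ultimately show ?thesis by (rule LIMSEQ_unique)
qed

text \<open>Dynkin's \<pi>-\<lambda> argument, started from the open intervals, which are stable
  under intersection. Everything is restricted to \<open>U\<close>, so that equality can also be
  localised to a half-line.\<close>

lemma borel_measure_sum_eqI:
  assumes fb: "fin_borel M1" "fin_borel M2" "fin_borel N1" "fin_borel N2" and U: "U \<in> sets borel"
    and eq: "\<And>a b. measure M1 ({a<..<b} \<inter> U) + measure M2 ({a<..<b} \<inter> U)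
       = measure N1 ({a<..<b} \<inter> U) + measure N2 ({a<..<b} \<inter> U)"
    and S: "S \<in> sets borel"
  shows "measure M1 (S \<inter> U) + measure M2 (S \<inter> U) = measure N1 (S \<inter> U) + measure N2 (S \<inter> U)"
proof -
  let ?G = "range (\<lambda>(a, b). {a<..<b::real})"
  have G: "sets borel = sigma_sets UNIV ?G"
    using arg_cong[OF borel_eq_box[where 'a=real], of sets] by (simp only: box_real) (simp add: sets_measure_of)
  have S': "S \<in> sigma_sets UNIV ?G" using S G by simp
  note fin = fb[THEN fin_borelD(1)] and sts = fb[THEN fin_borelD(2)]
  have UN: "(\<lambda>i. measure M (A i \<inter> U)) sums measure M ((\<Union>i. A i) \<inter> U)"
    if "fin_borel M" "disjoint_family A" "range A \<subseteq> sets borel" for M and A :: "nat \<Rightarrow> real set"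
  proof -
    interpret finite_measure M using fin_borelD[OF that(1)] by simp
    have "(\<lambda>i. measure M (A i \<inter> U)) sums measure M (\<Union>i. A i \<inter> U)"
    proof (rule finite_measure_UNION)
      show "range (\<lambda>i. A i \<inter> U) \<subseteq> sets M" using that(3) U by (auto simp: fin_borelD(2)[OF that(1)])
      show "disjoint_family (\<lambda>i. A i \<inter> U)" using that(2) unfolding disjoint_family_on_def by blast
    qed
    moreover have "(\<Union>i. A i \<inter> U) = (\<Union>i. A i) \<inter> U" by blast
    ultimately show ?thesis by simp
  qed
  have lim: "(\<lambda>n. measure M ({- real n<..<real n} \<inter> U)) \<longlonglongrightarrow> measure M U" if "fin_borel M" for M
  proof -
    interpret finite_measure M using fin_borelD[OF that(1)] by simp
    have "(\<lambda>n. measure M ({- real n<..<real n} \<inter> U)) \<longlonglongrightarrow> measure M (\<Union>n. {- real n<..<real n} \<inter> U)"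
    proof (rule finite_Lim_measure_incseq)
      show "range (\<lambda>n. {- real n<..<real n} \<inter> U) \<subseteq> sets M" using U by (auto simp: fin_borelD(2)[OF that(1)])
      show "incseq (\<lambda>n. {- real n<..<real n} \<inter> U)" by (rule incseq_SucI) auto
    qed
    moreover have "(\<Union>n. {- real n<..<real n} \<inter> U) = U"
    proof -
      have "\<exists>n. - real n < x \<and> x < real n" for x
        using reals_Archimedean2[of "\<bar>x\<bar>"] by (metis abs_less_iff minus_less_iff)
      then show ?thesis by auto
    qed
    ultimately show ?thesis by simp
  qed
  \<comment> \<open>Complements need the total mass on \<open>U\<close>; exhausting the line by the
    intervals (-n, n) provides it.\<close>
  have eqU: "measure M1 U + measure M2 U = measure N1 U + measure N2 U"
    by (rule LIMSEQ_unique[OF tendsto_add[OF lim lim]]) (use fb in \<open>auto simp: eq intro!: tendsto_add lim\<close>)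
  have st: "Int_stable ?G"
  proof (rule Int_stableI)
    fix A B assume "A \<in> ?G" "B \<in> ?G"
    then obtain a b c d where "A = {a<..<b}" "B = {c<..<d}" by auto
    then have "A \<inter> B = {max a c<..<min b d}" by auto
    then show "A \<inter> B \<in> ?G" by auto
  qed
  show ?thesis
  proof (induction rule: sigma_sets_induct_disjoint[OF st _ S', case_names closed basic empty compl union])
    case (basic A)
    then show ?case using eq by auto
  next
    case empty
    then show ?case by simp
  next
    case (compl A)
    then have A: "A \<in> sets borel" using G by simp
    have "measure M ((UNIV - A) \<inter> U) = measure M U - measure M (A \<inter> U)" if "fin_borel M" for M
    proof -
      interpret finite_measure M using fin_borelD[OF that(1)] by simp
      have "(UNIV - A) \<inter> U = U - A \<inter> U" by auto
      then show ?thesis using A U fin_borelD(2)[OF that] by (simp add: finite_measure_Diff)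
    qed
    then show ?case using compl eqU fb by simp
  next
    case (union A)
    have "range A \<subseteq> sets borel" using union G by simp
    note UNA = UN[OF _ union(1) this]
    have s1: "(\<lambda>i. measure M1 (A i \<inter> U) + measure M2 (A i \<inter> U)) sums (measure M1 ((\<Union>i. A i) \<inter> U) + measure M2 ((\<Union>i. A i) \<inter> U))"
      by (intro sums_add UNA fb)
    have s2: "(\<lambda>i. measure N1 (A i \<inter> U) + measure N2 (A i \<inter> U)) sums (measure N1 ((\<Union>i. A i) \<inter> U) + measure N2 ((\<Union>i. A i) \<inter> U))"
      by (intro sums_add UNA fb)
    show ?case by (rule sums_unique2[OF s1]) (simp only: union(3) s2)
  qed auto
qed

lemma has_Du_iff: "has_Du u \<mu> \<nu> \<longleftrightarrow> fin_borel \<mu> \<and> fin_borel \<nu> \<and>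
     (\<forall>\<phi>. test_fun UNIV \<phi> \<longrightarrow>
        (LINT x|lborel. u x * deriv \<phi> x) = - ((LINT x|\<mu>. \<phi> x) - (LINT x|\<nu>. \<phi> x)))"
  by (auto simp: has_Du_def fin_borel_def)

lemma fin_borel_eqI:
  assumes "fin_borel M" "fin_borel N" "\<And>S. S \<in> sets borel \<Longrightarrow> measure M S = measure N S"
  shows "M = N"
  using assms by (intro measure_eqI) (auto simp: fin_borel_def finite_measure.emeasure_eq_measure)

text \<open>The two separating sets cut S into pieces on which the identity loses most of its terms:
  on S \<inter> Z' - Z both \<mu>' and \<nu> vanish, which forces \<mu> = 0 there, and symmetrically
  on S \<inter> Z - Z'; off Z \<union> Z' both \<nu> and \<nu>' vanish, which leaves \<mu> =
  \<mu>'.\<close>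

lemma mutually_singular_eqI:
  assumes fb: "fin_borel \<mu>" "fin_borel \<nu>" "fin_borel \<mu>'" "fin_borel \<nu>'"
    and ms: "mutually_singular \<mu> \<nu>" "mutually_singular \<mu>' \<nu>'"
    and eq: "\<And>S. S \<in> sets borel \<Longrightarrow> measure \<mu> S + measure \<nu>' S = measure \<mu>' S + measure \<nu> S"
  shows "\<mu> = \<mu>'"
proof (rule fin_borel_eqI[OF fb(1,3)])
  from ms obtain Z Z' where Z: "Z \<in> sets borel" "emeasure \<mu> Z = 0" "emeasure \<nu> (- Z) = 0"
     and Z': "Z' \<in> sets borel" "emeasure \<mu>' Z' = 0" "emeasure \<nu>' (- Z') = 0"
    unfolding mutually_singular_def by auto
  have sub: "measure M B = 0" if "emeasure M A = 0" "B \<subseteq> A" "fin_borel M" "A \<in> sets borel" for M A B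
    using emeasure_eq_0[of A M B] that fin_borelD(2)[OF that(3)] by (simp add: measure_def)
  have split: "measure M S = measure M (S \<inter> A) + measure M (S - A)" if "fin_borel M" "S \<in> sets borel" "A \<in> sets borel" for M S A
    using finite_measure.finite_measure_Union[OF fin_borelD(1)[OF that(1)], of "S \<inter> A" "S - A"] that fin_borelD(2)[OF that(1)]
    by (auto simp: Int_Diff_Un)
  fix S :: "real set" assume S: "S \<in> sets borel"
  have "measure \<mu> (S \<inter> Z) = 0" by (rule sub[OF Z(2)]) (use fb Z in auto)
  moreover have "measure \<mu>' (S \<inter> Z') = 0" by (rule sub[OF Z'(2)]) (use fb Z' in auto)
  moreover have "measure \<mu> (S \<inter> Z' - Z) = 0"
  proof -
    have "measure \<mu>' (S \<inter> Z' - Z) = 0" by (rule sub[OF Z'(2)]) (use fb Z' in auto)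
    moreover have "measure \<nu> (S \<inter> Z' - Z) = 0" by (rule sub[OF Z(3)]) (use fb Z in auto)
    ultimately show ?thesis
      using eq[of "S \<inter> Z' - Z"] S Z(1) Z'(1) measure_nonneg[of \<mu> "S \<inter> Z' - Z"] measure_nonneg[of \<nu>' "S \<inter> Z' - Z"]
      by (smt (verit) sets.Diff sets.Int)
  qed
  moreover have "measure \<mu>' (S \<inter> Z - Z') = 0"
  proof -
    have "measure \<mu> (S \<inter> Z - Z') = 0" by (rule sub[OF Z(2)]) (use fb Z in auto)
    moreover have "measure \<nu>' (S \<inter> Z - Z') = 0" by (rule sub[OF Z'(3)]) (use fb Z' in auto)
    ultimately show ?thesis
      using eq[of "S \<inter> Z - Z'"] S Z(1) Z'(1) measure_nonneg[of \<mu>' "S \<inter> Z - Z'"] measure_nonneg[of \<nu> "S \<inter> Z - Z'"]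
      by (smt (verit) sets.Diff sets.Int)
  qed
  moreover have "measure \<mu> (S - Z - Z') = measure \<mu>' (S - Z' - Z)"
  proof -
    have "measure \<nu> (S - Z - Z') = 0" by (rule sub[OF Z(3)]) (use fb Z in auto)
    moreover have "measure \<nu>' (S - Z - Z') = 0" by (rule sub[OF Z'(3)]) (use fb Z' in auto)
    moreover have "S - Z - Z' = S - Z' - Z" by auto
    ultimately show ?thesis using eq[of "S - Z - Z'"] S Z Z' by simp
  qed
  moreover have "(S - Z) \<inter> Z' = S \<inter> Z' - Z" "(S - Z') \<inter> Z = S \<inter> Z - Z'" by auto
  ultimately show "measure \<mu> S = measure \<mu>' S"
    using split[OF fb(1) S Z(1)] split[OF fb(1) _ Z'(1), of "S - Z"] split[OF fb(3) S Z'(1)] split[OF fb(3) _ Z(1), of "S - Z'"]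
      S Z Z' by simp
qed

lemma mutually_singular_sym:
  assumes "mutually_singular \<mu> \<nu>" shows "mutually_singular \<nu> \<mu>"
proof -
  from assms obtain Z where "Z \<in> sets borel" "emeasure \<mu> Z = 0" "emeasure \<nu> (- Z) = 0"
    unfolding mutually_singular_def by auto
  then show ?thesis unfolding mutually_singular_def by (intro bexI[of _ "- Z"]) auto
qed

lemma has_Du_measure_eq:
  assumes "has_Du u \<mu> \<nu>" "has_Du u \<mu>' \<nu>'" "S \<in> sets borel"
  shows "measure \<mu> S + measure \<nu>' S = measure \<mu>' S + measure \<nu> S"
proof -
  note fb = assms(1,2)[unfolded has_Du_iff]
  have "measure \<mu> (S \<inter> UNIV) + measure \<nu>' (S \<inter> UNIV) = measure \<mu>' (S \<inter> UNIV) + measure \<nu> (S \<inter> UNIV)"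
  proof (rule borel_measure_sum_eqI)
    fix a b :: real
    have "test_fun {a<..<b} \<phi> \<Longrightarrow> test_fun UNIV \<phi>" for \<phi> by (simp add: test_fun_def)
    then have "test_fun {a<..<b} \<phi> \<Longrightarrow>
      (LINT x|\<mu>. \<phi> x) + (LINT x|\<nu>'. \<phi> x) = (LINT x|\<mu>'. \<phi> x) + (LINT x|\<nu>. \<phi> x)" for \<phi>
      using fb by (smt (verit))
    then show "measure \<mu> ({a<..<b} \<inter> UNIV) + measure \<nu>' ({a<..<b} \<inter> UNIV) = measure \<mu>' ({a<..<b} \<inter> UNIV) + measure \<nu> ({a<..<b} \<inter> UNIV)"
      using test_fun_interval_measure_eq[of \<mu> \<nu>' \<mu>' \<nu> a b] fb by simp
  qed (use fb assms(3) in auto)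
  then show ?thesis by simp
qed

lemma Jordan_unique:
  assumes "has_Du u \<mu> \<nu>" "mutually_singular \<mu> \<nu>" "has_Du u \<mu>' \<nu>'" "mutually_singular \<mu>' \<nu>'"
  shows "\<mu> = \<mu>'" "\<nu> = \<nu>'"
proof -
  note fb = assms(1,3)[unfolded has_Du_iff]
  show "\<mu> = \<mu>'" using fb assms has_Du_measure_eq[OF assms(1,3)] by (intro mutually_singular_eqI[of \<mu> \<nu> \<mu>' \<nu>']) auto
  show "\<nu> = \<nu>'" using fb assms has_Du_measure_eq[OF assms(1,3)]
    by (intro mutually_singular_eqI[of \<nu> \<mu> \<nu>' \<mu>']) (auto simp: mutually_singular_sym add.commute)
qed

lemma Du_eqI:
  assumes "has_Du u \<mu> \<nu>" "mutually_singular \<mu> \<nu>"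
  shows "Du_pos u = \<mu>" "Du_neg u = \<nu>"
  unfolding Du_pos_def Du_neg_def using assms Jordan_unique[OF _ _ assms]
  by (blast intro: the_equality)+

text \<open>Serves as common dominating measure of the two parts of a signed measure, so that both
  acquire densities.\<close>

definition sum_measure :: "'a measure \<Rightarrow> 'a measure \<Rightarrow> 'a measure" where
  "sum_measure M N = measure_of (space M) (sets M) (\<lambda>A. emeasure M A + emeasure N A)"

lemma sets_sum_measure [simp, measurable_cong]: "sets (sum_measure M N) = sets M"
  by (simp add: sum_measure_def)

lemma emeasure_sum_measure:
  assumes "sets N = sets M" "A \<in> sets M"
  shows "emeasure (sum_measure M N) A = emeasure M A + emeasure N A"
  unfolding sum_measure_def
proof (rule emeasure_measure_of_sigma)
  show "sigma_algebra (space M) (sets M)" by (rule sets.sigma_algebra_axioms)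
  show "countably_additive (sets M) (\<lambda>A. emeasure M A + emeasure N A)"
  proof (rule countably_additiveI)
    fix A :: "nat \<Rightarrow> 'a set" assume A: "range A \<subseteq> sets M" "disjoint_family A"
    have "(\<Sum>i. emeasure M (A i) + emeasure N (A i)) = (\<Sum>i. emeasure M (A i)) + (\<Sum>i. emeasure N (A i))"
      by (intro suminf_add[symmetric]) auto
    also have "\<dots> = emeasure M (\<Union>(range A)) + emeasure N (\<Union>(range A))"
      using A assms(1) by (simp add: suminf_emeasure)
    finally show "(\<Sum>i. emeasure M (A i) + emeasure N (A i)) = emeasure M (\<Union>(range A)) + emeasure N (\<Union>(range A))" .
  qed
qed (use assms in \<open>auto simp: positive_def\<close>)

text \<open>With f and g the densities of the given parts with respect to their sum, the positive
  parts of f - g and of g - f represent the same difference and live on the complementary sets f > g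
  and f \<le> g.\<close>

lemma Jordan_exists:
  assumes "has_Du u \<mu>0 \<nu>0"
  obtains \<mu> \<nu> where "has_Du u \<mu> \<nu>" "mutually_singular \<mu> \<nu>"
proof -
  note fb = assms[unfolded has_Du_iff]
  define \<sigma> where "\<sigma> = sum_measure \<mu>0 \<nu>0"
  have sts: "sets \<sigma> = sets borel" "sets \<mu>0 = sets borel" "sets \<nu>0 = sets borel"
    using fb by (auto simp: \<sigma>_def fin_borelD)
  have em: "emeasure \<sigma> A = emeasure \<mu>0 A + emeasure \<nu>0 A" if "A \<in> sets borel" for A
    using that sts by (simp add: \<sigma>_def emeasure_sum_measure)
  have sp: "space \<sigma> = UNIV" using sets_eq_imp_space_eq[OF sts(1)] by simp
  have "finite_measure \<sigma>"
    using em[of UNIV] fb fin_borelD(1,3)[of \<mu>0] fin_borelD(1,3)[of \<nu>0] finite_measure.emeasure_finite[of \<mu>0 UNIV] finite_measure.emeasure_finite[of \<nu>0 UNIV]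
    by (intro finite_measureI) (simp add: sp)
  then interpret finite_measure \<sigma> .
  have RN: "\<exists>f. f \<in> borel_measurable borel \<and> (\<forall>x. 0 \<le> f x) \<and> density \<sigma> (\<lambda>x. ennreal (f x)) = M"
    if "M \<in> {\<mu>0, \<nu>0}" for M
  proof -
    have fm: "finite_measure M" "sets M = sets \<sigma>" using that fb sts by (auto simp: fin_borelD)
    have ac: "absolutely_continuous \<sigma> M"
      using that em sts by (auto simp: absolutely_continuous_def null_sets_def)
    obtain D where D: "D \<in> borel_measurable \<sigma>" "AE x in \<sigma>. RN_deriv \<sigma> M x = ennreal (D x)" "\<And>x. 0 \<le> D x"
      using real_RN_deriv[OF fm(1) ac fm(2)] by metis
    have "density \<sigma> (\<lambda>x. ennreal (D x)) = density \<sigma> (RN_deriv \<sigma> M)"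
      using D by (intro density_cong) auto
    also have "\<dots> = M" by (rule density_RN_deriv[OF ac fm(2)])
    finally have "density \<sigma> (\<lambda>x. ennreal (D x)) = M" .
    moreover have "D \<in> borel_measurable borel" using D(1) by (simp only: measurable_cong_sets[OF sts(1) refl])
    ultimately show ?thesis using D(3) by blast
  qed
  obtain f g where f: "f \<in> borel_measurable borel" "\<And>x. 0 \<le> f x" "density \<sigma> (\<lambda>x. ennreal (f x)) = \<mu>0"
    and g: "g \<in> borel_measurable borel" "\<And>x. 0 \<le> g x" "density \<sigma> (\<lambda>x. ennreal (g x)) = \<nu>0"
    using RN[of \<mu>0] RN[of \<nu>0] by blast
  have [measurable]: "f \<in> borel_measurable \<sigma>" "g \<in> borel_measurable \<sigma>"
    using f(1) g(1) by (simp_all only: measurable_cong_sets[OF sts(1) refl])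
  have fin: "integrable \<sigma> h" if "h \<in> borel_measurable borel" "\<And>x. 0 \<le> h x" "finite_measure (density \<sigma> (\<lambda>x. ennreal (h x)))" for h
  proof -
    have [measurable]: "h \<in> borel_measurable \<sigma>" using that(1) by (simp only: measurable_cong_sets[OF sts(1) refl])
    have "emeasure (density \<sigma> (\<lambda>x. ennreal (h x))) UNIV < \<infinity>"
      using finite_measure.emeasure_finite[OF that(3)] by (simp add: less_top)
    then show ?thesis
      using that(2) sts(1) by (subst (asm) emeasure_density) (auto simp: integrable_iff_bounded sp)
  qed
  have fi: "integrable \<sigma> f" "integrable \<sigma> g"
    using fin[OF f(1,2)] fin[OF g(1,2)] fb by (simp_all add: f(3) g(3) fin_borel_def)
  define p n where "p x = max (f x - g x) 0" and "n x = max (g x - f x) 0" for x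
  have [measurable]: "p \<in> borel_measurable \<sigma>" "n \<in> borel_measurable \<sigma>" unfolding p_def n_def by auto
  have pi: "integrable \<sigma> p" "integrable \<sigma> n" unfolding p_def n_def using fi by auto
  define \<mu> \<nu> where "\<mu> = density \<sigma> (\<lambda>x. ennreal (p x))" and "\<nu> = density \<sigma> (\<lambda>x. ennreal (n x))"
  have dfin: "fin_borel (density \<sigma> (\<lambda>x. ennreal (h x)))" if "integrable \<sigma> h" "\<And>x. 0 \<le> h x" for h
  proof -
    have "emeasure (density \<sigma> (\<lambda>x. ennreal (h x))) UNIV \<noteq> \<infinity>"
      using that borel_measurable_integrable[OF that(1)] sts(1)
      by (subst emeasure_density) (auto simp: integrable_iff_bounded)
    then show ?thesis unfolding fin_borel_def using sts by (auto intro!: finite_measureI simp: sp)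
  qed
  have fbn: "fin_borel \<mu>" "fin_borel \<nu>"
    unfolding \<mu>_def \<nu>_def by (intro dfin pi; simp add: p_def n_def)+
  have "has_Du u \<mu> \<nu>"
    unfolding has_Du_iff
  proof (intro conjI allI impI fbn)
    fix \<phi> :: "real \<Rightarrow> real" assume t: "test_fun UNIV \<phi>"
    have c: "continuous_on UNIV \<phi>" using t by (auto simp: test_fun_def smooth_continuous)
    then have [measurable]: "\<phi> \<in> borel_measurable \<sigma>"
      using borel_measurable_continuous_onI measurable_cong_sets[OF sts(1) refl] by blast
    obtain L where L: "\<And>x. x \<notin> {-L..L} \<Longrightarrow> \<phi> x = 0" using t test_fun_support[of \<phi>] by (auto simp: test_fun_def)
    obtain B where B: "\<And>x. \<bar>\<phi> x\<bar> \<le> B" using continuous_compact_support_bounded[OF c L] by metis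
    have ii: "integrable \<sigma> (\<lambda>x. h x * \<phi> x)" if "integrable \<sigma> h" for h
    proof (rule Bochner_Integration.integrable_bound)
      show "integrable \<sigma> (\<lambda>x. B * h x)" using that by simp
      have [measurable]: "h \<in> borel_measurable \<sigma>" using that by auto
      show "(\<lambda>x. h x * \<phi> x) \<in> borel_measurable \<sigma>" by measurable
      have "\<bar>h x * \<phi> x\<bar> \<le> \<bar>B * h x\<bar>" for x
        using mult_mono[OF B[of x] order_refl[of "\<bar>h x\<bar>"]] B[of x] abs_ge_zero[of "\<phi> x"] by (simp add: abs_mult mult.commute del: abs_ge_zero)
      then show "AE x in \<sigma>. norm (h x * \<phi> x) \<le> norm (B * h x)" by simp
    qed
    have "(LINT x|\<mu>0. \<phi> x) - (LINT x|\<nu>0. \<phi> x) = (LINT x|\<sigma>. f x * \<phi> x) - (LINT x|\<sigma>. g x * \<phi> x)"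
      using f(2) g(2) by (simp add: f(3)[symmetric] g(3)[symmetric] integral_density)
    also have "\<dots> = (LINT x|\<sigma>. p x * \<phi> x) - (LINT x|\<sigma>. n x * \<phi> x)"
    proof -
      have "(LINT x|\<sigma>. f x * \<phi> x) + (LINT x|\<sigma>. n x * \<phi> x) = (LINT x|\<sigma>. g x * \<phi> x) + (LINT x|\<sigma>. p x * \<phi> x)"
        using ii[OF fi(1)] ii[OF fi(2)] ii[OF pi(1)] ii[OF pi(2)]
        by (simp flip: Bochner_Integration.integral_add, intro Bochner_Integration.integral_cong) (auto simp: p_def n_def max_def algebra_simps)
      then show ?thesis by simp
    qed
    also have "\<dots> = (LINT x|\<mu>. \<phi> x) - (LINT x|\<nu>. \<phi> x)"
    proof -
      have "0 \<le> p x" "0 \<le> n x" for x by (simp_all add: p_def n_def)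
      then show ?thesis by (simp add: \<mu>_def \<nu>_def integral_density)
    qed
    finally show "(LINT x|lborel. u x * deriv \<phi> x) = - ((LINT x|\<mu>. \<phi> x) - (LINT x|\<nu>. \<phi> x))"
      using fb t by simp
  qed
  moreover have "mutually_singular \<mu> \<nu>"
    unfolding mutually_singular_def
  proof (intro bexI conjI)
    have [measurable]: "f \<in> borel_measurable borel" "g \<in> borel_measurable borel" using f g by auto
    have "{x. f x \<le> g x} \<in> sets borel"
      using borel_measurable_le[of f borel g] f g by simp
    then show Z: "{x. f x \<le> g x} \<in> sets borel" .
    have "(\<integral>\<^sup>+ x. ennreal (p x) * indicator {x. f x \<le> g x} x \<partial>\<sigma>) = (\<integral>\<^sup>+ x. 0 \<partial>\<sigma>)"
      by (intro nn_integral_cong) (auto simp: p_def indicator_def max_def)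
    then show "emeasure \<mu> {x. f x \<le> g x} = 0"
      unfolding \<mu>_def by (subst emeasure_density) (use Z sts in auto)
    have "(\<integral>\<^sup>+ x. ennreal (n x) * indicator (- {x. f x \<le> g x}) x \<partial>\<sigma>) = (\<integral>\<^sup>+ x. 0 \<partial>\<sigma>)"
      by (intro nn_integral_cong) (auto simp: n_def indicator_def max_def)
    then show "emeasure \<nu> (- {x. f x \<le> g x}) = 0"
      unfolding \<nu>_def by (subst emeasure_density) (use Z sts in auto)
  qed
  ultimately show thesis by (rule that)
qed


section \<open>Functions of bounded variation supported in an interval\<close>

lemma deriv_notin_supp:
  fixes \<phi> :: "real \<Rightarrow> real"
  assumes "x \<notin> supp \<phi>" shows "deriv \<phi> x = 0"
proof -
  have "open (- supp \<phi>)" by (simp add: supp_def open_Compl)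
  then have "((\<lambda>_. 0) has_real_derivative 0) (at x) \<longleftrightarrow> (\<phi> has_real_derivative 0) (at x)"
    using assms notin_supp[of _ \<phi>] by (intro DERIV_cong_ev) (auto simp: eventually_nhds intro!: exI[of _ "- supp \<phi>"])
  then show ?thesis by (simp add: DERIV_imp_deriv)
qed

lemma measure_atMost_mono: "fin_borel M \<Longrightarrow> mono (\<lambda>r. measure M {..r})"
  by (intro monoI finite_measure.finite_measure_mono) (auto simp: fin_borelD)

lemma measure_atMost_borel: "fin_borel M \<Longrightarrow> (\<lambda>r. measure M {..r}) \<in> borel_measurable borel"
  by (rule borel_measurable_mono[OF measure_atMost_mono])

lemma measure_le_UNIV: "fin_borel M \<Longrightarrow> measure M A \<le> measure M UNIV"
  using finite_measure.bounded_measure[of M A] by (simp add: fin_borelD)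

lemma AE_concentrated:
  assumes "fin_borel M" "emeasure M (- {L..R}) = 0"
  shows "AE x in M. x \<in> {L..R}"
proof -
  have "- {L..R} \<in> null_sets M" using assms by (auto simp: null_sets_def fin_borelD)
  from AE_not_in[OF this] show ?thesis by eventually_elim auto
qed

lemma concentrated_integrable:
  fixes f :: "real \<Rightarrow> real"
  assumes "fin_borel M" "emeasure M (- {L..R}) = 0" "f \<in> borel_measurable borel" "\<And>x. x \<in> {L..R} \<Longrightarrow> \<bar>f x\<bar> \<le> B"
  shows "integrable M f"
proof (rule fin_borel_integrable[OF assms(1,3)])
  show "AE x in M. \<bar>f x\<bar> \<le> B" using AE_concentrated[OF assms(1,2)] by (rule eventually_mono) (use assms(4) in blast)
qed

lemma concentrated_integrable_continuous:
  fixes f :: "real \<Rightarrow> real"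
  assumes "fin_borel M" "emeasure M (- {L..R}) = 0" "f \<in> borel_measurable borel" "continuous_on {L..R} f"
  shows "integrable M f"
proof -
  have "compact (f ` {L..R})" by (intro compact_continuous_image assms) auto
  then obtain B where B: "\<forall>x\<in>{L..R}. \<bar>f x\<bar> \<le> B"
    using compact_imp_bounded[of "f ` {L..R}"] unfolding bounded_pos by auto
  then show ?thesis by (intro concentrated_integrable[OF assms(1-3), of B]) auto
qed

text \<open>Stieltjes integration by parts, proved by Fubini on the triangle s \<le> r: for fixed s,
  integrating \<phi>' over [s, R] gives \<phi> R - \<phi> s.\<close>

lemma integral_cdf_mult_deriv:
  assumes M: "fin_borel M" "emeasure M (- {L..R}) = 0"
    and \<phi>: "\<And>x. (\<phi> has_real_derivative \<phi>' x) (at x)" "continuous_on UNIV \<phi>'"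
  shows "(LINT r:{L..R}|lborel. measure M {..r} * \<phi>' r) = \<phi> R * measure M UNIV - (LINT x|M. \<phi> x)"
proof -
  interpret M: finite_measure M using fin_borelD[OF M(1)] by simp
  interpret pair_sigma_finite lborel M ..
  have [measurable_cong]: "sets M = sets borel" using fin_borelD[OF M(1)] by simp
  have spM: "space M = UNIV" using fin_borelD[OF M(1)] by simp
  have [measurable]: "\<phi>' \<in> borel_measurable borel" using \<phi>(2) by (rule borel_measurable_continuous_onI)
  have c\<phi>: "continuous_on UNIV \<phi>" using DERIV_isCont[OF \<phi>(1)] by (simp add: continuous_at_imp_continuous_on)
  then have [measurable]: "\<phi> \<in> borel_measurable borel" by (rule borel_measurable_continuous_onI)
  note cdf [measurable] = measure_atMost_borel[OF M(1)]
  define f where "f = (\<lambda>(r, s). (indicator {L..R} r * \<phi>' r) * indicator {x. snd x \<le> fst x} (r, s) :: real)"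
  have [measurable]: "f \<in> borel_measurable (lborel \<Otimes>\<^sub>M M)"
    unfolding f_def by measurable
  have in0: "integrable lborel (\<lambda>r. indicator {L..R} r * \<phi>' r)"
    using borel_integrable_compact[of "{L..R}" \<phi>'] \<phi>(2) by (simp add: continuous_on_subset)
  \<comment> \<open>The function \<open>h\<close> is the absolute value in the integrability proof
    and the identity in the computation.\<close>
  have inner: "(LINT s|M. h (indicator {x. snd x \<le> fst x} (r, s)) * c) = measure M {..r} * h 1 * c"
    if "h 0 = 0" for h :: "real \<Rightarrow> real" and r c
  proof -
    have "(LINT s|M. h (indicator {x. snd x \<le> fst x} (r, s)) * c) = (LINT s|M. indicator {..r} s * (h 1 * c))"
      using that by (intro Bochner_Integration.integral_cong) (auto simp: indicator_def)
    also have "\<dots> = measure M {..r} * (h 1 * c)" by (simp add: spM)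
    finally show ?thesis by simp
  qed
  have int: "integrable (lborel \<Otimes>\<^sub>M M) f"
  proof (rule Fubini_integrable)
    show "integrable lborel (\<lambda>x. LINT y|M. norm (f (x, y)))"
    proof (rule Bochner_Integration.integrable_bound)
      show "integrable lborel (\<lambda>r. measure M UNIV * (indicator {L..R} r * \<phi>' r))" using in0 by simp
      show "AE x in lborel. norm (LINT y|M. norm (f (x, y))) \<le> norm (measure M UNIV * (indicator {L..R} x * \<phi>' x))"
      proof (rule AE_I2)
        fix x
        have "(LINT y|M. norm (f (x, y))) = measure M {..x} * \<bar>indicator {L..R} x * \<phi>' x\<bar>"
          using inner[of abs x "\<bar>indicator {L..R} x * \<phi>' x\<bar>"] by (simp add: f_def abs_mult mult_ac)
        moreover have "measure M {..x} * \<bar>indicator {L..R} x * \<phi>' x\<bar> \<le> measure M UNIV * \<bar>indicator {L..R} x * \<phi>' x\<bar>"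
          by (intro mult_right_mono measure_le_UNIV M) auto
        ultimately show "norm (LINT y|M. norm (f (x, y))) \<le> norm (measure M UNIV * (indicator {L..R} x * \<phi>' x))"
          unfolding real_norm_def abs_mult by (simp add: abs_mult)
      qed
    qed measurable
    have "integrable M (\<lambda>s. f (r, s))" for r
      unfolding f_def by (rule fin_borel_integrable_UNIV[OF M(1), of _ "\<bar>indicator {L..R} r * \<phi>' r\<bar>"]) (auto simp: indicator_def)
    then show "AE x in lborel. integrable M (\<lambda>y. f (x, y))" by simp
  qed measurable
  have "(LINT r:{L..R}|lborel. measure M {..r} * \<phi>' r) = (LINT r|lborel. LINT s|M. f (r, s))"
    unfolding set_lebesgue_integral_def
  proof (rule Bochner_Integration.integral_cong)
    fix r
    show "indicat_real {L..R} r *\<^sub>R (measure M {..r} * \<phi>' r) = (LINT s|M. f (r, s))"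
      using inner[of "\<lambda>x. x" r "indicator {L..R} r * \<phi>' r"] by (simp only: f_def prod.case mult_ac) simp
  qed simp
  also have "\<dots> = (LINT s|M. LINT r|lborel. f (r, s))"
    using int by (rule Fubini_integral[symmetric, of "\<lambda>x y. f (x, y)", simplified])
  also have "\<dots> = (LINT s|M. \<phi> R - \<phi> s)"
  proof (rule integral_cong_AE)
    show "AE s in M. (LINT r|lborel. f (r, s)) = \<phi> R - \<phi> s"
      using AE_concentrated[OF M]
    proof eventually_elim
      case (elim s)
      have "(LINT r|lborel. f (r, s)) = (LINT r|lborel. indicator {s..R} r *\<^sub>R \<phi>' r)"
        using elim by (intro Bochner_Integration.integral_cong) (auto simp: f_def indicator_def)
      also have "\<dots> = \<phi> R - \<phi> s"
        using elim \<phi> by (intro integral_FTC_atLeastAtMost)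
          (auto intro: continuous_on_subset DERIV_subset simp: has_real_derivative_iff_has_vector_derivative[symmetric])
      finally show ?case .
    qed
  qed measurable
  also have "\<dots> = \<phi> R * measure M UNIV - (LINT x|M. \<phi> x)"
  proof -
    have "integrable M \<phi>"
      by (rule concentrated_integrable_continuous[OF M]) (use continuous_on_subset[OF c\<phi>] in auto)
    then show ?thesis by (simp add: spM)
  qed
  finally show ?thesis .
qed

text \<open>Test functions supported off [L, R] see a zero integral, so \<mu> and \<nu> agree on
  each outer half-line. Two mutually singular measures that agree on all Borel parts of a set both
  vanish on it.\<close>

lemma has_Du_concentrated:
  assumes Du: "has_Du u \<mu> \<nu>" and ms: "mutually_singular \<mu> \<nu>"
    and u0: "AE r in lborel. r \<notin> {L..R} \<longrightarrow> u r = 0"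
  shows "emeasure \<mu> (- {L..R}) = 0" "emeasure \<nu> (- {L..R}) = 0"
proof -
  note fb = Du[unfolded has_Du_iff]
  obtain Z where Z: "Z \<in> sets borel" "emeasure \<mu> Z = 0" "emeasure \<nu> (- Z) = 0"
    using ms unfolding mutually_singular_def by auto
  have sub: "measure M B = 0" if "emeasure M A = 0" "B \<subseteq> A" "fin_borel M" "A \<in> sets borel" for M A B
    using emeasure_eq_0[of A M B] that fin_borelD(2)[OF that(3)] by (simp add: measure_def)
  have eq: "measure \<mu> (S \<inter> U) = measure \<nu> (S \<inter> U)" if U: "U \<in> {{..<L}, {R<..}}" and S: "S \<in> sets borel" for U S
  proof -
    have "measure \<mu> ({a<..<b} \<inter> U) + measure \<mu> ({a<..<b} \<inter> U) = measure \<nu> ({a<..<b} \<inter> U) + measure \<nu> ({a<..<b} \<inter> U)" for a b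
    proof -
      obtain c d where cd: "{a<..<b} \<inter> U = {c<..<d}"
      proof (cases "U = {..<L}")
        case True
        then have "{a<..<b} \<inter> U = {a<..<min b L}" by auto
        then show ?thesis by (rule that)
      next
        case False
        then have "{a<..<b} \<inter> U = {max a R<..<b}" using U by auto
        then show ?thesis by (rule that)
      qed
      have "(LINT x|\<mu>. \<phi> x) + (LINT x|\<mu>. \<phi> x) = (LINT x|\<nu>. \<phi> x) + (LINT x|\<nu>. \<phi> x)" if "test_fun {c<..<d} \<phi>" for \<phi>
      proof -
        have t: "test_fun UNIV \<phi>" and s: "supp \<phi> \<subseteq> {c<..<d}" using that by (auto simp: test_fun_def)
        have "U \<subseteq> - {L..R}" using U by auto
        then have "{c<..<d} \<subseteq> - {L..R}" using cd by blast
        then have "{L..R} \<inter> supp \<phi> = {}" using s by blast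
        then have "deriv \<phi> x = 0" if "x \<in> {L..R}" for x using that deriv_notin_supp[of x \<phi>] by blast
        then have "AE x in lborel. u x * deriv \<phi> x = 0" using u0 by auto
        then have "(LINT x|lborel. u x * deriv \<phi> x) = 0" by (rule integral_eq_zero_AE)
        then show ?thesis using fb t by auto
      qed
      then show ?thesis unfolding cd using fb by (intro test_fun_interval_measure_eq) auto
    qed
    moreover have "U \<in> sets borel" using U by auto
    ultimately have "measure \<mu> (S \<inter> U) + measure \<mu> (S \<inter> U) = measure \<nu> (S \<inter> U) + measure \<nu> (S \<inter> U)"
      using borel_measure_sum_eqI[of \<mu> \<mu> \<nu> \<nu> U S] fb S by presburger
    then show ?thesis by simp
  qed
  have zero: "measure \<mu> U = 0 \<and> measure \<nu> U = 0" if U: "U \<in> {{..<L}, {R<..}}" for U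
  proof -
    have Ub: "U \<in> sets borel" using U by auto
    have d: "measure M U = measure M (Z \<inter> U) + measure M ((- Z) \<inter> U)" if "fin_borel M" for M
    proof -
      have "U = (Z \<inter> U) \<union> ((- Z) \<inter> U)" by auto
      moreover have "measure M ((Z \<inter> U) \<union> ((- Z) \<inter> U)) = measure M (Z \<inter> U) + measure M ((- Z) \<inter> U)"
        using finite_measure.finite_measure_Union[OF fin_borelD(1)[OF that], of "Z \<inter> U" "(- Z) \<inter> U"] Ub Z fin_borelD(2)[OF that]
        by auto
      ultimately show ?thesis by simp
    qed
    have "measure \<mu> (Z \<inter> U) = 0" by (rule sub[OF Z(2)]) (use fb Z in auto)
    moreover have "measure \<nu> ((- Z) \<inter> U) = 0" by (rule sub[OF Z(3)]) (use fb Z in auto)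
    ultimately show ?thesis using d[of \<mu>] d[of \<nu>] eq[OF U, of Z] eq[OF U, of "- Z"] Z fb by auto
  qed
  have "emeasure M (- {L..R}) = 0" if M: "fin_borel M" "measure M {..<L} = 0" "measure M {R<..} = 0" for M
  proof -
    have "emeasure M {..<L} = 0" "emeasure M {R<..} = 0"
      using M finite_measure.emeasure_eq_measure[OF fin_borelD(1)[OF M(1)]] by auto
    then have "{..<L} \<union> {R<..} \<in> null_sets M" using fin_borelD(2)[OF M(1)] by (intro null_sets.Un) (auto simp: null_sets_def)
    moreover have "- {L..R} \<subseteq> {..<L} \<union> {R<..}" by auto
    ultimately show ?thesis using emeasure_eq_0[of "{..<L} \<union> {R<..}" M "- {L..R}"] by auto
  qed
  then show "emeasure \<mu> (- {L..R}) = 0" "emeasure \<nu> (- {L..R}) = 0"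
    using zero[of "{..<L}"] zero[of "{R<..}"] fb by auto
qed

lemma density_integrable_fin_borel:
  assumes "integrable lborel h" "\<And>x. 0 \<le> h x"
  shows "fin_borel (density lborel (\<lambda>x. ennreal (h x)))"
proof -
  have "emeasure (density lborel (\<lambda>x. ennreal (h x))) UNIV \<noteq> \<infinity>"
    using assms borel_measurable_integrable[OF assms(1)]
    by (subst emeasure_density) (auto simp: integrable_iff_bounded)
  then show ?thesis unfolding fin_borel_def by (auto intro!: finite_measureI)
qed

text \<open>The fundamental lemma of the calculus of variations, read as an equality of the two
  finite measures with densities h^+ and h^-: they agree on open intervals, hence everywhere, hence
  their densities agree almost everywhere. Intervals are first cut down to (c, d), where all of h
  lives.\<close>

lemma integral_test_fun_eq_0_imp_AE_0:
  fixes h :: "real \<Rightarrow> real"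
  assumes h: "integrable lborel h" "\<And>x. x \<notin> {c<..<d} \<Longrightarrow> h x = 0"
    and eq: "\<And>\<phi>. test_fun {c<..<d} \<phi> \<Longrightarrow> (LINT x|lborel. h x * \<phi> x) = 0"
  shows "AE x in lborel. h x = 0"
proof -
  define P N where "P = density lborel (\<lambda>x. ennreal (max (h x) 0))" and "N = density lborel (\<lambda>x. ennreal (max (- h x) 0))"
  have [measurable]: "h \<in> borel_measurable borel" using h(1) by simp
  have i: "integrable lborel (\<lambda>x. max (h x) 0)" "integrable lborel (\<lambda>x. max (- h x) 0)" using h(1) by auto
  have fb: "fin_borel P" "fin_borel N" unfolding P_def N_def by (intro density_integrable_fin_borel i; simp)+
  have mult: "integrable lborel (\<lambda>x. g x * \<phi> x)" if "integrable lborel g" "test_fun UNIV \<phi>" for g \<phi> :: "real \<Rightarrow> real"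
  proof -
    have c: "continuous_on UNIV \<phi>" using that by (auto simp: test_fun_def smooth_continuous)
    have "compact (supp \<phi>)" using that by (simp add: test_fun_def)
    then obtain L where L: "\<And>x. x \<notin> {-L..L} \<Longrightarrow> \<phi> x = 0" using test_fun_support[of \<phi>] by metis
    obtain B where B: "0 \<le> B" "\<And>x. \<bar>\<phi> x\<bar> \<le> B" using continuous_compact_support_bounded[OF c L] by metis
    have [measurable]: "\<phi> \<in> borel_measurable borel" using c by (rule borel_measurable_continuous_onI)
    have [measurable]: "g \<in> borel_measurable borel" using that by simp
    show ?thesis
    proof (rule Bochner_Integration.integrable_bound)
      show "integrable lborel (\<lambda>x. B * g x)" using that by simp
      have "\<bar>g x * \<phi> x\<bar> \<le> \<bar>B * g x\<bar>" for x
        using mult_left_mono[OF B(2)[of x] abs_ge_zero[of "g x"]] B(1) by (simp add: abs_mult mult.commute)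
      then show "AE x in lborel. norm (g x * \<phi> x) \<le> norm (B * g x)" by simp
    qed measurable
  qed
  have "measure P (S \<inter> UNIV) + measure P (S \<inter> UNIV) = measure N (S \<inter> UNIV) + measure N (S \<inter> UNIV)" if "S \<in> sets borel" for S
  proof (rule borel_measure_sum_eqI)
    fix a b :: real
    have cut: "measure M ({a<..<b} \<inter> UNIV) = measure M {max a c<..<min b d}"
      if "M = density lborel (\<lambda>x. ennreal (g x))" "g \<in> borel_measurable borel" "\<And>x. x \<notin> {c<..<d} \<Longrightarrow> g x = 0" for M and g :: "real \<Rightarrow> real"
    proof -
      have "emeasure M {a<..<b} = emeasure M {max a c<..<min b d}"
        using that(2,3) unfolding that(1) by (subst (1 2) emeasure_density) (auto intro!: nn_integral_cong simp: indicator_def)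
      then show ?thesis by (simp add: measure_def)
    qed
    have "measure P {max a c<..<min b d} + measure P {max a c<..<min b d} = measure N {max a c<..<min b d} + measure N {max a c<..<min b d}"
    proof (rule test_fun_interval_measure_eq)
      fix \<phi> assume t: "test_fun {max a c<..<min b d} \<phi>"
      then have t': "test_fun {c<..<d} \<phi>" "test_fun UNIV \<phi>" by (auto simp: test_fun_def)
      then have [measurable]: "\<phi> \<in> borel_measurable borel"
        by (auto simp: test_fun_def intro!: borel_measurable_continuous_onI smooth_continuous)
      have "0 = (LINT x|lborel. h x * \<phi> x)" using eq[OF t'(1)] by simp
      also have "\<dots> = (LINT x|lborel. max (h x) 0 * \<phi> x - max (- h x) 0 * \<phi> x)"
        by (intro Bochner_Integration.integral_cong) (auto simp: max_def)
      also have "\<dots> = (LINT x|lborel. max (h x) 0 * \<phi> x) - (LINT x|lborel. max (- h x) 0 * \<phi> x)"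
        by (intro Bochner_Integration.integral_diff mult i t')
      also have "(LINT x|lborel. max (h x) 0 * \<phi> x) = (LINT x|P. \<phi> x)"
        unfolding P_def by (subst integral_density) auto
      also have "(LINT x|lborel. max (- h x) 0 * \<phi> x) = (LINT x|N. \<phi> x)"
        unfolding N_def by (subst integral_density) auto
      finally show "(LINT x|P. \<phi> x) + (LINT x|P. \<phi> x) = (LINT x|N. \<phi> x) + (LINT x|N. \<phi> x)" by simp
    qed (use fb in auto)
    moreover have "measure P ({a<..<b} \<inter> UNIV) = measure P {max a c<..<min b d}"
      by (rule cut[OF P_def]) (use h(2) in auto)
    moreover have "measure N ({a<..<b} \<inter> UNIV) = measure N {max a c<..<min b d}"
      by (rule cut[OF N_def]) (use h(2) in auto)
    ultimately show "measure P ({a<..<b} \<inter> UNIV) + measure P ({a<..<b} \<inter> UNIV) = measure N ({a<..<b} \<inter> UNIV) + measure N ({a<..<b} \<inter> UNIV)"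
      by simp
  qed (use fb that in auto)
  then have PN: "measure P S = measure N S" if "S \<in> sets borel" for S using that by simp
  have "P = N" by (rule fin_borel_eqI[OF fb PN])
  moreover have "(\<integral>\<^sup>+x. ennreal (max (h x) 0) \<partial>lborel) \<noteq> \<infinity>"
    using i(1) by (simp add: integrable_iff_bounded)
  ultimately have "AE x in lborel. ennreal (max (h x) 0) = ennreal (max (- h x) 0)"
    unfolding P_def N_def
    using finite_density_unique[of "\<lambda>x. ennreal (max (h x) 0)" lborel "\<lambda>x. ennreal (max (- h x) 0)"] by simp
  then show ?thesis by eventually_elim (auto simp: max_def split: if_splits)
qed

lemma ex_unit_bump:
  fixes a b :: real
  assumes "a < b"
  obtains \<beta> where "smooth \<beta>" "\<And>x. x \<notin> {a..b} \<Longrightarrow> \<beta> x = 0" "(LINT x|lborel. \<beta> x) = 1" "\<And>x. 0 \<le> \<beta> x"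
proof -
  \<comment> \<open>For points at distance more than (b - a) / 3 from both ends, n times the
    distance then exceeds 4/3 > 1, so the bump is positive there.\<close>
  define n where "n = 4 / (b - a)"
  have n: "n > 0" using assms by (simp add: n_def)
  let ?f = "bump n a b"
  have z: "?f x = 0" if "x \<notin> {a..b}" for x
  proof (rule bump_eq_0[OF n])
    have "1 / n > 0" using n by simp
    then show "x \<notin> {a + 1 / n..b - 1 / n}" using that unfolding atLeastAtMost_iff by argo
  qed
  have c: "continuous_on UNIV ?f" by (intro smooth_continuous bump_smooth)
  have int: "integrable lborel ?f"
  proof -
    have "integrable lborel (\<lambda>x. indicator {a..b} x *\<^sub>R ?f x)"
      by (intro borel_integrable_compact) (auto intro: continuous_on_subset[OF c])
    moreover have "(\<lambda>x. indicator {a..b} x *\<^sub>R ?f x) = ?f"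
    proof
      fix x show "indicator {a..b} x *\<^sub>R ?f x = ?f x" using z[of x] by (cases "x \<in> {a..b}") simp_all
    qed
    ultimately show ?thesis by simp
  qed
  have pos: "(LINT x|lborel. ?f x) > 0"
  proof (rule ccontr)
    assume "\<not> ?thesis"
    then have "(LINT x|lborel. ?f x) = 0" using integral_nonneg_AE[of ?f lborel] bump_nonneg by (simp add: order_antisym)
    then have f0: "AE x in lborel. ?f x = 0" using integral_nonneg_eq_0_iff_AE[OF int] bump_nonneg by simp
    have nz: "?f x \<noteq> 0" if x: "x \<in> {a + (b - a) / 3 <..< a + (b - a) / 2}" for x
    proof -
      have "n * ((b - a) / 3) > 1" using assms by (simp add: n_def)
      moreover have "x - a > (b - a) / 3" "b - x > (b - a) / 3"
        using x assms by (auto simp: field_simps)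
      ultimately have "n * (x - a) > 1" "n * (b - x) > 1"
        using n by (meson less_trans mult_strict_left_mono)+
      then show ?thesis using bump_pos[of n x a b] by simp
    qed
    have "AE x in lborel. x \<notin> {a + (b - a) / 3 <..< a + (b - a) / 2}"
      using f0 by (rule eventually_mono) (use nz in blast)
    then have "{a + (b - a) / 3 <..< a + (b - a) / 2} \<in> null_sets lborel" by (simp add: AE_iff_null_sets)
    moreover have "a + (b - a) / 3 < a + (b - a) / 2" using assms by argo
    ultimately show False by (simp add: null_sets_def)
  qed
  let ?I = "LINT x|lborel. ?f x"
  show ?thesis
  proof (rule that[of "\<lambda>x. ?f x / ?I"])
    show "smooth (\<lambda>x. ?f x / ?I)"
      using smooth_linear_combination[OF bump_smooth[of n a b] bump_smooth[of n a b], of "1 / ?I" 0] by simp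
    show "?f x / ?I = 0" if "x \<notin> {a..b}" for x using z[OF that] by simp
    show "(LINT x|lborel. ?f x / ?I) = 1" using pos by simp
    show "0 \<le> ?f x / ?I" for x using pos bump_nonneg by simp
  qed
qed

lemma integrable_continuous_compact_support:
  fixes f :: "'a::euclidean_space \<Rightarrow> real"
  assumes "continuous_on UNIV f" "compact S" "\<And>x. x \<notin> S \<Longrightarrow> f x = 0"
  shows "integrable lborel f"
proof -
  have "integrable lborel (\<lambda>x. indicator S x *\<^sub>R f x)"
    by (intro borel_integrable_compact assms continuous_on_subset[OF assms(1)]) simp
  moreover have "(\<lambda>x. indicator S x *\<^sub>R f x) = f"
  proof
    fix x show "indicator S x *\<^sub>R f x = f x" using assms(3)[of x] by (cases "x \<in> S") simp_all
  qed
  ultimately show ?thesis by simp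
qed

lemma integrable_continuous_interval_support:
  fixes f :: "real \<Rightarrow> real"
  assumes "continuous_on UNIV f" "\<And>x. x \<notin> {L..R} \<Longrightarrow> f x = 0"
  shows "integrable lborel f"
  by (rule integrable_continuous_compact_support[OF assms(1) compact_Icc assms(2)])

text \<open>The argument of du Bois-Reymond: only test functions of integral zero are derivatives of
  test functions, so each g is corrected by a multiple of a fixed unit bump before it is integrated.
  By integration by parts, the distribution function of \<mu> - \<nu> satisfies the same identity as
  u.\<close>

lemma has_Du_representation:
  assumes Du: "has_Du u \<mu> \<nu>" and ms: "mutually_singular \<mu> \<nu>"
    and u: "integrable lborel u" and u0: "AE r in lborel. r \<notin> {L..R} \<longrightarrow> u r = 0" and LR: "L \<le> R"
  shows "AE r in lborel. u r = measure \<mu> {..r} - measure \<nu> {..r}"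
    and "measure \<mu> UNIV = measure \<nu> UNIV"
proof -
  note fb = Du[unfolded has_Du_iff]
  note conc = has_Du_concentrated[OF Du ms u0]
  have conc': "emeasure M (- {c..d}) = 0" if "fin_borel M" "emeasure M (- {L..R}) = 0" "c \<le> L" "R \<le> d" for M c d
    using emeasure_eq_0[of "- {L..R}" M "- {c..d}"] that fin_borelD(2)[OF that(1)] by auto
  define v where "v r = measure \<mu> {..r} - measure \<nu> {..r}" for r
  have [measurable]: "v \<in> borel_measurable borel" unfolding v_def
    using fb measure_atMost_borel by (intro borel_measurable_diff) auto
  have [measurable]: "u \<in> borel_measurable borel" using u by simp
  have v0: "v r = 0" if "r < L" for r
  proof -
    have "measure M {..r} = 0" if "fin_borel M" "emeasure M (- {L..R}) = 0" for M
    proof -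
      have "{..r} \<subseteq> - {L..R}" using \<open>r < L\<close> by auto
      then show ?thesis
        using emeasure_eq_0[of "- {L..R}" M "{..r}"] that fin_borelD(2)[OF that(1)] by (simp add: measure_def)
    qed
    then show ?thesis using fb conc by (simp add: v_def)
  qed
  have v1: "v r = measure \<mu> UNIV - measure \<nu> UNIV" if "R < r" for r
  proof -
    have "measure M {..r} = measure M UNIV" if M: "fin_borel M" "emeasure M (- {L..R}) = 0" for M
    proof (rule measure_eq_AE)
      show "AE x in M. x \<in> {..r} \<longleftrightarrow> x \<in> UNIV" using AE_concentrated[OF M] by eventually_elim (use \<open>R < r\<close> in auto)
    qed (use fin_borelD[OF M(1)] in auto)
    then show ?thesis using fb conc by (simp add: v_def)
  qed
  have vB: "\<bar>v r\<bar> \<le> measure \<mu> UNIV + measure \<nu> UNIV" for r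
  proof -
    have "measure \<mu> {..r} \<le> measure \<mu> UNIV" "measure \<nu> {..r} \<le> measure \<nu> UNIV" using fb by (simp_all add: measure_le_UNIV)
    then show ?thesis
      using measure_nonneg[of \<mu> "{..r}"] measure_nonneg[of \<nu> "{..r}"] unfolding v_def by linarith
  qed
  define K where "K = \<bar>L\<bar> + \<bar>R\<bar> + 1"
  have K: "-K < L" "R < K" "K > 0" by (auto simp: K_def)
  define h where "h r = (u r - v r) * indicator {-K<..<K} r" for r
  have vint: "integrable lborel (\<lambda>r. v r * indicator {-K-2..K} r)"
  proof (rule Bochner_Integration.integrable_bound)
    show "integrable lborel (\<lambda>r. (measure \<mu> UNIV + measure \<nu> UNIV) * indicator {-K-2..K} r)"
      by (intro integrable_mult_right integrable_real_indicator) (auto simp: emeasure_lborel_Icc_eq)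
    show "AE r in lborel. norm (v r * indicator {-K-2..K} r) \<le> norm ((measure \<mu> UNIV + measure \<nu> UNIV) * indicator {-K-2..K} r)"
      using vB by (auto simp: abs_mult indicator_def)
  qed measurable
  have hint: "integrable lborel h"
  proof -
    have "integrable lborel (\<lambda>r. u r * indicator {-K<..<K} r - v r * indicator {-K-2..K} r * indicator {-K<..<K} r)"
      by (intro Bochner_Integration.integrable_diff integrable_real_mult_indicator u vint) auto
    moreover have "h = (\<lambda>r. u r * indicator {-K<..<K} r - v r * indicator {-K-2..K} r * indicator {-K<..<K} r)"
      by (auto simp: h_def indicator_def)
    ultimately show ?thesis by simp
  qed
  \<comment> \<open>The correcting bump sits left of [L, R], where u and v both vanish, so the
    correction changes neither pairing.\<close>
  obtain \<beta> where \<beta>: "smooth \<beta>" "\<And>x. x \<notin> {-K-2..-K-1} \<Longrightarrow> \<beta> x = 0" "(LINT x|lborel. \<beta> x) = 1"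
    using ex_unit_bump[of "-K-2" "-K-1"] by (metis diff_strict_left_mono one_less_numeral_iff semiring_norm(76))
  have "AE r in lborel. h r = 0"
  proof (rule integral_test_fun_eq_0_imp_AE_0[OF hint])
    show "h x = 0" if "x \<notin> {-K<..<K}" for x using that by (simp add: h_def)
    fix g assume t: "test_fun {-K<..<K} g"
    then have sg: "smooth g" and g0: "\<And>x. x \<notin> {-K<..<K} \<Longrightarrow> g x = 0"
    proof -
      show "smooth g" using t by (simp add: test_fun_def)
      fix x assume "x \<notin> {-K<..<K}"
      then have "x \<notin> supp g" using t unfolding test_fun_def by blast
      then show "g x = 0" by (rule notin_supp)
    qed
    define c where "c = (LINT x|lborel. g x)"
    define g1 where "g1 x = 1 * g x + (- c) * \<beta> x" for x
    have sg1: "smooth g1" unfolding g1_def by (intro smooth_linear_combination sg \<beta>)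
    have g10: "g1 x = 0" if "x \<notin> {-K-2..K}" for x using that g0[of x] \<beta>(2)[of x] K by (auto simp: g1_def)
    have cont: "continuous_on UNIV g1" "continuous_on UNIV g" "continuous_on UNIV \<beta>" using sg1 sg \<beta> by (auto intro: smooth_continuous)
    have gi: "integrable lborel g" by (rule integrable_continuous_interval_support[of _ "-K" K]) (use cont g0 in auto)
    have bi: "integrable lborel \<beta>" by (rule integrable_continuous_interval_support[of _ "-K-2" "-K-1"]) (use cont \<beta> in auto)
    have "(LINT x|lborel. g1 x) = 0" unfolding g1_def using gi bi \<beta>(3) by (simp add: c_def)
    moreover have "-K-2 \<le> K" using K by simp
    ultimately obtain \<phi> where \<phi>: "\<And>x. (\<phi> has_real_derivative g1 x) (at x)" "\<And>x. x \<le> -K-2 \<Longrightarrow> \<phi> x = 0" "\<And>x. K \<le> x \<Longrightarrow> \<phi> x = 0"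
      using ex_antiderivative[OF cont(1) g10] by metis
    have t\<phi>: "test_fun UNIV \<phi>"
      by (rule test_funI[of _ "-K-2" K]) (use smooth_antiderivative[OF sg1 \<phi>(1)] \<phi> in auto)
    have d: "deriv \<phi> = g1" using \<phi>(1) DERIV_imp_deriv by blast
    have E: "(LINT r:{-K-2..K}|lborel. measure M {..r} * g1 r) = - (LINT x|M. \<phi> x)" if "fin_borel M" "emeasure M (- {L..R}) = 0" for M
      using integral_cdf_mult_deriv[OF that(1) conc'[OF that, of "-K-2" K] \<phi>(1) cont(1)] K \<phi>(3)[of K] by simp
    have gb: "g1 \<in> borel_measurable borel" "g \<in> borel_measurable borel" "\<beta> \<in> borel_measurable borel"
      using cont by (auto intro: borel_measurable_continuous_onI)
    note [measurable] = gb
    obtain B1 where B1: "\<And>x. \<bar>g1 x\<bar> \<le> B1" using continuous_compact_support_bounded[OF cont(1) g10] by metis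
    obtain B where B: "\<And>x. \<bar>g x\<bar> \<le> B" using continuous_compact_support_bounded[OF cont(2), of "-K" K] g0 by (metis atLeastAtMost_iff greaterThanLessThan_iff less_eq_real_def)
    have si: "set_integrable lborel {-K-2..K} (\<lambda>r. measure M {..r} * g1 r)" if "fin_borel M" for M
      unfolding set_integrable_def
    proof (rule Bochner_Integration.integrable_bound)
      show "integrable lborel (\<lambda>r. measure M UNIV * B1 * indicator {-K-2..K} r)"
        by (intro integrable_mult_right integrable_real_indicator) (auto simp: emeasure_lborel_Icc_eq)
      show "AE x in lborel. norm (indicat_real {-K-2..K} x *\<^sub>R (measure M {..x} * g1 x)) \<le> norm (measure M UNIV * B1 * indicator {-K-2..K} x)"
      proof (rule AE_I2)
        fix x
        have "measure M {..x} * \<bar>g1 x\<bar> \<le> measure M UNIV * B1"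
          using B1[of x] measure_le_UNIV[OF that, of "{..x}"] by (intro mult_mono) auto
        moreover have "0 \<le> B1" using B1[of x] by linarith
        ultimately show "norm (indicat_real {-K-2..K} x *\<^sub>R (measure M {..x} * g1 x)) \<le> norm (measure M UNIV * B1 * indicator {-K-2..K} x)"
          by (auto simp: indicator_def abs_mult)
      qed
      have [measurable]: "(\<lambda>r. measure M {..r}) \<in> borel_measurable borel" by (rule measure_atMost_borel[OF that])
      show "(\<lambda>x. indicat_real {-K-2..K} x *\<^sub>R (measure M {..x} * g1 x)) \<in> borel_measurable lborel" by measurable
    qed
    have "(LINT r:{-K-2..K}|lborel. v r * g1 r) = - ((LINT x|\<mu>. \<phi> x) - (LINT x|\<nu>. \<phi> x))"
      using E[of \<mu>] E[of \<nu>] fb conc set_integral_diff(2)[OF si[of \<mu>] si[of \<nu>]] by (simp add: v_def left_diff_distrib)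
    also have "\<dots> = (LINT x|lborel. u x * g1 x)" using fb t\<phi> unfolding d[symmetric] by simp
    finally have eq1: "(LINT r:{-K-2..K}|lborel. v r * g1 r) = (LINT x|lborel. u x * g1 x)" .
    have eq2: "(LINT x|lborel. u x * g1 x) = (LINT x|lborel. u x * g x)"
    proof (rule integral_cong_AE)
      show "AE x in lborel. u x * g1 x = u x * g x" using u0
      proof eventually_elim
        case (elim x) then show ?case using \<beta>(2)[of x] K by (cases "x \<in> {L..R}") (auto simp: g1_def)
      qed
    qed auto
    have eq3: "(LINT r:{-K-2..K}|lborel. v r * g1 r) = (LINT r|lborel. v r * g r)"
      unfolding set_lebesgue_integral_def
    proof (rule Bochner_Integration.integral_cong)
      fix x
      show "indicat_real {-K-2..K} x *\<^sub>R (v x * g1 x) = v x * g x"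
      proof (cases "x < L")
        case False then show ?thesis using \<beta>(2)[of x] K g0[of x] by (auto simp: g1_def indicator_def)
      qed (simp add: v0)
    qed simp
    have ui: "integrable lborel (\<lambda>x. u x * g x)"
    proof (rule Bochner_Integration.integrable_bound)
      show "integrable lborel (\<lambda>x. B * u x)" using u by simp
      have "\<bar>u x\<bar> * \<bar>g x\<bar> \<le> \<bar>u x\<bar> * \<bar>B\<bar>" for x using B[of x] by (intro mult_left_mono) auto
      then show "AE x in lborel. norm (u x * g x) \<le> norm (B * u x)" by (simp add: abs_mult mult.commute)
    qed measurable
    have vi: "integrable lborel (\<lambda>x. v x * g x)"
    proof (rule Bochner_Integration.integrable_bound)
      show "integrable lborel (\<lambda>x. B * (v x * indicator {-K-2..K} x))" using vint by simp
      have "\<bar>v x\<bar> * \<bar>g x\<bar> \<le> \<bar>v x\<bar> * \<bar>B\<bar>" for x using B[of x] by (intro mult_left_mono) auto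
      then show "AE x in lborel. norm (v x * g x) \<le> norm (B * (v x * indicator {-K-2..K} x))"
        using g0 by (auto simp: abs_mult mult.commute indicator_def)
    qed measurable
    have "(LINT x|lborel. h x * g x) = (LINT x|lborel. u x * g x - v x * g x)"
    proof (rule Bochner_Integration.integral_cong)
      fix x show "h x * g x = u x * g x - v x * g x" using g0[of x] by (cases "x \<in> {-K<..<K}") (auto simp: h_def algebra_simps)
    qed simp
    also have "\<dots> = 0" using eq1 eq2 eq3 ui vi by simp
    finally show "(LINT x|lborel. h x * g x) = 0" .
  qed
  then have uv: "AE r in lborel. r \<in> {-K<..<K} \<longrightarrow> u r = v r"
    by eventually_elim (auto simp: h_def)
  \<comment> \<open>To the right of R, v equals the difference of the total masses while u vanishes
    almost everywhere, and (R, K) has positive length.\<close>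
  show mass: "measure \<mu> UNIV = measure \<nu> UNIV"
  proof (rule ccontr)
    assume ne: "\<not> ?thesis"
    have "AE r in lborel. r \<notin> {R<..<K}" using uv u0
    proof eventually_elim
      case (elim r)
      show ?case
      proof
        assume r: "r \<in> {R<..<K}"
        then have "u r = 0" "u r = v r" using elim K LR by auto
        then show False using v1[of r] r ne by auto
      qed
    qed
    then have "{R<..<K} \<in> null_sets lborel" by (simp add: AE_iff_null_sets)
    then show False using K by (simp add: null_sets_def)
  qed
  show "AE r in lborel. u r = measure \<mu> {..r} - measure \<nu> {..r}"
    using uv u0
  proof eventually_elim
    case (elim r)
    show ?case
    proof (cases "r \<in> {L..R}")
      case True then show ?thesis using elim K by (auto simp: v_def)
    next
      case False
      then consider "r < L" | "R < r" by force
      then have "v r = 0" using v0 v1 mass by cases auto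
      then show ?thesis using elim False by (simp add: v_def)
    qed
  qed
qed


section \<open>The admissible classes\<close>

lemma A_BV_integrable: "u \<in> A_BV R1 R2 \<Longrightarrow> integrable lborel u"
  by (simp add: A_BV_def BV_def)

lemma A_BV_has_Du:
  assumes "u \<in> A_BV R1 R2"
  shows "has_Du u (Du_pos u) (Du_neg u)" "mutually_singular (Du_pos u) (Du_neg u)"
proof -
  obtain \<mu>0 \<nu>0 where "has_Du u \<mu>0 \<nu>0" using assms by (auto simp: A_BV_def BV_def)
  from Jordan_exists[OF this] obtain \<mu> \<nu> where "has_Du u \<mu> \<nu>" "mutually_singular \<mu> \<nu>" .
  then show "has_Du u (Du_pos u) (Du_neg u)" "mutually_singular (Du_pos u) (Du_neg u)"
    using Du_eqI[of u \<mu> \<nu>] by simp_all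
qed

lemma A_BV_fin_borel:
  assumes "u \<in> A_BV R1 R2"
  shows "fin_borel (Du_pos u)" "fin_borel (Du_neg u)"
  using A_BV_has_Du[OF assms] by (simp_all add: has_Du_iff)

lemma A_BV_concentrated:
  assumes "u \<in> A_BV R1 R2"
  shows "emeasure (Du_pos u) (- {R1..R2}) = 0" "emeasure (Du_neg u) (- {R1..R2}) = 0"
  using has_Du_concentrated[OF A_BV_has_Du[OF assms], of R1 R2] assms by (auto simp: A_BV_def)

lemma A_BV_representation:
  assumes "u \<in> A_BV R1 R2" "R1 \<le> R2"
  shows "AE r in lborel. u r = measure (Du_pos u) {..r} - measure (Du_neg u) {..r}"
    "measure (Du_pos u) UNIV = measure (Du_neg u) UNIV"
  using has_Du_representation[OF A_BV_has_Du[OF assms(1)] A_BV_integrable[OF assms(1)], of R1 R2] assms by (auto simp: A_BV_def)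

lemma integrable_mult_continuous:
  fixes u f :: "real \<Rightarrow> real"
  assumes "integrable lborel u" "continuous_on {a..b} f"
  shows "set_integrable lborel {a..b} (\<lambda>r. f r * u r)"
proof -
  have "compact (f ` {a..b})" by (intro compact_continuous_image assms) auto
  then obtain B where B: "\<forall>x\<in>{a..b}. \<bar>f x\<bar> \<le> B"
    using compact_imp_bounded[of "f ` {a..b}"] unfolding bounded_pos by auto
  have m: "(\<lambda>r. indicator {a..b} r *\<^sub>R f r) \<in> borel_measurable borel"
    using assms(2) by (intro borel_measurable_continuous_on_indicator) auto
  have [measurable]: "u \<in> borel_measurable borel" using assms(1) by simp
  show ?thesis unfolding set_integrable_def
  proof (rule Bochner_Integration.integrable_bound)
    show "integrable lborel (\<lambda>r. B * u r)" using assms(1) by simp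
    have "(\<lambda>r. (indicator {a..b} r *\<^sub>R f r) * u r) \<in> borel_measurable borel" using m by measurable
    then show "(\<lambda>r. indicator {a..b} r *\<^sub>R (f r * u r)) \<in> borel_measurable lborel" by (simp add: mult.assoc)
    show "AE x in lborel. norm (indicat_real {a..b} x *\<^sub>R (f x * u x)) \<le> norm (B * u x)"
    proof (rule AE_I2)
      fix x show "norm (indicat_real {a..b} x *\<^sub>R (f x * u x)) \<le> norm (B * u x)"
      proof (cases "x \<in> {a..b}")
        case True
        then have "\<bar>f x\<bar> * \<bar>u x\<bar> \<le> \<bar>B\<bar> * \<bar>u x\<bar>" using B by (intro mult_right_mono) (force, simp)
        then show ?thesis using True by (simp add: abs_mult)
      qed simp
    qed
  qed
qed

text \<open>Extends the defining identity of Du from test functions to arbitrary continuously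
  differentiable \<phi>: the boundary terms at R2 cancel because the two parts of Du have equal
  mass.\<close>

lemma A_BV_integral_by_parts:
  assumes u: "u \<in> A_BV R1 R2" "R1 \<le> R2"
    and \<phi>: "\<And>x. (\<phi> has_real_derivative \<phi>' x) (at x)" "continuous_on UNIV \<phi>'"
  shows "(LINT r:{R1..R2}|lborel. \<phi>' r * u r) = - ((LINT x|Du_pos u. \<phi> x) - (LINT x|Du_neg u. \<phi> x))"
proof -
  note fb = A_BV_fin_borel[OF u(1)] and c = A_BV_concentrated[OF u(1)]
  have i: "set_integrable lborel {R1..R2} (\<lambda>r. measure M {..r} * \<phi>' r)" if "fin_borel M" for M
  proof -
    have [measurable]: "(\<lambda>r. measure M {..r}) \<in> borel_measurable borel" by (rule measure_atMost_borel[OF that])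
    have "integrable lborel (\<lambda>r. measure M {..r} * indicator {R1..R2} r)"
    proof (rule Bochner_Integration.integrable_bound)
      show "integrable lborel (\<lambda>r. measure M UNIV * indicator {R1..R2} r)"
        by (intro integrable_mult_right integrable_real_indicator) (auto simp: emeasure_lborel_Icc_eq)
      show "AE x in lborel. norm (measure M {..x} * indicat_real {R1..R2} x) \<le> norm (measure M UNIV * indicat_real {R1..R2} x)"
        using measure_le_UNIV[OF that] by (auto simp: indicator_def)
    qed measurable
    from integrable_mult_continuous[OF this continuous_on_subset[OF \<phi>(2)], of R1 R2]
    have "set_integrable lborel {R1..R2} (\<lambda>r. \<phi>' r * (measure M {..r} * indicat_real {R1..R2} r))" by simp
    then show ?thesis unfolding set_integrable_def
      by (rule Bochner_Integration.integrable_cong[THEN iffD1, rotated -1]) (auto simp: indicator_def)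
  qed
  have "(LINT r:{R1..R2}|lborel. \<phi>' r * u r) = (LINT r:{R1..R2}|lborel. measure (Du_pos u) {..r} * \<phi>' r - measure (Du_neg u) {..r} * \<phi>' r)"
  proof (rule set_lebesgue_integral_cong_AE)
    show "AE x\<in>{R1..R2} in lborel. \<phi>' x * u x = measure (Du_pos u) {..x} * \<phi>' x - measure (Du_neg u) {..x} * \<phi>' x"
      using A_BV_representation(1)[OF u] by eventually_elim (simp add: right_diff_distrib mult.commute)
    have [measurable]: "\<phi>' \<in> borel_measurable borel" using \<phi>(2) by (rule borel_measurable_continuous_onI)
    have [measurable]: "u \<in> borel_measurable borel" using A_BV_integrable[OF u(1)] by simp
    note [measurable] = measure_atMost_borel[OF fb(1)] measure_atMost_borel[OF fb(2)]
    show "(\<lambda>x. \<phi>' x * u x) \<in> borel_measurable lborel" by measurable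
    show "(\<lambda>x. measure (Du_pos u) {..x} * \<phi>' x - measure (Du_neg u) {..x} * \<phi>' x) \<in> borel_measurable lborel" by measurable
  qed simp
  also have "\<dots> = (LINT r:{R1..R2}|lborel. measure (Du_pos u) {..r} * \<phi>' r) - (LINT r:{R1..R2}|lborel. measure (Du_neg u) {..r} * \<phi>' r)"
    by (intro set_integral_diff i fb)
  also have "\<dots> = - ((LINT x|Du_pos u. \<phi> x) - (LINT x|Du_neg u. \<phi> x))"
    using integral_cdf_mult_deriv[OF fb(1) c(1) \<phi>] integral_cdf_mult_deriv[OF fb(2) c(2) \<phi>] A_BV_representation(2)[OF u]
    by simp
  finally show ?thesis .
qed

lemma A_weight_DERIV: "(A_weight R2 has_real_derivative - r\<^sup>2) (at r)"
  unfolding A_weight_def[abs_def] by (auto intro!: derivative_eq_intros)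

lemma A_BV_integral_A_weight:
  assumes "u \<in> A_BV R1 R2" "R1 \<le> R2"
  shows "(LINT x|Du_pos u. A_weight R2 x) - (LINT x|Du_neg u. A_weight R2 x) = 1"
proof -
  have "(LINT r:{R1..R2}|lborel. - r\<^sup>2 * u r) = - ((LINT x|Du_pos u. A_weight R2 x) - (LINT x|Du_neg u. A_weight R2 x))"
    by (rule A_BV_integral_by_parts[OF assms A_weight_DERIV]) (intro continuous_intros)
  moreover have "(LINT r:{R1..R2}|lborel. - r\<^sup>2 * u r) = - (LINT r:{R1..R2}|lborel. r\<^sup>2 * u r)"
    by (simp add: set_integral_uminus[symmetric] set_lebesgue_integral_def)
  ultimately show ?thesis using assms by (simp add: A_BV_def)
qed

lemma A_smoothD:
  assumes "u \<in> A_smooth R1 R2"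
  shows "smooth u" "\<And>r. 0 \<le> u r" "\<And>r. r \<notin> {R1<..<R2} \<Longrightarrow> u r = 0" "\<And>r. r \<notin> {R1<..<R2} \<Longrightarrow> deriv u r = 0"
    "(LINT r:{R1..R2}|lborel. r\<^sup>2 * u r) = 1" "continuous_on S (deriv u)" "continuous_on S u"
    "integrable lborel u" "integrable lborel (deriv u)"
proof -
  have s: "supp u \<subseteq> {R1<..<R2}" using assms by (simp add: A_smooth_def)
  show sm: "smooth u" using assms by (simp add: A_smooth_def)
  show "\<And>r. 0 \<le> u r" "(LINT r:{R1..R2}|lborel. r\<^sup>2 * u r) = 1" using assms by (simp_all add: A_smooth_def)
  show z: "u r = 0" if "r \<notin> {R1<..<R2}" for r using s that notin_supp[of r u] by blast
  show z': "deriv u r = 0" if "r \<notin> {R1<..<R2}" for r using s that deriv_notin_supp[of r u] by blast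
  show c: "continuous_on S (deriv u)" "continuous_on S u" for S using sm by (simp_all add: smooth_continuous smooth_deriv)
  show "integrable lborel u" by (rule integrable_continuous_interval_support[of _ R1 R2]) (use c z in auto)
  show "integrable lborel (deriv u)" by (rule integrable_continuous_interval_support[of _ R1 R2]) (use c z' in auto)
qed

lemma integral_deriv_compact_support:
  fixes f :: "real \<Rightarrow> real"
  assumes "\<And>x. (f has_real_derivative f' x) (at x)" "continuous_on UNIV f'" "\<And>x. x \<notin> {L..R} \<Longrightarrow> f x = 0" "\<And>x. x \<notin> {L..R} \<Longrightarrow> f' x = 0"
  shows "(LINT x|lborel. f' x) = 0"
proof -
  define K where "K = \<bar>L\<bar> + \<bar>R\<bar> + 1"
  have K: "-K < L" "R < K" "-K \<le> K" by (auto simp: K_def)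
  have "(LINT x|lborel. f' x) = (LINT x|lborel. indicator {-K..K} x *\<^sub>R f' x)"
  proof (rule Bochner_Integration.integral_cong)
    fix x show "f' x = indicator {-K..K} x *\<^sub>R f' x"
      using assms(4)[of x] K by (cases "x \<in> {L..R}") (auto simp: indicator_def)
  qed simp
  also have "\<dots> = f K - f (-K)"
    using assms K by (intro integral_FTC_atLeastAtMost)
      (auto intro: continuous_on_subset DERIV_subset simp: has_real_derivative_iff_has_vector_derivative[symmetric])
  also have "\<dots> = 0" using assms(3) K by simp
  finally show ?thesis .
qed

lemma A_smooth_has_Du:
  assumes "u \<in> A_smooth R1 R2"
  shows "has_Du u (pos_deriv_measure u) (neg_deriv_measure u)" "mutually_singular (pos_deriv_measure u) (neg_deriv_measure u)"
proof -
  note u = A_smoothD[OF assms]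
  have [measurable]: "deriv u \<in> borel_measurable borel" "u \<in> borel_measurable borel"
    using u(6,7) by (auto intro: borel_measurable_continuous_onI)
  have fb: "fin_borel (pos_deriv_measure u)" "fin_borel (neg_deriv_measure u)"
    unfolding pos_deriv_measure_def neg_deriv_measure_def
    by (rule density_integrable_fin_borel; use u(9) in simp)+
  show "has_Du u (pos_deriv_measure u) (neg_deriv_measure u)"
    unfolding has_Du_iff
  proof (intro conjI allI impI fb)
    fix \<phi> :: "real \<Rightarrow> real" assume t: "test_fun UNIV \<phi>"
    then have s: "smooth \<phi>" by (simp add: test_fun_def)
    note c = smooth_continuous[OF s] smooth_continuous[OF smooth_deriv[OF s]]
    have [measurable]: "\<phi> \<in> borel_measurable borel" "deriv \<phi> \<in> borel_measurable borel"
      using c by (auto intro: borel_measurable_continuous_onI)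
    have i: "integrable lborel (\<lambda>x. f x * g x)" if "continuous_on UNIV f" "continuous_on UNIV g" "\<And>r. r \<notin> {R1<..<R2} \<Longrightarrow> f r = 0" for f g :: "real \<Rightarrow> real"
      by (rule integrable_continuous_interval_support[of _ R1 R2]) (use that in \<open>auto intro: continuous_intros\<close>)
    have "(LINT x|lborel. deriv u x * \<phi> x + u x * deriv \<phi> x) = 0"
    proof (rule integral_deriv_compact_support[of "\<lambda>x. u x * \<phi> x" _ R1 R2])
      show "((\<lambda>x. u x * \<phi> x) has_real_derivative deriv u x * \<phi> x + u x * deriv \<phi> x) (at x)" for x
        using DERIV_mult'[OF smooth_DERIV[OF u(1)] smooth_DERIV[OF s]] by (simp add: add.commute)
      show "continuous_on UNIV (\<lambda>x. deriv u x * \<phi> x + u x * deriv \<phi> x)"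
        by (intro continuous_intros c u(6,7))
    qed (use u in auto)
    moreover have "(LINT x|lborel. deriv u x * \<phi> x + u x * deriv \<phi> x) = (LINT x|lborel. deriv u x * \<phi> x) + (LINT x|lborel. u x * deriv \<phi> x)"
      by (intro Bochner_Integration.integral_add i c u) auto
    moreover have "(LINT x|lborel. deriv u x * \<phi> x) = (LINT x|lborel. pos_part (deriv u x) * \<phi> x) - (LINT x|lborel. neg_part (deriv u x) * \<phi> x)"
    proof (subst Bochner_Integration.integral_diff[symmetric])
      show "integrable lborel (\<lambda>x. pos_part (deriv u x) * \<phi> x)" "integrable lborel (\<lambda>x. neg_part (deriv u x) * \<phi> x)"
        by (intro i c u continuous_intros; use u(4) in simp)+
      show "(LINT x|lborel. deriv u x * \<phi> x) = (LINT x|lborel. pos_part (deriv u x) * \<phi> x - neg_part (deriv u x) * \<phi> x)"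
        by (intro Bochner_Integration.integral_cong) (auto simp: max_def)
    qed
    moreover have "(LINT x|pos_deriv_measure u. \<phi> x) = (LINT x|lborel. pos_part (deriv u x) * \<phi> x)"
      unfolding pos_deriv_measure_def by (subst integral_density) auto
    moreover have "(LINT x|neg_deriv_measure u. \<phi> x) = (LINT x|lborel. neg_part (deriv u x) * \<phi> x)"
      unfolding neg_deriv_measure_def by (subst integral_density) auto
    ultimately show "(LINT x|lborel. u x * deriv \<phi> x) = - ((LINT x|pos_deriv_measure u. \<phi> x) - (LINT x|neg_deriv_measure u. \<phi> x))"
      by linarith
  qed
  show "mutually_singular (pos_deriv_measure u) (neg_deriv_measure u)"
    unfolding mutually_singular_def
  proof (intro bexI conjI)
    show Z: "{x. deriv u x \<le> 0} \<in> sets borel" by measurable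
    have "(\<integral>\<^sup>+ x. ennreal (pos_part (deriv u x)) * indicator {x. deriv u x \<le> 0} x \<partial>lborel) = (\<integral>\<^sup>+ x. 0 \<partial>(lborel :: real measure))"
      by (intro nn_integral_cong) (auto simp: indicator_def max_def)
    then show "emeasure (pos_deriv_measure u) {x. deriv u x \<le> 0} = 0"
      unfolding pos_deriv_measure_def by (subst emeasure_density) (use Z in auto)
    have "(\<integral>\<^sup>+ x. ennreal (neg_part (deriv u x)) * indicator (- {x. deriv u x \<le> 0}) x \<partial>lborel) = (\<integral>\<^sup>+ x. 0 \<partial>(lborel :: real measure))"
      by (intro nn_integral_cong) (auto simp: indicator_def max_def)
    then show "emeasure (neg_deriv_measure u) (- {x. deriv u x \<le> 0}) = 0"
      unfolding neg_deriv_measure_def by (subst emeasure_density) (use Z in auto)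
  qed
qed

lemma A_smooth_Du:
  assumes "u \<in> A_smooth R1 R2"
  shows "Du_pos u = pos_deriv_measure u" "Du_neg u = neg_deriv_measure u"
  using Du_eqI[OF A_smooth_has_Du[OF assms]] by simp_all

lemma A_smooth_subset_A_BV: "A_smooth R1 R2 \<subseteq> A_BV R1 R2"
proof
  fix u assume u: "u \<in> A_smooth R1 R2"
  note u' = A_smoothD[OF u]
  show "u \<in> A_BV R1 R2"
    unfolding A_BV_def BV_def using A_smooth_has_Du(1)[OF u] u'(2,3,5,8) by auto
qed

section \<open>Bounds for the enclosed fraction, the lapse and the weight of \<J>\<close>

locale shell =
  fixes M1 M2 R1 R2 :: real
  assumes M1: "0 < M1" and M12: "M1 < M2" and MR: "2 * M2 < R1" and R12: "R1 < R2"
begin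

abbreviation "P \<equiv> enclosed R1 R2"
abbreviation "F \<equiv> lapse M1 M2 R1 R2"
abbreviation "w u r \<equiv> r^3 / sqrt (lapse M1 M2 R1 R2 u r)"

text \<open>The lapse of the full mass M2 at the smallest radius; no admissible lapse falls below it
  on r \<ge> R1.\<close>

definition "F0 = 1 - 2 * M2 / R1"

lemma R1_pos: "0 < R1" using M1 M12 MR by linarith

lemma F0: "0 < F0" "F0 < 1" using R1_pos M1 M12 MR by (auto simp: F0_def field_simps)

lemma P_eq:
  assumes "u \<in> A_BV R1 R2" "r \<in> {R1..R2}"
  shows "P u r = (LINT s:{R1..r}|lborel. s\<^sup>2 * u s)"
proof -
  have "(LINT s:{R1..R1}|lborel. s\<^sup>2 * u s) = 0"
  proof -
    have "AE x in lborel. x \<noteq> R1" by (rule AE_lborel_singleton)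
    then have "AE x in lborel. indicator {R1..R1} x *\<^sub>R (x\<^sup>2 * u x) = 0" by eventually_elim auto
    then show ?thesis unfolding set_lebesgue_integral_def by (rule integral_eq_zero_AE)
  qed
  then show ?thesis using assms R12 by (auto simp: enclosed_def A_BV_def)
qed

lemma P_integrable:
  assumes "u \<in> A_BV R1 R2"
  shows "set_integrable lborel {a..b} (\<lambda>s. s\<^sup>2 * u s)"
  by (rule integrable_mult_continuous[OF A_BV_integrable[OF assms]]) (intro continuous_intros)

lemma P_mono:
  assumes u: "u \<in> A_BV R1 R2" and "R1 \<le> r" "r \<le> s" "s \<le> R2"
  shows "P u r \<le> P u s"
proof -
  have "(LINT x:{R1..r}|lborel. x\<^sup>2 * u x) \<le> (LINT x:{R1..s}|lborel. x\<^sup>2 * u x)"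
    unfolding set_lebesgue_integral_def
  proof (rule integral_mono_AE)
    show "AE x in lborel. indicat_real {R1..r} x *\<^sub>R (x\<^sup>2 * u x) \<le> indicat_real {R1..s} x *\<^sub>R (x\<^sup>2 * u x)"
    proof -
      have "AE x in lborel. 0 \<le> u x" using u by (simp add: A_BV_def)
      then show ?thesis
      proof eventually_elim
        case (elim x)
        have "0 \<le> x\<^sup>2 * u x" using elim by simp
        then show ?case using assms(3) by (auto simp: indicator_def)
      qed
    qed
  qed (use P_integrable[OF u] in \<open>simp_all add: set_integrable_def\<close>)
  then show ?thesis using assms P_eq[OF u] by simp
qed

lemma P_bounds:
  assumes "u \<in> A_BV R1 R2"
  shows "0 \<le> P u r" "P u r \<le> 1"
proof -
  have e: "P u R1 = 0" "P u R2 = 1" using R12 by (simp_all add: enclosed_def)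
  have "0 \<le> P u r \<and> P u r \<le> 1"
    using P_mono[OF assms, of R1 r] P_mono[OF assms, of r R2] R12 e
    by (cases "r \<le> R1"; cases "R2 \<le> r") (auto simp: enclosed_def)
  then show "0 \<le> P u r" "P u r \<le> 1" by auto
qed

lemma P_continuous:
  assumes "u \<in> A_BV R1 R2"
  shows "continuous_on {R1..R2} (P u)"
proof -
  have "continuous_on {R1..R2} (\<lambda>r. integral {R1..r} (\<lambda>s. s\<^sup>2 * u s))"
    by (intro indefinite_integral_continuous_1 set_borel_integral_eq_integral P_integrable assms)
  then show ?thesis
    using P_eq[OF assms] set_borel_integral_eq_integral(2)[OF P_integrable[OF assms]]
    by (subst continuous_on_cong[OF refl]) auto
qed

lemma P_diff:
  assumes "u \<in> A_BV R1 R2" "v \<in> A_BV R1 R2"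
  shows "\<bar>P u r - P v r\<bar> \<le> R2\<^sup>2 * L1_dist u v"
proof (cases "r \<in> {R1..R2}")
  case False
  then have "P u r = P v r" by (auto simp: enclosed_def)
  then show ?thesis by (simp add: L1_dist_def)
next
  case True
  have iu: "integrable lborel (\<lambda>x. \<bar>u x - v x\<bar>)" using A_BV_integrable[OF assms(1)] A_BV_integrable[OF assms(2)] by simp
  have "P u r - P v r = (LINT s:{R1..r}|lborel. s\<^sup>2 * u s - s\<^sup>2 * v s)"
    using P_eq[OF assms(1) True] P_eq[OF assms(2) True] set_integral_diff(2)[OF P_integrable[OF assms(1)] P_integrable[OF assms(2)], of R1 r] by simp
  also have "\<bar>\<dots>\<bar> \<le> (LINT s|lborel. \<bar>indicator {R1..r} s *\<^sub>R (s\<^sup>2 * u s - s\<^sup>2 * v s)\<bar>)"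
    unfolding set_lebesgue_integral_def by (rule integral_abs_bound)
  also have "\<dots> \<le> (LINT s|lborel. R2\<^sup>2 * \<bar>u s - v s\<bar>)"
  proof (rule integral_mono)
    have "set_integrable lborel {R1..r} (\<lambda>s. s\<^sup>2 * u s - s\<^sup>2 * v s)"
      by (intro set_integral_diff P_integrable assms)
    then show "integrable lborel (\<lambda>s. \<bar>indicator {R1..r} s *\<^sub>R (s\<^sup>2 * u s - s\<^sup>2 * v s)\<bar>)"
      unfolding set_integrable_def by (rule integrable_abs)
    fix s
    show "\<bar>indicator {R1..r} s *\<^sub>R (s\<^sup>2 * u s - s\<^sup>2 * v s)\<bar> \<le> R2\<^sup>2 * \<bar>u s - v s\<bar>"
    proof (cases "s \<in> {R1..r}")
      case s: True
      then have "s\<^sup>2 \<le> R2\<^sup>2" using True R1_pos by (intro power_mono) auto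
      then have "s\<^sup>2 * \<bar>u s - v s\<bar> \<le> R2\<^sup>2 * \<bar>u s - v s\<bar>" by (intro mult_right_mono) auto
      moreover have "\<bar>s\<^sup>2 * u s - s\<^sup>2 * v s\<bar> = s\<^sup>2 * \<bar>u s - v s\<bar>"
        by (simp flip: right_diff_distrib add: abs_mult)
      ultimately show ?thesis using s by simp
    qed simp
  qed (use iu in simp)
  also have "\<dots> = R2\<^sup>2 * L1_dist u v" by (simp add: L1_dist_def)
  finally show ?thesis .
qed

lemma F_lower:
  assumes "u \<in> A_BV R1 R2" "R1 \<le> r"
  shows "F0 \<le> F u r"
proof -
  have r: "0 < r" using assms R1_pos by simp
  have "mass M1 M2 R1 R2 u r \<le> M2"
  proof -
    have "0 \<le> (M2 - M1) * (1 - P u r)" using P_bounds(2)[OF assms(1), of r] M12 by (intro mult_nonneg_nonneg) auto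
    moreover have "mass M1 M2 R1 R2 u r = M2 - (M2 - M1) * (1 - P u r)" by (simp add: mass_def algebra_simps)
    ultimately show ?thesis by simp
  qed
  then have "2 * mass M1 M2 R1 R2 u r / r \<le> 2 * M2 / r" using r by (intro divide_right_mono) auto
  also have "\<dots> \<le> 2 * M2 / R1" using r R1_pos M1 M12 assms by (intro divide_left_mono) auto
  finally show ?thesis by (simp add: lapse_def F0_def)
qed

lemma F_upper:
  assumes "u \<in> A_BV R1 R2" "R1 \<le> r"
  shows "F u r \<le> 1 - 2 * M1 / r"
proof -
  have "M1 \<le> mass M1 M2 R1 R2 u r"
    using P_bounds(1)[OF assms(1), of r] M12 by (simp add: mass_def)
  then have "2 * M1 / r \<le> 2 * mass M1 M2 R1 R2 u r / r" using assms R1_pos by (intro divide_right_mono) auto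
  then show ?thesis by (simp add: lapse_def)
qed

lemma F_pos: "u \<in> A_BV R1 R2 \<Longrightarrow> R1 \<le> r \<Longrightarrow> 0 < F u r"
  using F_lower F0 by force

lemma F_le_1:
  assumes "u \<in> A_BV R1 R2" "R1 \<le> r" shows "F u r \<le> 1"
proof -
  have "0 \<le> 2 * M1 / r" using M1 R1_pos assms by simp
  then show ?thesis using F_upper[OF assms] by linarith
qed

text \<open>Outside [R1, R2] all lapses coincide, and inside they differ only through the enclosed
  fraction, so the bound is uniform in r. Control of inverse lapses, weights and metrics is deduced
  from it.\<close>

lemma F_diff:
  assumes "u \<in> A_BV R1 R2" "v \<in> A_BV R1 R2"
  shows "\<bar>F u r - F v r\<bar> \<le> 2 * (M2 - M1) / R1 * R2\<^sup>2 * L1_dist u v"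
proof (cases "R1 \<le> r")
  case False
  then have "F u r = F v r" by (auto simp: lapse_def mass_def enclosed_def)
  then show ?thesis using M12 R1_pos by (simp add: L1_dist_def)
next
  case True
  have "F u r - F v r = - (2 * (M2 - M1) / r * (P u r - P v r))"
    by (simp add: lapse_def mass_def algebra_simps add_divide_distrib diff_divide_distrib)
  then have "\<bar>F u r - F v r\<bar> = 2 * (M2 - M1) / r * \<bar>P u r - P v r\<bar>"
    using True R1_pos M12 by (simp add: abs_mult)
  also have "\<dots> \<le> 2 * (M2 - M1) / R1 * (R2\<^sup>2 * L1_dist u v)"
    using True R1_pos M12 P_diff[OF assms] by (intro mult_mono divide_left_mono) auto
  finally show ?thesis by (simp add: mult.assoc)
qed

lemma F_continuous:
  assumes "u \<in> A_BV R1 R2" shows "continuous_on {R1..R2} (F u)"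
  unfolding lapse_def[abs_def] mass_def[abs_def] using R1_pos by (intro continuous_intros P_continuous assms) auto

lemma w_continuous:
  assumes "u \<in> A_BV R1 R2" shows "continuous_on {R1..R2} (w u)"
proof (intro continuous_on_divide continuous_on_power continuous_on_id continuous_on_real_sqrt F_continuous assms ballI)
  fix r assume "r \<in> {R1..R2}"
  then show "sqrt (F u r) \<noteq> 0" using F_pos[OF assms, of r] by simp
qed

lemma w_lower: "u \<in> A_BV R1 R2 \<Longrightarrow> r \<in> {R1..R2} \<Longrightarrow> R1^3 \<le> w u r"
proof -
  assume a: "u \<in> A_BV R1 R2" "r \<in> {R1..R2}"
  have "R1^3 \<le> r^3" using a R1_pos by (intro power_mono) auto
  also have "r^3 = r^3 / 1" by simp
  also have "\<dots> \<le> w u r" using a F_pos[of u r] F_le_1[of u r] R1_pos by (intro divide_left_mono) auto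
  finally show ?thesis .
qed

lemma w_upper: "u \<in> A_BV R1 R2 \<Longrightarrow> r \<in> {R1..R2} \<Longrightarrow> w u r \<le> R2^3 / sqrt F0"
  using F_lower[of u r] F_pos[of u r] F0 R1_pos by (intro frac_le power_mono) auto

lemma q_weight_alt: "2 * M1 < r \<Longrightarrow> q_weight M1 r = r^3 / sqrt (1 - 2 * M1 / r)"
proof -
  assume r: "2 * M1 < r"
  have "r powr (7/2) = r powr (3 + 1/2)" by simp
  also have "\<dots> = r^3 * sqrt r" using r M1 by (simp only: powr_add) (simp add: powr_half_sqrt powr_numeral)
  finally have "r powr (7/2) = r^3 * sqrt r" .
  moreover have "sqrt (1 - 2 * M1 / r) = sqrt (r - 2 * M1) / sqrt r" using r M1 by (simp add: real_sqrt_divide[symmetric] diff_divide_distrib)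
  ultimately show ?thesis by (simp add: q_weight_def)
qed

lemma q_le_w:
  assumes "u \<in> A_BV R1 R2" "r \<in> {R1..R2}"
  shows "q_weight M1 r \<le> w u r"
proof -
  have r: "2 * M1 < r" "0 < r" using assms R1_pos M12 MR by auto
  have "q_weight M1 r = r^3 / sqrt (1 - 2 * M1 / r)" by (rule q_weight_alt[OF r(1)])
  also have "\<dots> \<le> w u r" using F_upper[OF assms(1)] F_pos[OF assms(1)] assms(2) r by (intro divide_left_mono mult_pos_pos) (auto simp: real_sqrt_gt_zero intro: less_le_trans)
  finally show ?thesis .
qed

text \<open>The weight is cut off to [R1, R2], which is the range of integration of \<J> and a range
  on which the weight is continuous and positive.\<close>

lemma F_measurable:
  assumes "u \<in> A_BV R1 R2"
  shows "(\<lambda>r. indicator {R1..R2} r * w u r) \<in> borel_measurable borel"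
proof -
  have "(\<lambda>r. indicator {R1..R2} r *\<^sub>R w u r) \<in> borel_measurable borel"
    by (rule borel_measurable_continuous_on_indicator[OF _ w_continuous[OF assms]]) simp
  then show ?thesis by (simp only: real_scaleR_def)
qed

lemma w_integrable:
  assumes "u \<in> A_BV R1 R2" "v \<in> A_BV R1 R2" "M \<in> {Du_pos v, Du_neg v}"
  shows "integrable M (\<lambda>r. indicator {R1..R2} r * w u r)"
proof -
  have "0 \<le> w u r" if "r \<in> {R1..R2}" for r
    using w_lower[OF assms(1) that] R1_pos zero_le_power[of R1 3] by linarith
  then have b: "\<bar>indicator {R1..R2} r * w u r\<bar> \<le> R2^3 / sqrt F0" if "r \<in> {R1..R2}" for r
    unfolding abs_mult using w_upper[OF assms(1) that] that by (simp only: indicator_simps abs_one abs_of_nonneg)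
  have "fin_borel M" "emeasure M (- {R1..R2}) = 0"
    using assms(3) A_BV_fin_borel[OF assms(2)] A_BV_concentrated[OF assms(2)] by auto
  then show ?thesis by (rule concentrated_integrable[OF _ _ F_measurable[OF assms(1)] b])
qed

lemma I_eq_J:
  assumes "u \<in> A_smooth R1 R2"
  shows "I_fun M1 M2 R1 R2 u = J_fun M1 M2 R1 R2 u"
proof -
  have u: "u \<in> A_BV R1 R2" using assms A_smooth_subset_A_BV by auto
  have [measurable]: "deriv u \<in> borel_measurable borel"
    using A_smoothD(6)[OF assms] by (auto intro: borel_measurable_continuous_onI)
  have "J_fun M1 M2 R1 R2 u = (LINT r|pos_deriv_measure u. indicator {R1..R2} r * w u r)"
    by (simp add: J_fun_def set_lebesgue_integral_def A_smooth_Du[OF assms])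
  also have "\<dots> = (LINT r|lborel. pos_part (deriv u r) * (indicator {R1..R2} r * w u r))"
  proof -
    have "(LINT r|pos_deriv_measure u. W r) = (LINT r|lborel. pos_part (deriv u r) * W r)"
      if "W \<in> borel_measurable borel" for W :: "real \<Rightarrow> real"
      unfolding pos_deriv_measure_def using that by (subst integral_density) auto
    from this[OF F_measurable[OF u]] show ?thesis .
  qed
  also have "\<dots> = I_fun M1 M2 R1 R2 u"
    unfolding I_fun_def set_lebesgue_integral_def by (intro Bochner_Integration.integral_cong) (auto simp: mult_ac)
  finally show ?thesis ..
qed

end


section \<open>The optimal rising radius\<close>

lemma x0_facts:
  assumes "0 < M1" "2 * M1 < R2"
  shows "2 * M1 < x0 M1 R2" "x0 M1 R2 < 7 * M1 / 3"
    "M1 * x0 M1 R2 ^ 3 + 3 * R2 ^ 3 * x0 M1 R2 - 7 * M1 * R2 ^ 3 = 0"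
  using theI'[OF x0_ex1[OF assms]] unfolding x0_def by blast+

text \<open>The cubic is strictly increasing on r > 0 and vanishes at \<open>x0\<close>; its sign
  thus locates r relative to \<open>x0\<close>.\<close>

lemma x0_less_iff:
  assumes "0 < M1" "2 * M1 < R2" "0 < r"
  shows "x0 M1 R2 < r \<longleftrightarrow> 0 < M1 * r ^ 3 + 3 * R2 ^ 3 * r - 7 * M1 * R2 ^ 3"
proof -
  let ?f = "\<lambda>x. M1 * x^3 + 3 * R2^3 * x - 7 * M1 * R2^3"
  have R: "0 < R2^3" using assms by simp
  have mono: "?f x < ?f y" if "0 < x" "x < y" for x y
  proof -
    have "x^3 < y^3" using that by (intro power_strict_mono) auto
    then have "M1 * x^3 < M1 * y^3" using assms by simp
    moreover have "3 * R2^3 * x < 3 * R2^3 * y" using that R by simp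
    ultimately show ?thesis by simp
  qed
  note x = x0_facts[OF assms(1,2)]
  have x0: "0 < x0 M1 R2" using x(1) assms(1) by linarith
  have z: "?f (x0 M1 R2) = 0" using x(3) by simp
  show ?thesis
  proof (cases r "x0 M1 R2" rule: linorder_cases)
    case less then show ?thesis using mono[OF assms(3) less] z by simp
  next
    case equal then show ?thesis using z by simp
  next
    case greater then show ?thesis using mono[OF x0 greater] z by simp
  qed
qed

lemma x0_less_R2:
  assumes "0 < M1" "2 * M1 < R2"
  shows "x0 M1 R2 < R2"
proof -
  have "M1 * R2 ^ 3 + 3 * R2 ^ 3 * R2 - 7 * M1 * R2 ^ 3 = 3 * R2^3 * (R2 - 2 * M1)" by (simp add: algebra_simps)
  also have "\<dots> > 0" using assms by simp
  finally show ?thesis using x0_less_iff[OF assms, of R2] assms by simp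
qed

text \<open>Both derivatives keep \<open>q_weight\<close> as a factor, which leaves only rational
  functions to be compared. The zero 7 M1 / 3 of the numerator is where q is minimal, and
  \<open>x0\<close> lies to its left.\<close>

definition q_deriv :: "real \<Rightarrow> real \<Rightarrow> real" where
  "q_deriv M1 r = q_weight M1 r * (3 * r - 7 * M1) / (r * (r - 2 * M1))"

definition q_deriv2 :: "real \<Rightarrow> real \<Rightarrow> real" where
  "q_deriv2 M1 r = q_weight M1 r * (35 * (r - 2 * M1)\<^sup>2 - 14 * r * (r - 2 * M1) + 3 * r\<^sup>2) / (4 * r\<^sup>2 * (r - 2 * M1)\<^sup>2)"

lemma q_weight_pos: "0 < M1 \<Longrightarrow> 2 * M1 < r \<Longrightarrow> 0 < q_weight M1 r"
  by (simp add: q_weight_def)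

lemma q_weight_DERIV:
  assumes "0 < M1" "2 * M1 < r"
  shows "(q_weight M1 has_real_derivative q_deriv M1 r) (at r)"
proof -
  have r: "0 < r" "0 < r - 2 * M1" using assms by auto
  define s where "s = sqrt (r - 2 * M1)"
  have s: "s * s = r - 2 * M1" "0 < s" using r by (auto simp: s_def)
  have p: "r powr (5/2) = r powr (7/2) / r"
    using powr_diff[of r "7/2" 1] r by simp
  have "((\<lambda>r. r powr (7/2) / sqrt (r - 2 * M1)) has_real_derivative
      ((7/2 * r powr (5/2)) * s - r powr (7/2) * (1 / (2 * s))) / (s * s)) (at r)"
    using r by (auto intro!: derivative_eq_intros simp: s_def field_simps)
  moreover have "((7/2 * r powr (5/2)) * s - r powr (7/2) * (1 / (2 * s))) / (s * s) = q_deriv M1 r"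
  proof -
    have "((7/2 * (X / r)) * s - X * (1 / (2 * s))) / (s * s) = X / s * (3 * r - 7 * M1) / (r * (s * s))" for X
    proof -
      have "3 * r - 7 * M1 = (7 * (s * s) - r) / 2" using s by simp
      then show ?thesis using r s(2) by (simp add: divide_simps) (simp add: algebra_simps)
    qed
    from this[of "r powr (7/2)"] show ?thesis by (simp add: p q_deriv_def q_weight_def s(1) flip: s_def)
  qed
  ultimately show ?thesis unfolding q_weight_def[abs_def] by simp
qed

lemma q_deriv_DERIV:
  assumes "0 < M1" "2 * M1 < r"
  shows "(q_deriv M1 has_real_derivative q_deriv2 M1 r) (at r)"
proof -
  have r: "r \<noteq> 0" "r - 2 * M1 \<noteq> 0" using assms by auto
  have "((\<lambda>r. q_weight M1 r * (3 * r - 7 * M1) / (r * (r - 2 * M1))) has_real_derivative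
     ((q_deriv M1 r * (3 * r - 7 * M1) + q_weight M1 r * 3) * (r * (r - 2 * M1)) - q_weight M1 r * (3 * r - 7 * M1) * ((r - 2 * M1) + r)) / (r * (r - 2 * M1))^2) (at r)"
    using r by (auto intro!: derivative_eq_intros q_weight_DERIV assms simp: power2_eq_square)
  moreover have "((q_deriv M1 r * (3 * r - 7 * M1) + q_weight M1 r * 3) * (r * (r - 2 * M1)) - q_weight M1 r * (3 * r - 7 * M1) * ((r - 2 * M1) + r)) / (r * (r - 2 * M1))^2 = q_deriv2 M1 r"
  proof -
    define Q where "Q = q_weight M1 r"
    define t where "t = r - 2 * M1"
    have t: "t \<noteq> 0" "M1 = (r - t) / 2" using r by (auto simp: t_def)
    have "((Q * (3 * r - 7 * M1) / (r * t) * (3 * r - 7 * M1) + Q * 3) * (r * t) - Q * (3 * r - 7 * M1) * (t + r)) / (r * t)^2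
      = Q * (35 * t\<^sup>2 - 14 * r * t + 3 * r\<^sup>2) / (4 * r\<^sup>2 * t\<^sup>2)"
      unfolding t(2) using t(1) r(1) by (simp add: divide_simps) (simp add: algebra_simps power2_eq_square)
    then show ?thesis by (simp add: q_deriv_def q_deriv2_def Q_def t_def)
  qed
  ultimately show ?thesis unfolding q_deriv_def[abs_def] by simp
qed

lemma q_deriv2_nonneg:
  assumes "0 < M1" "2 * M1 < r"
  shows "0 \<le> q_deriv2 M1 r"
proof -
  \<comment> \<open>Completing the square: with t = r - 2 M1 the numerator of q'' is q times a
    positive definite quadratic form in r and t.\<close>
  have "35 * t\<^sup>2 - 14 * r * t + 3 * r\<^sup>2 = 35 * (t - r / 5)\<^sup>2 + 8/5 * r\<^sup>2" for t
    by (simp add: power2_eq_square algebra_simps)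
  then have "0 \<le> 35 * (r - 2 * M1)\<^sup>2 - 14 * r * (r - 2 * M1) + 3 * r\<^sup>2" by (metis add_nonneg_nonneg mult_nonneg_nonneg zero_le_power2 zero_le_numeral divide_nonneg_nonneg)
  then show ?thesis unfolding q_deriv2_def
    using q_weight_pos[OF assms] by (intro divide_nonneg_nonneg mult_nonneg_nonneg) auto
qed

lemma q_above_tangent:
  assumes "0 < M1" "2 * M1 < a" "2 * M1 < r"
  shows "q_deriv M1 a * (r - a) \<le> q_weight M1 r - q_weight M1 a"
proof (rule convex_on_imp_above_tangent[of "{2 * M1<..}"])
  show "convex_on {2 * M1<..} (q_weight M1)"
    using q_weight_DERIV q_deriv_DERIV q_deriv2_nonneg assms(1)
    by (intro f''_ge0_imp_convex[of _ _ "q_deriv M1" "q_deriv2 M1"]) auto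
  show "(q_weight M1 has_real_derivative q_deriv M1 a) (at a within {2 * M1<..})"
    using q_weight_DERIV[OF assms(1,2)] by (rule has_field_derivative_at_within)
qed (use assms in \<open>auto simp: interior_open\<close>)

section \<open>The gap q - \<lambda> A around the optimal rising radius\<close>

context shell begin

abbreviation "a \<equiv> rising_radius M1 R1 R2"
abbreviation "lam \<equiv> lambda_star M1 R1 R2"
abbreviation "H \<equiv> H_star M1 R1 R2"
abbreviation "us \<equiv> u_star M1 R1 R2"
abbreviation "A \<equiv> A_weight R2"
abbreviation "q \<equiv> q_weight M1"

lemma M1R2: "2 * M1 < R2" using M12 MR R12 by linarith

lemma M1R1: "2 * M1 < R1" using M12 MR by linarith

lemma a_facts: "R1 \<le> a" "a < R2" "x0 M1 R2 \<le> a" "2 * M1 < a" "0 < a"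
  using x0_less_R2[OF M1 M1R2] R12 M1R1 R1_pos by (auto simp: rising_radius_def)

lemma A_pos: "R1 \<le> r \<Longrightarrow> r < R2 \<Longrightarrow> 0 < A r"
  using power_strict_mono[of r R2 3] R1_pos by (simp add: A_weight_def)

lemma A_lower: "r \<in> {R1..R2} \<Longrightarrow> R1\<^sup>2 * (R2 - r) / 3 \<le> A r"
proof -
  assume r: "r \<in> {R1..R2}"
  have "R2^3 - r^3 = (R2 - r) * (R2\<^sup>2 + R2 * r + r\<^sup>2)" by (simp add: power2_eq_square power3_eq_cube algebra_simps)
  moreover have "R1\<^sup>2 \<le> R2\<^sup>2 + R2 * r + r\<^sup>2"
  proof -
    have "R1\<^sup>2 \<le> R2\<^sup>2" using R1_pos R12 by (intro power_mono) auto
    moreover have "0 \<le> R2 * r" using R1_pos R12 r by auto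
    ultimately show ?thesis by (simp add: add_increasing2)
  qed
  moreover from this have "(R2 - r) * R1\<^sup>2 \<le> (R2 - r) * (R2\<^sup>2 + R2 * r + r\<^sup>2)" by (rule mult_left_mono) (use r in auto)
  ultimately have "(R2 - r) * R1\<^sup>2 \<le> R2^3 - r^3" by simp
  then show ?thesis by (simp add: A_weight_def mult.commute)
qed

lemma H_pos: "0 < H" using A_pos a_facts by (simp add: H_star_def)

lemma lam_eq: "lam = q a * H" by (simp add: lambda_star_def Psi_def H_star_def)

lemma lam_pos: "0 < lam" using q_weight_pos[OF M1 a_facts(4)] H_pos by (simp add: lam_eq)

lemma lam_A: "lam * A a = q a" using A_pos[OF a_facts(1,2)] by (simp add: lambda_star_def Psi_def)

text \<open>The derivative of the gap q - \<lambda> A at \<open>a\<close>; divided by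
  \<open>A a\<close> it is the derivative of \<open>Psi\<close> there.\<close>

definition "slope = q_deriv M1 a + lam * a\<^sup>2"

text \<open>Clearing denominators turns the derivative into the cubic that defines
  \<open>x0\<close>. This is why the slope vanishes at \<open>x0\<close> and is positive when
  \<open>a\<close> lies beyond \<open>x0\<close>.\<close>

lemma slope_eq: "slope = q a * (M1 * a^3 + 3 * R2^3 * a - 7 * M1 * R2^3) / (3 * a * (a - 2 * M1) * A a)"
proof -
  have A: "A a = (R2^3 - a^3) / 3" "0 < A a" using A_pos[OF a_facts(1,2)] by (simp_all add: A_weight_def)
  define t where "t = a - 2 * M1"
  have t: "0 < t" using a_facts by (simp add: t_def)
  have B: "R2^3 - a^3 \<noteq> 0" using A by auto
  have "q a * (3 * a - 7 * M1) / (a * t) + q a / ((R2^3 - a^3) / 3) * a\<^sup>2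
     = q a * ((3 * a - 7 * M1) * (R2^3 - a^3) + 3 * a^3 * t) / (a * t * (R2^3 - a^3))"
    using a_facts(5) t B by (simp add: divide_simps) (simp add: algebra_simps power2_eq_square power3_eq_cube)
  also have "(3 * a - 7 * M1) * (R2^3 - a^3) + 3 * a^3 * t = M1 * a^3 + 3 * R2^3 * a - 7 * M1 * R2^3"
    by (simp add: t_def algebra_simps power2_eq_square power3_eq_cube)
  finally show ?thesis by (simp add: slope_def q_deriv_def lambda_star_def Psi_def A(1) t_def mult_ac)
qed

lemma slope_interior: "a = x0 M1 R2 \<Longrightarrow> slope = 0"
  using x0_facts(3)[OF M1 M1R2] by (simp add: slope_eq)

lemma slope_boundary: "x0 M1 R2 < a \<Longrightarrow> 0 < slope"
  unfolding slope_eq using x0_less_iff[OF M1 M1R2 a_facts(5)] q_weight_pos[OF M1 a_facts(4)] a_facts A_pos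
  by (intro divide_pos_pos mult_pos_pos) auto

text \<open>First-order optimality: either the slope is 0, or \<open>a\<close> is the left end of
  the interval and the slope is positive.\<close>

lemma slope_term_nonneg:
  assumes "r \<in> {R1..R2}"
  shows "0 \<le> slope * (r - a)"
proof (cases "a = x0 M1 R2")
  case True
  then show ?thesis using slope_interior by simp
next
  case False
  then have "x0 M1 R2 < a" "a = R1" by (auto simp: rising_radius_def max_def split: if_splits)
  then show ?thesis using slope_boundary assms by (simp add: less_imp_le)
qed

lemma A_expand: "A r = A a - a\<^sup>2 * (r - a) - (r - a)\<^sup>2 * (r + 2 * a) / 3"
  by (simp add: A_weight_def power2_eq_square power3_eq_cube field_simps)

text \<open>Convexity puts q above its tangent at \<open>a\<close>. The quadratic term comes from
  the exact expansion of the cubic A, whose remainder (r - a)^2 (r + 2 a) / 3 is at least (r - a)^2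
  R1 / 3.\<close>

lemma gap_lower:
  assumes "r \<in> {R1..R2}"
  shows "slope * (r - a) + lam * R1 / 3 * (r - a)\<^sup>2 \<le> q r - lam * A r"
proof -
  have r: "2 * M1 < r" using assms M1R1 by auto
  have "lam * A r = q a - lam * a\<^sup>2 * (r - a) - lam * ((r - a)\<^sup>2 * (r + 2 * a) / 3)"
    using A_expand[of r] by (simp add: right_diff_distrib lam_A mult.assoc)
  moreover have "lam * ((r - a)\<^sup>2 * R1 / 3) \<le> lam * ((r - a)\<^sup>2 * (r + 2 * a) / 3)"
    using lam_pos assms a_facts R1_pos by (intro mult_left_mono divide_right_mono) auto
  moreover have "lam * ((r - a)\<^sup>2 * R1 / 3) = lam * R1 / 3 * (r - a)\<^sup>2" "slope * (r - a) = q_deriv M1 a * (r - a) + lam * a\<^sup>2 * (r - a)"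
    by (simp_all add: slope_def algebra_simps)
  ultimately show ?thesis using q_above_tangent[OF M1 a_facts(4) r] by linarith
qed

lemma gap_quadratic:
  assumes "r \<in> {R1..R2}"
  shows "lam * R1 / 3 * (r - a)\<^sup>2 \<le> q r - lam * A r"
  using gap_lower[OF assms] slope_term_nonneg[OF assms] by linarith

lemma gap_linear:
  assumes "r \<in> {R1..R2}"
  shows "slope * (r - a) \<le> q r - lam * A r"
proof -
  have "0 \<le> lam * R1 / 3 * (r - a)\<^sup>2" using lam_pos R1_pos by simp
  then show ?thesis using gap_lower[OF assms] by linarith
qed

lemma gap_DERIV:
  assumes "2 * M1 < r"
  shows "((\<lambda>r. q r - lam * A r) has_real_derivative q_deriv M1 r + lam * r\<^sup>2) (at r)"
    "((\<lambda>r. q_deriv M1 r + lam * r\<^sup>2) has_real_derivative q_deriv2 M1 r + lam * (2 * r)) (at r)"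
  by (auto intro!: derivative_eq_intros q_weight_DERIV q_deriv_DERIV A_weight_DERIV M1 assms)

lemma q_deriv2_continuous: "S \<subseteq> {2 * M1<..} \<Longrightarrow> continuous_on S (q_deriv2 M1)"
proof -
  assume S: "S \<subseteq> {2 * M1<..}"
  have "continuous_on S q" using q_weight_DERIV[OF M1] S
    by (intro continuous_at_imp_continuous_on) (auto intro: DERIV_isCont)
  then show ?thesis unfolding q_deriv2_def[abs_def]
    by (intro continuous_intros) (use S M1 in auto)
qed

text \<open>Two applications of the mean value theorem, with \<open>K\<close> a bound for the second
  derivative on [a, R2]. It makes the deficit of a displaced step at most quadratic in the
  displacement when the slope is 0 and at most linear otherwise, as the optimality of the exponents
  demands.\<close>

lemma gap_upper:
  obtains K where "0 \<le> K" "\<And>c. c \<in> {a..R2} \<Longrightarrow> q c - lam * A c \<le> (slope + K * (c - a)) * (c - a)"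
proof -
  have "compact ((\<lambda>r. q_deriv2 M1 r + lam * (2 * r)) ` {a..R2})"
    using a_facts by (intro compact_continuous_image continuous_intros q_deriv2_continuous) auto
  then obtain K where K: "0 < K" "\<forall>r\<in>{a..R2}. \<bar>q_deriv2 M1 r + lam * (2 * r)\<bar> \<le> K"
    using compact_imp_bounded[of "(\<lambda>r. q_deriv2 M1 r + lam * (2 * r)) ` {a..R2}"] unfolding bounded_pos by auto
  show ?thesis
  proof (rule that[of K])
    fix c assume c: "c \<in> {a..R2}"
    show "q c - lam * A c \<le> (slope + K * (c - a)) * (c - a)"
    proof (cases "c = a")
      case True
      then show ?thesis using lam_A by simp
    next
      case False
      then have ac: "a < c" using c by simp
      obtain z where z: "a < z" "z < c" "(q c - lam * A c) - (q a - lam * A a) = (c - a) * (q_deriv M1 z + lam * z\<^sup>2)"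
        using MVT2[OF ac, of "\<lambda>r. q r - lam * A r" "\<lambda>r. q_deriv M1 r + lam * r\<^sup>2"] gap_DERIV(1) a_facts(4) by auto
      obtain y where y: "a < y" "y < z" "(q_deriv M1 z + lam * z\<^sup>2) - (q_deriv M1 a + lam * a\<^sup>2) = (z - a) * (q_deriv2 M1 y + lam * (2 * y))"
        using MVT2[OF z(1), of "\<lambda>r. q_deriv M1 r + lam * r\<^sup>2" "\<lambda>y. q_deriv2 M1 y + lam * (2 * y)"] gap_DERIV(2) a_facts(4) by auto
      have "y \<in> {a..R2}" using y z c by auto
      then have "\<bar>q_deriv2 M1 y + lam * (2 * y)\<bar> \<le> K" using K(2) by blast
      then have "q_deriv2 M1 y + lam * (2 * y) \<le> K" by linarith
      then have "(z - a) * (q_deriv2 M1 y + lam * (2 * y)) \<le> (z - a) * K"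
        using z by (intro mult_left_mono) auto
      also have "\<dots> \<le> (c - a) * K" using z K by (intro mult_right_mono) auto
      finally have "(z - a) * (q_deriv2 M1 y + lam * (2 * y)) \<le> (c - a) * K" .
      then have "q_deriv M1 z + lam * z\<^sup>2 \<le> slope + K * (c - a)" using y(3) by (simp add: slope_def mult.commute)
      then have "(c - a) * (q_deriv M1 z + lam * z\<^sup>2) \<le> (c - a) * (slope + K * (c - a))" using ac by (intro mult_left_mono) auto
      then show ?thesis using z(3) lam_A by (simp add: mult.commute)
    qed
  qed (use K in simp)
qed

end


section \<open>The deficit and the distance to the optimizer\<close>

lemma dirac_eq_density: "dirac h c = density (return borel c) (\<lambda>_. ennreal h)"
  by (rule measure_eqI) (auto simp: dirac_def emeasure_density_const)

lemma fin_borel_dirac: "fin_borel (dirac h c)"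
  unfolding fin_borel_def by (auto simp: dirac_def space_scale_measure ennreal_mult_eq_top_iff intro!: finite_measureI split: split_indicator)

lemma integral_dirac:
  fixes f :: "real \<Rightarrow> real"
  assumes "0 \<le> h" "f \<in> borel_measurable borel"
  shows "(LINT x|dirac h c. f x) = h * f c"
  unfolding dirac_eq_density using assms by (subst integral_density) (auto simp: integral_return)

lemma measure_dirac: "0 \<le> h \<Longrightarrow> S \<in> sets borel \<Longrightarrow> measure (dirac h c) S = h * indicator S c"
  by (simp add: dirac_def measure_return)

lemma integral_open_interval_deriv:
  fixes \<phi> :: "real \<Rightarrow> real"
  assumes "c \<le> d" "\<And>x. x \<in> {c..d} \<Longrightarrow> (\<phi> has_real_derivative \<phi>' x) (at x)" "continuous_on {c..d} \<phi>'"
  shows "(LINT r|lborel. indicator {c<..<d} r * \<phi>' r) = \<phi> d - \<phi> c"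
    "integrable lborel (\<lambda>r. indicator {c<..<d} r * \<phi>' r)"
proof -
  have i: "integrable lborel (\<lambda>r. indicator {c..d} r *\<^sub>R \<phi>' r)"
    by (rule borel_integrable_compact) (use assms in auto)
  then have m: "(\<lambda>r. indicator {c..d} r *\<^sub>R \<phi>' r) \<in> borel_measurable borel" by simp
  have e: "indicator {c<..<d} r * \<phi>' r = indicator {c<..<d} r * (indicator {c..d} r *\<^sub>R \<phi>' r)" for r
    by (auto simp: indicator_def)
  have m': "(\<lambda>r. indicator {c<..<d} r * \<phi>' r) \<in> borel_measurable borel"
    unfolding e by (intro borel_measurable_times m borel_measurable_indicator) simp
  have ae: "AE r in lborel. indicator {c..d} r *\<^sub>R \<phi>' r = indicator {c<..<d} r * \<phi>' r"
    using AE_lborel_singleton[of c] AE_lborel_singleton[of d] by eventually_elim (auto simp: indicator_def)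
  have "(LINT r|lborel. indicator {c<..<d} r * \<phi>' r) = (LINT r|lborel. indicator {c..d} r *\<^sub>R \<phi>' r)"
    using ae by (intro integral_cong_AE) (use m m' in \<open>auto elim: eventually_mono\<close>)
  also have "\<dots> = \<phi> d - \<phi> c"
    using assms by (intro integral_FTC_atLeastAtMost)
      (auto intro: DERIV_subset simp: has_real_derivative_iff_has_vector_derivative[symmetric])
  finally show "(LINT r|lborel. indicator {c<..<d} r * \<phi>' r) = \<phi> d - \<phi> c" .
  show "integrable lborel (\<lambda>r. indicator {c<..<d} r * \<phi>' r)"
    using integrable_cong_AE_imp[OF i _ ae] m' by simp
qed

definition step_fun :: "real \<Rightarrow> real \<Rightarrow> real \<Rightarrow> real \<Rightarrow> real" where
  "step_fun h c d r = h * indicator {c<..<d} r"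

lemma step_fun_has_Du:
  assumes "0 \<le> h" "c < d"
  shows "has_Du (step_fun h c d) (dirac h c) (dirac h d)" "mutually_singular (dirac h c) (dirac h d)"
    "integrable lborel (step_fun h c d)"
proof -
  show "integrable lborel (step_fun h c d)"
    unfolding step_fun_def[abs_def] using assms by (intro integrable_mult_right integrable_real_indicator) (auto simp: emeasure_lborel_Ioo)
  show "has_Du (step_fun h c d) (dirac h c) (dirac h d)"
    unfolding has_Du_iff
  proof (intro conjI allI impI fin_borel_dirac)
    fix \<phi> :: "real \<Rightarrow> real" assume t: "test_fun UNIV \<phi>"
    then have s: "smooth \<phi>" by (simp add: test_fun_def)
    have m: "\<phi> \<in> borel_measurable borel" by (intro borel_measurable_continuous_onI smooth_continuous s)
    have "(LINT x|lborel. step_fun h c d x * deriv \<phi> x) = (LINT x|lborel. h * (indicator {c<..<d} x * deriv \<phi> x))"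
      by (simp add: step_fun_def mult.assoc)
    also have "\<dots> = h * (\<phi> d - \<phi> c)"
      using integral_open_interval_deriv(1)[of c d \<phi> "deriv \<phi>"] assms(2) s by (simp add: smooth_DERIV smooth_continuous smooth_deriv)
    also have "\<dots> = - ((LINT x|dirac h c. \<phi> x) - (LINT x|dirac h d. \<phi> x))"
      using assms m by (simp add: integral_dirac algebra_simps)
    finally show "(LINT x|lborel. step_fun h c d x * deriv \<phi> x) = - ((LINT x|dirac h c. \<phi> x) - (LINT x|dirac h d. \<phi> x))" .
  qed
  show "mutually_singular (dirac h c) (dirac h d)"
    unfolding mutually_singular_def using assms by (intro bexI[of _ "- {c}"]) (auto simp: dirac_def)
qed

text \<open>Both sides compute the product measure of the set of pairs (r, x) for which r lies
  between x and c. This is the 1-Wasserstein distance from \<open>M\<close> to its whole mass placed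
  at c.\<close>

lemma nn_integral_cdf_diff:
  assumes M: "fin_borel M"
  shows "(\<integral>\<^sup>+ r. ennreal \<bar>measure M {..r} - measure M UNIV * indicator {c..} r\<bar> \<partial>lborel) = (\<integral>\<^sup>+ x. ennreal \<bar>x - c\<bar> \<partial>M)"
proof -
  interpret M: finite_measure M using fin_borelD[OF M] by simp
  interpret pair_sigma_finite lborel M ..
  have sM [measurable_cong]: "sets M = sets borel" using fin_borelD[OF M] by simp
  have spM: "space M = UNIV" using fin_borelD[OF M] by simp
  define S where "S = {p. (snd p \<le> fst p \<and> fst p < c) \<or> (c \<le> fst p \<and> fst p < snd p)} \<inter> space (lborel \<Otimes>\<^sub>M M)"
  have Sm: "S \<in> sets (lborel \<Otimes>\<^sub>M M)" unfolding S_def by measurable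
  have sl: "Pair r -` S = (if r < c then {..r} else {r<..})" for r
    by (auto simp: S_def space_pair_measure spM)
  have "emeasure M (Pair r -` S) = ennreal \<bar>measure M {..r} - measure M UNIV * indicator {c..} r\<bar>" for r
  proof (cases "r < c")
    case True then show ?thesis by (simp add: sl M.emeasure_eq_measure)
  next
    case False
    have "measure M {r<..} = measure M UNIV - measure M {..r}"
      using M.finite_measure_compl[of "{..r}"] by (simp add: sM spM Compl_eq_Diff_UNIV[symmetric] Compl_atMost)
    moreover have "measure M {r<..} \<ge> 0" by simp
    ultimately show ?thesis using False by (simp add: sl M.emeasure_eq_measure)
  qed
  then have "emeasure (lborel \<Otimes>\<^sub>M M) S = (\<integral>\<^sup>+ r. ennreal \<bar>measure M {..r} - measure M UNIV * indicator {c..} r\<bar> \<partial>lborel)"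
    using M.emeasure_pair_measure_alt[OF Sm] by simp
  moreover have "emeasure (lborel \<Otimes>\<^sub>M M) S = (\<integral>\<^sup>+ x. ennreal \<bar>x - c\<bar> \<partial>M)"
  proof -
    have "(\<lambda>r. (r, x)) -` S = (if x \<le> c then {x..<c} else {c..<x})" for x
      by (auto simp: S_def space_pair_measure spM)
    then have "emeasure lborel ((\<lambda>r. (r, x)) -` S) = ennreal \<bar>x - c\<bar>" for x by auto
    then show ?thesis using emeasure_pair_measure_alt2[OF Sm] by simp
  qed
  ultimately show ?thesis by simp
qed

lemma integral_cdf_diff:
  assumes M: "fin_borel M" "emeasure M (- {L..R}) = 0"
  shows "integrable lborel (\<lambda>r. \<bar>measure M {..r} - measure M UNIV * indicator {c..} r\<bar>)"
    "(LINT r|lborel. \<bar>measure M {..r} - measure M UNIV * indicator {c..} r\<bar>) = (LINT x|M. \<bar>x - c\<bar>)"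
proof -
  note [measurable] = measure_atMost_borel[OF M(1)]
  have i: "integrable M (\<lambda>x. \<bar>x - c\<bar>)"
    by (rule concentrated_integrable_continuous[OF M]) (auto intro!: continuous_intros)
  have n: "(\<integral>\<^sup>+ x. ennreal \<bar>x - c\<bar> \<partial>M) = ennreal (LINT x|M. \<bar>x - c\<bar>)"
    by (rule nn_integral_eq_integral[OF i]) simp
  show i2: "integrable lborel (\<lambda>r. \<bar>measure M {..r} - measure M UNIV * indicator {c..} r\<bar>)"
    using nn_integral_cdf_diff[OF M(1), of c] n by (intro integrableI_nonneg) auto
  have "ennreal (LINT r|lborel. \<bar>measure M {..r} - measure M UNIV * indicator {c..} r\<bar>) = ennreal (LINT x|M. \<bar>x - c\<bar>)"
    using nn_integral_cdf_diff[OF M(1), of c] n nn_integral_eq_integral[OF i2] by simp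
  then show "(LINT r|lborel. \<bar>measure M {..r} - measure M UNIV * indicator {c..} r\<bar>) = (LINT x|M. \<bar>x - c\<bar>)"
    by (subst (asm) ennreal_inj) (auto intro!: integral_nonneg_AE)
qed

lemma L1_dist_triangle:
  assumes "integrable lborel u" "integrable lborel v" "integrable lborel w"
  shows "L1_dist u w \<le> L1_dist u v + L1_dist v w"
proof -
  have "L1_dist u w \<le> (LINT x|lborel. \<bar>u x - v x\<bar> + \<bar>v x - w x\<bar>)"
    unfolding L1_dist_def using assms by (intro integral_mono) auto
  also have "\<dots> = L1_dist u v + L1_dist v w" unfolding L1_dist_def using assms by simp
  finally show ?thesis .
qed

lemma L1_dist_nonneg: "0 \<le> L1_dist u v"
  unfolding L1_dist_def by (rule integral_nonneg_AE) simp

lemma concentrated_integral_mono: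
  fixes f g :: "real \<Rightarrow> real"
  assumes M: "fin_borel M" "emeasure M (- {L..R}) = 0" and "integrable M f" "integrable M g" "\<And>x. x \<in> {L..R} \<Longrightarrow> f x \<le> g x"
  shows "(LINT x|M. f x) \<le> (LINT x|M. g x)"
proof (rule integral_mono_AE[OF assms(3,4)])
  show "AE x in M. f x \<le> g x" using AE_concentrated[OF M] by (rule eventually_mono) (use assms(5) in blast)
qed

section \<open>Deficit, moments of Du and distance to the optimizer\<close>

context shell begin

abbreviation "stepf c \<equiv> step_fun (1 / A c) c R2"

lemma us_eq: "us = stepf a"
  by (auto simp: u_star_def step_fun_def H_star_def)

lemma step_A_BV:
  assumes "R1 \<le> c" "c < R2"
  shows "stepf c \<in> A_BV R1 R2" "Du_pos (stepf c) = dirac (1 / A c) c" "Du_neg (stepf c) = dirac (1 / A c) R2"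
proof -
  have A: "0 < A c" by (rule A_pos[OF assms])
  note S = step_fun_has_Du[of "1 / A c" c R2]
  have "(LINT r:{R1..R2}|lborel. r\<^sup>2 * stepf c r) = (LINT r|lborel. 1 / A c * (indicator {c<..<R2} r * r\<^sup>2))"
    unfolding set_lebesgue_integral_def using assms
    by (intro Bochner_Integration.integral_cong) (auto simp: step_fun_def indicator_def)
  also have "\<dots> = 1 / A c * (R2^3 / 3 - c^3 / 3)"
  proof -
    have "((\<lambda>r. r^3 / 3) has_real_derivative x\<^sup>2) (at x)" for x :: real by (auto intro!: derivative_eq_intros)
    then show ?thesis
      using integral_open_interval_deriv(1)[of c R2 "\<lambda>r. r^3 / 3" "\<lambda>r. r\<^sup>2"] assms
      by (simp add: continuous_intros)
  qed
  also have "\<dots> = 1" using A by (simp add: A_weight_def diff_divide_distrib)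
  finally show "stepf c \<in> A_BV R1 R2"
    unfolding A_BV_def BV_def using S A assms by (auto simp: step_fun_def indicator_def intro!: AE_I2)
  show "Du_pos (stepf c) = dirac (1 / A c) c" "Du_neg (stepf c) = dirac (1 / A c) R2"
    using Du_eqI[OF S(1,2)] A assms by auto
qed

lemma step_F:
  assumes "R1 \<le> c" "c < R2"
  shows "F (stepf c) c = 1 - 2 * M1 / c"
proof -
  have "P (stepf c) c = (LINT s:{R1..c}|lborel. s\<^sup>2 * stepf c s)" using P_eq[OF step_A_BV(1)[OF assms], of c] assms by simp
  also have "\<dots> = (LINT s|(lborel :: real measure). 0)"
    unfolding set_lebesgue_integral_def by (intro Bochner_Integration.integral_cong) (auto simp: step_fun_def indicator_def)
  finally show ?thesis by (simp add: lapse_def mass_def)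
qed

lemma J_alt: "J_fun M1 M2 R1 R2 u = (LINT r|Du_pos u. indicator {R1..R2} r * w u r)"
  by (simp add: J_fun_def set_lebesgue_integral_def)

lemma step_J:
  assumes "R1 \<le> c" "c < R2"
  shows "J_fun M1 M2 R1 R2 (stepf c) = q c / A c"
proof -
  have A: "0 < A c" by (rule A_pos[OF assms])
  have "J_fun M1 M2 R1 R2 (stepf c) = (LINT r|dirac (1 / A c) c. indicator {R1..R2} r * w (stepf c) r)"
    by (simp add: J_alt step_A_BV[OF assms])
  also have "\<dots> = 1 / A c * (indicator {R1..R2} c * w (stepf c) c)"
    using A F_measurable[OF step_A_BV(1)[OF assms]] integral_dirac[of "1 / A c" "\<lambda>r. indicator {R1..R2} r * w (stepf c) r" c]
    by (simp only:) simp
  also have "\<dots> = q c / A c" using assms M1R1 by (simp add: step_F q_weight_alt)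
  finally show ?thesis .
qed

lemma us_A_BV: "us \<in> A_BV R1 R2" "Du_pos us = dirac H a" "Du_neg us = dirac H R2" "J_fun M1 M2 R1 R2 us = lam"
  using step_A_BV[OF a_facts(1,2)] step_J[OF a_facts(1,2)] by (simp_all add: us_eq H_star_def lambda_star_def Psi_def)

abbreviation "\<delta> \<equiv> deficit M1 M2 R1 R2"

lemma A_continuous: "continuous_on S A"
  unfolding A_weight_def[abs_def] by (intro continuous_intros) auto

lemma A_borel: "A \<in> borel_measurable borel"
  by (intro borel_measurable_continuous_onI A_continuous)

text \<open>The constraint replaces \<lambda> times the integral of A against the positive part by
  \<lambda> plus \<lambda> times that against the negative part. Here \<open>g\<close> is any
  continuous minorant of the gap; below it is taken to be zero, linear and quadratic.\<close>

lemma deficit_lower: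
  assumes u: "u \<in> A_BV R1 R2" and g: "continuous_on UNIV g" "\<And>r. r \<in> {R1..R2} \<Longrightarrow> lam * A r + g r \<le> q r"
  shows "(LINT r|Du_pos u. g r) + lam * (LINT r|Du_neg u. A r) \<le> \<delta> u"
proof -
  note fb = A_BV_fin_borel[OF u] and c = A_BV_concentrated[OF u]
  have gm: "g \<in> borel_measurable borel" using g by (intro borel_measurable_continuous_onI)
  have i: "integrable (Du_pos u) g"
    by (rule concentrated_integrable_continuous[OF fb(1) c(1) gm continuous_on_subset[OF g(1)]]) simp
  have iA: "integrable (Du_pos u) A"
    by (rule concentrated_integrable_continuous[OF fb(1) c(1) A_borel A_continuous])
  have "(LINT r|Du_pos u. lam * A r + g r) \<le> (LINT r|Du_pos u. indicator {R1..R2} r * w u r)"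
  proof (rule concentrated_integral_mono[OF fb(1) c(1)])
    show "lam * A r + g r \<le> indicator {R1..R2} r * w u r" if "r \<in> {R1..R2}" for r
      using g(2)[OF that] q_le_w[OF u that] that by simp
    show "integrable (Du_pos u) (\<lambda>r. indicat_real {R1..R2} r * w u r)" by (rule w_integrable[OF u u]) simp
  qed (use i iA in simp)
  moreover have "(LINT r|Du_pos u. lam * A r + g r) = lam * (1 + (LINT r|Du_neg u. A r)) + (LINT r|Du_pos u. g r)"
    using i iA A_BV_integral_A_weight[OF u] R12 by simp
  ultimately show ?thesis by (simp add: deficit_def J_alt algebra_simps)
qed

lemma A_neg_integral:
  assumes u: "u \<in> A_BV R1 R2"
  shows "R1\<^sup>2 / 3 * (LINT r|Du_neg u. \<bar>r - R2\<bar>) \<le> (LINT r|Du_neg u. A r)" "0 \<le> (LINT r|Du_neg u. A r)"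
proof -
  note fb = A_BV_fin_borel[OF u] and c = A_BV_concentrated[OF u]
  have iA: "integrable (Du_neg u) A"
    by (rule concentrated_integrable_continuous[OF fb(2) c(2) A_borel A_continuous])
  have i: "integrable (Du_neg u) (\<lambda>r. \<bar>r - R2\<bar>)"
    by (rule concentrated_integrable_continuous[OF fb(2) c(2)]) (auto intro!: continuous_intros)
  have "(LINT r|Du_neg u. R1\<^sup>2 / 3 * \<bar>r - R2\<bar>) \<le> (LINT r|Du_neg u. A r)"
    by (rule concentrated_integral_mono[OF fb(2) c(2)]) (use i iA A_lower in \<open>auto simp: mult.commute\<close>)
  then show l: "R1\<^sup>2 / 3 * (LINT r|Du_neg u. \<bar>r - R2\<bar>) \<le> (LINT r|Du_neg u. A r)" by simp
  have "0 \<le> (LINT r|Du_neg u. \<bar>r - R2\<bar>)" by (rule integral_nonneg_AE) simp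
  then have "0 \<le> R1\<^sup>2 / 3 * (LINT r|Du_neg u. \<bar>r - R2\<bar>)" by simp
  with l show "0 \<le> (LINT r|Du_neg u. A r)" by linarith
qed

lemma deficit_nonneg:
  assumes u: "u \<in> A_BV R1 R2" shows "0 \<le> \<delta> u" "lam * (LINT r|Du_neg u. A r) \<le> \<delta> u"
proof -
  have "0 \<le> lam * R1 / 3 * (r - a)\<^sup>2" for r using lam_pos R1_pos by simp
  then have "lam * A r + 0 \<le> q r" if "r \<in> {R1..R2}" for r
    using gap_quadratic[OF that] by (smt (verit))
  from deficit_lower[OF u _ this] show l: "lam * (LINT r|Du_neg u. A r) \<le> \<delta> u" by simp
  have "0 \<le> lam * (LINT r|Du_neg u. A r)" using A_neg_integral(2)[OF u] lam_pos by simp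
  with l show "0 \<le> \<delta> u" by linarith
qed

text \<open>The cost of transporting the positive part of Du to the point \<open>a\<close>.\<close>

definition "X u = (LINT r|Du_pos u. \<bar>r - a\<bar>)"

lemma pos_integrable:
  assumes u: "u \<in> A_BV R1 R2" and "continuous_on UNIV g"
  shows "integrable (Du_pos u) (g :: real \<Rightarrow> real)" "integrable (Du_neg u) g"
proof -
  note fb = A_BV_fin_borel[OF u] and c = A_BV_concentrated[OF u]
  have "g \<in> borel_measurable borel" "continuous_on {R1..R2} g"
    using assms(2) by (auto intro: borel_measurable_continuous_onI continuous_on_subset)
  then show "integrable (Du_pos u) g" "integrable (Du_neg u) g"
    by - (rule concentrated_integrable_continuous[OF fb(1) c(1)] concentrated_integrable_continuous[OF fb(2) c(2)]; assumption)+
qed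

lemma X_nonneg: "0 \<le> X u"
  unfolding X_def by (rule integral_nonneg_AE) simp

lemma X_linear:
  assumes u: "u \<in> A_BV R1 R2" and b: "a = R1" "x0 M1 R2 < R1"
  shows "X u \<le> \<delta> u / slope"
proof -
  have s: "0 < slope" using slope_boundary b by simp
  have "(LINT r|Du_pos u. slope * (r - a)) + lam * (LINT r|Du_neg u. A r) \<le> \<delta> u"
    by (rule deficit_lower[OF u]) (use gap_linear in \<open>auto intro!: continuous_intros simp: algebra_simps\<close>)
  then have "(LINT r|Du_pos u. slope * (r - a)) \<le> \<delta> u"
    using A_neg_integral(2)[OF u] lam_pos by (smt (verit) mult_nonneg_nonneg)
  moreover have "(LINT r|Du_pos u. slope * (r - a)) = slope * X u"
  proof -
    have "(LINT r|Du_pos u. slope * (r - a)) = (LINT r|Du_pos u. slope * \<bar>r - a\<bar>)"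
    proof (rule antisym; rule concentrated_integral_mono[OF A_BV_fin_borel(1)[OF u] A_BV_concentrated(1)[OF u]])
    qed (use b in \<open>auto intro!: pos_integrable[OF u] continuous_intros\<close>)
    then show ?thesis by (simp add: X_def)
  qed
  ultimately show ?thesis using s by (simp add: field_simps)
qed

lemma mass_bound:
  assumes u: "u \<in> A_BV R1 R2"
  shows "measure (Du_pos u) UNIV \<le> (lam + \<delta> u) / R1^3"
proof -
  note fb = A_BV_fin_borel[OF u] and c = A_BV_concentrated[OF u]
  have "(LINT r|Du_pos u. R1^3) \<le> (LINT r|Du_pos u. indicator {R1..R2} r * w u r)"
  proof (rule concentrated_integral_mono[OF fb(1) c(1)])
    show "R1^3 \<le> indicator {R1..R2} r * w u r" if "r \<in> {R1..R2}" for r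
      using w_lower[OF u that] that by simp
    show "integrable (Du_pos u) (\<lambda>r. indicat_real {R1..R2} r * w u r)" by (rule w_integrable[OF u u]) simp
    show "integrable (Du_pos u) (\<lambda>r. R1^3)" by (rule pos_integrable(1)[OF u]) simp
  qed
  then have "R1^3 * measure (Du_pos u) UNIV \<le> lam + \<delta> u" using fin_borelD(3)[OF fb(1)] by (simp add: deficit_def J_alt mult.commute)
  then show ?thesis using R1_pos by (simp add: pos_le_divide_eq mult.commute)
qed

text \<open>The first summand bounds the mass of the positive part for deficit at most 1, the second
  is the reciprocal of the quadratic growth rate of the gap.\<close>

definition "KX = (lam + 1) / R1^3 + 3 / (lam * R1)"

lemma KX_nonneg: "0 \<le> KX" using lam_pos R1_pos by (simp add: KX_def)

lemma X_quadratic: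
  assumes u: "u \<in> A_BV R1 R2" and d1: "\<delta> u \<le> 1"
  shows "X u \<le> KX * sqrt (\<delta> u)"
proof -
  let ?h = "measure (Du_pos u) UNIV"
  let ?D = "LINT r|Du_pos u. (r - a)\<^sup>2"
  have "(LINT r|Du_pos u. lam * R1 / 3 * (r - a)\<^sup>2) + lam * (LINT r|Du_neg u. A r) \<le> \<delta> u"
    by (rule deficit_lower[OF u]) (use gap_quadratic in \<open>auto intro!: continuous_intros simp: algebra_simps\<close>)
  then have "lam * R1 / 3 * ?D \<le> \<delta> u"
    using A_neg_integral(2)[OF u] lam_pos by (simp only: integral_mult_right_zero) (smt (verit) mult_nonneg_nonneg)
  then have D: "?D \<le> 3 / (lam * R1) * \<delta> u" using lam_pos R1_pos by (simp add: field_simps)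
  have h: "?h \<le> (lam + 1) / R1^3"
    using mass_bound[OF u] d1 R1_pos by (smt (verit) divide_right_mono zero_less_power)
  have e: "X u \<le> \<epsilon> * ((lam + 1) / R1^3) + 3 / (lam * R1) * \<delta> u / \<epsilon>" if "0 < \<epsilon>" for \<epsilon>
  proof -
    have pw: "\<bar>x\<bar> \<le> \<epsilon> + x\<^sup>2 / \<epsilon>" for x
    proof -
      have "0 \<le> (\<bar>x\<bar> - \<epsilon>)\<^sup>2 + \<bar>x\<bar> * \<epsilon>" using that by simp
      moreover have "(\<bar>x\<bar> - \<epsilon>)\<^sup>2 = x\<^sup>2 - 2 * (\<bar>x\<bar> * \<epsilon>) + \<epsilon> * \<epsilon>" by (simp add: power2_eq_square algebra_simps)
      moreover have "(\<epsilon> + x\<^sup>2 / \<epsilon>) * \<epsilon> = \<epsilon> * \<epsilon> + x\<^sup>2" using that by (simp add: distrib_right)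
      ultimately have "\<bar>x\<bar> * \<epsilon> \<le> (\<epsilon> + x\<^sup>2 / \<epsilon>) * \<epsilon>" by linarith
      then show ?thesis using that by (rule mult_right_le_imp_le)
    qed
    have "X u \<le> (LINT r|Du_pos u. \<epsilon> + (r - a)\<^sup>2 / \<epsilon>)"
      unfolding X_def by (intro integral_mono pos_integrable[OF u] continuous_intros pw) (use that in auto)
    also have "\<dots> = \<epsilon> * ?h + ?D / \<epsilon>"
    proof -
      have "integrable (Du_pos u) (\<lambda>r. (r - a)\<^sup>2 / \<epsilon>)" "integrable (Du_pos u) (\<lambda>r. \<epsilon>)"
        by (intro pos_integrable[OF u] continuous_intros; use that in simp)+
      then show ?thesis using fin_borelD(3)[OF A_BV_fin_borel(1)[OF u]] by (subst Bochner_Integration.integral_add) (auto simp: mult.commute)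
    qed
    also have "\<dots> \<le> \<epsilon> * ((lam + 1) / R1^3) + 3 / (lam * R1) * \<delta> u / \<epsilon>"
      using h D that by (intro add_mono mult_left_mono divide_right_mono) auto
    finally show ?thesis .
  qed
  show ?thesis
  proof (cases "\<delta> u = 0")
    case True
    have "X u \<le> 0"
    proof (rule field_le_epsilon)
      fix \<eta> :: real assume "0 < \<eta>"
      define k where "k = (lam + 1) / R1^3"
      have k: "0 < k" using lam_pos R1_pos by (simp add: k_def)
      have "X u \<le> \<eta> / k * k + 3 / (lam * R1) * \<delta> u / (\<eta> / k)"
        unfolding k_def by (rule e, fold k_def) (use \<open>0 < \<eta>\<close> k in simp)
      then show "X u \<le> 0 + \<eta>" using True k by simp
    qed
    then show ?thesis using True by simp
  next
    case False
    then have p: "0 < \<delta> u" using deficit_nonneg[OF u] by simp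
    have "X u \<le> sqrt (\<delta> u) * ((lam + 1) / R1^3) + 3 / (lam * R1) * \<delta> u / sqrt (\<delta> u)" by (rule e) (use p in simp)
    also have "\<delta> u = sqrt (\<delta> u) * sqrt (\<delta> u)" using p by simp
    then have "3 / (lam * R1) * \<delta> u / sqrt (\<delta> u) = 3 / (lam * R1) * sqrt (\<delta> u)" by (metis p real_div_sqrt less_imp_le times_divide_eq_right)
    finally show ?thesis by (simp add: KX_def algebra_simps)
  qed
qed

lemma A_Lipschitz: "r \<in> {R1..R2} \<Longrightarrow> \<bar>A r - A a\<bar> \<le> R2\<^sup>2 * \<bar>r - a\<bar>"
proof -
  assume r: "r \<in> {R1..R2}"
  have a: "0 < a" "a \<le> R2" using a_facts by auto
  have "A r - A a = - ((r\<^sup>2 + r * a + a\<^sup>2) / 3 * (r - a))" by (simp add: A_weight_def power2_eq_square power3_eq_cube field_simps)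
  then have eq: "\<bar>A r - A a\<bar> = (r\<^sup>2 + r * a + a\<^sup>2) / 3 * \<bar>r - a\<bar>" using r a R1_pos by (simp add: abs_mult)
  moreover have "r\<^sup>2 \<le> R2\<^sup>2" "r * a \<le> R2\<^sup>2" "a\<^sup>2 \<le> R2\<^sup>2"
    using r a R1_pos mult_mono[of r R2 a R2] by (auto simp: power2_eq_square intro!: mult_mono)
  ultimately have "(r\<^sup>2 + r * a + a\<^sup>2) / 3 \<le> R2\<^sup>2" by simp
  then have "(r\<^sup>2 + r * a + a\<^sup>2) / 3 * \<bar>r - a\<bar> \<le> R2\<^sup>2 * \<bar>r - a\<bar>" by (rule mult_right_mono) simp
  then show ?thesis using eq by simp
qed

text \<open>The constraint determines the total mass h of the positive part: h A(a) - 1 is the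
  integral of A against the negative part minus that of A - A(a) against the positive part. The
  deficit bounds \<lambda> times the former, and the Lipschitz bound for A controls the latter by
  the first moment.\<close>

lemma mass_deviation:
  assumes u: "u \<in> A_BV R1 R2"
  shows "\<bar>measure (Du_pos u) UNIV - H\<bar> \<le> H * (R2\<^sup>2 * X u + \<delta> u / lam)"
proof -
  let ?h = "measure (Du_pos u) UNIV"
  have Aa: "0 < A a" "H = 1 / A a" using A_pos[OF a_facts(1,2)] by (simp_all add: H_star_def)
  have iA: "integrable (Du_pos u) A" by (intro pos_integrable[OF u] A_continuous)
  have c: "integrable (Du_pos u) (\<lambda>_. A a)" by (intro pos_integrable[OF u]) simp
  have "(LINT r|Du_pos u. A r - A a) = (LINT r|Du_pos u. A r) - A a * ?h"
    using iA c fin_borelD(3)[OF A_BV_fin_borel(1)[OF u]] by (subst Bochner_Integration.integral_diff) (auto simp: mult.commute)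
  then have "?h * A a - 1 = (LINT r|Du_neg u. A r) - (LINT r|Du_pos u. A r - A a)"
    using A_BV_integral_A_weight[OF u] R12 by (simp add: algebra_simps)
  moreover have "\<bar>LINT r|Du_pos u. A r - A a\<bar> \<le> R2\<^sup>2 * X u"
  proof -
    have "\<bar>LINT r|Du_pos u. A r - A a\<bar> \<le> (LINT r|Du_pos u. \<bar>A r - A a\<bar>)" by (rule integral_abs_bound)
    also have "\<dots> \<le> (LINT r|Du_pos u. R2\<^sup>2 * \<bar>r - a\<bar>)"
      by (rule concentrated_integral_mono[OF A_BV_fin_borel(1)[OF u] A_BV_concentrated(1)[OF u]])
        (auto intro!: pos_integrable[OF u] continuous_intros A_continuous A_Lipschitz)
    finally show ?thesis by (simp add: X_def)
  qed
  moreover have "(LINT r|Du_neg u. A r) \<le> \<delta> u / lam" using deficit_nonneg(2)[OF u] lam_pos by (simp add: field_simps)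
  ultimately have "\<bar>?h * A a - 1\<bar> \<le> R2\<^sup>2 * X u + \<delta> u / lam" using A_neg_integral(2)[OF u] by linarith
  moreover have "?h - H = H * (?h * A a - 1)" using Aa by (simp add: field_simps)
  ultimately show ?thesis using H_pos by (simp add: abs_mult)
qed

lemma neg_moment:
  assumes u: "u \<in> A_BV R1 R2"
  shows "(LINT r|Du_neg u. \<bar>r - R2\<bar>) \<le> 3 / (R1\<^sup>2 * lam) * \<delta> u"
proof -
  have "lam * (R1\<^sup>2 / 3 * (LINT r|Du_neg u. \<bar>r - R2\<bar>)) \<le> lam * (LINT r|Du_neg u. A r)"
    using A_neg_integral(1)[OF u] lam_pos by (intro mult_left_mono) auto
  also have "\<dots> \<le> \<delta> u" by (rule deficit_nonneg(2)[OF u])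
  finally show ?thesis using lam_pos R1_pos by (simp add: field_simps)
qed

text \<open>The comparison passes through a step on (a, R2) whose height h is the mass of the
  positive part of Du. Moving the mass costs the two first moments; correcting the height h to
  \<open>H\<close> costs the mass deviation.\<close>

lemma L1_stability:
  obtains C where "0 \<le> C" "\<And>u. u \<in> A_BV R1 R2 \<Longrightarrow> L1_dist u us \<le> C * (X u + \<delta> u)"
proof
  define C where "C = 1 + 3 / (R1\<^sup>2 * lam) + (R2 - a) * H * (R2\<^sup>2 + 1 / lam)"
  have nn: "0 \<le> 3 / (R1\<^sup>2 * lam)" "0 \<le> (R2 - a) * H" "0 \<le> 1 / lam" using lam_pos H_pos a_facts by auto
  have "0 \<le> (R2 - a) * H * (R2\<^sup>2 + 1 / lam)" by (rule mult_nonneg_nonneg[OF nn(2)]) (use nn(3) in simp)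
  then show "0 \<le> C" unfolding C_def using nn(1) by linarith
  fix u assume u: "u \<in> A_BV R1 R2"
  note fb = A_BV_fin_borel[OF u] and c = A_BV_concentrated[OF u]
  define h where "h = measure (Du_pos u) UNIV"
  let ?v = "step_fun h a R2"
  have h0: "0 \<le> h" by (simp add: h_def)
  have iv: "integrable lborel ?v" using step_fun_has_Du(3)[OF h0 a_facts(2)] .
  have iu: "integrable lborel u" by (rule A_BV_integrable[OF u])
  have ius: "integrable lborel us" by (rule A_BV_integrable[OF us_A_BV(1)])
  note d1 = integral_cdf_diff[OF fb(1) c(1), of a] and d2 = integral_cdf_diff[OF fb(2) c(2), of R2]
  have "L1_dist u ?v \<le> (LINT r|lborel. \<bar>measure (Du_pos u) {..r} - measure (Du_pos u) UNIV * indicator {a..} r\<bar> + \<bar>measure (Du_neg u) {..r} - measure (Du_neg u) UNIV * indicator {R2..} r\<bar>)"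
    unfolding L1_dist_def
  proof (rule integral_mono_AE)
    show "AE r in lborel. \<bar>u r - ?v r\<bar> \<le> \<bar>measure (Du_pos u) {..r} - measure (Du_pos u) UNIV * indicator {a..} r\<bar> + \<bar>measure (Du_neg u) {..r} - measure (Du_neg u) UNIV * indicator {R2..} r\<bar>"
      using A_BV_representation(1)[OF u less_imp_le[OF R12]] AE_lborel_singleton[of a] AE_lborel_singleton[of R2]
    proof eventually_elim
      case (elim r)
      \<comment> \<open>Off the two jump points the indicator of the open interval is a difference
        of indicators of closed half-lines, the form in which distribution functions of point masses
        appear.\<close>
      have "?v r = h * indicator {a..} r - h * indicator {R2..} r"
        using elim a_facts by (auto simp: step_fun_def indicator_def)
      then have "u r - ?v r = (measure (Du_pos u) {..r} - measure (Du_pos u) UNIV * indicator {a..} r) - (measure (Du_neg u) {..r} - measure (Du_neg u) UNIV * indicator {R2..} r)"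
        using elim(1) A_BV_representation(2)[OF u less_imp_le[OF R12]] by (simp add: h_def)
      then show ?case by linarith
    qed
  qed (use iu iv d1 d2 in auto)
  also have "\<dots> = X u + (LINT r|Du_neg u. \<bar>r - R2\<bar>)"
    using d1 d2 by (simp add: X_def)
  finally have 1: "L1_dist u ?v \<le> X u + 3 / (R1\<^sup>2 * lam) * \<delta> u" using neg_moment[OF u] by linarith
  have "L1_dist ?v us = (LINT r|lborel. \<bar>h - H\<bar> * indicator {a<..<R2} r)"
    unfolding L1_dist_def by (intro Bochner_Integration.integral_cong) (auto simp: step_fun_def u_star_def indicator_def)
  also have "\<dots> = \<bar>h - H\<bar> * (R2 - a)" using a_facts by simp
  also have "\<dots> \<le> H * (R2\<^sup>2 * X u + \<delta> u / lam) * (R2 - a)"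
    using mass_deviation[OF u] a_facts by (intro mult_right_mono) (auto simp: h_def)
  also have "\<dots> = ((R2 - a) * H) * (R2\<^sup>2 * X u + 1 / lam * \<delta> u)" by simp
  also have "\<dots> \<le> ((R2 - a) * H) * ((R2\<^sup>2 + 1 / lam) * (X u + \<delta> u))"
  proof (rule mult_left_mono[OF _ nn(2)])
    have "0 \<le> R2\<^sup>2 * \<delta> u" "0 \<le> 1 / lam * X u" using nn X_nonneg deficit_nonneg[OF u] by (intro mult_nonneg_nonneg; simp)+
    then show "R2\<^sup>2 * X u + 1 / lam * \<delta> u \<le> (R2\<^sup>2 + 1 / lam) * (X u + \<delta> u)" by (simp only: distrib_left distrib_right; linarith)
  qed
  finally have 2: "L1_dist ?v us \<le> ((R2 - a) * H) * ((R2\<^sup>2 + 1 / lam) * (X u + \<delta> u))" .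
  have "0 \<le> 3 / (R1\<^sup>2 * lam) * X u" "0 \<le> \<delta> u" using nn X_nonneg deficit_nonneg[OF u] by (auto intro: mult_nonneg_nonneg)
  then have "X u + 3 / (R1\<^sup>2 * lam) * \<delta> u \<le> (1 + 3 / (R1\<^sup>2 * lam)) * (X u + \<delta> u)"
    by (simp only: distrib_left distrib_right; linarith)
  then show "L1_dist u us \<le> C * (X u + \<delta> u)"
    using 1 2 L1_dist_triangle[OF iu iv ius] unfolding C_def by (simp only: distrib_right mult.assoc; linarith)
qed

lemma Linf_norm_le:
  assumes "0 \<le> c" "\<And>x. x \<in> S \<Longrightarrow> \<bar>f x\<bar> \<le> c"
  shows "Linf_norm S f \<le> c"
  unfolding Linf_norm_def by (rule cInf_lower) (use assms in \<open>auto intro!: bdd_belowI[of _ 0]\<close>)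

text \<open>A bound has to be exhibited: the infimum of an empty set of reals would carry no
  sign.\<close>

lemma Linf_norm_nonneg:
  assumes "0 \<le> c" "\<And>x. x \<in> S \<Longrightarrow> \<bar>f x\<bar> \<le> c"
  shows "0 \<le> Linf_norm S f"
  unfolding Linf_norm_def using assms by (intro cInf_greatest) (auto intro!: exI[of _ c])

text \<open>The constant of \<open>F_diff\<close>: the lapse is Lipschitz in the profile with
  respect to the L1 distance.\<close>

definition "KF = 2 * (M2 - M1) / R1 * R2\<^sup>2"

lemma KF_nonneg: "0 \<le> KF" using M12 R1_pos by (simp add: KF_def)

lemma F_inverse_diff:
  assumes "u \<in> A_BV R1 R2" "v \<in> A_BV R1 R2" "r \<in> {R1..R2}"
  shows "\<bar>inverse (F u r) - inverse (F v r)\<bar> \<le> KF / F0\<^sup>2 * L1_dist u v"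
proof -
  have p: "0 < F u r" "0 < F v r" "F0 \<le> F u r" "F0 \<le> F v r"
    using F_pos[OF assms(1)] F_pos[OF assms(2)] F_lower[OF assms(1)] F_lower[OF assms(2)] assms(3) by auto
  have "inverse (F u r) - inverse (F v r) = (F v r - F u r) / (F u r * F v r)" using p by (simp add: field_simps)
  then have "\<bar>inverse (F u r) - inverse (F v r)\<bar> = \<bar>F u r - F v r\<bar> / (F u r * F v r)" using p by (simp add: abs_minus_commute)
  also have "\<dots> \<le> KF * L1_dist u v / F0\<^sup>2"
  proof (rule frac_le)
    show "F0\<^sup>2 \<le> F u r * F v r" using p F0 by (simp add: power2_eq_square mult_mono)
  qed (use F_diff[OF assms(1,2), of r] KF_nonneg L1_dist_nonneg F0 in \<open>auto simp: KF_def\<close>)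
  finally show ?thesis by simp
qed

text \<open>The deviation is comparable to the L1 distance alone, so stability and the sharpness of
  its exponents are decided there.\<close>

lemma deviation_bounds:
  assumes u: "u \<in> A_BV R1 R2"
  shows "deviation M1 M2 R1 R2 u \<le> (1 + KF + KF / F0\<^sup>2) * L1_dist u us" "L1_dist u us \<le> deviation M1 M2 R1 R2 u"
proof -
  have nn: "0 \<le> KF * L1_dist u us" "0 \<le> KF / F0\<^sup>2 * L1_dist u us" using KF_nonneg L1_dist_nonneg by simp_all
  have b1: "\<bar>F u r - lapse_star M1 M2 R1 R2 r\<bar> \<le> KF * L1_dist u us" for r
    using F_diff[OF u us_A_BV(1)] by (simp add: lapse_star_def KF_def)
  have b2: "\<bar>inverse (F u r) - inverse (lapse_star M1 M2 R1 R2 r)\<bar> \<le> KF / F0\<^sup>2 * L1_dist u us" if "r \<in> {R1..R2}" for r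
    using F_inverse_diff[OF u us_A_BV(1) that] by (simp add: lapse_star_def)
  let ?f = "\<lambda>r. F u r - lapse_star M1 M2 R1 R2 r" and ?g = "\<lambda>r. inverse (F u r) - inverse (lapse_star M1 M2 R1 R2 r)"
  have l: "Linf_norm {R1..R2} ?f \<le> KF * L1_dist u us" "Linf_norm {R1..R2} ?g \<le> KF / F0\<^sup>2 * L1_dist u us"
    "0 \<le> Linf_norm {R1..R2} ?f" "0 \<le> Linf_norm {R1..R2} ?g"
  proof -
    show "Linf_norm {R1..R2} ?f \<le> KF * L1_dist u us" by (rule Linf_norm_le[OF nn(1) b1])
    show "Linf_norm {R1..R2} ?g \<le> KF / F0\<^sup>2 * L1_dist u us" by (rule Linf_norm_le[OF nn(2) b2])
    show "0 \<le> Linf_norm {R1..R2} ?f" by (rule Linf_norm_nonneg[OF nn(1) b1])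
    show "0 \<le> Linf_norm {R1..R2} ?g" by (rule Linf_norm_nonneg[OF nn(2) b2])
  qed
  show "deviation M1 M2 R1 R2 u \<le> (1 + KF + KF / F0\<^sup>2) * L1_dist u us"
    unfolding deviation_def using l(1,2) by (simp only: distrib_right; linarith)
  show "L1_dist u us \<le> deviation M1 M2 R1 R2 u" unfolding deviation_def using l(3,4) by linarith
qed

end


section \<open>Stability and minimizing sequences\<close>

text \<open>Near c the function is within \<epsilon> of f c by continuity; at distance at least d
  the oscillation 2 B is paid for by the first moment, since it is at most 2 B / d times the
  distance. Continuity is asked for on [L, R] only, because the weights inserted later are cut off
  to that interval.\<close>

lemma tendsto_integral_concentrating:
  fixes f :: "real \<Rightarrow> real"
  assumes M: "\<And>n::nat. fin_borel (M n)" "\<And>n. emeasure (M n) (- {L..R}) = 0"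
    and mass: "(\<lambda>n. measure (M n) UNIV) \<longlonglongrightarrow> h" and mom: "(\<lambda>n. LINT x|M n. \<bar>x - c\<bar>) \<longlonglongrightarrow> 0"
    and c: "c \<in> {L..R}" and f: "f \<in> borel_measurable borel" "continuous_on {L..R} f"
  shows "(\<lambda>n. LINT x|M n. f x) \<longlonglongrightarrow> h * f c"
proof -
  have "compact (f ` {L..R})" by (intro compact_continuous_image f) auto
  then obtain B where B: "0 < B" "\<And>x. x \<in> {L..R} \<Longrightarrow> \<bar>f x\<bar> \<le> B"
    using compact_imp_bounded[of "f ` {L..R}"] unfolding bounded_pos by auto
  have i1: "integrable (M n) f" for n by (rule concentrated_integrable_continuous[OF M f])
  have i2: "integrable (M n) (\<lambda>x. \<bar>x - c\<bar>)" for n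
    by (rule concentrated_integrable_continuous[OF M]) (auto intro!: continuous_intros)
  have i3: "integrable (M n) (\<lambda>_. k)" for n and k :: real
    by (rule fin_borel_integrable_UNIV[OF M(1), of _ "\<bar>k\<bar>"]) auto
  have "(\<lambda>n. (LINT x|M n. f x) - measure (M n) UNIV * f c) \<longlonglongrightarrow> 0"
  proof (rule LIMSEQ_I)
    fix e :: real assume e: "0 < e"
    define k where "k = \<bar>h\<bar> + 1"
    have k: "0 < k" "h \<le> k" by (auto simp: k_def)
    define \<epsilon> where "\<epsilon> = e / (2 * k)"
    have \<epsilon>: "0 < \<epsilon>" using e k by (simp add: \<epsilon>_def)
    obtain d where d: "0 < d" "\<And>x. x \<in> {L..R} \<Longrightarrow> \<bar>x - c\<bar> < d \<Longrightarrow> \<bar>f x - f c\<bar> < \<epsilon>"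
      using f(2) c \<epsilon> unfolding continuous_on_iff dist_real_def by metis
    have pw: "\<bar>f x - f c\<bar> \<le> \<epsilon> + 2 * B / d * \<bar>x - c\<bar>" if "x \<in> {L..R}" for x
    proof (cases "\<bar>x - c\<bar> < d")
      case True
      have "0 \<le> 2 * B / d * \<bar>x - c\<bar>" using B d by simp
      then show ?thesis using d(2)[OF that True] by linarith
    next
      case False
      have "\<bar>f x - f c\<bar> \<le> 2 * B" using B(2)[OF that] B(2)[OF c] by linarith
      also have "2 * B \<le> 2 * B / d * \<bar>x - c\<bar>" using False B d by (simp add: pos_le_divide_eq)
      finally show ?thesis using \<epsilon> by simp
    qed
    have bd: "\<bar>(LINT x|M n. f x) - measure (M n) UNIV * f c\<bar> \<le> \<epsilon> * measure (M n) UNIV + 2 * B / d * (LINT x|M n. \<bar>x - c\<bar>)" for n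
    proof -
      have "(LINT x|M n. f x - f c) = (LINT x|M n. f x) - measure (M n) UNIV * f c"
        by (subst Bochner_Integration.integral_diff[OF i1 i3]) (simp add: fin_borelD(3)[OF M(1)])
      then have "\<bar>(LINT x|M n. f x) - measure (M n) UNIV * f c\<bar> \<le> (LINT x|M n. \<bar>f x - f c\<bar>)"
        using integral_abs_bound[of "M n" "\<lambda>x. f x - f c"] by simp
      also have "\<dots> \<le> (LINT x|M n. \<epsilon> + 2 * B / d * \<bar>x - c\<bar>)"
      proof (rule concentrated_integral_mono[OF M])
        show "integrable (M n) (\<lambda>x. \<bar>f x - f c\<bar>)"
          by (rule integrable_abs[OF Bochner_Integration.integrable_diff[OF i1 i3]])
        show "integrable (M n) (\<lambda>x. \<epsilon> + 2 * B / d * \<bar>x - c\<bar>)"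
          by (rule Bochner_Integration.integrable_add[OF i3 integrable_mult_right[OF i2]])
      qed (rule pw)
      also have "\<dots> = \<epsilon> * measure (M n) UNIV + 2 * B / d * (LINT x|M n. \<bar>x - c\<bar>)"
        by (subst Bochner_Integration.integral_add[OF i3 integrable_mult_right[OF i2]]) (simp add: fin_borelD(3)[OF M(1)])
      finally show ?thesis .
    qed
    have "(\<lambda>n. \<epsilon> * measure (M n) UNIV + 2 * B / d * (LINT x|M n. \<bar>x - c\<bar>)) \<longlonglongrightarrow> \<epsilon> * h + 2 * B / d * 0"
      by (rule tendsto_add[OF tendsto_mult_left[OF mass] tendsto_mult_left[OF mom]])
    moreover have "\<epsilon> * h + 2 * B / d * 0 < e"
    proof -
      have "\<epsilon> * h \<le> \<epsilon> * k" using \<epsilon> k by (intro mult_left_mono) auto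
      also have "\<dots> = e / 2" using k by (simp add: \<epsilon>_def)
      finally show ?thesis using e by simp
    qed
    ultimately have "eventually (\<lambda>n. \<epsilon> * measure (M n) UNIV + 2 * B / d * (LINT x|M n. \<bar>x - c\<bar>) < e) sequentially"
      by (rule order_tendstoD)
    then obtain N where "\<And>n. n \<ge> N \<Longrightarrow> \<epsilon> * measure (M n) UNIV + 2 * B / d * (LINT x|M n. \<bar>x - c\<bar>) < e"
      unfolding eventually_sequentially by blast
    then show "\<exists>N. \<forall>n\<ge>N. norm ((LINT x|M n. f x) - measure (M n) UNIV * f c - 0) < e"
      using bd by (intro exI[of _ N]) (auto intro: le_less_trans)
  qed
  from tendsto_add[OF this tendsto_mult_right[OF mass, of "f c"]] show ?thesis by simp
qed

lemma weak_star_diracI: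
  assumes "\<And>n::nat. fin_borel (M n)" "\<And>n. emeasure (M n) (- {L..R}) = 0"
    and "(\<lambda>n. measure (M n) UNIV) \<longlonglongrightarrow> h" "(\<lambda>n. LINT x|M n. \<bar>x - c\<bar>) \<longlonglongrightarrow> 0"
    and "c \<in> {L..R}" "0 \<le> h"
  shows "weak_star M (dirac h c)"
  unfolding weak_star_def
proof (intro allI impI)
  fix f :: "real \<Rightarrow> real" assume f: "continuous_on UNIV f \<and> compact (supp f)"
  then have fm: "f \<in> borel_measurable borel" by (auto intro: borel_measurable_continuous_onI)
  have "continuous_on {L..R} f" using f continuous_on_subset by blast
  from tendsto_integral_concentrating[OF assms(1-5) fm this]
  show "(\<lambda>n. LINT x|M n. f x) \<longlonglongrightarrow> (LINT x|dirac h c. f x)" using integral_dirac[OF assms(6) fm] by simp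
qed

context shell begin

abbreviation "dev \<equiv> deviation M1 M2 R1 R2"

lemma L1_stability_ex: "\<exists>C\<ge>0. \<forall>u\<in>A_BV R1 R2. L1_dist u us \<le> C * (X u + \<delta> u)"
proof (rule L1_stability)
  fix C assume "0 \<le> C" "\<And>u. u \<in> A_BV R1 R2 \<Longrightarrow> L1_dist u us \<le> C * (X u + \<delta> u)"
  then show ?thesis by blast
qed

lemma gap_upper_ex: "\<exists>K\<ge>0. \<forall>c\<in>{a..R2}. q c - lam * A c \<le> (slope + K * (c - a)) * (c - a)"
proof (rule gap_upper)
  fix K assume "0 \<le> K" "\<And>c. c \<in> {a..R2} \<Longrightarrow> q c - lam * A c \<le> (slope + K * (c - a)) * (c - a)"
  then show ?thesis by blast
qed

lemma stability:
  "\<exists>C. \<forall>u\<in>A_BV R1 R2. \<delta> u \<le> 1 \<longrightarrow>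
        (a = x0 M1 R2 \<longrightarrow> dev u \<le> C * sqrt (\<delta> u)) \<and>
        (a = R1 \<and> R1 > x0 M1 R2 \<longrightarrow> dev u \<le> C * \<delta> u)"
proof -
  obtain C where C: "0 \<le> C" "\<And>u. u \<in> A_BV R1 R2 \<Longrightarrow> L1_dist u us \<le> C * (X u + \<delta> u)" using L1_stability_ex by blast
  define D where "D = 1 + KF + KF / F0\<^sup>2"
  have D: "0 \<le> D" using KF_nonneg by (simp add: D_def)
  have dv: "dev u \<le> D * (C * (X u + \<delta> u))" if "u \<in> A_BV R1 R2" for u
    using deviation_bounds(1)[OF that] mult_left_mono[OF C(2)[OF that] D] by (simp add: D_def)
  \<comment> \<open>One constant has to serve both cases, hence a sum of two nonnegative ones. In
    the interior case the slope is 0 and the quotient is 0 by convention.\<close>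
  define E where "E = D * C * (KX + 1) + D * C * (\<bar>1 / slope\<bar> + 1)"
  have E0: "0 \<le> D * C * (KX + 1)" "0 \<le> D * C * (\<bar>1 / slope\<bar> + 1)" using D C KX_nonneg by simp_all
  have "(a = x0 M1 R2 \<longrightarrow> dev u \<le> E * sqrt (\<delta> u)) \<and> (a = R1 \<and> R1 > x0 M1 R2 \<longrightarrow> dev u \<le> E * \<delta> u)"
    if u: "u \<in> A_BV R1 R2" "\<delta> u \<le> 1" for u
  proof (intro conjI impI)
    have d0: "0 \<le> \<delta> u" by (rule deficit_nonneg(1)[OF u(1)])
    have "\<delta> u \<le> sqrt (\<delta> u)"
    proof -
      have "sqrt (\<delta> u) * sqrt (\<delta> u) \<le> 1 * sqrt (\<delta> u)" using u(2) d0 by (intro mult_right_mono) auto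
      then show ?thesis using d0 by simp
    qed
    then have "X u + \<delta> u \<le> (KX + 1) * sqrt (\<delta> u)" using X_quadratic[OF u] by (simp only: distrib_right; linarith)
    then have "D * C * (X u + \<delta> u) \<le> D * C * ((KX + 1) * sqrt (\<delta> u))" using D C by (intro mult_left_mono) auto
    also have "\<dots> \<le> E * sqrt (\<delta> u)"
      using mult_right_mono[OF E0(2), of "sqrt (\<delta> u)"] d0 by (simp only: E_def distrib_right mult.assoc; simp)
    finally show "dev u \<le> E * sqrt (\<delta> u)" using dv[OF u(1)] by (simp only: mult.assoc; linarith)
    assume b: "a = R1 \<and> R1 > x0 M1 R2"
    then have s: "0 < slope" using slope_boundary by simp
    have "X u + \<delta> u \<le> (\<bar>1 / slope\<bar> + 1) * \<delta> u" using X_linear[OF u(1)] b s by (simp add: distrib_right)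
    then have "D * C * (X u + \<delta> u) \<le> D * C * ((\<bar>1 / slope\<bar> + 1) * \<delta> u)" using D C by (intro mult_left_mono) auto
    also have "\<dots> \<le> E * \<delta> u"
      using mult_right_mono[OF E0(1) d0] by (simp only: E_def distrib_right mult.assoc; simp)
    finally show "dev u \<le> E * \<delta> u" using dv[OF u(1)] by (simp only: mult.assoc; linarith)
  qed
  then show ?thesis by blast
qed

lemma L1_zero_imp_AE:
  assumes "u \<in> A_BV R1 R2" "L1_dist u us \<le> 0"
  shows "AE r in lborel. u r = us r"
proof -
  have "integrable lborel (\<lambda>x. \<bar>u x - us x\<bar>)" using A_BV_integrable[OF assms(1)] A_BV_integrable[OF us_A_BV(1)] by simp
  moreover have "(LINT x|lborel. \<bar>u x - us x\<bar>) = 0" using assms(2) L1_dist_nonneg[of u us] unfolding L1_dist_def by linarith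
  ultimately have "AE x in lborel. \<bar>u x - us x\<bar> = 0" by (subst (asm) integral_nonneg_eq_0_iff_AE) auto
  then show ?thesis by (rule eventually_mono) simp
qed

lemma zero_deficit_imp_AE:
  assumes "u \<in> A_BV R1 R2" "\<delta> u = 0"
  shows "AE r in lborel. u r = us r"
proof -
  obtain C where C: "0 \<le> C" "\<And>u. u \<in> A_BV R1 R2 \<Longrightarrow> L1_dist u us \<le> C * (X u + \<delta> u)" using L1_stability_ex by blast
  have "X u \<le> 0" using X_quadratic[OF assms(1)] assms(2) by simp
  then have "C * (X u + \<delta> u) \<le> 0" using C(1) assms(2) by (simp add: mult_nonneg_nonpos)
  then show ?thesis using C(2)[OF assms(1)] by (intro L1_zero_imp_AE assms) linarith
qed

lemma J_cong_AE:
  assumes u: "u \<in> A_BV R1 R2" "v \<in> A_BV R1 R2" and ae: "AE r in lborel. u r = v r"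
  shows "J_fun M1 M2 R1 R2 u = J_fun M1 M2 R1 R2 v"
proof -
  have [measurable]: "u \<in> borel_measurable borel" "v \<in> borel_measurable borel"
    using A_BV_integrable[OF u(1)] A_BV_integrable[OF u(2)] by auto
  have "has_Du u (Du_pos v) (Du_neg v)"
    unfolding has_Du_iff
  proof (intro conjI allI impI A_BV_fin_borel[OF u(2)])
    fix \<phi> :: "real \<Rightarrow> real" assume t: "test_fun UNIV \<phi>"
    then have s: "smooth \<phi>" by (simp add: test_fun_def)
    have [measurable]: "deriv \<phi> \<in> borel_measurable borel" by (intro borel_measurable_continuous_onI smooth_continuous smooth_deriv s)
    have "(LINT x|lborel. u x * deriv \<phi> x) = (LINT x|lborel. v x * deriv \<phi> x)"
      using ae by (intro integral_cong_AE) auto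
    then show "(LINT x|lborel. u x * deriv \<phi> x) = - ((LINT x|Du_pos v. \<phi> x) - (LINT x|Du_neg v. \<phi> x))"
      using A_BV_has_Du(1)[OF u(2)] t unfolding has_Du_iff by simp
  qed
  then have D: "Du_pos u = Du_pos v" using Du_eqI(1) A_BV_has_Du(2)[OF u(2)] by blast
  have "L1_dist u v = 0" unfolding L1_dist_def by (rule integral_eq_zero_AE) (use ae in \<open>auto elim: eventually_mono\<close>)
  then have "F u r = F v r" for r using F_diff[OF u, of r] by simp
  then show ?thesis by (simp add: J_fun_def D)
qed

lemma minimizer_iff:
  assumes u: "u \<in> A_BV R1 R2"
  shows "(\<forall>v\<in>A_BV R1 R2. J_fun M1 M2 R1 R2 u \<le> J_fun M1 M2 R1 R2 v) \<longleftrightarrow> (AE r in lborel. u r = us r)"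
proof
  assume "\<forall>v\<in>A_BV R1 R2. J_fun M1 M2 R1 R2 u \<le> J_fun M1 M2 R1 R2 v"
  then have "J_fun M1 M2 R1 R2 u \<le> lam" using us_A_BV by auto
  then have "\<delta> u = 0" using deficit_nonneg(1)[OF u] by (simp add: deficit_def)
  then show "AE r in lborel. u r = us r" by (rule zero_deficit_imp_AE[OF u])
next
  assume "AE r in lborel. u r = us r"
  then have "J_fun M1 M2 R1 R2 u = lam" using J_cong_AE[OF u us_A_BV(1)] us_A_BV(4) by simp
  then show "\<forall>v\<in>A_BV R1 R2. J_fun M1 M2 R1 R2 u \<le> J_fun M1 M2 R1 R2 v"
    using deficit_nonneg(1) by (auto simp: deficit_def)
qed

text \<open>A smooth admissible profile tends to 0 at R2, whereas \<open>u_star\<close> has the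
  value \<open>H\<close> > 0 on an interval ending there, so the two cannot agree almost
  everywhere.\<close>

lemma smooth_deficit_pos:
  assumes "u \<in> A_smooth R1 R2" shows "I_fun M1 M2 R1 R2 u \<noteq> lam"
proof
  assume "I_fun M1 M2 R1 R2 u = lam"
  have u: "u \<in> A_BV R1 R2" using assms A_smooth_subset_A_BV by auto
  have "\<delta> u = 0" using \<open>I_fun M1 M2 R1 R2 u = lam\<close> I_eq_J[OF assms] by (simp add: deficit_def)
  then have ae: "AE r in lborel. u r = us r" by (rule zero_deficit_imp_AE[OF u])
  have c: "isCont u R2" using A_smoothD(7)[OF assms, of UNIV] by (simp add: continuous_on_eq_continuous_at)
  have z: "u R2 = 0" using A_smoothD(3)[OF assms] by simp
  obtain d where d: "0 < d" "\<And>x. \<bar>x - R2\<bar> < d \<Longrightarrow> \<bar>u x\<bar> < H"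
    using c[unfolded continuous_at_eps_delta, rule_format, OF H_pos] z by (auto simp: dist_real_def)
  define e where "e = max a (R2 - d)"
  have e: "e < R2" "a \<le> e" "R2 - d \<le> e" using d a_facts by (auto simp: e_def)
  have "AE r in lborel. r \<notin> {e<..<R2}"
    using ae
  proof (rule eventually_mono)
    fix r assume r: "u r = us r"
    show "r \<notin> {e<..<R2}"
    proof
      assume "r \<in> {e<..<R2}"
      then have "us r = H" "\<bar>r - R2\<bar> < d" using e by (auto simp: u_star_def)
      then show False using d(2)[of r] r H_pos by simp
    qed
  qed
  then have "{e<..<R2} \<in> null_sets lborel" by (simp add: AE_iff_null_sets)
  then show False using e by (simp add: null_sets_def)
qed

text \<open>The step from a + t vanishes on (a, a + t), where \<open>u_star\<close> equals
  \<open>H\<close>, so its deviation is at least H t, while its deficit is at most K t^e. A bound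
  with exponent p would make H at most a constant times t^(e p - 1), which fails as t tends to
  0.\<close>

lemma rate_optimal:
  assumes K: "0 \<le> K" "0 < T" "\<And>t. 0 < t \<Longrightarrow> t < T \<Longrightarrow> \<delta> (stepf (a + t)) \<le> K * t powr e"
    and e: "0 < e" "1 < e * p" and T: "T \<le> R2 - a"
  shows "\<not> (\<exists>C. \<forall>u\<in>A_BV R1 R2. \<delta> u \<le> 1 \<longrightarrow> dev u \<le> C * \<delta> u powr p)"
proof
  assume "\<exists>C. \<forall>u\<in>A_BV R1 R2. \<delta> u \<le> 1 \<longrightarrow> dev u \<le> C * \<delta> u powr p"
  then obtain C where C: "\<And>u. u \<in> A_BV R1 R2 \<Longrightarrow> \<delta> u \<le> 1 \<Longrightarrow> dev u \<le> C * \<delta> u powr p" by blast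
  have p: "0 < p" using e by (metis less_trans zero_less_mult_pos zero_less_one)
  have lim: "((\<lambda>t. \<bar>C\<bar> * K powr p * t powr (e * p - 1)) \<longlongrightarrow> \<bar>C\<bar> * K powr p * 0) (at_right 0)"
    using e by (intro tendsto_mult tendsto_const) real_asymp
  have "((\<lambda>t. K * t powr e) \<longlongrightarrow> K * 0) (at_right 0)"
    using e by (intro tendsto_mult tendsto_const) real_asymp
  then have "eventually (\<lambda>t. K * t powr e < 1) (at_right 0)" by (rule order_tendstoD) simp
  moreover have "eventually (\<lambda>t. t < T) (at_right 0)" using K(2) eventually_at_right_less eventually_at_right_field by blast
  moreover have "eventually (\<lambda>t::real. 0 < t) (at_right 0)" by (simp add: eventually_at_right_less)
  ultimately have "eventually (\<lambda>t. H \<le> \<bar>C\<bar> * K powr p * t powr (e * p - 1)) (at_right 0)"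
  proof eventually_elim
    case (elim t)
    let ?c = "a + t"
    have c: "R1 \<le> ?c" "?c < R2" using elim a_facts T by auto
    note S = step_A_BV[OF c]
    have d: "\<delta> (stepf ?c) \<le> K * t powr e" using K(3) elim by simp
    have d0: "0 \<le> \<delta> (stepf ?c)" by (rule deficit_nonneg(1)[OF S(1)])
    have "H * t = (LINT r|lborel. H * indicator {a<..<?c} r)" using elim by simp
    also have "\<dots> \<le> L1_dist (stepf ?c) us"
      unfolding L1_dist_def
    proof (rule integral_mono)
      show "integrable lborel (\<lambda>r. H * indicator {a<..<?c} r)"
        by (intro integrable_mult_right integrable_real_indicator) (use elim in \<open>auto simp: emeasure_lborel_Ioo\<close>)
      show "integrable lborel (\<lambda>r. \<bar>stepf ?c r - us r\<bar>)" using A_BV_integrable[OF S(1)] A_BV_integrable[OF us_A_BV(1)] by simp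
      show "H * indicator {a<..<?c} r \<le> \<bar>stepf ?c r - us r\<bar>" for r
        using H_pos c by (auto simp: indicator_def step_fun_def u_star_def)
    qed
    also have "\<dots> \<le> dev (stepf ?c)" by (rule deviation_bounds(2)[OF S(1)])
    also have "\<dots> \<le> C * \<delta> (stepf ?c) powr p" by (rule C[OF S(1)]) (use d elim in simp)
    also have "\<dots> \<le> \<bar>C\<bar> * (K * t powr e) powr p"
      using d d0 p by (intro mult_mono powr_mono2) auto
    also have "(K * t powr e) powr p = K powr p * t powr (e * p)" using K(1) elim by (simp add: powr_mult powr_powr)
    also have "t powr (e * p) = t powr (e * p - 1) * t" using elim powr_add[of t "e * p - 1" 1] by simp
    finally have "H * t \<le> (\<bar>C\<bar> * K powr p * t powr (e * p - 1)) * t" by (simp add: mult.assoc)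
    then show ?case using elim by simp
  qed
  then have "H \<le> \<bar>C\<bar> * K powr p * 0" by (intro tendsto_lowerbound[OF lim]) auto
  then show False using H_pos by simp
qed

text \<open>The deficit of a step is the gap divided by A, both taken at the radius where it rises.
  Staying left of the midpoint of (a, R2) bounds that denominator from below by its value at the
  midpoint.\<close>

lemma step_deficit_upper:
  "\<exists>K\<ge>0. \<forall>t. 0 < t \<longrightarrow> t < (R2 - a) / 2 \<longrightarrow> \<delta> (stepf (a + t)) \<le> (slope + K * t) * t / A ((a + R2) / 2)"
proof -
  obtain K where K: "0 \<le> K" "\<And>c. c \<in> {a..R2} \<Longrightarrow> q c - lam * A c \<le> (slope + K * (c - a)) * (c - a)" using gap_upper_ex by blast
  show ?thesis
  proof (intro exI[of _ K] conjI allI impI K(1))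
    fix t assume t: "0 < t" "t < (R2 - a) / 2"
    let ?c = "a + t"
    have c: "R1 \<le> ?c" "?c < R2" using t a_facts by (auto simp: field_simps)
    have m: "R1 \<le> (a + R2) / 2" "(a + R2) / 2 < R2" using a_facts by auto
    have A1: "0 < A ((a + R2) / 2)" by (rule A_pos[OF m])
    have "?c ^ 3 \<le> ((a + R2) / 2) ^ 3" using t a_facts by (intro power_mono) (auto simp: field_simps)
    then have A2: "A ((a + R2) / 2) \<le> A ?c" by (simp add: A_weight_def)
    have "slope * (?c - a) \<ge> 0" by (rule slope_term_nonneg) (use c in auto)
    then have s: "0 \<le> slope * t" by simp
    have "\<delta> (stepf ?c) = (q ?c - lam * A ?c) / A ?c" using A_pos[OF c] step_J[OF c] by (simp add: deficit_def field_simps)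
    also have "\<dots> \<le> (slope + K * t) * t / A ?c" using K(2)[of ?c] c t A_pos[OF c] by (intro divide_right_mono) auto
    also have "\<dots> \<le> (slope + K * t) * t / A ((a + R2) / 2)"
      using A1 A2 s K(1) t by (intro divide_left_mono mult_pos_pos) (auto simp: distrib_right)
    finally show "\<delta> (stepf ?c) \<le> (slope + K * t) * t / A ((a + R2) / 2)" .
  qed
qed

lemma optimal_interior:
  assumes "a = x0 M1 R2" "1 / 2 < p"
  shows "\<not> (\<exists>C. \<forall>u\<in>A_BV R1 R2. \<delta> u \<le> 1 \<longrightarrow> dev u \<le> C * \<delta> u powr p)"
proof -
  obtain K where K: "0 \<le> K" "\<And>t. 0 < t \<Longrightarrow> t < (R2 - a) / 2 \<Longrightarrow> \<delta> (stepf (a + t)) \<le> (slope + K * t) * t / A ((a + R2) / 2)"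
    using step_deficit_upper by blast
  have A1: "0 < A ((a + R2) / 2)" using a_facts by (intro A_pos) auto
  show ?thesis
  proof (rule rate_optimal[of "K / A ((a + R2) / 2)" "(R2 - a) / 2" 2])
    fix t assume t: "0 < t" "t < (R2 - a) / 2"
    then show "\<delta> (stepf (a + t)) \<le> K / A ((a + R2) / 2) * t powr 2"
      using K(2)[OF t] slope_interior[OF assms(1)] by (simp add: power2_eq_square mult.assoc)
  qed (use K A1 assms a_facts in auto)
qed

lemma optimal_boundary:
  assumes "a = R1" "x0 M1 R2 < R1" "1 < p"
  shows "\<not> (\<exists>C. \<forall>u\<in>A_BV R1 R2. \<delta> u \<le> 1 \<longrightarrow> dev u \<le> C * \<delta> u powr p)"
proof -
  obtain K where K: "0 \<le> K" "\<And>t. 0 < t \<Longrightarrow> t < (R2 - a) / 2 \<Longrightarrow> \<delta> (stepf (a + t)) \<le> (slope + K * t) * t / A ((a + R2) / 2)"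
    using step_deficit_upper by blast
  have A1: "0 < A ((a + R2) / 2)" using a_facts by (intro A_pos) auto
  have s: "0 < slope" using slope_boundary assms by simp
  have s1: "0 \<le> slope + K * (R2 - a)" using s K a_facts by simp
  show ?thesis
  proof (rule rate_optimal[of "(slope + K * (R2 - a)) / A ((a + R2) / 2)" "(R2 - a) / 2" 1])
    fix t assume t: "0 < t" "t < (R2 - a) / 2"
    have "(slope + K * t) * t / A ((a + R2) / 2) \<le> (slope + K * (R2 - a)) * t / A ((a + R2) / 2)"
      using t K(1) A1 by (intro divide_right_mono mult_right_mono add_left_mono mult_left_mono) auto
    then show "\<delta> (stepf (a + t)) \<le> (slope + K * (R2 - a)) / A ((a + R2) / 2) * t powr 1"
      using K(2)[OF t] t by simp
  qed (use s1 A1 assms a_facts in auto)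
qed

section \<open>Minimizing sequences and their limits\<close>

definition "minimizing u \<longleftrightarrow> (\<forall>n. u n \<in> A_smooth R1 R2) \<and> (\<lambda>n::nat. I_fun M1 M2 R1 R2 (u n)) \<longlonglongrightarrow> lam"

lemma minimizing_limits:
  assumes "minimizing u"
  shows "\<And>n. u n \<in> A_BV R1 R2" "L1_conv u us" "(\<lambda>n. measure (Du_pos (u n)) UNIV) \<longlonglongrightarrow> H"
    "(\<lambda>n. X (u n)) \<longlonglongrightarrow> 0" "(\<lambda>n. LINT r|Du_neg (u n). \<bar>r - R2\<bar>) \<longlonglongrightarrow> 0"
proof -
  show u: "\<And>n. u n \<in> A_BV R1 R2" using assms A_smooth_subset_A_BV by (auto simp: minimizing_def)
  have "(\<lambda>n. \<delta> (u n)) = (\<lambda>n. I_fun M1 M2 R1 R2 (u n) - lam)"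
    using assms I_eq_J by (auto simp: minimizing_def deficit_def)
  moreover have "(\<lambda>n. I_fun M1 M2 R1 R2 (u n) - lam) \<longlonglongrightarrow> lam - lam" using assms by (intro tendsto_intros) (simp add: minimizing_def)
  ultimately have d: "(\<lambda>n. \<delta> (u n)) \<longlonglongrightarrow> 0" by simp
  have sd: "(\<lambda>n. KX * sqrt (\<delta> (u n))) \<longlonglongrightarrow> 0" using tendsto_mult[OF tendsto_const[of KX] tendsto_real_sqrt[OF d]] by simp
  have ev: "eventually (\<lambda>n. \<delta> (u n) < 1) sequentially" using order_tendstoD(2)[OF d, of 1] by simp
  show X: "(\<lambda>n. X (u n)) \<longlonglongrightarrow> 0"
  proof (rule tendsto_sandwich[OF _ _ tendsto_const sd])
    show "eventually (\<lambda>n. 0 \<le> X (u n)) sequentially" using X_nonneg by simp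
    show "eventually (\<lambda>n. X (u n) \<le> KX * sqrt (\<delta> (u n))) sequentially"
      using ev by eventually_elim (use X_quadratic[OF u] in force)
  qed
  obtain C where C: "0 \<le> C" "\<And>u. u \<in> A_BV R1 R2 \<Longrightarrow> L1_dist u us \<le> C * (X u + \<delta> u)" using L1_stability_ex by blast
  have lim: "(\<lambda>n. C * (X (u n) + \<delta> (u n))) \<longlonglongrightarrow> C * (0 + 0)" by (intro tendsto_intros X d)
  show "L1_conv u us" unfolding L1_conv_def
    by (rule tendsto_sandwich[OF _ _ tendsto_const lim[simplified]]) (auto simp: L1_dist_nonneg C(2)[OF u])
  have lim2: "(\<lambda>n. H * (R2\<^sup>2 * X (u n) + \<delta> (u n) / lam)) \<longlonglongrightarrow> H * (R2\<^sup>2 * 0 + 0 / lam)"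
    using lam_pos by (intro tendsto_intros X d) auto
  have "(\<lambda>n. \<bar>measure (Du_pos (u n)) UNIV - H\<bar>) \<longlonglongrightarrow> 0"
    by (rule tendsto_sandwich[OF _ _ tendsto_const lim2[simplified]]) (auto simp: mass_deviation[OF u])
  then show "(\<lambda>n. measure (Du_pos (u n)) UNIV) \<longlonglongrightarrow> H" by (simp add: tendsto_rabs_zero_iff LIM_zero_iff)
  have lim3: "(\<lambda>n. 3 / (R1\<^sup>2 * lam) * \<delta> (u n)) \<longlonglongrightarrow> 3 / (R1\<^sup>2 * lam) * 0" by (intro tendsto_intros d)
  show "(\<lambda>n. LINT r|Du_neg (u n). \<bar>r - R2\<bar>) \<longlonglongrightarrow> 0"
    by (rule tendsto_sandwich[OF _ _ tendsto_const lim3[simplified]]) (use neg_moment[OF u] in \<open>auto intro!: always_eventually integral_nonneg_AE\<close>)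
qed

lemma minimizing_weak_star:
  assumes m: "minimizing u"
  shows "weak_star (\<lambda>n. pos_deriv_measure (u n)) (dirac H a)" "weak_star (\<lambda>n. neg_deriv_measure (u n)) (dirac H R2)"
    "strict_BV_conv u us"
proof -
  note L = minimizing_limits[OF m]
  note c = A_BV_fin_borel[OF L(1)] A_BV_concentrated[OF L(1)]
  have eq: "Du_pos (u n) = pos_deriv_measure (u n)" "Du_neg (u n) = neg_deriv_measure (u n)" for n
    using m A_smooth_Du[of "u n" R1 R2] by (simp_all add: minimizing_def)
  have mass: "measure (Du_neg (u n)) UNIV = measure (Du_pos (u n)) UNIV" for n
    using A_BV_representation(2)[OF L(1)] R12 by simp
  have "weak_star (\<lambda>n. Du_pos (u n)) (dirac H a)"
    by (rule weak_star_diracI[OF c(1,3)]) (use L(3,4) a_facts H_pos in \<open>auto simp: X_def\<close>)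
  then show "weak_star (\<lambda>n. pos_deriv_measure (u n)) (dirac H a)" by (simp add: eq)
  have "weak_star (\<lambda>n. Du_neg (u n)) (dirac H R2)"
    by (rule weak_star_diracI[OF c(2,4)]) (use L(3,5) R12 H_pos in \<open>auto simp: mass\<close>)
  then show "weak_star (\<lambda>n. neg_deriv_measure (u n)) (dirac H R2)" by (simp add: eq)
  have "(\<lambda>n. measure (Du_pos (u n)) UNIV + measure (Du_pos (u n)) UNIV) \<longlonglongrightarrow> H + H" by (intro tendsto_add L)
  moreover have "total_variation us = H + H" using H_pos by (simp add: total_variation_def us_A_BV measure_dirac)
  ultimately show "strict_BV_conv u us" unfolding strict_BV_conv_def total_variation_def[of "u _"] using L(2) by (simp add: mass)
qed

text \<open>Since F u \<ge> F0, an additive error \<eta> between lapses is at most the fraction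
  \<eta> / F0 of F u. The resulting factor depends on the two profiles only through their L1
  distance and tends to 1 with it.\<close>

lemma w_compare:
  assumes "u \<in> A_BV R1 R2" "v \<in> A_BV R1 R2" "r \<in> {R1..R2}"
  shows "w u r \<le> sqrt (1 + KF * L1_dist u v / F0) * w v r"
proof -
  have p: "0 < F u r" "0 < F v r" "F0 \<le> F u r" "0 \<le> r^3"
    using F_pos[OF assms(1)] F_pos[OF assms(2)] F_lower[OF assms(1)] assms(3) R1_pos by auto
  have e0: "0 \<le> KF * L1_dist u v" using KF_nonneg L1_dist_nonneg by simp
  have "F v r \<le> F u r + KF * L1_dist u v" using F_diff[OF assms(1,2), of r] by (simp add: KF_def)
  also have "\<dots> \<le> F u r + KF * L1_dist u v / F0 * F u r"
  proof -
    have "KF * L1_dist u v / F0 * F0 \<le> KF * L1_dist u v / F0 * F u r" using e0 F0 p by (intro mult_left_mono) auto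
    then show ?thesis using F0 by simp
  qed
  also have "\<dots> = (1 + KF * L1_dist u v / F0) * F u r" by (simp add: distrib_right)
  finally have "sqrt (F v r) \<le> sqrt (1 + KF * L1_dist u v / F0) * sqrt (F u r)" by (simp flip: real_sqrt_mult)
  then have "1 / sqrt (F u r) \<le> sqrt (1 + KF * L1_dist u v / F0) / sqrt (F v r)" using p by (simp add: field_simps)
  then have "r^3 * (1 / sqrt (F u r)) \<le> r^3 * (sqrt (1 + KF * L1_dist u v / F0) / sqrt (F v r))" using p(4) by (rule mult_left_mono)
  then show ?thesis by (simp add: mult.commute)
qed

lemma w_diff:
  assumes "u \<in> A_BV R1 R2" "v \<in> A_BV R1 R2" "r \<in> {R1..R2}"
  shows "\<bar>w u r - w v r\<bar> \<le> (sqrt (1 + KF * L1_dist u v / F0) - 1) * (R2^3 / sqrt F0)"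
proof -
  let ?k = "sqrt (1 + KF * L1_dist u v / F0)"
  have "0 \<le> KF * L1_dist u v / F0" using KF_nonneg L1_dist_nonneg F0 by simp
  then have k: "0 \<le> ?k - 1" by simp
  have s: "L1_dist v u = L1_dist u v" by (simp add: L1_dist_def abs_minus_commute)
  have "(?k - 1) * w v r \<le> (?k - 1) * (R2^3 / sqrt F0)" "(?k - 1) * w u r \<le> (?k - 1) * (R2^3 / sqrt F0)"
    using w_upper[OF assms(1,3)] w_upper[OF assms(2,3)] k by (intro mult_left_mono; simp)+
  then show ?thesis using w_compare[OF assms] w_compare[OF assms(2,1,3)] unfolding s by (simp only: left_diff_distrib; linarith)
qed

text \<open>The weights converge uniformly on [R1, R2] and the masses stay bounded, so the weight of
  u n may be replaced by the fixed one of \<open>u_star\<close>; then the concentration of the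
  positive part at \<open>a\<close> applies to f times that weight.\<close>

lemma NEC_weak_star:
  assumes m: "minimizing u"
  shows "weak_star (\<lambda>n. NEC_measure M1 M2 R1 R2 (u n)) (dirac ((M2 - M1) / 2 * lam) a)"
  unfolding weak_star_def
proof (intro allI impI)
  fix f :: "real \<Rightarrow> real" assume f: "continuous_on UNIV f \<and> compact (supp f)"
  note L = minimizing_limits[OF m]
  note c = A_BV_fin_borel[OF L(1)] A_BV_concentrated[OF L(1)]
  have fc: "continuous_on S f" for S using f continuous_on_subset by blast
  have [measurable]: "f \<in> borel_measurable borel" by (intro borel_measurable_continuous_onI fc)
  define W where "W v r = indicator {R1..R2} r * w v r" for v r
  have Wm: "W v \<in> borel_measurable borel" if "v \<in> A_BV R1 R2" for v unfolding W_def[abs_def] by (rule F_measurable[OF that])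
  have W0: "0 \<le> W v r" if "v \<in> A_BV R1 R2" for v r
    using w_lower[OF that, of r] R1_pos by (auto simp: W_def indicator_def intro: order_trans[of 0 "R1^3"])
  have N: "(LINT r|NEC_measure M1 M2 R1 R2 (u n). f r) = (M2 - M1) / 2 * (LINT r|Du_pos (u n). f r * W (u n) r)" for n
  proof -
    have us: "u n \<in> A_smooth R1 R2" using m by (simp add: minimizing_def)
    have [measurable]: "deriv (u n) \<in> borel_measurable borel"
      using A_smoothD(6)[OF us] by (auto intro: borel_measurable_continuous_onI)
    note [measurable] = Wm[OF L(1)[of n]]
    have "NEC_measure M1 M2 R1 R2 (u n) = density lborel (\<lambda>r. ennreal ((M2 - M1) / 2 * (pos_part (deriv (u n) r) * W (u n) r)))"
      unfolding NEC_measure_def W_def by (intro arg_cong[of _ _ "density lborel"] ext arg_cong[of _ _ ennreal]) simp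
    moreover have "0 \<le> (M2 - M1) / 2 * (pos_part (deriv (u n) r) * W (u n) r)" for r
      using M12 W0[OF L(1)] by (intro mult_nonneg_nonneg) auto
    ultimately have "(LINT r|NEC_measure M1 M2 R1 R2 (u n). f r) = (LINT r|lborel. (M2 - M1) / 2 * (pos_part (deriv (u n) r) * W (u n) r) * f r)"
      by (simp add: integral_density)
    also have "\<dots> = (M2 - M1) / 2 * (LINT r|lborel. pos_part (deriv (u n) r) * (f r * W (u n) r))"
      by (subst integral_mult_right_zero[symmetric]) (intro Bochner_Integration.integral_cong; simp)
    also have "(LINT r|lborel. pos_part (deriv (u n) r) * (f r * W (u n) r)) = (LINT r|Du_pos (u n). f r * W (u n) r)"
      unfolding A_smooth_Du[OF us] pos_deriv_measure_def by (subst integral_density) auto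
    finally show ?thesis .
  qed
  obtain B where B: "0 \<le> B" "\<And>x. \<bar>f x\<bar> \<le> B"
  proof -
    obtain K where "\<And>x. x \<notin> {-K..K} \<Longrightarrow> f x = 0" using test_fun_support[of f] f by metis
    from continuous_compact_support_bounded[OF fc this] that show thesis by blast
  qed
  have int: "integrable (Du_pos (u n)) (W v)" if "v \<in> A_BV R1 R2" for n v
    unfolding W_def[abs_def] by (rule w_integrable[OF that L(1)[of n]]) simp
  have intf: "integrable (Du_pos (u n)) (\<lambda>r. f r * W v r)" if v: "v \<in> A_BV R1 R2" for n v
  proof (rule Bochner_Integration.integrable_bound)
    show "integrable (Du_pos (u n)) (\<lambda>r. B * W v r)" using int[OF v] by simp
    show "(\<lambda>r. f r * W v r) \<in> borel_measurable (Du_pos (u n))"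
      using Wm[OF v] by (intro fin_borel_measurable[OF c(1)]) measurable
    show "AE x in Du_pos (u n). norm (f x * W v x) \<le> norm (B * W v x)"
      using B by (auto simp: abs_mult intro!: mult_right_mono AE_I2)
  qed
  let ?k = "\<lambda>n. (sqrt (1 + KF * L1_dist (u n) us / F0) - 1) * (R2^3 / sqrt F0)"
  have main: "(\<lambda>n. LINT r|Du_pos (u n). f r * W us r) \<longlonglongrightarrow> H * (f a * W us a)"
  proof (rule tendsto_integral_concentrating[OF c(1,3) L(3)])
    show "(\<lambda>n. LINT x|Du_pos (u n). \<bar>x - a\<bar>) \<longlonglongrightarrow> 0" using L(4) by (simp add: X_def)
    show "a \<in> {R1..R2}" using a_facts by auto
    show "(\<lambda>r. f r * W us r) \<in> borel_measurable borel" using Wm[OF us_A_BV(1)] by measurable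
    have "continuous_on {R1..R2} (\<lambda>r. f r * w us r)" by (intro continuous_intros fc w_continuous us_A_BV)
    then show "continuous_on {R1..R2} (\<lambda>r. f r * W us r)" by (rule continuous_on_eq) (simp add: W_def)
  qed
  have diff: "(\<lambda>n. (LINT r|Du_pos (u n). f r * W (u n) r) - (LINT r|Du_pos (u n). f r * W us r)) \<longlonglongrightarrow> 0"
  proof (rule Lim_null_comparison)
    show "eventually (\<lambda>n. norm ((LINT r|Du_pos (u n). f r * W (u n) r) - (LINT r|Du_pos (u n). f r * W us r)) \<le> B * ?k n * measure (Du_pos (u n)) UNIV) sequentially"
    proof (intro always_eventually allI)
      fix n
      have "(LINT r|Du_pos (u n). f r * W (u n) r) - (LINT r|Du_pos (u n). f r * W us r) = (LINT r|Du_pos (u n). f r * W (u n) r - f r * W us r)"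
        by (rule Bochner_Integration.integral_diff[symmetric, OF intf[OF L(1)] intf[OF us_A_BV(1)]])
      then have "\<bar>(LINT r|Du_pos (u n). f r * W (u n) r) - (LINT r|Du_pos (u n). f r * W us r)\<bar> \<le> (LINT r|Du_pos (u n). \<bar>f r * W (u n) r - f r * W us r\<bar>)"
        using integral_abs_bound[of "Du_pos (u n)" "\<lambda>r. f r * W (u n) r - f r * W us r"] by presburger
      also have "\<dots> \<le> (LINT r|Du_pos (u n). B * ?k n)"
      proof (rule concentrated_integral_mono[OF c(1,3)])
        show "integrable (Du_pos (u n)) (\<lambda>r. \<bar>f r * W (u n) r - f r * W us r\<bar>)"
          by (rule integrable_abs[OF Bochner_Integration.integrable_diff[OF intf[OF L(1)] intf[OF us_A_BV(1)]]])
        show "integrable (Du_pos (u n)) (\<lambda>r. B * ?k n)" by (rule pos_integrable(1)[OF L(1)]) simp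
        fix r assume r: "r \<in> {R1..R2}"
        have "\<bar>f r * W (u n) r - f r * W us r\<bar> = \<bar>f r\<bar> * \<bar>w (u n) r - w us r\<bar>"
        proof -
          have "f r * W (u n) r - f r * W us r = f r * (w (u n) r - w us r)" using r by (simp add: W_def right_diff_distrib)
          then show ?thesis by (simp only: abs_mult)
        qed
        also have "\<dots> \<le> B * ?k n" by (intro mult_mono B w_diff[OF L(1) us_A_BV(1) r]) auto
        finally show "\<bar>f r * W (u n) r - f r * W us r\<bar> \<le> B * ?k n" .
      qed
      also have "\<dots> = B * ?k n * measure (Du_pos (u n)) UNIV" using fin_borelD(3)[OF c(1)] by simp
      finally show "norm ((LINT r|Du_pos (u n). f r * W (u n) r) - (LINT r|Du_pos (u n). f r * W us r)) \<le> B * ?k n * measure (Du_pos (u n)) UNIV" by simp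
    qed
    have "(\<lambda>n. B * ?k n * measure (Du_pos (u n)) UNIV) \<longlonglongrightarrow> B * ((sqrt (1 + KF * 0 / F0) - 1) * (R2^3 / sqrt F0)) * H"
      using F0 by (intro tendsto_intros L(3) L(2)[unfolded L1_conv_def]) auto
    then show "(\<lambda>n. B * ?k n * measure (Du_pos (u n)) UNIV) \<longlonglongrightarrow> 0" by simp
  qed
  have lim: "(\<lambda>n. (M2 - M1) / 2 * (LINT r|Du_pos (u n). f r * W (u n) r)) \<longlonglongrightarrow> (M2 - M1) / 2 * (H * (f a * W us a))"
    using tendsto_add[OF diff main] by (intro tendsto_mult tendsto_const) simp
  \<comment> \<open>No mass is enclosed at \<open>a\<close>, so the weight there is exactly q
    a.\<close>
  have "H * W us a = lam"
    using a_facts step_F[OF a_facts(1,2)] q_weight_alt[OF a_facts(4)] by (simp add: W_def us_eq[symmetric] lam_eq)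
  then have e1: "(M2 - M1) / 2 * (H * (f a * W us a)) = (M2 - M1) / 2 * lam * f a" by (simp add: mult_ac)
  have e2: "(LINT r|dirac ((M2 - M1) / 2 * lam) a. f r) = (M2 - M1) / 2 * lam * f a"
    using M12 lam_pos by (intro integral_dirac) auto
  show "(\<lambda>n. LINT r|NEC_measure M1 M2 R1 R2 (u n). f r) \<longlonglongrightarrow> (LINT r|dirac ((M2 - M1) / 2 * lam) a. f r)"
    unfolding N e2 e1[symmetric] by (rule lim)
qed

end


section \<open>Lower semicontinuity\<close>

text \<open>Differentiation under the integral by dominated convergence; the mean value theorem
  bounds the difference quotients by B' \<bar>c\<bar>. The affine dependence on r with a measurable
  shift \<open>T\<close> fits a kernel transported by a map of s, as in the recovery
  sequence.\<close>

lemma DERIV_integral_parameter: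
  fixes f f' T :: "real \<Rightarrow> real"
  assumes M: "fin_borel M" and T: "T \<in> borel_measurable borel"
    and f: "\<And>x. (f has_real_derivative f' x) (at x)" "\<And>x. \<bar>f x\<bar> \<le> B" "\<And>x. \<bar>f' x\<bar> \<le> B'" "f' \<in> borel_measurable borel"
  shows "((\<lambda>r. LINT s|M. f (c * r + T s)) has_real_derivative (LINT s|M. c * f' (c * r + T s))) (at r)"
proof -
  note Mm [measurable_cong] = fin_borelD(2)[OF M]
  interpret finite_measure M using fin_borelD[OF M] by simp
  have fm [measurable]: "f \<in> borel_measurable borel"
    by (intro borel_measurable_continuous_onI continuous_at_imp_continuous_on ballI DERIV_isCont[OF f(1)])
  note [measurable] = T f(4)
  have int: "integrable M (\<lambda>s. f (c * y + T s))" for y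
    by (rule fin_borel_integrable_UNIV[OF M _ f(2)]) measurable
  have lip: "\<bar>f x - f y\<bar> \<le> B' * \<bar>x - y\<bar>" for x y
  proof (cases x y rule: linorder_cases)
    case less
    obtain z where "f y - f x = (y - x) * f' z" using MVT2[OF less, of f f'] f(1) by blast
    then have "\<bar>f x - f y\<bar> = \<bar>x - y\<bar> * \<bar>f' z\<bar>" by (metis abs_minus_commute abs_mult)
    also have "\<dots> \<le> \<bar>x - y\<bar> * B'" by (intro mult_left_mono f) simp
    finally show ?thesis by (simp add: mult.commute)
  next
    case greater
    obtain z where "f x - f y = (x - y) * f' z" using MVT2[OF greater, of f f'] f(1) by blast
    then have "\<bar>f x - f y\<bar> = \<bar>x - y\<bar> * \<bar>f' z\<bar>" by (metis abs_mult)
    also have "\<dots> \<le> \<bar>x - y\<bar> * B'" by (intro mult_left_mono f) simp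
    finally show ?thesis by (simp add: mult.commute)
  qed simp
  have chain: "((\<lambda>r. f (c * r + t)) has_real_derivative c * f' (c * r + t)) (at r)" for t
    by (rule DERIV_cong[OF DERIV_chain2[OF f(1)]]) (auto intro!: derivative_eq_intros)
  show ?thesis
    unfolding has_field_derivative_iff tendsto_at_iff_sequentially
  proof (intro allI impI)
    fix X assume X: "\<forall>i. X i \<in> UNIV - {r}" "X \<longlonglongrightarrow> r"
    have Xr: "X i \<noteq> r" for i using X by auto
    have lim: "(\<lambda>i. LINT s|M. (f (c * X i + T s) - f (c * r + T s)) / (X i - r)) \<longlonglongrightarrow> (LINT s|M. c * f' (c * r + T s))"
    proof (rule integral_dominated_convergence[where w="\<lambda>_. B' * \<bar>c\<bar>"])
      show "AE s in M. (\<lambda>i. (f (c * X i + T s) - f (c * r + T s)) / (X i - r)) \<longlonglongrightarrow> c * f' (c * r + T s)"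
      proof (rule AE_I2)
        fix s
        have "((\<lambda>y. (f (c * y + T s) - f (c * r + T s)) / (y - r)) \<longlongrightarrow> c * f' (c * r + T s)) (at r)"
          using chain[of "T s"] by (simp add: has_field_derivative_iff)
        then show "(\<lambda>i. (f (c * X i + T s) - f (c * r + T s)) / (X i - r)) \<longlonglongrightarrow> c * f' (c * r + T s)"
          using X unfolding tendsto_at_iff_sequentially o_def by blast
      qed
      show "AE s in M. norm ((f (c * X i + T s) - f (c * r + T s)) / (X i - r)) \<le> B' * \<bar>c\<bar>" for i
      proof (rule AE_I2)
        fix s
        have "\<bar>f (c * X i + T s) - f (c * r + T s)\<bar> \<le> B' * \<bar>c * (X i - r)\<bar>"
          using lip[of "c * X i + T s" "c * r + T s"] by (simp add: right_diff_distrib)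
        then show "norm ((f (c * X i + T s) - f (c * r + T s)) / (X i - r)) \<le> B' * \<bar>c\<bar>"
          using Xr[of i] by (simp add: abs_mult pos_divide_le_eq mult.assoc)
      qed
    qed measurable
    have E: "(LINT s|M. (f (c * X i + T s) - f (c * r + T s)) / (X i - r)) = ((LINT s|M. f (c * X i + T s)) - (LINT s|M. f (c * r + T s))) / (X i - r)" for i
      using int by simp
    show "((\<lambda>y. ((LINT s|M. f (c * y + T s)) - (LINT s|M. f (c * r + T s))) / (y - r)) \<circ> X) \<longlonglongrightarrow> (LINT s|M. c * f' (c * r + T s))"
      unfolding o_def E[symmetric] by (rule lim)
  qed
qed

lemma smooth_integral_parameter:
  fixes f T :: "real \<Rightarrow> real"
  assumes M: "fin_borel M" and T: "T \<in> borel_measurable borel" and f: "smooth f" "\<And>k. \<exists>B. \<forall>x. \<bar>(deriv ^^ k) f x\<bar> \<le> B"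
  shows "smooth (\<lambda>r. LINT s|M. f (c * r + T s))"
proof -
  define D where "D k r = (LINT s|M. c ^ k * (deriv ^^ k) f (c * r + T s))" for k r
  have "(D k has_real_derivative D (Suc k) r) (at r)" for k r
  proof -
    obtain B B' where B: "\<And>x. \<bar>(deriv ^^ k) f x\<bar> \<le> B" "\<And>x. \<bar>(deriv ^^ Suc k) f x\<bar> \<le> B'" using f(2) by meson
    have m: "(deriv ^^ Suc k) f \<in> borel_measurable borel"
      by (intro borel_measurable_continuous_onI smooth_continuous smooth_deriv_iter f)
    have "((\<lambda>r. LINT s|M. (deriv ^^ k) f (c * r + T s)) has_real_derivative (LINT s|M. c * (deriv ^^ Suc k) f (c * r + T s))) (at r)"
      by (rule DERIV_integral_parameter[OF M T smooth_deriv_iter_DERIV[OF f(1)] B m])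
    from DERIV_cmult[OF this, of "c ^ k"]
    have "((\<lambda>r. c ^ k * (LINT s|M. (deriv ^^ k) f (c * r + T s))) has_real_derivative c ^ k * (LINT s|M. c * (deriv ^^ Suc k) f (c * r + T s))) (at r)" .
    moreover have "D k = (\<lambda>r. c ^ k * (LINT s|M. (deriv ^^ k) f (c * r + T s)))"
      by (rule ext) (simp only: D_def integral_mult_right_zero)
    moreover have "D (Suc k) r = c ^ k * (LINT s|M. c * (deriv ^^ Suc k) f (c * r + T s))"
      unfolding D_def by (simp del: funpow.simps add: mult_ac)
    ultimately show ?thesis by (simp only:)
  qed
  from smoothI_derivs[of D, OF this] have "smooth (D 0)" .
  moreover have "D 0 = (\<lambda>r. LINT s|M. f (c * r + T s))" by (rule ext) (simp add: D_def)
  ultimately show ?thesis by (simp only:)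
qed

section \<open>The lower bound in the relaxation\<close>

context shell begin

text \<open>The variations of the \<open>v n\<close> are not bounded a priori, so the change of weight from \<open>u\<close> to
  \<open>v n\<close> has to be absorbed by a factor and not by an additive error.\<close>

lemma liminf_ge_C1:
  assumes u: "u \<in> A_BV R1 R2" and us: "\<And>n. v n \<in> A_smooth R1 R2" and conv: "L1_conv v u"
    and \<eta>: "\<And>x. (\<eta> has_real_derivative \<eta>' x) (at x)" "continuous_on UNIV \<eta>'"
    and bounds: "\<And>r. r \<in> {R1..R2} \<Longrightarrow> 0 \<le> \<eta> r" "\<And>r. r \<in> {R1..R2} \<Longrightarrow> \<eta> r \<le> w u r"
  shows "ereal ((LINT r|Du_pos u. \<eta> r) - (LINT r|Du_neg u. \<eta> r)) \<le> liminf (\<lambda>n. ereal (I_fun M1 M2 R1 R2 (v n)))"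
proof -
  have v: "v n \<in> A_BV R1 R2" for n using us A_smooth_subset_A_BV by auto
  define k where "k n = sqrt (1 + KF * L1_dist u (v n) / F0)" for n
  have k1: "1 \<le> k n" for n using KF_nonneg L1_dist_nonneg F0 by (simp add: k_def)
  have c: "continuous_on UNIV \<eta>" by (intro continuous_at_imp_continuous_on ballI DERIV_isCont[OF \<eta>(1)])
  let ?g = "\<lambda>n. (LINT r|Du_pos (v n). \<eta> r) - (LINT r|Du_neg (v n). \<eta> r)"
  have lower: "?g n / k n \<le> I_fun M1 M2 R1 R2 (v n)" for n
  proof -
    note fb = A_BV_fin_borel[OF v[of n]] and cc = A_BV_concentrated[OF v[of n]]
    have "0 \<le> (LINT r|Du_neg (v n). \<eta> r)"
      using concentrated_integral_mono[OF fb(2) cc(2), of "\<lambda>_. 0" \<eta>] pos_integrable(2)[OF v c] bounds(1) by simp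
    then have "?g n \<le> (LINT r|Du_pos (v n). \<eta> r)" by simp
    also have "\<dots> \<le> (LINT r|Du_pos (v n). k n * (indicator {R1..R2} r * w (v n) r))"
    proof (rule concentrated_integral_mono[OF fb(1) cc(1)])
      show "integrable (Du_pos (v n)) \<eta>" by (rule pos_integrable(1)[OF v c])
      show "integrable (Du_pos (v n)) (\<lambda>r. k n * (indicat_real {R1..R2} r * w (v n) r))"
        by (intro integrable_mult_right w_integrable[OF v v[of n]]) simp
      fix r assume r: "r \<in> {R1..R2}"
      show "\<eta> r \<le> k n * (indicator {R1..R2} r * w (v n) r)"
        using bounds(2)[OF r] w_compare[OF u v[of n] r] r by (simp add: k_def)
    qed
    also have "\<dots> = k n * I_fun M1 M2 R1 R2 (v n)" unfolding I_eq_J[OF us] J_alt by (rule integral_mult_right_zero)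
    finally show ?thesis using k1[of n] by (simp add: pos_divide_le_eq mult.commute)
  qed
  \<comment> \<open>After integration by parts the pairing is linear in the profile, with a
    coefficient bounded on [R1, R2], so it passes to the limit under L1 convergence.\<close>
  have g: "?g n = - (LINT r:{R1..R2}|lborel. \<eta>' r * v n r)" for n
    using A_BV_integral_by_parts[OF v less_imp_le[OF R12] \<eta>] by simp
  have gu: "(LINT r|Du_pos u. \<eta> r) - (LINT r|Du_neg u. \<eta> r) = - (LINT r:{R1..R2}|lborel. \<eta>' r * u r)"
    using A_BV_integral_by_parts[OF u less_imp_le[OF R12] \<eta>] by simp
  have c': "continuous_on {R1..R2} \<eta>'" using \<eta>(2) continuous_on_subset by blast
  then have "compact (\<eta>' ` {R1..R2})" by (intro compact_continuous_image) auto
  then obtain B where B: "0 < B" "\<And>x. x \<in> {R1..R2} \<Longrightarrow> \<bar>\<eta>' x\<bar> \<le> B"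
    using compact_imp_bounded[of "\<eta>' ` {R1..R2}"] unfolding bounded_pos by auto
  have diff: "\<bar>?g n - ((LINT r|Du_pos u. \<eta> r) - (LINT r|Du_neg u. \<eta> r))\<bar> \<le> B * L1_dist (v n) u" for n
  proof -
    note i = integrable_mult_continuous[OF A_BV_integrable[OF v] c'] integrable_mult_continuous[OF A_BV_integrable[OF u] c']
    have e: "?g n - ((LINT r|Du_pos u. \<eta> r) - (LINT r|Du_neg u. \<eta> r)) = - (LINT r|lborel. indicator {R1..R2} r *\<^sub>R (\<eta>' r * v n r - \<eta>' r * u r))"
      unfolding g gu using set_integral_diff(2)[OF i(1)[of n] i(2)] by (simp add: set_lebesgue_integral_def)
    have "\<bar>LINT r|lborel. indicator {R1..R2} r *\<^sub>R (\<eta>' r * v n r - \<eta>' r * u r)\<bar> \<le> (LINT r|lborel. \<bar>indicator {R1..R2} r *\<^sub>R (\<eta>' r * v n r - \<eta>' r * u r)\<bar>)"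
      by (rule integral_abs_bound)
    also have "\<dots> \<le> (LINT r|lborel. B * \<bar>v n r - u r\<bar>)"
    proof (rule integral_mono)
      show "integrable lborel (\<lambda>r. \<bar>indicator {R1..R2} r *\<^sub>R (\<eta>' r * v n r - \<eta>' r * u r)\<bar>)"
        using set_integral_diff(1)[OF i(1)[of n] i(2)] unfolding set_integrable_def by (rule integrable_abs)
      show "integrable lborel (\<lambda>r. B * \<bar>v n r - u r\<bar>)" using A_BV_integrable[OF v[of n]] A_BV_integrable[OF u] by simp
      fix r
      show "\<bar>indicator {R1..R2} r *\<^sub>R (\<eta>' r * v n r - \<eta>' r * u r)\<bar> \<le> B * \<bar>v n r - u r\<bar>"
      proof (cases "r \<in> {R1..R2}")
        case True
        have "\<bar>\<eta>' r * v n r - \<eta>' r * u r\<bar> = \<bar>\<eta>' r\<bar> * \<bar>v n r - u r\<bar>" by (simp flip: right_diff_distrib add: abs_mult)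
        also have "\<dots> \<le> B * \<bar>v n r - u r\<bar>" by (intro mult_right_mono B True) simp
        finally show ?thesis using True by simp
      qed (use B in simp)
    qed
    also have "\<dots> = B * L1_dist (v n) u" by (simp add: L1_dist_def)
    finally show ?thesis unfolding e by simp
  qed
  have L: "(\<lambda>n. L1_dist (v n) u) \<longlonglongrightarrow> 0" using conv by (simp add: L1_conv_def)
  have "(\<lambda>n. ?g n - ((LINT r|Du_pos u. \<eta> r) - (LINT r|Du_neg u. \<eta> r))) \<longlonglongrightarrow> 0"
  proof (rule Lim_null_comparison)
    show "eventually (\<lambda>n. norm (?g n - ((LINT r|Du_pos u. \<eta> r) - (LINT r|Du_neg u. \<eta> r))) \<le> B * L1_dist (v n) u) sequentially"
      using diff by simp
    show "(\<lambda>n. B * L1_dist (v n) u) \<longlonglongrightarrow> 0" using tendsto_mult_left[OF L, of B] by simp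
  qed
  then have glim: "?g \<longlonglongrightarrow> (LINT r|Du_pos u. \<eta> r) - (LINT r|Du_neg u. \<eta> r)" by (simp add: LIM_zero_iff)
  have "L1_dist u (v n) = L1_dist (v n) u" for n by (simp add: L1_dist_def abs_minus_commute)
  then have ks: "k = (\<lambda>n. sqrt (1 + KF * L1_dist (v n) u / F0))" by (intro ext) (simp only: k_def)
  have "k \<longlonglongrightarrow> sqrt (1 + KF * 0 / F0)" unfolding ks by (intro tendsto_intros L) (use F0 in simp)
  then have "(\<lambda>n. ?g n / k n) \<longlonglongrightarrow> ((LINT r|Du_pos u. \<eta> r) - (LINT r|Du_neg u. \<eta> r)) / 1" using glim by (intro tendsto_divide) auto
  then have "(\<lambda>n. ereal (?g n / k n)) \<longlonglongrightarrow> ereal ((LINT r|Du_pos u. \<eta> r) - (LINT r|Du_neg u. \<eta> r))" by simp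
  then have "ereal ((LINT r|Du_pos u. \<eta> r) - (LINT r|Du_neg u. \<eta> r)) = liminf (\<lambda>n. ereal (?g n / k n))"
    by (rule lim_imp_Liminf[OF sequentially_bot, symmetric])
  also have "\<dots> \<le> liminf (\<lambda>n. ereal (I_fun M1 M2 R1 R2 (v n)))" by (intro Liminf_mono always_eventually allI) (use lower in simp)
  finally show ?thesis .
qed

text \<open>By inner regularity a compact set K disjoint from Z carries the positive part up to
  \<epsilon>, and it is null for the negative part. Continuous functions of the distance to K,
  enlarged by one harmless point, decrease to its indicator, so a late one does almost as
  well.\<close>

lemma ex_cutoff:
  assumes u: "u \<in> A_BV R1 R2" and "0 < \<epsilon>"
  shows "\<exists>g. continuous_on UNIV g \<and> (\<forall>r. 0 \<le> g r) \<and> (\<forall>r. g r \<le> 1) \<and>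
    J_fun M1 M2 R1 R2 u - (R2^3 / sqrt F0 + 1) * \<epsilon> \<le> (LINT r|Du_pos u. indicator {R1..R2} r * w u r * g r) - (LINT r|Du_neg u. indicator {R1..R2} r * w u r * g r)"
proof -
  note fb = A_BV_fin_borel[OF u] and cc = A_BV_concentrated[OF u]
  define W where "W r = indicator {R1..R2} r * w u r" for r
  define Wm where "Wm = R2^3 / sqrt F0"
  have Wmeas: "W \<in> borel_measurable borel" unfolding W_def[abs_def] by (rule F_measurable[OF u])
  have W: "0 \<le> W r" "W r \<le> Wm" for r
    using w_lower[OF u, of r] w_upper[OF u, of r] R1_pos R12 F0 by (auto simp: W_def Wm_def indicator_def intro: order_trans[of 0 "R1^3"])
  obtain Z where Z: "Z \<in> sets borel" "emeasure (Du_pos u) Z = 0" "emeasure (Du_neg u) (- Z) = 0"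
    using A_BV_has_Du(2)[OF u] unfolding mutually_singular_def by auto
  interpret p: finite_measure "Du_pos u" using fb fin_borelD by auto
  interpret n: finite_measure "Du_neg u" using fb fin_borelD by auto
  note sp = fin_borelD(2,3)[OF fb(1)] and sn = fin_borelD(2,3)[OF fb(2)]
  obtain K where K: "K \<subseteq> - Z" "compact K" "measure (Du_pos u) (- Z) - \<epsilon> < measure (Du_pos u) K"
  proof -
    have mz: "- Z \<in> sets borel" using Z(1) by auto
    have "emeasure (Du_pos u) (- Z) = (SUP K\<in>{K. K \<subseteq> - Z \<and> compact K}. emeasure (Du_pos u) K)"
      by (rule inner_regular[OF sp(1) _ mz]) (simp add: p.emeasure_eq_measure)
    \<comment> \<open>The second alternative covers a negative difference, which
      \<open>ennreal\<close> would truncate to 0.\<close>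
    then have "\<exists>K\<in>{K. K \<subseteq> - Z \<and> compact K}. ennreal (measure (Du_pos u) (- Z) - \<epsilon>) < emeasure (Du_pos u) K \<or> measure (Du_pos u) (- Z) - \<epsilon> < 0"
    proof (cases "measure (Du_pos u) (- Z) - \<epsilon> < 0")
      case True
      then show ?thesis by (intro bexI[of _ "{}"]) auto
    next
      case False
      have "ennreal (measure (Du_pos u) (- Z) - \<epsilon>) < emeasure (Du_pos u) (- Z)"
        using assms(2) False by (simp add: p.emeasure_eq_measure ennreal_lessI)
      then show ?thesis unfolding \<open>emeasure (Du_pos u) (- Z) = _\<close> less_SUP_iff by blast
    qed
    then obtain K where "K \<subseteq> - Z" "compact K" "ennreal (measure (Du_pos u) (- Z) - \<epsilon>) < emeasure (Du_pos u) K \<or> measure (Du_pos u) (- Z) - \<epsilon> < 0" by blast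
    moreover from this(3) have "measure (Du_pos u) (- Z) - \<epsilon> < measure (Du_pos u) K"
    proof (rule contrapos_pp)
      assume "\<not> measure (Du_pos u) (- Z) - \<epsilon> < measure (Du_pos u) K"
      then have l: "measure (Du_pos u) K \<le> measure (Du_pos u) (- Z) - \<epsilon>" by simp
      then have "emeasure (Du_pos u) K \<le> ennreal (measure (Du_pos u) (- Z) - \<epsilon>)"
        unfolding p.emeasure_eq_measure by (rule ennreal_leI)
      moreover have "0 \<le> measure (Du_pos u) (- Z) - \<epsilon>" using l measure_nonneg[of "Du_pos u" K] by linarith
      ultimately show "\<not> (ennreal (measure (Du_pos u) (- Z) - \<epsilon>) < emeasure (Du_pos u) K \<or> measure (Du_pos u) (- Z) - \<epsilon> < 0)" by auto
    qed
    ultimately show thesis using that by blast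
  qed
  \<comment> \<open>The extra point lies outside [R1, R2] and is thus null for the negative part. It
    makes the set nonempty, as the distance to the empty set is 0 by convention.\<close>
  define K' where "K' = insert (R1 - 1) K"
  have K': "compact K'" "closed K'" "K' \<noteq> {}" "K' \<in> sets borel" using K(2) by (auto simp: K'_def compact_imp_closed intro!: borel_closed)
  have nK: "measure (Du_neg u) K' = 0"
  proof -
    have "emeasure (Du_neg u) (- Z \<union> - {R1..R2}) = 0"
      by (rule emeasure_Un_null_set[THEN trans]) (use Z cc sn in \<open>auto simp: null_sets_def\<close>)
    moreover have "K' \<subseteq> - Z \<union> - {R1..R2}" using K(1) by (auto simp: K'_def)
    ultimately have "emeasure (Du_neg u) K' = 0" using emeasure_eq_0[of "- Z \<union> - {R1..R2}" "Du_neg u" K'] Z(1) sn by simp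
    then show ?thesis by (simp add: measure_def)
  qed
  have pK: "measure (Du_pos u) (- K') \<le> \<epsilon>"
  proof -
    have "measure (Du_pos u) Z = 0" using Z by (simp add: measure_def)
    then have "measure (Du_pos u) (- Z) = measure (Du_pos u) UNIV"
      using p.finite_measure_compl[of Z] Z(1) sp by (simp add: Compl_eq_Diff_UNIV)
    moreover have "measure (Du_pos u) (- K') = measure (Du_pos u) UNIV - measure (Du_pos u) K'"
      using p.finite_measure_compl[of K'] K' sp by (simp add: Compl_eq_Diff_UNIV)
    moreover have "measure (Du_pos u) K \<le> measure (Du_pos u) K'"
      using K' sp by (intro p.finite_measure_mono) (auto simp: K'_def)
    ultimately show ?thesis using K(3) by linarith
  qed
  define g where "g j r = max 0 (1 - real j * infdist r K')" for j r
  have gc: "continuous_on UNIV (g j)" for j unfolding g_def[abs_def] by (intro continuous_intros)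
  have gb: "0 \<le> g j r" "g j r \<le> 1" for j r using infdist_nonneg[of r K'] by (auto simp: g_def)
  have gl: "(\<lambda>j. g j r) \<longlonglongrightarrow> indicator K' r" for r
  proof (cases "r \<in> K'")
    case True then show ?thesis by (simp add: g_def)
  next
    case False
    then have i: "0 < infdist r K'" using infdist_pos_not_in_closed[OF K'(2,3) False] by simp
    have "eventually (\<lambda>j. g j r = 0) sequentially"
    proof -
      obtain N where "1 / infdist r K' < real N" using reals_Archimedean2 by blast
      then have "1 \<le> real j * infdist r K'" if "j \<ge> N" for j
      proof -
        have "1 < real N * infdist r K'" using \<open>1 / infdist r K' < real N\<close> i by (simp add: pos_divide_less_eq)
        also have "\<dots> \<le> real j * infdist r K'" using that i by (intro mult_right_mono) auto
        finally show ?thesis by simp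
      qed
      then show ?thesis unfolding eventually_sequentially by (auto simp: g_def intro!: exI[of _ N])
    qed
    then show ?thesis using False by (simp add: tendsto_eventually)
  qed
  have lim: "(\<lambda>j. LINT r|M. W r * g j r) \<longlonglongrightarrow> (LINT r|M. W r * indicator K' r)" if M: "fin_borel M" for M
  proof -
    interpret finite_measure M using fin_borelD[OF M] by simp
    have [measurable_cong]: "sets M = sets borel" using fin_borelD[OF M] by simp
    note [measurable] = Wmeas borel_measurable_continuous_onI[OF gc] K'(4)
    show ?thesis
    proof (rule integral_dominated_convergence[where w="\<lambda>_. Wm"])
      show "AE r in M. (\<lambda>j. W r * g j r) \<longlonglongrightarrow> W r * indicator K' r" by (intro AE_I2 tendsto_intros gl)
      show "AE r in M. norm (W r * g j r) \<le> Wm" for j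
      proof (rule AE_I2)
        fix r
        have "W r * g j r \<le> Wm * 1" using W[of r] gb[of j r] by (intro mult_mono) auto
        then show "norm (W r * g j r) \<le> Wm" using W[of r] gb[of j r] by (simp add: abs_mult)
      qed
    qed measurable
  qed
  have Wi: "integrable M W" "integrable M (\<lambda>r. W r * indicator K' r)" "integrable M (\<lambda>r. Wm * indicator (- K') r)" if M: "fin_borel M" for M
  proof -
    note [measurable] = Wmeas K'(4)
    have "\<bar>W r\<bar> \<le> Wm" "\<bar>W r * indicator K' r\<bar> \<le> Wm" for r
      using W[of r] order_trans[OF W[of r]] by (auto simp: indicator_def)
    then show "integrable M W" "integrable M (\<lambda>r. W r * indicator K' r)"
      using fin_borel_integrable_UNIV[OF M, of W Wm] fin_borel_integrable_UNIV[OF M, of "\<lambda>r. W r * indicator K' r" Wm] by auto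
    show "integrable M (\<lambda>r. Wm * indicator (- K') r)"
      by (rule fin_borel_integrable_UNIV[OF M, of _ "\<bar>Wm\<bar>"]) (auto simp: indicator_def)
  qed
  have l1: "(LINT r|Du_neg u. W r * indicator K' r) = 0"
  proof -
    have "(LINT r|Du_neg u. W r * indicator K' r) \<le> (LINT r|Du_neg u. Wm * indicator K' r)"
    proof (rule integral_mono[OF Wi(2)[OF fb(2)]])
      show "integrable (Du_neg u) (\<lambda>r. Wm * indicator K' r)"
        by (rule fin_borel_integrable_UNIV[OF fb(2), of _ "\<bar>Wm\<bar>"]) (use K'(4) in \<open>auto simp: indicator_def\<close>)
    qed (use W in \<open>auto simp: indicator_def\<close>)
    also have "\<dots> = 0" using nK K'(4) sn by simp
    finally show ?thesis using integral_nonneg_AE[of "\<lambda>r. W r * indicator K' r" "Du_neg u"] W by (simp add: antisym)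
  qed
  have l2: "J_fun M1 M2 R1 R2 u - Wm * \<epsilon> \<le> (LINT r|Du_pos u. W r * indicator K' r)"
  proof -
    have Wm0: "0 \<le> Wm" using W[of R1] by linarith
    have "(LINT r|Du_pos u. W r) \<le> (LINT r|Du_pos u. W r * indicator K' r + Wm * indicator (- K') r)"
    proof (rule integral_mono)
      show "W r \<le> W r * indicator K' r + Wm * indicator (- K') r" for r using W[of r] by (auto simp: indicator_def)
    qed (use Wi[OF fb(1)] in auto)
    also have "(LINT r|Du_pos u. W r * indicator K' r + Wm * indicator (- K') r) = (LINT r|Du_pos u. W r * indicator K' r) + Wm * measure (Du_pos u) (- K')"
      using Wi[OF fb(1)] K'(4) sp by simp
    also have "Wm * measure (Du_pos u) (- K') \<le> Wm * \<epsilon>" using pK W[of R1] by (intro mult_left_mono) (auto intro: order_trans)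
    finally show ?thesis by (simp add: J_alt W_def)
  qed
  have "(\<lambda>j. (LINT r|Du_pos u. W r * g j r) - (LINT r|Du_neg u. W r * g j r)) \<longlonglongrightarrow> (LINT r|Du_pos u. W r * indicator K' r) - 0"
    using tendsto_diff[OF lim[OF fb(1)] lim[OF fb(2)]] l1 by simp
  moreover have "J_fun M1 M2 R1 R2 u - (Wm + 1) * \<epsilon> < (LINT r|Du_pos u. W r * indicator K' r) - 0" using l2 assms(2) by (simp add: distrib_right)
  ultimately have "eventually (\<lambda>j. J_fun M1 M2 R1 R2 u - (Wm + 1) * \<epsilon> < (LINT r|Du_pos u. W r * g j r) - (LINT r|Du_neg u. W r * g j r)) sequentially"
    by (rule order_tendstoD)
  then obtain j where "J_fun M1 M2 R1 R2 u - (Wm + 1) * \<epsilon> < (LINT r|Du_pos u. W r * g j r) - (LINT r|Du_neg u. W r * g j r)"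
    unfolding eventually_sequentially by blast
  then have "J_fun M1 M2 R1 R2 u - (Wm + 1) * \<epsilon> \<le> (LINT r|Du_pos u. W r * g j r) - (LINT r|Du_neg u. W r * g j r)" by (rule less_imp_le)
  then show ?thesis unfolding W_def Wm_def by (intro exI[of _ "g j"] conjI allI gc gb)
qed

text \<open>\<open>liminf_ge_C1\<close> asks for a differentiable function between 0 and the weight.
  Shrinking the cut-off weight by the factor 1 - \<epsilon> and raising it by e1 leaves a margin e1
  on both sides, within which a polynomial approximation fits.\<close>

lemma liminf_ge_approx:
  assumes u: "u \<in> A_BV R1 R2" and us: "\<And>n. v n \<in> A_smooth R1 R2" and conv: "L1_conv v u" and \<epsilon>: "0 < \<epsilon>" "\<epsilon> < 1"
  shows "ereal ((1 - \<epsilon>) * (J_fun M1 M2 R1 R2 u - (R2^3 / sqrt F0 + 1) * \<epsilon>) - \<epsilon> * R1^3 * measure (Du_pos u) UNIV)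
     \<le> liminf (\<lambda>n. ereal (I_fun M1 M2 R1 R2 (v n)))"
proof -
  note fb = A_BV_fin_borel[OF u] and cc = A_BV_concentrated[OF u]
  obtain g where g: "continuous_on UNIV g" "\<And>r. 0 \<le> g r" "\<And>r. g r \<le> 1"
    "J_fun M1 M2 R1 R2 u - (R2^3 / sqrt F0 + 1) * \<epsilon> \<le> (LINT r|Du_pos u. indicator {R1..R2} r * w u r * g r) - (LINT r|Du_neg u. indicator {R1..R2} r * w u r * g r)"
    using ex_cutoff[OF u \<epsilon>(1)] by blast
  define W where "W r = indicator {R1..R2} r * w u r" for r
  \<comment> \<open>Since the weight is at least R1^3, this makes 2 e1 at most \<epsilon> times the
    weight: raising and approximating together stay below it.\<close>
  define e1 where "e1 = \<epsilon> * R1^3 / 2"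
  have e1: "0 < e1" using \<epsilon> R1_pos by (simp add: e1_def)
  define \<eta>0 where "\<eta>0 r = e1 + (1 - \<epsilon>) * (w u r * g r)" for r
  have "continuous_on {R1..R2} \<eta>0" unfolding \<eta>0_def[abs_def]
    by (intro continuous_on_add continuous_on_mult continuous_on_const w_continuous[OF u] continuous_on_subset[OF g(1)]) auto
  from Stone_Weierstrass_real_polynomial_function[OF compact_Icc this e1]
  obtain p where p: "real_polynomial_function p" "\<And>x. x \<in> {R1..R2} \<Longrightarrow> \<bar>\<eta>0 x - p x\<bar> < e1" by blast
  obtain p' where p': "real_polynomial_function p'" "\<And>x. (p has_real_derivative p' x) (at x)"
    using has_real_derivative_polynomial_function[OF p(1)] by blast
  have pc: "continuous_on S p" "continuous_on S p'" for S
    using p p' continuous_on_polymonial_function real_polynomial_function_eq by blast+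
  have wg: "0 \<le> w u r * g r" "w u r * g r \<le> w u r" "R1^3 \<le> w u r" if "r \<in> {R1..R2}" for r
  proof -
    show l: "R1^3 \<le> w u r" by (rule w_lower[OF u that])
    have w0: "0 \<le> w u r" using l R1_pos zero_le_power[of R1 3] by linarith
    show "0 \<le> w u r * g r" by (intro mult_nonneg_nonneg w0 g)
    show "w u r * g r \<le> w u r" using mult_left_mono[OF g(3)[of r] w0] by simp
  qed
  have main: "ereal ((LINT r|Du_pos u. p r) - (LINT r|Du_neg u. p r)) \<le> liminf (\<lambda>n. ereal (I_fun M1 M2 R1 R2 (v n)))"
  proof (rule liminf_ge_C1[OF u us conv p'(2) pc(2)])
    fix r assume r: "r \<in> {R1..R2}"
    have "0 \<le> (1 - \<epsilon>) * (w u r * g r)" by (rule mult_nonneg_nonneg[OF _ wg(1)[OF r]]) (use \<epsilon> in simp)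
    then show "0 \<le> p r" using p(2)[OF r] by (simp only: \<eta>0_def; linarith)
    have "(1 - \<epsilon>) * (w u r * g r) \<le> (1 - \<epsilon>) * w u r" using wg(2)[OF r] \<epsilon> by (intro mult_left_mono) auto
    moreover have "\<epsilon> * R1^3 \<le> \<epsilon> * w u r" using \<epsilon> by (intro mult_left_mono wg(3)[OF r]) simp
    then have "2 * e1 \<le> \<epsilon> * w u r" by (simp add: e1_def)
    ultimately show "p r \<le> w u r" using p(2)[OF r] by (simp only: \<eta>0_def left_diff_distrib mult_1; linarith)
  qed
  have Wc: "W \<in> borel_measurable borel" unfolding W_def[abs_def] by (rule F_measurable[OF u])
  have gm: "g \<in> borel_measurable borel" "p \<in> borel_measurable borel" using g(1) pc by (auto intro: borel_measurable_continuous_onI)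
  have cont: "continuous_on {R1..R2} (\<lambda>r. W r * g r)"
  proof -
    have "continuous_on {R1..R2} (\<lambda>r. w u r * g r)" by (intro continuous_on_mult w_continuous[OF u] continuous_on_subset[OF g(1)]) auto
    then show ?thesis by (rule continuous_on_eq) (simp add: W_def)
  qed
  have int: "integrable M (\<lambda>r. W r * g r)" "integrable M p" "integrable M (\<lambda>_. k)" if M: "fin_borel M" "emeasure M (- {R1..R2}) = 0" for M and k :: real
  proof -
    have "(\<lambda>r. W r * g r) \<in> borel_measurable borel" using Wc gm by measurable
    then show "integrable M (\<lambda>r. W r * g r)" by (rule concentrated_integrable_continuous[OF M _ cont])
    show "integrable M p" by (rule concentrated_integrable_continuous[OF M gm(2) pc(1)])
    show "integrable M (\<lambda>_. k)" by (rule concentrated_integrable_continuous[OF M]) auto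
  qed
  have I1: "(1 - \<epsilon>) * (LINT r|M. W r * g r) \<le> (LINT r|M. p r)" if M: "fin_borel M" "emeasure M (- {R1..R2}) = 0" for M
  proof -
    have "(LINT r|M. (1 - \<epsilon>) * (W r * g r)) \<le> (LINT r|M. p r)"
    proof (rule concentrated_integral_mono[OF M])
      show "(1 - \<epsilon>) * (W r * g r) \<le> p r" if "r \<in> {R1..R2}" for r using p(2)[OF that] that by (simp only: \<eta>0_def W_def indicator_simps mult_1; linarith)
    qed (use int[OF M] in auto)
    then show ?thesis by simp
  qed
  have I2: "(LINT r|M. p r) \<le> (1 - \<epsilon>) * (LINT r|M. W r * g r) + 2 * e1 * measure M UNIV" if M: "fin_borel M" "emeasure M (- {R1..R2}) = 0" for M
  proof -
    have "(LINT r|M. p r) \<le> (LINT r|M. (1 - \<epsilon>) * (W r * g r) + 2 * e1)"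
    proof (rule concentrated_integral_mono[OF M])
      show "p r \<le> (1 - \<epsilon>) * (W r * g r) + 2 * e1" if "r \<in> {R1..R2}" for r using p(2)[OF that] that by (simp only: \<eta>0_def W_def indicator_simps mult_1; linarith)
    qed (use int[OF M] in auto)
    also have "\<dots> = (1 - \<epsilon>) * (LINT r|M. W r * g r) + 2 * e1 * measure M UNIV"
      using int[OF M] fin_borelD(3)[OF M(1)] by (subst Bochner_Integration.integral_add) auto
    finally show ?thesis .
  qed
  have eq: "measure (Du_neg u) UNIV = measure (Du_pos u) UNIV" using A_BV_representation(2)[OF u] R12 by simp
  have "(1 - \<epsilon>) * (J_fun M1 M2 R1 R2 u - (R2^3 / sqrt F0 + 1) * \<epsilon>) \<le> (1 - \<epsilon>) * ((LINT r|Du_pos u. W r * g r) - (LINT r|Du_neg u. W r * g r))"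
    using g(4) \<epsilon> by (intro mult_left_mono) (auto simp: W_def)
  also have "\<dots> \<le> ((LINT r|Du_pos u. p r) - (LINT r|Du_neg u. p r)) + 2 * e1 * measure (Du_pos u) UNIV"
    using I1[OF fb(1) cc(1)] I2[OF fb(2) cc(2)] by (simp only: right_diff_distrib eq; linarith)
  finally have "(1 - \<epsilon>) * (J_fun M1 M2 R1 R2 u - (R2^3 / sqrt F0 + 1) * \<epsilon>) - \<epsilon> * R1^3 * measure (Du_pos u) UNIV \<le> (LINT r|Du_pos u. p r) - (LINT r|Du_neg u. p r)"
    by (simp add: e1_def)
  then show ?thesis using main by (meson ereal_less_eq(3) order_trans)
qed

lemma liminf_ge_J:
  assumes u: "u \<in> A_BV R1 R2" and us: "\<And>n. v n \<in> A_smooth R1 R2" and conv: "L1_conv v u"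
  shows "ereal (J_fun M1 M2 R1 R2 u) \<le> liminf (\<lambda>n. ereal (I_fun M1 M2 R1 R2 (v n)))"
proof -
  let ?f = "\<lambda>\<epsilon>. (1 - \<epsilon>) * (J_fun M1 M2 R1 R2 u - (R2^3 / sqrt F0 + 1) * \<epsilon>) - \<epsilon> * R1^3 * measure (Du_pos u) UNIV"
  have "(?f \<longlongrightarrow> (1 - 0) * (J_fun M1 M2 R1 R2 u - (R2^3 / sqrt F0 + 1) * 0) - 0 * R1^3 * measure (Du_pos u) UNIV) (at_right 0)"
    by (intro tendsto_diff tendsto_mult tendsto_const tendsto_ident_at)
  then have lim: "((\<lambda>\<epsilon>. ereal (?f \<epsilon>)) \<longlongrightarrow> ereal (J_fun M1 M2 R1 R2 u)) (at_right 0)" by simp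
  have "eventually (\<lambda>\<epsilon>::real. 0 < \<epsilon> \<and> \<epsilon> < 1) (at_right 0)"
    unfolding eventually_at_right_field by (intro exI[of _ 1]) auto
  then have "eventually (\<lambda>\<epsilon>. ereal (?f \<epsilon>) \<le> liminf (\<lambda>n. ereal (I_fun M1 M2 R1 R2 (v n)))) (at_right 0)"
    by eventually_elim (use liminf_ge_approx[OF assms] in blast)
  from tendsto_upperbound[OF lim this] show ?thesis by simp
qed

end


section \<open>Recovery sequences\<close>

lemma ex_mollifier:
  "\<exists>\<rho> \<Phi> :: real \<Rightarrow> real. smooth \<rho> \<and> (\<forall>x. 0 \<le> \<rho> x) \<and> (\<forall>x. x \<notin> {0..1} \<longrightarrow> \<rho> x = 0) \<and> (LINT x|lborel. \<rho> x) = 1 \<and>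
     (\<forall>x. (\<Phi> has_real_derivative \<rho> x) (at x)) \<and> (\<forall>x\<le>0. \<Phi> x = 0) \<and> (\<forall>x\<ge>1. \<Phi> x = 1)"
proof -
  have "(0::real) < 1" by simp
  from ex_unit_bump[OF this] obtain \<rho> :: "real \<Rightarrow> real" where \<rho>: "smooth \<rho>" "\<And>x. x \<notin> {0..1} \<Longrightarrow> \<rho> x = 0" "(LINT x|lborel. \<rho> x) = 1" "\<And>x. 0 \<le> \<rho> x" by metis
  from ex_antiderivative[OF smooth_continuous[OF \<rho>(1)] \<rho>(2)] obtain \<Phi> where
    "\<And>x. (\<Phi> has_real_derivative \<rho> x) (at x)" "\<And>x. x \<le> 0 \<Longrightarrow> \<Phi> x = 0" "\<And>x. 1 \<le> x \<Longrightarrow> \<Phi> x = (LINT y|lborel. \<rho> y)"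
    by (metis zero_le_one)
  with \<rho> show ?thesis by (intro exI[of _ \<rho>] exI[of _ \<Phi>]) auto
qed

locale mollified = shell +
  fixes \<rho> \<Phi> u :: "real \<Rightarrow> real"
  assumes \<rho>_smooth: "smooth \<rho>" and \<rho>_nonneg: "\<And>x. 0 \<le> \<rho> x" and \<rho>_support: "\<And>x. x \<notin> {0..1} \<Longrightarrow> \<rho> x = 0"
    and \<rho>_integral: "(LINT x|lborel. \<rho> x) = 1"
    and \<Phi>_DERIV: "\<And>x. (\<Phi> has_real_derivative \<rho> x) (at x)" and \<Phi>_0: "\<And>x. x \<le> 0 \<Longrightarrow> \<Phi> x = 0" and \<Phi>_1: "\<And>x. 1 \<le> x \<Longrightarrow> \<Phi> x = 1"
    and u: "u \<in> A_BV R1 R2"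
begin

lemma \<Phi>_mono: "x \<le> y \<Longrightarrow> \<Phi> x \<le> \<Phi> y"
  using \<Phi>_DERIV \<rho>_nonneg by (metis DERIV_nonneg_imp_nondecreasing)

lemma \<Phi>_bounds: "0 \<le> \<Phi> x" "\<Phi> x \<le> 1" "\<bar>\<Phi> x\<bar> \<le> 1"
proof -
  show "0 \<le> \<Phi> x" using \<Phi>_mono[of "min x 0" x] \<Phi>_0[of "min x 0"] by simp
  moreover show "\<Phi> x \<le> 1" using \<Phi>_mono[of x "max x 1"] \<Phi>_1[of "max x 1"] by simp
  ultimately show "\<bar>\<Phi> x\<bar> \<le> 1" by simp
qed

lemma \<rho>_bounded: "\<exists>B. \<forall>x. \<bar>(deriv ^^ k) \<rho> x\<bar> \<le> B"
proof -
  have "(deriv ^^ k) \<rho> x = 0" if "x \<notin> {0..1}" for x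
    using that
  proof (induction k arbitrary: x)
    case 0 then show ?case using \<rho>_support by simp
  next
    case (Suc k)
    have "supp ((deriv ^^ k) \<rho>) \<subseteq> {0..1}" using Suc.IH by (intro supp_subset) auto
    then have "x \<notin> supp ((deriv ^^ k) \<rho>)" using Suc.prems by blast
    then show ?case by (simp add: deriv_notin_supp)
  qed
  from continuous_compact_support_bounded[OF smooth_continuous[OF smooth_deriv_iter[OF \<rho>_smooth]] this] show ?thesis by metis
qed

lemma \<Phi>_deriv: "deriv \<Phi> = \<rho>" using \<Phi>_DERIV DERIV_imp_deriv by blast

lemma \<Phi>_smooth: "smooth \<Phi>" by (rule smooth_antiderivative[OF \<rho>_smooth \<Phi>_DERIV])

lemma \<Phi>_bounded: "\<exists>B. \<forall>x. \<bar>(deriv ^^ k) \<Phi> x\<bar> \<le> B"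
proof (cases k)
  case 0 then show ?thesis using \<Phi>_bounds(3) by auto
next
  case (Suc j)
  have "(deriv ^^ Suc j) \<Phi> = (deriv ^^ j) \<rho>" by (simp only: funpow_Suc_right o_apply \<Phi>_deriv)
  then show ?thesis using \<rho>_bounded[of j] Suc by simp
qed

lemma \<rho>_borel: "\<rho> \<in> borel_measurable borel" by (intro borel_measurable_continuous_onI smooth_continuous \<rho>_smooth)

lemma \<Phi>_borel: "\<Phi> \<in> borel_measurable borel" by (intro borel_measurable_continuous_onI smooth_continuous \<Phi>_smooth)

text \<open>The mollifier lives on \<open>[0, 1]\<close>, hence moves mass to the right by at most \<open>\<epsilon>\<close>; contracting
  \<open>[R1, R2]\<close> into \<open>[R1 + \<epsilon>, R2 - 2 * \<epsilon>]\<close> beforehand keeps the support inside \<open>(R1, R2)\<close>.\<close>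

definition "contraction \<epsilon> s = R1 + \<epsilon> + (1 - 3 * \<epsilon> / (R2 - R1)) * (s - R1)"

text \<open>Brings the quotient of r minus the contracted point by \<epsilon> into the affine form
  required by \<open>smooth_integral_parameter\<close>.\<close>

definition "offset \<epsilon> s = - contraction \<epsilon> s / \<epsilon>"

text \<open>\<Phi> is a smoothed indicator of a half-line, so this is the distribution function of
  the contracted and mollified Du. Starting from Du instead of u exhibits the derivative directly as
  a difference of averages over the two parts.\<close>

definition "moll \<epsilon> r = (LINT s|Du_pos u. \<Phi> (1 / \<epsilon> * r + offset \<epsilon> s)) - (LINT s|Du_neg u. \<Phi> (1 / \<epsilon> * r + offset \<epsilon> s))"

lemma fb: "fin_borel (Du_pos u)" "fin_borel (Du_neg u)" using A_BV_fin_borel[OF u] by auto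

lemma conc: "emeasure (Du_pos u) (- {R1..R2}) = 0" "emeasure (Du_neg u) (- {R1..R2}) = 0" using A_BV_concentrated[OF u] by auto

lemma offset_borel: "offset \<epsilon> \<in> borel_measurable borel"
  unfolding offset_def[abs_def] contraction_def by measurable

lemma contraction_bounds:
  assumes "0 < \<epsilon>" "3 * \<epsilon> < R2 - R1" "s \<in> {R1..R2}"
  shows "R1 + \<epsilon> \<le> contraction \<epsilon> s" "contraction \<epsilon> s \<le> R2 - 2 * \<epsilon>" "\<bar>contraction \<epsilon> s - s\<bar> \<le> 2 * \<epsilon>"
proof -
  define \<theta> where "\<theta> = (s - R1) / (R2 - R1)"
  have \<theta>: "0 \<le> \<theta>" "\<theta> \<le> 1" "s - R1 = \<theta> * (R2 - R1)" using assms R12 by (auto simp: \<theta>_def)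
  have c: "contraction \<epsilon> s = R1 + \<epsilon> + (s - R1) - 3 * \<epsilon> * \<theta>" using R12 by (simp add: contraction_def \<theta>_def algebra_simps)
  then have c2: "contraction \<epsilon> s = R1 + \<epsilon> + \<theta> * (R2 - R1 - 3 * \<epsilon>)" using \<theta>(3) by (simp add: algebra_simps)
  have "0 \<le> \<theta> * (R2 - R1 - 3 * \<epsilon>)" "\<theta> * (R2 - R1 - 3 * \<epsilon>) \<le> 1 * (R2 - R1 - 3 * \<epsilon>)"
    using \<theta> assms by (auto intro!: mult_nonneg_nonneg mult_right_mono)
  then show "R1 + \<epsilon> \<le> contraction \<epsilon> s" "contraction \<epsilon> s \<le> R2 - 2 * \<epsilon>" using c2 by auto
  have "0 \<le> \<epsilon> * \<theta>" "\<epsilon> * \<theta> \<le> \<epsilon> * 1" using \<theta> assms by (auto intro!: mult_left_mono)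
  then show "\<bar>contraction \<epsilon> s - s\<bar> \<le> 2 * \<epsilon>" using c assms by (simp add: abs_le_iff)
qed

lemma arg_eq: "0 < \<epsilon> \<Longrightarrow> 1 / \<epsilon> * r + offset \<epsilon> s = (r - contraction \<epsilon> s) / \<epsilon>"
  by (simp add: offset_def diff_divide_distrib)

lemma moll_smooth: "smooth (moll \<epsilon>)"
proof -
  have "smooth (\<lambda>r. 1 * (LINT s|Du_pos u. \<Phi> (1 / \<epsilon> * r + offset \<epsilon> s)) + (-1) * (LINT s|Du_neg u. \<Phi> (1 / \<epsilon> * r + offset \<epsilon> s)))"
    by (intro smooth_linear_combination smooth_integral_parameter fb offset_borel \<Phi>_smooth \<Phi>_bounded)
  then show ?thesis unfolding moll_def[abs_def] by simp
qed

lemma moll_DERIV: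
  "(moll \<epsilon> has_real_derivative (LINT s|Du_pos u. 1 / \<epsilon> * \<rho> (1 / \<epsilon> * r + offset \<epsilon> s)) - (LINT s|Du_neg u. 1 / \<epsilon> * \<rho> (1 / \<epsilon> * r + offset \<epsilon> s))) (at r)"
proof -
  obtain B where B: "\<And>x. \<bar>\<rho> x\<bar> \<le> B" using \<rho>_bounded[of 0] by auto
  show ?thesis unfolding moll_def[abs_def]
    by (intro DERIV_diff DERIV_integral_parameter[OF fb(1) offset_borel \<Phi>_DERIV \<Phi>_bounds(3) B \<rho>_borel]
        DERIV_integral_parameter[OF fb(2) offset_borel \<Phi>_DERIV \<Phi>_bounds(3) B \<rho>_borel])
qed

lemma moll_deriv_le:
  assumes "0 < \<epsilon>"
  shows "deriv (moll \<epsilon>) r \<le> (LINT s|Du_pos u. 1 / \<epsilon> * \<rho> (1 / \<epsilon> * r + offset \<epsilon> s))"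
proof -
  have "0 \<le> (LINT s|Du_neg u. 1 / \<epsilon> * \<rho> (1 / \<epsilon> * r + offset \<epsilon> s))"
    using \<rho>_nonneg assms by (intro integral_nonneg_AE AE_I2) simp
  then show ?thesis using DERIV_imp_deriv[OF moll_DERIV] by simp
qed

text \<open>As a difference of integrals against the parts of Du, \<open>moll\<close> hides its sign
  and its support. Integrating by parts in s turns it into an integral of u; for small \<epsilon>
  the kernel is nonnegative, and sign and support can be read off.\<close>

lemma moll_eq:
  assumes "0 < \<epsilon>"
  shows "moll \<epsilon> r = (LINT s:{R1..R2}|lborel. ((1 - 3 * \<epsilon> / (R2 - R1)) / \<epsilon> * \<rho> (1 / \<epsilon> * r + offset \<epsilon> s)) * u s)"
proof -
  let ?k = "(1 - 3 * \<epsilon> / (R2 - R1)) / \<epsilon>"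
  have "(offset \<epsilon> has_real_derivative - ?k) (at s)" for s
    unfolding offset_def[abs_def] contraction_def using assms by (auto intro!: derivative_eq_intros simp: minus_divide_left)
  then have "((\<lambda>s. 1 / \<epsilon> * r + offset \<epsilon> s) has_real_derivative - ?k) (at s)" for s
    by (auto intro!: derivative_eq_intros)
  from DERIV_chain2[OF \<Phi>_DERIV this]
  have d: "((\<lambda>s. \<Phi> (1 / \<epsilon> * r + offset \<epsilon> s)) has_real_derivative \<rho> (1 / \<epsilon> * r + offset \<epsilon> s) * (- ?k)) (at s)" for s .
  have sc: "continuous_on UNIV (offset \<epsilon>)"
    unfolding offset_def[abs_def] contraction_def by (intro continuous_intros) (use assms R12 in auto)
  have c: "continuous_on UNIV (\<lambda>s. \<rho> (1 / \<epsilon> * r + offset \<epsilon> s) * (- ?k))"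
    by (intro continuous_on_mult continuous_on_const continuous_on_compose2[OF smooth_continuous[OF \<rho>_smooth, of UNIV]] continuous_on_add sc) auto
  have "moll \<epsilon> r = - (LINT s:{R1..R2}|lborel. (\<rho> (1 / \<epsilon> * r + offset \<epsilon> s) * (- ?k)) * u s)"
    unfolding A_BV_integral_by_parts[OF u less_imp_le[OF R12] d c] by (simp add: moll_def)
  also have "\<dots> = (LINT s:{R1..R2}|lborel. (?k * \<rho> (1 / \<epsilon> * r + offset \<epsilon> s)) * u s)"
    unfolding set_lebesgue_integral_def
    by (subst Bochner_Integration.integral_minus[symmetric]) (intro Bochner_Integration.integral_cong; simp)
  finally show ?thesis .
qed

lemma moll_nonneg:
  assumes "0 < \<epsilon>" "3 * \<epsilon> < R2 - R1"
  shows "0 \<le> moll \<epsilon> r"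
proof -
  have k: "0 \<le> (1 - 3 * \<epsilon> / (R2 - R1)) / \<epsilon>" using assms by simp
  have "AE s in lborel. 0 \<le> u s" using u by (simp add: A_BV_def)
  then have "AE s in lborel. 0 \<le> indicator {R1..R2} s *\<^sub>R (((1 - 3 * \<epsilon> / (R2 - R1)) / \<epsilon> * \<rho> (1 / \<epsilon> * r + offset \<epsilon> s)) * u s)"
  proof eventually_elim
    case (elim s)
    have "0 \<le> ((1 - 3 * \<epsilon> / (R2 - R1)) / \<epsilon> * \<rho> (1 / \<epsilon> * r + offset \<epsilon> s)) * u s"
      by (rule mult_nonneg_nonneg[OF mult_nonneg_nonneg[OF k \<rho>_nonneg] elim])
    then show ?case by (rule scaleR_nonneg_nonneg[OF indicator_pos_le])
  qed
  then show ?thesis unfolding moll_eq[OF assms(1)] set_lebesgue_integral_def by (rule integral_nonneg_AE)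
qed

lemma moll_support:
  assumes "0 < \<epsilon>" "3 * \<epsilon> < R2 - R1" "r \<notin> {R1 + \<epsilon>..R2 - \<epsilon>}"
  shows "moll \<epsilon> r = 0"
proof -
  have "\<rho> (1 / \<epsilon> * r + offset \<epsilon> s) = 0" if s: "s \<in> {R1..R2}" for s
  proof (rule \<rho>_support)
    have "r - contraction \<epsilon> s < 0 \<or> r - contraction \<epsilon> s > \<epsilon>" using contraction_bounds[OF assms(1,2) s] assms(3) by auto
    then show "1 / \<epsilon> * r + offset \<epsilon> s \<notin> {0..1}" unfolding arg_eq[OF assms(1)] using assms(1) by (auto simp: field_simps)
  qed
  then have "(\<lambda>s. indicator {R1..R2} s *\<^sub>R (((1 - 3 * \<epsilon> / (R2 - R1)) / \<epsilon> * \<rho> (1 / \<epsilon> * r + offset \<epsilon> s)) * u s)) = (\<lambda>s. 0)"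
    by (intro ext) (simp add: indicator_def)
  then show ?thesis unfolding moll_eq[OF assms(1)] set_lebesgue_integral_def by simp
qed

lemma moll_bounded: "\<bar>moll \<epsilon> r\<bar> \<le> 2 * measure (Du_pos u) UNIV"
proof -
  have b: "\<bar>LINT s|M. \<Phi> (1 / \<epsilon> * r + offset \<epsilon> s)\<bar> \<le> measure M UNIV" if M: "fin_borel M" for M
  proof -
    have "(\<lambda>s. \<Phi> (1 / \<epsilon> * r + offset \<epsilon> s)) \<in> borel_measurable borel"
      by (intro measurable_compose[OF _ \<Phi>_borel] borel_measurable_add borel_measurable_const offset_borel)
    then have i: "integrable M (\<lambda>s. \<Phi> (1 / \<epsilon> * r + offset \<epsilon> s))" by (rule fin_borel_integrable_UNIV[OF M _ \<Phi>_bounds(3)])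
    have "\<bar>LINT s|M. \<Phi> (1 / \<epsilon> * r + offset \<epsilon> s)\<bar> \<le> (LINT s|M. \<bar>\<Phi> (1 / \<epsilon> * r + offset \<epsilon> s)\<bar>)" by (rule integral_abs_bound)
    also have "\<dots> \<le> (LINT s|M. 1)"
    proof (rule integral_mono)
      show "integrable M (\<lambda>s. \<bar>\<Phi> (1 / \<epsilon> * r + offset \<epsilon> s)\<bar>)" using i by (rule integrable_abs)
      show "integrable M (\<lambda>s. 1 :: real)" by (rule fin_borel_integrable_UNIV[OF M, of _ 1]) auto
    qed (rule \<Phi>_bounds)
    finally show ?thesis using fin_borelD(3)[OF M] by simp
  qed
  have "measure (Du_neg u) UNIV = measure (Du_pos u) UNIV" using A_BV_representation(2)[OF u] R12 by simp
  then show ?thesis using b[OF fb(1)] b[OF fb(2)] by (simp add: moll_def)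
qed

text \<open>The 4 makes the contraction admissible already for n = 0: three times
  \<open>eps n\<close> stays below R2 - R1.\<close>

definition "eps n = (R2 - R1) / (real n + 4)"

lemma eps: "0 < eps n" "3 * eps n < R2 - R1"
proof -
  have L: "0 < R2 - R1" using R12 by simp
  then show "0 < eps n" by (simp add: eps_def)
  have "3 * l < l * (real n + 4)" if "0 < l" for l :: real
  proof -
    have "0 \<le> l * real n" using that by simp
    then show ?thesis using that unfolding distrib_left by linarith
  qed
  from this[OF L] show "3 * eps n < R2 - R1" by (simp only: eps_def times_divide_eq_right) (simp add: pos_divide_less_eq)
qed

lemma eps_lim: "eps \<longlonglongrightarrow> 0"
  unfolding eps_def[abs_def] by real_asymp

lemma contraction_lim: "(\<lambda>n. contraction (eps n) s) \<longlonglongrightarrow> s"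
proof -
  have "(\<lambda>n. contraction (eps n) s) \<longlonglongrightarrow> R1 + 0 + (1 - 3 * 0 / (R2 - R1)) * (s - R1)"
    unfolding contraction_def by (intro tendsto_intros eps_lim) (use R12 in auto)
  then show ?thesis by simp
qed

text \<open>For s < r the argument of \<Phi> eventually exceeds 1, for s > r it eventually becomes
  negative. Only s = r is undecided, and it is excluded because r is not an atom; this leaves out
  countably many r.\<close>

lemma moll_part_lim:
  assumes M: "fin_borel M" and r: "measure M {r} = 0"
  shows "(\<lambda>n. LINT s|M. \<Phi> (1 / eps n * r + offset (eps n) s)) \<longlonglongrightarrow> measure M {..r}"
proof -
  interpret finite_measure M using fin_borelD[OF M] by simp
  have sM [measurable_cong]: "sets M = sets borel" using fin_borelD[OF M] by simp
  have "{r} \<in> null_sets M" using r by (simp add: null_sets_def sM emeasure_eq_measure)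
  from AE_not_in[OF this] have ne: "AE s in M. s \<noteq> r" by simp
  have m: "(\<lambda>s. \<Phi> (1 / eps n * r + offset (eps n) s)) \<in> borel_measurable M" for n
    by (rule fin_borel_measurable[OF M]) (intro measurable_compose[OF _ \<Phi>_borel] borel_measurable_add borel_measurable_const offset_borel)
  have "(\<lambda>n. LINT s|M. \<Phi> (1 / eps n * r + offset (eps n) s)) \<longlonglongrightarrow> (LINT s|M. indicator {..r} s)"
  proof (rule integral_dominated_convergence[where w="\<lambda>_. 1"])
    show "AE s in M. (\<lambda>n. \<Phi> (1 / eps n * r + offset (eps n) s)) \<longlonglongrightarrow> indicator {..r} s"
      using ne
    proof eventually_elim
      case (elim s)
      have l1: "(\<lambda>n. r - contraction (eps n) s - eps n) \<longlonglongrightarrow> r - s - 0" and l2: "(\<lambda>n. r - contraction (eps n) s) \<longlonglongrightarrow> r - s"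
        by (intro tendsto_intros contraction_lim eps_lim)+
      show ?case
      proof (cases "s < r")
        case True
        then have "eventually (\<lambda>n. 0 < r - contraction (eps n) s - eps n) sequentially" by (intro order_tendstoD(1)[OF l1]) simp
        then have "eventually (\<lambda>n. \<Phi> (1 / eps n * r + offset (eps n) s) = 1) sequentially"
        proof (rule eventually_mono)
          fix n assume l: "0 < r - contraction (eps n) s - eps n"
          show "\<Phi> (1 / eps n * r + offset (eps n) s) = 1"
            unfolding arg_eq[OF eps(1)] by (rule \<Phi>_1) (use l eps(1)[of n] in \<open>simp add: pos_le_divide_eq\<close>)
        qed
        then show ?thesis using True by (simp add: tendsto_eventually)
      next
        case False
        then have "r < s" using elim by simp
        then have "eventually (\<lambda>n. r - contraction (eps n) s < 0) sequentially" by (intro order_tendstoD(2)[OF l2]) simp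
        then have "eventually (\<lambda>n. \<Phi> (1 / eps n * r + offset (eps n) s) = 0) sequentially"
        proof (rule eventually_mono)
          fix n assume l: "r - contraction (eps n) s < 0"
          show "\<Phi> (1 / eps n * r + offset (eps n) s) = 0"
            unfolding arg_eq[OF eps(1)] by (rule \<Phi>_0) (use l eps(1)[of n] in \<open>simp add: pos_divide_le_eq\<close>)
        qed
        then show ?thesis using \<open>r < s\<close> by (simp add: tendsto_eventually)
      qed
    qed
    show "AE s in M. norm (\<Phi> (1 / eps n * r + offset (eps n) s)) \<le> 1" for n using \<Phi>_bounds(3) by simp
  qed (use m in auto)
  then show ?thesis using fin_borelD(3)[OF M] by simp
qed

lemma AE_not_atom:
  assumes M: "fin_borel M" shows "AE r in lborel. measure M {r} = 0"
proof -
  interpret finite_measure M using fin_borelD[OF M] by simp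
  have "{r. measure M {r} \<noteq> 0} \<in> null_sets lborel"
    by (rule countable_imp_null_set_lborel[OF countable_support])
  from AE_not_in[OF this] show ?thesis by simp
qed

lemma moll_integrable: "0 < \<epsilon> \<Longrightarrow> 3 * \<epsilon> < R2 - R1 \<Longrightarrow> integrable lborel (moll \<epsilon>)"
  by (rule integrable_continuous_interval_support[of _ "R1 + \<epsilon>" "R2 - \<epsilon>"]) (auto intro: smooth_continuous moll_smooth moll_support)

lemma moll_L1: "L1_conv (\<lambda>n. moll (eps n)) u"
proof -
  let ?h = "2 * measure (Du_pos u) UNIV"
  have [measurable]: "u \<in> borel_measurable borel" using A_BV_integrable[OF u] by simp
  have [measurable]: "moll e \<in> borel_measurable borel" for e by (intro borel_measurable_continuous_onI smooth_continuous moll_smooth)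
  have "(\<lambda>n. LINT r|lborel. \<bar>moll (eps n) r - u r\<bar>) \<longlonglongrightarrow> (LINT r|(lborel :: real measure). 0)"
  proof (rule integral_dominated_convergence[where w="\<lambda>r. ?h * indicator {R1..R2} r + \<bar>u r\<bar>"])
    show "integrable lborel (\<lambda>r. ?h * indicator {R1..R2} r + \<bar>u r\<bar>)"
      by (intro Bochner_Integration.integrable_add integrable_mult_right integrable_real_indicator integrable_abs A_BV_integrable[OF u]) (auto simp: emeasure_lborel_Icc_eq)
    show "AE r in lborel. (\<lambda>n. \<bar>moll (eps n) r - u r\<bar>) \<longlonglongrightarrow> 0"
      using AE_not_atom[OF fb(1)] AE_not_atom[OF fb(2)] A_BV_representation(1)[OF u less_imp_le[OF R12]]
    proof eventually_elim
      case (elim r)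
      have "(\<lambda>n. moll (eps n) r) \<longlonglongrightarrow> u r"
        unfolding moll_def elim(3) by (intro tendsto_diff moll_part_lim fb elim)
      then show ?case by (simp add: tendsto_rabs_zero_iff LIM_zero_iff)
    qed
    show "AE r in lborel. norm \<bar>moll (eps n) r - u r\<bar> \<le> ?h * indicator {R1..R2} r + \<bar>u r\<bar>" for n
    proof (rule AE_I2)
      fix r
      have "\<bar>moll (eps n) r\<bar> \<le> ?h * indicator {R1..R2} r"
        using moll_bounded[of "eps n" r] moll_support[OF eps, of r n] eps(1)[of n] by (cases "r \<in> {R1..R2}") auto
      then show "norm \<bar>moll (eps n) r - u r\<bar> \<le> ?h * indicator {R1..R2} r + \<bar>u r\<bar>" by simp
    qed
  qed measurable
  then show ?thesis by (simp add: L1_conv_def L1_dist_def)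
qed

lemma \<rho>_scaled_integral:
  assumes "0 < \<epsilon>"
  shows "(LINT r|lborel. 1 / \<epsilon> * \<rho> (1 / \<epsilon> * r + t)) = 1" "integrable lborel (\<lambda>r. 1 / \<epsilon> * \<rho> (1 / \<epsilon> * r + t))"
proof -
  have "(LINT x|lborel. \<rho> x) = \<bar>1 / \<epsilon>\<bar> *\<^sub>R (LINT r|lborel. \<rho> (t + 1 / \<epsilon> * r))"
    by (rule lborel_integral_real_affine) (use assms in simp)
  then show "(LINT r|lborel. 1 / \<epsilon> * \<rho> (1 / \<epsilon> * r + t)) = 1" using \<rho>_integral assms by (simp add: add.commute)
  then show "integrable lborel (\<lambda>r. 1 / \<epsilon> * \<rho> (1 / \<epsilon> * r + t))" by (metis not_integrable_integral_eq zero_neq_one)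
qed

text \<open>The negative part of Du only lowers the derivative, so the positive part of the
  derivative is at most the mollified positive part of Du. By Fubini each point s contributes at
  most an average of the weight over points at distance at most 3 \<epsilon>: the contraction moves
  s by at most 2 \<epsilon> and the kernel by at most \<epsilon> more.\<close>

lemma moll_energy:
  assumes \<epsilon>: "0 < \<epsilon>" "3 * \<epsilon> < R2 - R1" and \<eta>: "0 \<le> \<eta>"
    and close: "\<And>r s. r \<in> {R1..R2} \<Longrightarrow> s \<in> {R1..R2} \<Longrightarrow> \<bar>r - s\<bar> \<le> 3 * \<epsilon> \<Longrightarrow> w u r \<le> w u s + \<eta>"
  shows "(LINT r|lborel. indicator {R1..R2} r * w u r * pos_part (deriv (moll \<epsilon>) r)) \<le> J_fun M1 M2 R1 R2 u + \<eta> * measure (Du_pos u) UNIV"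
proof -
  define W where "W r = indicator {R1..R2} r * w u r" for r
  define Wm where "Wm = R2^3 / sqrt F0"
  have Wmeas [measurable]: "W \<in> borel_measurable borel" unfolding W_def[abs_def] by (rule F_measurable[OF u])
  have W: "0 \<le> W r" "W r \<le> Wm" for r
    using w_lower[OF u, of r] w_upper[OF u, of r] R1_pos R12 F0 by (auto simp: W_def Wm_def indicator_def intro: order_trans[of 0 "R1^3"])
  let ?M = "Du_pos u"
  interpret M: finite_measure ?M using fb fin_borelD by auto
  interpret pair_sigma_finite lborel ?M ..
  have sM [measurable_cong]: "sets ?M = sets borel" using fin_borelD[OF fb(1)] by simp
  have spM: "space ?M = UNIV" using fin_borelD[OF fb(1)] by simp
  note [measurable] = \<rho>_borel offset_borel
  define R where "R r s = 1 / \<epsilon> * \<rho> (1 / \<epsilon> * r + offset \<epsilon> s)" for r s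
  have R0: "0 \<le> R r s" for r s using \<rho>_nonneg \<epsilon> by (simp add: R_def)
  obtain B where B: "\<And>x. \<bar>\<rho> x\<bar> \<le> B" using \<rho>_bounded[of 0] by auto
  have RB: "R r s \<le> 1 / \<epsilon> * B" for r s unfolding R_def using B \<epsilon> by (intro mult_left_mono) (auto intro: order_trans[OF abs_ge_self])
  have Rm [measurable]: "(\<lambda>(r, s). R r s) \<in> borel_measurable (lborel \<Otimes>\<^sub>M ?M)" unfolding R_def by measurable
  define f where "f = (\<lambda>(r, s). W r * R r s)"
  have fm [measurable]: "f \<in> borel_measurable (lborel \<Otimes>\<^sub>M ?M)"
    unfolding f_def split_beta by measurable
  have fint: "integrable (lborel \<Otimes>\<^sub>M ?M) f"
  proof (rule integrableI_bounded_set[where A="{R1..R2} \<times> UNIV" and B="Wm * (1 / \<epsilon> * B)"])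
    show "{R1..R2} \<times> UNIV \<in> sets (lborel \<Otimes>\<^sub>M ?M)" by (intro pair_measureI) (auto simp: sM)
    have "emeasure (lborel \<Otimes>\<^sub>M ?M) ({R1..R2} \<times> UNIV) = emeasure lborel {R1..R2} * emeasure ?M UNIV"
      by (rule M.emeasure_pair_measure_Times) (auto simp: sM)
    also have "\<dots> < \<infinity>" by (simp add: emeasure_lborel_Icc_eq M.emeasure_eq_measure ennreal_mult_less_top)
    finally show "emeasure (lborel \<Otimes>\<^sub>M ?M) ({R1..R2} \<times> UNIV) < \<infinity>" .
    have "norm (f x) \<le> Wm * (1 / \<epsilon> * B)" for x
    proof (cases x)
      case (Pair r s)
      have "W r * R r s \<le> Wm * (1 / \<epsilon> * B)" using W[of r] order_trans[OF W] by (intro mult_mono RB R0) auto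
      moreover have "0 \<le> W r * R r s" by (intro mult_nonneg_nonneg W R0)
      ultimately show ?thesis by (simp add: f_def Pair)
    qed
    then show "AE x in lborel \<Otimes>\<^sub>M ?M. x \<in> {R1..R2} \<times> UNIV \<longrightarrow> norm (f x) \<le> Wm * (1 / \<epsilon> * B)" by simp
    have "f x = 0" if "x \<notin> {R1..R2} \<times> UNIV" for x
    proof (cases x)
      case (Pair r s)
      then have "r \<notin> {R1..R2}" using that by auto
      then show ?thesis by (simp add: f_def W_def Pair)
    qed
    then show "AE x in lborel \<Otimes>\<^sub>M ?M. x \<notin> {R1..R2} \<times> UNIV \<longrightarrow> f x = 0" by simp
  qed measurable
  have dm: "deriv (moll \<epsilon>) \<in> borel_measurable borel"
    by (intro borel_measurable_continuous_onI smooth_continuous smooth_deriv moll_smooth)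
  have Rs: "(\<lambda>s. R r s) \<in> borel_measurable borel" for r unfolding R_def by measurable
  have Ri: "integrable ?M (\<lambda>s. R r s)" for r
    by (rule fin_borel_integrable_UNIV[OF fb(1) Rs, of _ "1 / \<epsilon> * B"]) (use R0 RB in \<open>auto simp: abs_of_nonneg\<close>)
  have p: "pos_part (deriv (moll \<epsilon>) r) \<le> (LINT s|?M. R r s)" for r
    using moll_deriv_le[OF \<epsilon>(1), of r] integral_nonneg_AE[of "\<lambda>s. R r s" ?M] R0 by (simp add: R_def)
  have "(LINT r|lborel. W r * pos_part (deriv (moll \<epsilon>) r)) \<le> (LINT r|lborel. LINT s|?M. f (r, s))"
  proof (rule integral_mono_AE)
    show i2: "integrable lborel (\<lambda>r. LINT s|?M. f (r, s))" by (rule integrable_fst'[OF fint])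
    have le: "W r * pos_part (deriv (moll \<epsilon>) r) \<le> (LINT s|?M. f (r, s))" for r
      using mult_left_mono[OF p[of r] W(1)[of r]] by (simp add: f_def)
    show "integrable lborel (\<lambda>r. W r * pos_part (deriv (moll \<epsilon>) r))"
    proof (rule Bochner_Integration.integrable_bound[OF i2])
      show "(\<lambda>r. W r * pos_part (deriv (moll \<epsilon>) r)) \<in> borel_measurable lborel" using dm by measurable
      show "AE r in lborel. norm (W r * pos_part (deriv (moll \<epsilon>) r)) \<le> norm (LINT s|?M. f (r, s))"
        using le W(1) by (intro AE_I2) (auto simp: abs_mult intro: order_trans[OF _ abs_ge_self])
    qed
    show "AE r in lborel. W r * pos_part (deriv (moll \<epsilon>) r) \<le> (LINT s|?M. f (r, s))" using le by simp
  qed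
  also have "(LINT r|lborel. LINT s|?M. f (r, s)) = (LINT s|?M. LINT r|lborel. f (r, s))"
    using fint by (rule Fubini_integral[symmetric, of "\<lambda>x y. f (x, y)", simplified])
  also have "(LINT s|?M. LINT r|lborel. f (r, s)) \<le> (LINT s|?M. W s + \<eta>)"
  proof (rule concentrated_integral_mono[OF fb(1) conc(1)])
    interpret Q: pair_sigma_finite ?M lborel ..
    show "integrable ?M (\<lambda>s. LINT r|lborel. f (r, s))" using Q.integrable_fst'[OF integrable_product_swap[OF fint]] by simp
    have "integrable ?M W" unfolding W_def[abs_def] by (rule w_integrable[OF u u]) simp
    then show "integrable ?M (\<lambda>s. W s + \<eta>)" by simp
    fix s assume s: "s \<in> {R1..R2}"
    have "(LINT r|lborel. f (r, s)) \<le> (LINT r|lborel. (W s + \<eta>) * R r s)"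
    proof (rule integral_mono')
      show "integrable lborel (\<lambda>r. (W s + \<eta>) * R r s)" unfolding R_def by (intro integrable_mult_right \<rho>_scaled_integral \<epsilon>)
      fix r
      show "f (r, s) \<le> (W s + \<eta>) * R r s"
      proof (cases "\<rho> (1 / \<epsilon> * r + offset \<epsilon> s) = 0")
        case True then show ?thesis by (simp add: f_def R_def)
      next
        case False
        then have "1 / \<epsilon> * r + offset \<epsilon> s \<in> {0..1}" using \<rho>_support by blast
        then have r: "contraction \<epsilon> s \<le> r" "r \<le> contraction \<epsilon> s + \<epsilon>" unfolding arg_eq[OF \<epsilon>(1)] using \<epsilon> by (auto simp: field_simps)
        then have "r \<in> {R1..R2}" "\<bar>r - s\<bar> \<le> 3 * \<epsilon>" using contraction_bounds[OF \<epsilon> s] \<epsilon> by auto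
        then have "W r \<le> W s + \<eta>" using close[of r s] s by (simp add: W_def)
        then show ?thesis unfolding f_def prod.case by (rule mult_right_mono[OF _ R0])
      qed
        show "0 \<le> (W s + \<eta>) * R r s" by (intro mult_nonneg_nonneg add_nonneg_nonneg W(1) \<eta> R0)
    qed
    also have "\<dots> = (W s + \<eta>) * 1" unfolding R_def by (subst integral_mult_right_zero) (simp only: \<rho>_scaled_integral(1)[OF \<epsilon>(1)])
    finally show "(LINT r|lborel. f (r, s)) \<le> W s + \<eta>" by simp
  qed
  also have "(LINT s|?M. W s + \<eta>) = J_fun M1 M2 R1 R2 u + \<eta> * measure ?M UNIV"
  proof -
    have "integrable ?M W" unfolding W_def[abs_def] by (rule w_integrable[OF u u]) simp
    then have "(LINT s|?M. W s + \<eta>) = (LINT s|?M. W s) + \<eta> * measure ?M UNIV"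
      by (subst Bochner_Integration.integral_add) (auto simp: spM)
    then show ?thesis by (simp add: J_alt W_def)
  qed
  finally show ?thesis unfolding W_def .
qed

definition "mass2 n = (LINT r:{R1..R2}|lborel. r\<^sup>2 * moll (eps n) r)"

lemma mass2_lim: "mass2 \<longlonglongrightarrow> 1"
proof -
  have "\<bar>mass2 n - 1\<bar> \<le> R2\<^sup>2 * L1_dist (moll (eps n)) u" for n
  proof -
    have c: "continuous_on {R1..R2} (\<lambda>r::real. r\<^sup>2)" by (intro continuous_intros)
    note i = integrable_mult_continuous[OF moll_integrable[OF eps[of n]] c] integrable_mult_continuous[OF A_BV_integrable[OF u] c]
    have "1 = (LINT r:{R1..R2}|lborel. r\<^sup>2 * u r)" using u by (simp add: A_BV_def)
    then have "mass2 n - 1 = (LINT r:{R1..R2}|lborel. r\<^sup>2 * moll (eps n) r - r\<^sup>2 * u r)"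
      using set_integral_diff(2)[OF i] by (simp add: mass2_def)
    then have "\<bar>mass2 n - 1\<bar> \<le> (LINT r|lborel. \<bar>indicator {R1..R2} r *\<^sub>R (r\<^sup>2 * moll (eps n) r - r\<^sup>2 * u r)\<bar>)"
      unfolding set_lebesgue_integral_def
      using integral_abs_bound[of lborel "\<lambda>r. indicator {R1..R2} r *\<^sub>R (r\<^sup>2 * moll (eps n) r - r\<^sup>2 * u r)"] by presburger
    also have "\<dots> \<le> (LINT r|lborel. R2\<^sup>2 * \<bar>moll (eps n) r - u r\<bar>)"
    proof (rule integral_mono)
      show "integrable lborel (\<lambda>r. \<bar>indicator {R1..R2} r *\<^sub>R (r\<^sup>2 * moll (eps n) r - r\<^sup>2 * u r)\<bar>)"
        using set_integral_diff(1)[OF i] unfolding set_integrable_def by (rule integrable_abs)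
      show "integrable lborel (\<lambda>r. R2\<^sup>2 * \<bar>moll (eps n) r - u r\<bar>)" using moll_integrable[OF eps[of n]] A_BV_integrable[OF u] by simp
      fix r
      show "\<bar>indicator {R1..R2} r *\<^sub>R (r\<^sup>2 * moll (eps n) r - r\<^sup>2 * u r)\<bar> \<le> R2\<^sup>2 * \<bar>moll (eps n) r - u r\<bar>"
      proof (cases "r \<in> {R1..R2}")
        case True
        then have "r\<^sup>2 \<le> R2\<^sup>2" using R1_pos by (intro power_mono) auto
        then have "r\<^sup>2 * \<bar>moll (eps n) r - u r\<bar> \<le> R2\<^sup>2 * \<bar>moll (eps n) r - u r\<bar>" by (intro mult_right_mono) auto
        moreover have "\<bar>r\<^sup>2 * moll (eps n) r - r\<^sup>2 * u r\<bar> = r\<^sup>2 * \<bar>moll (eps n) r - u r\<bar>"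
          by (simp flip: right_diff_distrib add: abs_mult)
        ultimately show ?thesis using True by simp
      qed simp
    qed
    also have "\<dots> = R2\<^sup>2 * L1_dist (moll (eps n)) u" by (simp add: L1_dist_def)
    finally show ?thesis .
  qed
  then have "eventually (\<lambda>n. norm (mass2 n - 1) \<le> R2\<^sup>2 * L1_dist (moll (eps n)) u) sequentially" by simp
  moreover have "(\<lambda>n. R2\<^sup>2 * L1_dist (moll (eps n)) u) \<longlonglongrightarrow> 0"
    using tendsto_mult_left[OF moll_L1[unfolded L1_conv_def], of "R2\<^sup>2"] by simp
  ultimately have "(\<lambda>n. mass2 n - 1) \<longlonglongrightarrow> 0" by (rule Lim_null_comparison)
  then show ?thesis by (simp add: LIM_zero_iff)
qed

lemma normalized_A_smooth:
  assumes "0 < mass2 n"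
  shows "(\<lambda>r. 1 / mass2 n * moll (eps n) r) \<in> A_smooth R1 R2"
  unfolding A_smooth_def mem_Collect_eq
proof (intro conjI allI)
  show "smooth (\<lambda>r. 1 / mass2 n * moll (eps n) r)"
    using smooth_linear_combination[OF moll_smooth moll_smooth, of "1 / mass2 n" "eps n" 0 "eps n"] by simp
  show "0 \<le> 1 / mass2 n * moll (eps n) r" for r using assms moll_nonneg[OF eps] by simp
  have "supp (\<lambda>r. 1 / mass2 n * moll (eps n) r) \<subseteq> {R1 + eps n..R2 - eps n}"
    by (intro supp_subset) (auto simp: moll_support[OF eps])
  also have "\<dots> \<subseteq> {R1<..<R2}" using eps(1)[of n] by auto
  finally show "supp (\<lambda>r. 1 / mass2 n * moll (eps n) r) \<subseteq> {R1<..<R2}" .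
  have "(LINT r:{R1..R2}|lborel. r\<^sup>2 * (1 / mass2 n * moll (eps n) r)) = 1 / mass2 n * (LINT r:{R1..R2}|lborel. r\<^sup>2 * moll (eps n) r)"
    unfolding set_integral_mult_right[symmetric] by (simp add: mult_ac)
  then show "(LINT r:{R1..R2}|lborel. r\<^sup>2 * (1 / mass2 n * moll (eps n) r)) = 1" using assms by (simp flip: mass2_def)
qed

lemma moll_L1_norm: "(LINT r|lborel. \<bar>moll (eps n) r\<bar>) \<le> mass2 n / R1\<^sup>2"
proof -
  have c: "continuous_on {R1..R2} (\<lambda>r::real. r\<^sup>2)" by (intro continuous_intros)
  note i = integrable_mult_continuous[OF moll_integrable[OF eps[of n]] c]
  have "(LINT r|lborel. \<bar>moll (eps n) r\<bar>) \<le> (LINT r|lborel. 1 / R1\<^sup>2 * (indicator {R1..R2} r *\<^sub>R (r\<^sup>2 * moll (eps n) r)))"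
  proof (rule integral_mono)
    show "integrable lborel (\<lambda>r. \<bar>moll (eps n) r\<bar>)" using moll_integrable[OF eps] by simp
    show "integrable lborel (\<lambda>r. 1 / R1\<^sup>2 * (indicator {R1..R2} r *\<^sub>R (r\<^sup>2 * moll (eps n) r)))"
      using i unfolding set_integrable_def by (rule integrable_mult_right)
    fix r
    show "\<bar>moll (eps n) r\<bar> \<le> 1 / R1\<^sup>2 * (indicator {R1..R2} r *\<^sub>R (r\<^sup>2 * moll (eps n) r))"
    proof (cases "r \<in> {R1..R2}")
      case True
      then have "R1\<^sup>2 \<le> r\<^sup>2" using R1_pos by (intro power_mono) auto
      then have "R1\<^sup>2 * moll (eps n) r \<le> r\<^sup>2 * moll (eps n) r" by (intro mult_right_mono moll_nonneg[OF eps])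
      then show ?thesis using True R1_pos moll_nonneg[OF eps, of n r] by (simp add: pos_le_divide_eq mult.commute)
    next
      case False
      then show ?thesis using moll_support[OF eps, of r n] eps(1)[of n] by auto
    qed
  qed
  also have "\<dots> = mass2 n / R1\<^sup>2" by (subst integral_mult_right_zero) (simp add: mass2_def set_lebesgue_integral_def)
  finally show ?thesis .
qed

text \<open>Mollification preserves the constraint only approximately, so the functions are divided
  by \<open>mass2 n\<close>. The energy then picks up two factors that tend to 1: this
  normalisation, and the comparison of the weight of \<open>V n\<close> with that of u. Indices are
  shifted by \<open>N\<close> so that the normalisation is positive throughout.\<close>

lemma ex_recovery:
  "\<exists>v. (\<forall>n. v n \<in> A_smooth R1 R2) \<and> L1_conv v u \<and>
     (\<forall>e>0. eventually (\<lambda>n. I_fun M1 M2 R1 R2 (v n) \<le> J_fun M1 M2 R1 R2 u + e) sequentially)"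
proof -
  define V where "V n = (\<lambda>r. 1 / mass2 n * moll (eps n) r)" for n
  have "eventually (\<lambda>n. 1 / 2 < mass2 n) sequentially" by (rule order_tendstoD(1)[OF mass2_lim]) simp
  then obtain N where N: "\<And>n. n \<ge> N \<Longrightarrow> 1 / 2 < mass2 n" unfolding eventually_sequentially by blast
  have pos: "0 < mass2 n" if "n \<ge> N" for n using N[OF that] by linarith
  have VA: "V n \<in> A_smooth R1 R2" if "n \<ge> N" for n unfolding V_def by (rule normalized_A_smooth[OF pos[OF that]])
  have VB: "V n \<in> A_BV R1 R2" if "n \<ge> N" for n using VA[OF that] A_smooth_subset_A_BV by blast
  have V1: "L1_dist (V n) u \<le> \<bar>1 - mass2 n\<bar> / R1\<^sup>2 + L1_dist (moll (eps n)) u" if n: "n \<ge> N" for n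
  proof -
    have im: "integrable lborel (moll (eps n))" by (rule moll_integrable[OF eps])
    have iV: "integrable lborel (V n)" using im by (simp add: V_def)
    have "L1_dist (V n) (moll (eps n)) = (LINT r|lborel. \<bar>1 / mass2 n - 1\<bar> * \<bar>moll (eps n) r\<bar>)"
      unfolding L1_dist_def
    proof (rule Bochner_Integration.integral_cong)
      fix r have "V n r - moll (eps n) r = (1 / mass2 n - 1) * moll (eps n) r" by (simp only: V_def left_diff_distrib; simp)
      then show "\<bar>V n r - moll (eps n) r\<bar> = \<bar>1 / mass2 n - 1\<bar> * \<bar>moll (eps n) r\<bar>" by (simp only: abs_mult)
    qed simp
    also have "\<dots> \<le> \<bar>1 / mass2 n - 1\<bar> * (mass2 n / R1\<^sup>2)"
      by (subst integral_mult_right_zero) (intro mult_left_mono moll_L1_norm; simp)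
    also have "\<dots> = \<bar>1 - mass2 n\<bar> / R1\<^sup>2"
    proof -
      have "1 / mass2 n - 1 = (1 - mass2 n) / mass2 n" using pos[OF n] by (simp add: diff_divide_distrib)
      then show ?thesis using pos[OF n] by simp
    qed
    finally show ?thesis using L1_dist_triangle[OF iV im A_BV_integrable[OF u]] by linarith
  qed
  have VL: "(\<lambda>n. L1_dist (V n) u) \<longlonglongrightarrow> 0"
  proof (rule tendsto_sandwich[OF _ _ tendsto_const])
    show "eventually (\<lambda>n. 0 \<le> L1_dist (V n) u) sequentially" by (simp add: L1_dist_nonneg)
    show "eventually (\<lambda>n. L1_dist (V n) u \<le> \<bar>1 - mass2 n\<bar> / R1\<^sup>2 + L1_dist (moll (eps n)) u) sequentially"
      using V1 unfolding eventually_sequentially by blast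
    have "(\<lambda>n. \<bar>1 - mass2 n\<bar> / R1\<^sup>2 + L1_dist (moll (eps n)) u) \<longlonglongrightarrow> \<bar>1 - 1\<bar> / R1\<^sup>2 + 0"
      by (intro tendsto_intros mass2_lim moll_L1[unfolded L1_conv_def]) (use R1_pos in simp)
    then show "(\<lambda>n. \<bar>1 - mass2 n\<bar> / R1\<^sup>2 + L1_dist (moll (eps n)) u) \<longlonglongrightarrow> 0" by simp
  qed
  have en: "eventually (\<lambda>n. I_fun M1 M2 R1 R2 (V n) \<le> J_fun M1 M2 R1 R2 u + e) sequentially" if e: "0 < e" for e
  proof -
    let ?h = "measure (Du_pos u) UNIV"
    define k where "k = ?h + 1"
    have k: "0 < k" "?h < k" by (simp_all add: k_def add_nonneg_pos)
    define \<eta> where "\<eta> = e / (2 * k)"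
    have \<eta>: "0 < \<eta>" using e k by (simp add: \<eta>_def)
    have \<eta>h: "\<eta> * ?h < e"
    proof -
      have "\<eta> * ?h \<le> \<eta> * k" using \<eta> k by (intro mult_left_mono) auto
      also have "\<dots> = e / 2" using k by (simp add: \<eta>_def)
      finally show ?thesis using e by simp
    qed
    have "uniformly_continuous_on {R1..R2} (w u)" by (intro compact_uniformly_continuous w_continuous u) simp
    then obtain d where d: "0 < d" "\<And>r s. r \<in> {R1..R2} \<Longrightarrow> s \<in> {R1..R2} \<Longrightarrow> \<bar>r - s\<bar> < d \<Longrightarrow> \<bar>w u r - w u s\<bar> < \<eta>"
      unfolding uniformly_continuous_on_def dist_real_def using \<eta> by (metis abs_minus_commute)
    let ?J = "J_fun M1 M2 R1 R2 u"
    let ?k = "\<lambda>n. sqrt (1 + KF * L1_dist (V n) u / F0)"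
    have "(\<lambda>n. ?k n / mass2 n * (?J + \<eta> * ?h)) \<longlonglongrightarrow> sqrt (1 + KF * 0 / F0) / 1 * (?J + \<eta> * ?h)"
      by (intro tendsto_intros VL mass2_lim) (use F0 in auto)
    then have "eventually (\<lambda>n. ?k n / mass2 n * (?J + \<eta> * ?h) < ?J + e) sequentially"
      by (rule order_tendstoD(2)) (use \<eta>h in simp)
    moreover have "eventually (\<lambda>n. 3 * eps n < d) sequentially"
      using order_tendstoD(2)[OF tendsto_mult_left[OF eps_lim, of 3], of d] d(1) by simp
    moreover have "eventually (\<lambda>n. n \<ge> N) sequentially" by (rule eventually_ge_at_top)
    ultimately show ?thesis
    proof eventually_elim
      case (elim n)
      let ?c = "1 / mass2 n"
      have c: "0 < ?c" using pos[OF elim(3)] by simp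
      have dV: "deriv (V n) r = ?c * deriv (moll (eps n)) r" for r
        unfolding V_def by (intro DERIV_imp_deriv DERIV_cmult smooth_DERIV moll_smooth)
      have close: "w u r \<le> w u s + \<eta>" if "r \<in> {R1..R2}" "s \<in> {R1..R2}" "\<bar>r - s\<bar> \<le> 3 * eps n" for r s
        using d(2)[OF that(1,2)] that(3) elim(2) by (smt (verit))
      have k0: "0 \<le> ?k n" using KF_nonneg L1_dist_nonneg F0 by simp
      have I: "I_fun M1 M2 R1 R2 (V n) = (LINT r|lborel. indicator {R1..R2} r * w (V n) r * pos_part (deriv (V n) r))"
        unfolding I_fun_def set_lebesgue_integral_def by (intro Bochner_Integration.integral_cong) auto
      have int: "integrable lborel (\<lambda>r. indicator {R1..R2} r * w v r * pos_part (deriv (V n) r))" if v: "v \<in> A_BV R1 R2" for v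
      proof -
        have "set_integrable lborel {R1..R2} (\<lambda>r. w v r * pos_part (deriv (V n) r))"
          by (rule integrable_mult_continuous[OF _ w_continuous[OF v]]) (use A_smoothD(9)[OF VA[OF elim(3)]] in simp)
        then show ?thesis unfolding set_integrable_def by (simp only: real_scaleR_def mult.assoc)
      qed
      have "I_fun M1 M2 R1 R2 (V n) \<le> (LINT r|lborel. ?k n * (indicator {R1..R2} r * w u r * pos_part (deriv (V n) r)))"
        unfolding I
      proof (rule integral_mono)
        show "integrable lborel (\<lambda>r. indicator {R1..R2} r * w (V n) r * pos_part (deriv (V n) r))" by (rule int[OF VB[OF elim(3)]])
        show "integrable lborel (\<lambda>r. ?k n * (indicator {R1..R2} r * w u r * pos_part (deriv (V n) r)))" by (intro integrable_mult_right int u)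
        fix r
        show "indicator {R1..R2} r * w (V n) r * pos_part (deriv (V n) r) \<le> ?k n * (indicator {R1..R2} r * w u r * pos_part (deriv (V n) r))"
        proof (cases "r \<in> {R1..R2}")
          case True
          have "w (V n) r * pos_part (deriv (V n) r) \<le> (?k n * w u r) * pos_part (deriv (V n) r)"
            by (intro mult_right_mono w_compare[OF VB[OF elim(3)] u True]) simp
          then show ?thesis using True by (simp only: indicator_simps mult_1 mult.assoc)
        qed simp
      qed
      also have "\<dots> = ?k n * (?c * (LINT r|lborel. indicator {R1..R2} r * w u r * pos_part (deriv (moll (eps n)) r)))"
      proof -
        have pp: "pos_part (?c * x) = ?c * pos_part x" for x using c by (simp add: max_mult_distrib_left)
        have "(LINT r|lborel. indicator {R1..R2} r * w u r * pos_part (deriv (V n) r)) = (LINT r|lborel. ?c * (indicator {R1..R2} r * w u r * pos_part (deriv (moll (eps n)) r)))"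
          unfolding dV pp by (intro Bochner_Integration.integral_cong) (auto simp: mult_ac)
        then show ?thesis by (simp only: integral_mult_right_zero)
      qed
      also have "\<dots> \<le> ?k n * (?c * (?J + \<eta> * ?h))"
        using c k0 by (intro mult_left_mono moll_energy[OF eps less_imp_le[OF \<eta>] close]) auto
      also have "\<dots> = ?k n / mass2 n * (?J + \<eta> * ?h)" by simp
      finally show "I_fun M1 M2 R1 R2 (V n) \<le> ?J + e" using elim(1) by linarith
    qed
  qed
  show ?thesis
  proof (intro exI[of _ "\<lambda>n. V (n + N)"] conjI allI impI)
    show "V (n + N) \<in> A_smooth R1 R2" for n by (rule VA) simp
    show "L1_conv (\<lambda>n. V (n + N)) u" unfolding L1_conv_def using LIMSEQ_ignore_initial_segment[OF VL, of N] by simp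
    show "eventually (\<lambda>n. I_fun M1 M2 R1 R2 (V (n + N)) \<le> J_fun M1 M2 R1 R2 u + e) sequentially" if "0 < e" for e
      using sequentially_offset[OF en[OF that], of N] by simp
  qed
qed

end

section \<open>The relaxation and the infimum over smooth profiles\<close>

context shell begin

lemma recovery:
  assumes u: "u \<in> A_BV R1 R2"
  shows "\<exists>v. (\<forall>n. v n \<in> A_smooth R1 R2) \<and> L1_conv v u \<and>
     (\<forall>e>0. eventually (\<lambda>n. I_fun M1 M2 R1 R2 (v n) \<le> J_fun M1 M2 R1 R2 u + e) sequentially)"
proof -
  obtain \<rho> \<Phi> :: "real \<Rightarrow> real" where "smooth \<rho>" "\<forall>x. 0 \<le> \<rho> x" "\<forall>x. x \<notin> {0..1} \<longrightarrow> \<rho> x = 0" "(LINT x|lborel. \<rho> x) = 1"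
     "\<forall>x. (\<Phi> has_real_derivative \<rho> x) (at x)" "\<forall>x\<le>0. \<Phi> x = 0" "\<forall>x\<ge>1. \<Phi> x = 1" using ex_mollifier by blast
  then interpret mollified M1 M2 R1 R2 \<rho> \<Phi> u using u by unfold_locales auto
  show ?thesis by (rule ex_recovery)
qed

lemma relaxation:
  assumes u: "u \<in> A_BV R1 R2"
  shows "I_rel M1 M2 R1 R2 u = ereal (J_fun M1 M2 R1 R2 u)"
proof (rule antisym)
  obtain v where v: "\<forall>n. v n \<in> A_smooth R1 R2" "L1_conv v u" "\<And>e. 0 < e \<Longrightarrow> eventually (\<lambda>n. I_fun M1 M2 R1 R2 (v n) \<le> J_fun M1 M2 R1 R2 u + e) sequentially"
    using recovery[OF u] by blast
  have "I_rel M1 M2 R1 R2 u \<le> liminf (\<lambda>n. ereal (I_fun M1 M2 R1 R2 (v n)))"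
    unfolding I_rel_def using v by (intro Inf_lower) auto
  also have "\<dots> \<le> ereal (J_fun M1 M2 R1 R2 u)"
  proof (rule ereal_le_epsilon2)
    fix e :: real assume "0 < e"
    have "liminf (\<lambda>n. ereal (I_fun M1 M2 R1 R2 (v n))) \<le> limsup (\<lambda>n. ereal (I_fun M1 M2 R1 R2 (v n)))"
      by (rule Liminf_le_Limsup) simp
    also have "\<dots> \<le> ereal (J_fun M1 M2 R1 R2 u + e)"
      using v(3)[OF \<open>0 < e\<close>] by (intro Limsup_bounded) simp
    finally show "liminf (\<lambda>n. ereal (I_fun M1 M2 R1 R2 (v n))) \<le> ereal (J_fun M1 M2 R1 R2 u) + ereal e" by simp
  qed
  finally show "I_rel M1 M2 R1 R2 u \<le> ereal (J_fun M1 M2 R1 R2 u)" .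
  show "ereal (J_fun M1 M2 R1 R2 u) \<le> I_rel M1 M2 R1 R2 u"
    unfolding I_rel_def by (intro Inf_greatest) (auto intro: liminf_ge_J[OF u])
qed

lemma INF_I:
  "(INF u\<in>A_smooth R1 R2. ereal (I_fun M1 M2 R1 R2 u)) = ereal lam"
proof (rule antisym)
  show "ereal lam \<le> (INF u\<in>A_smooth R1 R2. ereal (I_fun M1 M2 R1 R2 u))"
  proof (rule INF_greatest)
    fix u assume s: "u \<in> A_smooth R1 R2"
    then have "u \<in> A_BV R1 R2" using A_smooth_subset_A_BV by blast
    from deficit_nonneg(1)[OF this] show "ereal lam \<le> ereal (I_fun M1 M2 R1 R2 u)" by (simp add: deficit_def I_eq_J[OF s])
  qed
  obtain v where v: "\<forall>n. v n \<in> A_smooth R1 R2" "\<And>e. 0 < e \<Longrightarrow> eventually (\<lambda>n. I_fun M1 M2 R1 R2 (v n) \<le> J_fun M1 M2 R1 R2 us + e) sequentially"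
    using recovery[OF us_A_BV(1)] by blast
  show "(INF u\<in>A_smooth R1 R2. ereal (I_fun M1 M2 R1 R2 u)) \<le> ereal lam"
  proof (rule ereal_le_epsilon2)
    fix e :: real assume "0 < e"
    then obtain n where n: "I_fun M1 M2 R1 R2 (v n) \<le> lam + e"
      using v(2)[of e] us_A_BV(4) unfolding eventually_sequentially by auto
    have "(INF u\<in>A_smooth R1 R2. ereal (I_fun M1 M2 R1 R2 u)) \<le> ereal (I_fun M1 M2 R1 R2 (v n))"
      using v(1) by (intro INF_lower) auto
    also have "\<dots> \<le> ereal lam + ereal e" using n by simp
    finally show "(INF u\<in>A_smooth R1 R2. ereal (I_fun M1 M2 R1 R2 u)) \<le> ereal lam + ereal e" .
  qed
qed

end


section \<open>Radial slices of distributions in the chart\<close>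

text \<open>The first component collects t and the angles, so that the radius can be integrated
  separately.\<close>

definition insert_r :: "(real \<times> real \<times> real) \<times> real \<Rightarrow> event" where
  "insert_r p = (fst (fst p), snd p, snd (fst p))"

lemma insert_r_measurable: "insert_r \<in> borel_measurable borel"
  by (intro borel_measurable_continuous_onI) (auto simp: insert_r_def[abs_def] intro!: continuous_intros)

lemma insert_r_measurable_pair: "insert_r \<in> (lborel \<Otimes>\<^sub>M lborel) \<rightarrow>\<^sub>M borel"
proof -
  have "insert_r \<in> (lborel :: ((real \<times> real \<times> real) \<times> real) measure) \<rightarrow>\<^sub>M borel" using insert_r_measurable by simp
  then show ?thesis by (simp only: lborel_prod)
qed

text \<open>Lebesgue measure is invariant under permuting coordinates: Tonelli for the nested
  integrals of an indicator, with the radius and the angles exchanged.\<close>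

lemma lborel_event_eq_distr: "(lborel :: event measure) = distr (lborel \<Otimes>\<^sub>M lborel) borel insert_r"
proof (rule measure_eqI)
  fix A :: "event set" assume "A \<in> sets lborel"
  then have A: "A \<in> sets borel" by simp
  let ?f = "\<lambda>x. indicator A x :: ennreal"
  have fm: "?f \<in> borel_measurable borel" using A by simp
  have f1: "?f \<in> borel_measurable (lborel \<Otimes>\<^sub>M (lborel :: (real \<times> real \<times> real) measure))" using fm by (simp add: lborel_prod)
  have f2: "(\<lambda>p. ?f (t, p)) \<in> borel_measurable (lborel \<Otimes>\<^sub>M (lborel :: (real \<times> real) measure))" for t :: real
  proof -
    have "(\<lambda>p. (t, p)) \<in> (borel :: (real \<times> real \<times> real) measure) \<rightarrow>\<^sub>M borel"
      by (intro borel_measurable_continuous_onI continuous_intros)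
    from measurable_compose[OF this fm] show ?thesis by (simp add: lborel_prod)
  qed
  have g1: "(\<lambda>p. ?f (insert_r p)) \<in> borel_measurable ((lborel :: (real \<times> real \<times> real) measure) \<Otimes>\<^sub>M lborel)"
    by (rule measurable_compose[OF insert_r_measurable_pair fm])
  have g2: "(\<lambda>y. \<integral>\<^sup>+r. ?f (insert_r (y, r)) \<partial>lborel) \<in> borel_measurable ((lborel :: real measure) \<Otimes>\<^sub>M (lborel :: (real \<times> real) measure))"
    using lborel.borel_measurable_nn_integral_fst[OF g1] by (simp add: lborel_prod)
  have "emeasure lborel A = (\<integral>\<^sup>+x. ?f x \<partial>lborel)" using A by simp
  also have "\<dots> = (\<integral>\<^sup>+t. \<integral>\<^sup>+p. ?f (t, p) \<partial>lborel \<partial>lborel)"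
    using lborel.nn_integral_fst[OF f1] by (simp add: lborel_prod)
  also have "\<dots> = (\<integral>\<^sup>+t. \<integral>\<^sup>+r. \<integral>\<^sup>+z. ?f (t, r, z) \<partial>lborel \<partial>lborel \<partial>lborel)"
    using lborel.nn_integral_fst[OF f2] by (simp add: lborel_prod)
  also have "\<dots> = (\<integral>\<^sup>+t. \<integral>\<^sup>+z. \<integral>\<^sup>+r. ?f (t, r, z) \<partial>lborel \<partial>lborel \<partial>lborel)"
  proof (rule nn_integral_cong)
    fix t :: real
    show "(\<integral>\<^sup>+r. \<integral>\<^sup>+z. ?f (t, r, z) \<partial>lborel \<partial>lborel) = (\<integral>\<^sup>+z. \<integral>\<^sup>+r. ?f (t, r, z) \<partial>lborel \<partial>lborel)"
      using lborel_pair.Fubini[of "\<lambda>p. ?f (t, p)"] f2[of t] by simp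
  qed
  also have "\<dots> = (\<integral>\<^sup>+y. \<integral>\<^sup>+r. ?f (insert_r (y, r)) \<partial>lborel \<partial>lborel)"
    using lborel.nn_integral_fst[OF g2] by (simp add: lborel_prod insert_r_def)
  also have "\<dots> = (\<integral>\<^sup>+p. ?f (insert_r p) \<partial>(lborel \<Otimes>\<^sub>M lborel))"
    by (rule lborel.nn_integral_fst[OF g1])
  also have "\<dots> = (\<integral>\<^sup>+x. ?f x \<partial>(distr (lborel \<Otimes>\<^sub>M lborel) borel insert_r))"
    by (subst nn_integral_distr[OF insert_r_measurable_pair]) (use A in auto)
  also have "\<dots> = emeasure (distr (lborel \<Otimes>\<^sub>M lborel) borel insert_r) A" using A by simp
  finally show "emeasure lborel A = emeasure (distr (lborel \<Otimes>\<^sub>M lborel) borel insert_r) A" .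
qed simp

lemma integral_event_slices:
  fixes f :: "event \<Rightarrow> real"
  assumes "integrable lborel f"
  shows "(LINT x|lborel. f x) = (LINT y|lborel. LINT r|lborel. f (fst y, r, snd y))"
    "integrable lborel (\<lambda>y. LINT r|lborel. f (fst y, r, snd y))"
proof -
  have fm: "f \<in> borel_measurable borel" using assms by simp
  have i: "integrable (lborel \<Otimes>\<^sub>M lborel) (\<lambda>p. f (insert_r p))"
    using assms unfolding lborel_event_eq_distr by (subst (asm) integrable_distr_eq[OF insert_r_measurable_pair fm])
  have "(LINT x|lborel. f x) = (LINT p|(lborel \<Otimes>\<^sub>M lborel). f (insert_r p))"
    unfolding lborel_event_eq_distr by (rule integral_distr[OF insert_r_measurable_pair fm])
  also have "\<dots> = (LINT y|lborel. LINT r|lborel. f (insert_r (y, r)))"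
    by (rule lborel_pair.integral_fst'[symmetric, OF i])
  finally show "(LINT x|lborel. f x) = (LINT y|lborel. LINT r|lborel. f (fst y, r, snd y))" by (simp add: insert_r_def)
  show "integrable lborel (\<lambda>y. LINT r|lborel. f (fst y, r, snd y))"
    using lborel_pair.integrable_fst'[OF i] by (simp add: insert_r_def)
qed

text \<open>Admits coefficients such as 1/r that are singular away from the support: the product is
  continuous on U, where g is, and zero on the open complement of S.\<close>

lemma continuous_on_mult_cutoff:
  fixes f g :: "'a::topological_space \<Rightarrow> real"
  assumes "continuous_on UNIV f" "closed S" "\<And>x. x \<notin> S \<Longrightarrow> f x = 0" "open U" "S \<subseteq> U" "continuous_on U g"
  shows "continuous_on UNIV (\<lambda>x. g x * f x)"
proof -
  have "continuous_on (U \<union> - S) (\<lambda>x. g x * f x)"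
  proof (rule continuous_on_open_Un)
    show "continuous_on U (\<lambda>x. g x * f x)" by (intro continuous_on_mult assms continuous_on_subset[OF assms(1)]) simp
    have "continuous_on (- S) (\<lambda>x. 0 :: real)" by simp
    then show "continuous_on (- S) (\<lambda>x. g x * f x)" by (rule continuous_on_eq) (use assms(3) in auto)
  qed (use assms in auto)
  moreover have "U \<union> - S = UNIV" using assms(5) by auto
  ultimately show ?thesis by simp
qed

lemma has_derivative_slice:
  fixes f :: "event \<Rightarrow> real"
  assumes "f differentiable (at (t, r, z))"
  shows "((\<lambda>r. f (t, r, z)) has_real_derivative pd Cr f (t, r, z)) (at r)"
proof -
  have "(f has_derivative frechet_derivative f (at (t, r, z))) (at (t, r, z))"
    using assms frechet_derivative_works by blast
  moreover have "((\<lambda>r. (t, r, z)) has_derivative (\<lambda>h. (0, h, 0))) (at r)"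
    by (auto intro!: derivative_eq_intros)
  ultimately have d: "((\<lambda>r. f (t, r, z)) has_derivative (\<lambda>h. frechet_derivative f (at (t, r, z)) (0, h, 0))) (at r)"
    using has_derivative_compose[of "\<lambda>r. (t, r, z)"] by blast
  have lin: "linear (frechet_derivative f (at (t, r, z)))" using assms by (rule linear_frechet_derivative)
  have "frechet_derivative f (at (t, r, z)) (0, h, 0) = pd Cr f (t, r, z) * h" for h
    using linear_scale[OF lin, of h "(0, 1, 0, 0)"] by (simp add: pd_def zero_prod_def mult.commute)
  then have "(\<lambda>h. frechet_derivative f (at (t, r, z)) (0, h, 0)) = (*) (pd Cr f (t, r, z))" by auto
  then show ?thesis using d by (simp add: has_field_derivative_def)
qed

lemma pd_eqI: "(f has_derivative f') (at x) \<Longrightarrow> pd m f x = f' (coord_vec m)"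
  unfolding pd_def using frechet_derivative_at by metis

lemma pd_notin_supp:
  assumes "x \<notin> supp f" shows "pd m f x = 0"
proof -
  have o: "open (- supp f)" by (simp add: supp_def open_Compl)
  have "(f has_derivative (\<lambda>_. 0)) (at x)"
    by (rule has_derivative_transform_within_open[OF _ o, of "\<lambda>_. 0"]) (use assms notin_supp[of _ f] in auto)
  then show ?thesis by (simp add: pd_eqI)
qed

section \<open>Test functions on the chart and the Einstein tensor paired with them\<close>

locale event_test =
  fixes I :: "real set" and \<phi> :: "event \<Rightarrow> real"
  assumes I: "open I" "I \<subseteq> {0<..}" and test: "test_fun (chart I) \<phi>"
begin

abbreviation "S \<equiv> supp \<phi>"

abbreviation "D \<equiv> pd Cr \<phi>"
abbreviation "DD \<equiv> pd Cr (pd Cr \<phi>)"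

lemma S: "compact S" "closed S" "S \<subseteq> chart I" "\<And>x. x \<in> S \<Longrightarrow> rad x \<in> I"
  using test by (auto simp: test_fun_def supp_def chart_def)

lemma smooth_facts:
  "\<phi> differentiable (at x)" "D differentiable (at x)" "continuous_on X \<phi>" "continuous_on X D" "continuous_on X DD"
proof -
  have c: "Ck k \<phi>" for k using test by (auto simp: test_fun_def smooth_def)
  have D: "D = (\<lambda>x. frechet_derivative \<phi> (at x) (coord_vec Cr))" by (rule ext) (simp only: pd_def)
  have DD: "DD = (\<lambda>x. frechet_derivative D (at x) (coord_vec Cr))" by (rule ext) (simp only: pd_def)
  have ck: "Ck k D" for k using c[of "Suc k"] unfolding D Ck.simps by blast
  have ck2: "Ck k DD" for k using ck[of "Suc k"] unfolding DD Ck.simps by blast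
  show "\<phi> differentiable (at x)" using c[of "Suc 0"] unfolding Ck.simps by blast
  show "D differentiable (at x)" using ck[of "Suc 0"] unfolding Ck.simps by blast
  show "continuous_on X \<phi>" using c[of 0] continuous_on_subset by auto
  show "continuous_on X D" using ck[of 0] continuous_on_subset by auto
  show "continuous_on X DD" using ck2[of 0] continuous_on_subset by auto
qed

lemma zero: "x \<notin> S \<Longrightarrow> \<phi> x = 0" "x \<notin> S \<Longrightarrow> D x = 0" "x \<notin> S \<Longrightarrow> DD x = 0"
proof -
  show "x \<notin> S \<Longrightarrow> \<phi> x = 0" by (rule notin_supp)
  show D: "x \<notin> S \<Longrightarrow> D x = 0" for x by (rule pd_notin_supp)
  have "supp D \<subseteq> S" by (rule supp_subset[OF S(2) D])
  then show "x \<notin> S \<Longrightarrow> DD x = 0" using pd_notin_supp[of x D] by blast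
qed

lemma open_pos: "open {x :: event. 0 < rad x}"
  by (intro open_Collect_less continuous_intros)

lemma S_pos: "S \<subseteq> {x. 0 < rad x}" using S(4) I(2) by force

lemma cutoff_integrable:
  assumes "continuous_on UNIV f" "\<And>x. x \<notin> S \<Longrightarrow> f x = 0" "continuous_on {x. 0 < rad x} g"
  shows "continuous_on UNIV (\<lambda>x. g x * f x)" "integrable lborel (\<lambda>x. g x * f x :: real)"
proof -
  show c: "continuous_on UNIV (\<lambda>x. g x * f x)"
    by (rule continuous_on_mult_cutoff[OF assms(1) S(2) assms(2) open_pos S_pos assms(3)])
  show "integrable lborel (\<lambda>x. g x * f x)"
    by (rule integrable_continuous_compact_support[OF c S(1)]) (use assms(2) in auto)
qed

lemma pd_cutoff:
  assumes h: "\<And>r. 0 < r \<Longrightarrow> (h has_real_derivative h' r) (at r)"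
  shows "pd Cr (\<lambda>x. h (rad x) * \<phi> x) x = h' (rad x) * \<phi> x + h (rad x) * D x"
proof (cases "x \<in> S")
  case True
  then have r: "0 < rad x" using S_pos by auto
  have "(rad has_derivative (\<lambda>v. fst (snd v))) (at x)" by (auto intro!: derivative_eq_intros)
  from has_derivative_compose[OF this h[OF r, unfolded has_field_derivative_def]]
  have "((\<lambda>x. h (rad x)) has_derivative (\<lambda>v. h' (rad x) * fst (snd v))) (at x)" .
  from pd_eqI[OF has_derivative_mult[OF this frechet_derivative_works[THEN iffD1, OF smooth_facts(1)]], of Cr]
  show ?thesis by (simp add: pd_def)
next
  case False
  have "supp (\<lambda>x. h (rad x) * \<phi> x) \<subseteq> S" by (rule supp_subset[OF S(2)]) (use zero(1) in auto)
  then have "pd Cr (\<lambda>x. h (rad x) * \<phi> x) x = 0" using pd_notin_supp False by blast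
  then show ?thesis using zero[OF False] by simp
qed

text \<open>The functions against which \<open>F\<close> is integrated once all derivatives in \<open>einstein F\<close> have been
  moved to the test function.\<close>

definition "\<Theta>t x = 2 / (rad x)^2 * \<phi> x - 1 / rad x * D x"
definition "\<Theta>s x = 1 / 2 * DD x + 1 / (rad x)^2 * \<phi> x - 1 / rad x * D x"

lemma \<Theta>_facts: "integrable lborel \<Theta>t" "integrable lborel \<Theta>s" "x \<notin> S \<Longrightarrow> \<Theta>t x = 0" "x \<notin> S \<Longrightarrow> \<Theta>s x = 0"
   "integrable lborel (\<lambda>x. 1 / (rad x)^2 * \<phi> x)"
proof -
  have c: "continuous_on {x :: event. 0 < rad x} (\<lambda>x. k / (rad x)^2)" "continuous_on {x :: event. 0 < rad x} (\<lambda>x. k / rad x)" for k :: real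
    by (intro continuous_intros; auto)+
  note i = cutoff_integrable(2)[OF smooth_facts(3) zero(1) c(1)] cutoff_integrable(2)[OF smooth_facts(4) zero(2) c(2)]
    integrable_mult_right[OF integrable_continuous_compact_support[OF smooth_facts(5) S(1) zero(3)]]
  show "integrable lborel \<Theta>t" unfolding \<Theta>t_def[abs_def] by (intro Bochner_Integration.integrable_diff i)
  show "integrable lborel \<Theta>s" unfolding \<Theta>s_def[abs_def] by (intro Bochner_Integration.integrable_diff Bochner_Integration.integrable_add i)
  show "integrable lborel (\<lambda>x. 1 / (rad x)^2 * \<phi> x)" by (rule i)
qed (simp_all add: \<Theta>t_def \<Theta>s_def zero)

lemma integrable_bounded_mult:
  fixes g :: "event \<Rightarrow> real"
  assumes F: "(\<lambda>x. F (rad x)) \<in> borel_measurable borel" "\<forall>r\<in>I. \<bar>F r\<bar> \<le> B" and g: "integrable lborel g" "\<And>x. x \<notin> S \<Longrightarrow> g x = 0"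
  shows "integrable lborel (\<lambda>x. F (rad x) * g x)"
proof (rule Bochner_Integration.integrable_bound)
  show "integrable lborel (\<lambda>x. B * g x)" using g by simp
  have [measurable]: "g \<in> borel_measurable borel" using g by simp
  show "(\<lambda>x. F (rad x) * g x) \<in> borel_measurable lborel" using F(1) by measurable
  show "AE x in lborel. norm (F (rad x) * g x) \<le> norm (B * g x)"
  proof (rule AE_I2)
    fix x show "norm (F (rad x) * g x) \<le> norm (B * g x)"
    proof (cases "x \<in> S")
      case True
      then have "\<bar>F (rad x)\<bar> * \<bar>g x\<bar> \<le> \<bar>B\<bar> * \<bar>g x\<bar>" using bspec[OF F(2) S(4)[OF True]] by (intro mult_right_mono) auto
      then show ?thesis by (simp add: abs_mult)
    qed (simp add: g(2))
  qed
qed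

lemma einstein_eq:
  assumes F: "(\<lambda>x. F (rad x)) \<in> borel_measurable borel" "\<forall>r\<in>I. \<bar>F r\<bar> \<le> B"
  shows "m \<in> {Ct, Cr} \<Longrightarrow> einstein F m m \<phi> = (LINT x|lborel. F (rad x) * \<Theta>t x) - (LINT x|lborel. 1 / (rad x)^2 * \<phi> x)"
    "m \<in> {Cth, Cph} \<Longrightarrow> einstein F m m \<phi> = (LINT x|lborel. F (rad x) * \<Theta>s x)"
    "m \<noteq> n \<Longrightarrow> einstein F m n \<phi> = 0"
proof -
  note bm = integrable_bounded_mult[OF F]
  have c: "continuous_on {x :: event. 0 < rad x} (\<lambda>x. k / (rad x)^2)" "continuous_on {x :: event. 0 < rad x} (\<lambda>x. k / rad x)" for k :: real
    by (intro continuous_intros; auto)+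
  note i1 = cutoff_integrable(2)[OF smooth_facts(3) zero(1) c(1)] and i2 = cutoff_integrable(2)[OF smooth_facts(4) zero(2) c(2)]
  have iDD: "integrable lborel DD" by (rule integrable_continuous_compact_support[OF smooth_facts(5) S(1) zero(3)])
  \<comment> \<open>At radius 0 both sides are 0 by the convention for division, so the identity
    holds on the whole space.\<close>
  have e: "(\<lambda>x. rad x * (1 / (rad x)^2 * \<phi> x)) = (\<lambda>x. 1 / rad x * \<phi> x)"
    by (auto simp: power2_eq_square)
  have d: "((\<lambda>r. 1 / r) has_real_derivative - 1 / r^2) (at r)" if "0 < r" for r :: real
    using that by (auto intro!: derivative_eq_intros simp: power2_eq_square)
  have p: "pd Cr (\<lambda>x. 1 / rad x * \<phi> x) x = - 1 / (rad x)^2 * \<phi> x + 1 / rad x * D x" for x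
    by (rule pd_cutoff[OF d])
  have pe: "pd Cr (\<lambda>x. rad x * (1 / (rad x)^2 * \<phi> x)) = (\<lambda>x. - 1 / (rad x)^2 * \<phi> x + 1 / rad x * D x)"
    "pd Cr (\<lambda>x. 1 / rad x * \<phi> x) = (\<lambda>x. - 1 / (rad x)^2 * \<phi> x + 1 / rad x * D x)"
    unfolding e by (rule ext, rule p)+
  note ed = einstein_def Let_def mult_distrib_def pd_distrib_def fun_distrib_def pe
  show "einstein F m n \<phi> = 0" if "m \<noteq> n" using that by (simp add: einstein_def Let_def)
  have I1: "integrable lborel (\<lambda>x. F (rad x) * (- 1 / (rad x)^2 * \<phi> x + 1 / rad x * D x))"
    by (rule bm[OF Bochner_Integration.integrable_add[OF i1 i2]]) (use zero in auto)
  have I2: "integrable lborel (\<lambda>x. F (rad x) * (1 / (rad x)^2 * \<phi> x))" by (rule bm[OF i1]) (use zero in auto)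
  have I3: "integrable lborel (\<lambda>x. F (rad x) * DD x)" by (rule bm[OF iDD]) (use zero in auto)
  show "einstein F m m \<phi> = (LINT x|lborel. F (rad x) * \<Theta>t x) - (LINT x|lborel. 1 / (rad x)^2 * \<phi> x)" if "m \<in> {Ct, Cr}"
  proof -
    have "einstein F m m \<phi> = - (LINT x|lborel. F (rad x) * (- 1 / (rad x)^2 * \<phi> x + 1 / rad x * D x)) + (LINT x|lborel. (F (rad x) - 1) * (1 / (rad x)^2 * \<phi> x))"
    proof -
      have b: "(m = Ct \<or> m = Cr) = True" using that by auto
      show ?thesis by (simp only: ed b not_False_eq_True not_True_eq_False if_True if_False simp_thms)
    qed
    also have "(LINT x|lborel. (F (rad x) - 1) * (1 / (rad x)^2 * \<phi> x)) = (LINT x|lborel. F (rad x) * (1 / (rad x)^2 * \<phi> x)) - (LINT x|lborel. 1 / (rad x)^2 * \<phi> x)"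
      unfolding left_diff_distrib mult_1 by (rule Bochner_Integration.integral_diff[OF I2 \<Theta>_facts(5)])
    also have "- (LINT x|lborel. F (rad x) * (- 1 / (rad x)^2 * \<phi> x + 1 / rad x * D x)) + ((LINT x|lborel. F (rad x) * (1 / (rad x)^2 * \<phi> x)) - (LINT x|lborel. 1 / (rad x)^2 * \<phi> x))
       = (LINT x|lborel. F (rad x) * (1 / (rad x)^2 * \<phi> x) - F (rad x) * (- 1 / (rad x)^2 * \<phi> x + 1 / rad x * D x)) - (LINT x|lborel. 1 / (rad x)^2 * \<phi> x)"
      using Bochner_Integration.integral_diff[OF I2 I1] by linarith
    also have "(\<lambda>x. F (rad x) * (1 / (rad x)^2 * \<phi> x) - F (rad x) * (- 1 / (rad x)^2 * \<phi> x + 1 / rad x * D x)) = (\<lambda>x. F (rad x) * \<Theta>t x)"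
      by (auto simp: \<Theta>t_def algebra_simps)
    finally show ?thesis .
  qed
  show "einstein F m m \<phi> = (LINT x|lborel. F (rad x) * \<Theta>s x)" if "m \<in> {Cth, Cph}"
  proof -
    have "einstein F m m \<phi> = 1 / 2 * (LINT x|lborel. F (rad x) * DD x) - (LINT x|lborel. F (rad x) * (- 1 / (rad x)^2 * \<phi> x + 1 / rad x * D x))"
    proof -
      have b: "(m = Ct \<or> m = Cr) = False" using that by auto
      show ?thesis by (simp only: ed b not_False_eq_True not_True_eq_False if_True if_False simp_thms)
    qed
    also have "\<dots> = (LINT x|lborel. 1 / 2 * (F (rad x) * DD x) - F (rad x) * (- 1 / (rad x)^2 * \<phi> x + 1 / rad x * D x))"
      by (subst Bochner_Integration.integral_diff[OF integrable_mult_right[OF I3] I1]) simp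
    also have "(\<lambda>x. 1 / 2 * (F (rad x) * DD x) - F (rad x) * (- 1 / (rad x)^2 * \<phi> x + 1 / rad x * D x)) = (\<lambda>x. F (rad x) * \<Theta>s x)"
      by (auto simp: \<Theta>s_def algebra_simps)
    finally show ?thesis .
  qed
qed

lemma einstein_tendsto:
  assumes F: "\<And>k::nat. (\<lambda>x. Fk k (rad x)) \<in> borel_measurable borel" "\<And>k. \<forall>r\<in>I. \<bar>Fk k r\<bar> \<le> B"
    and G: "(\<lambda>x. G (rad x)) \<in> borel_measurable borel" "\<forall>r\<in>I. \<bar>G r\<bar> \<le> B"
    and e: "\<And>k r. \<bar>Fk k r - G r\<bar> \<le> e k" "e \<longlonglongrightarrow> 0"
  shows "(\<lambda>k. einstein (Fk k) m n \<phi>) \<longlonglongrightarrow> einstein G m n \<phi>"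
proof -
  have lim: "(\<lambda>k. LINT x|lborel. Fk k (rad x) * g x) \<longlonglongrightarrow> (LINT x|lborel. G (rad x) * g x)"
    if g: "integrable lborel g" "\<And>x. x \<notin> S \<Longrightarrow> g x = 0" for g
  proof -
    have i: "integrable lborel (\<lambda>x. Fk k (rad x) * g x)" "integrable lborel (\<lambda>x. G (rad x) * g x)" for k
      by (rule integrable_bounded_mult[OF F g(1)] integrable_bounded_mult[OF G g(1)]; use g(2) in blast)+
    have "\<bar>(LINT x|lborel. Fk k (rad x) * g x) - (LINT x|lborel. G (rad x) * g x)\<bar> \<le> e k * (LINT x|lborel. \<bar>g x\<bar>)" for k
    proof -
      have "(LINT x|lborel. Fk k (rad x) * g x) - (LINT x|lborel. G (rad x) * g x) = (LINT x|lborel. Fk k (rad x) * g x - G (rad x) * g x)"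
        by (rule Bochner_Integration.integral_diff[symmetric, OF i(1) i(2)])
      then have "\<bar>(LINT x|lborel. Fk k (rad x) * g x) - (LINT x|lborel. G (rad x) * g x)\<bar> \<le> (LINT x|lborel. \<bar>Fk k (rad x) * g x - G (rad x) * g x\<bar>)"
        using integral_abs_bound[of lborel "\<lambda>x. Fk k (rad x) * g x - G (rad x) * g x"] by presburger
      also have "\<dots> \<le> (LINT x|lborel. e k * \<bar>g x\<bar>)"
      proof (rule integral_mono)
        show "integrable lborel (\<lambda>x. \<bar>Fk k (rad x) * g x - G (rad x) * g x\<bar>)"
          by (rule integrable_abs[OF Bochner_Integration.integrable_diff[OF i(1) i(2)]])
        show "integrable lborel (\<lambda>x. e k * \<bar>g x\<bar>)" using g(1) by simp
        fix x
        have "\<bar>Fk k (rad x) * g x - G (rad x) * g x\<bar> = \<bar>Fk k (rad x) - G (rad x)\<bar> * \<bar>g x\<bar>" by (simp flip: left_diff_distrib add: abs_mult)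
        also have "\<dots> \<le> e k * \<bar>g x\<bar>" by (intro mult_right_mono e) simp
        finally show "\<bar>Fk k (rad x) * g x - G (rad x) * g x\<bar> \<le> e k * \<bar>g x\<bar>" .
      qed
      finally show ?thesis by simp
    qed
    then have "eventually (\<lambda>k. norm ((LINT x|lborel. Fk k (rad x) * g x) - (LINT x|lborel. G (rad x) * g x)) \<le> e k * (LINT x|lborel. \<bar>g x\<bar>)) sequentially" by simp
    moreover have "(\<lambda>k. e k * (LINT x|lborel. \<bar>g x\<bar>)) \<longlonglongrightarrow> 0" using tendsto_mult_right[OF e(2), of "LINT x|lborel. \<bar>g x\<bar>"] by simp
    ultimately have "(\<lambda>k. (LINT x|lborel. Fk k (rad x) * g x) - (LINT x|lborel. G (rad x) * g x)) \<longlonglongrightarrow> 0" by (rule Lim_null_comparison)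
    then show ?thesis by (simp add: LIM_zero_iff)
  qed
  show ?thesis
  proof (cases "m = n")
    case False
    then show ?thesis by (simp add: einstein_eq(3)[OF F] einstein_eq(3)[OF G])
  next
    case True
    show ?thesis
    proof (cases "m \<in> {Ct, Cr}")
      case m: True
      show ?thesis unfolding \<open>m = n\<close>[symmetric] einstein_eq(1)[OF F m] einstein_eq(1)[OF G m]
        by (intro tendsto_diff tendsto_const lim \<Theta>_facts)
    next
      case False
      then have m: "m \<in> {Cth, Cph}" by (cases m) auto
      show ?thesis unfolding \<open>m = n\<close>[symmetric] einstein_eq(2)[OF F m] einstein_eq(2)[OF G m]
        by (intro lim \<Theta>_facts)
    qed
  qed
qed

text \<open>One compact interval in r > 0 serves all radial lines at once, which keeps the powers of
  1/r bounded wherever a slice is nonzero.\<close>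

lemma slice:
  obtains L R where "0 < L" "L \<le> R" "{L..R} \<subseteq> UNIV" "\<And>y r. r \<notin> {L..R} \<Longrightarrow> (fst y, r, snd y) \<notin> S"
proof (cases "S = {}")
  case True then show ?thesis using that[of 1 1] by auto
next
  case False
  have c: "compact (rad ` S)" by (intro compact_continuous_image S continuous_intros)
  obtain l where l: "l \<in> rad ` S" "\<And>x. x \<in> rad ` S \<Longrightarrow> l \<le> x" using compact_attains_inf[OF c] False by auto
  obtain r where r: "r \<in> rad ` S" "\<And>x. x \<in> rad ` S \<Longrightarrow> x \<le> r" using compact_attains_sup[OF c] False by auto
  show ?thesis
  proof (rule that[of l r])
    show "0 < l" using l S_pos by auto
    show "l \<le> r" using l(2)[OF r(1)] .
    show "(fst y, x, snd y) \<notin> S" if "x \<notin> {l..r}" for y x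
    proof
      assume "(fst y, x, snd y) \<in> S"
      then have "x \<in> rad ` S" by (force intro: rev_image_eqI)
      then show False using l(2) r(2) that by auto
    qed
  qed simp
qed

end


section \<open>The Einstein tensor of the optimal metric\<close>

text \<open>The function \<psi> vanishes to the left of L > 0, so the quotient rule extends across
  the singularity at 0.\<close>

lemma DERIV_divide_power:
  fixes \<psi> \<psi>' :: "real \<Rightarrow> real"
  assumes "\<And>r. (\<psi> has_real_derivative \<psi>' r) (at r)" "\<And>r. r \<notin> {L..R} \<Longrightarrow> \<psi> r = 0" "\<And>r. r \<notin> {L..R} \<Longrightarrow> \<psi>' r = 0" "0 < L"
  shows "((\<lambda>r. \<psi> r / r ^ k) has_real_derivative \<psi>' r / r ^ k - real k * \<psi> r / r ^ Suc k) (at r)"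
proof (cases "r < L")
  case True
  have z: "\<psi> r / r ^ k = 0" if "r < L" for r using assms(2)[of r] that by simp
  have "((\<lambda>r. 0) has_real_derivative 0) (at r)" by simp
  then have "((\<lambda>r. \<psi> r / r ^ k) has_real_derivative 0) (at r)"
    by (rule has_field_derivative_transform_within_open[of _ _ _ "{..<L}"]) (use True z in auto)
  then show ?thesis using assms(2)[of r] assms(3)[of r] True by simp
next
  case False
  then have r: "0 < r" using assms(4) by simp
  have "((\<lambda>r. \<psi> r / r ^ k) has_real_derivative (\<psi>' r * r ^ k - \<psi> r * (real k * r ^ (k - 1))) / (r ^ k * r ^ k)) (at r)"
    using r by (auto intro!: derivative_eq_intros assms(1))
  moreover have "(\<psi>' r * r ^ k - \<psi> r * (real k * r ^ (k - 1))) / (r ^ k * r ^ k) = \<psi>' r / r ^ k - real k * \<psi> r / r ^ Suc k"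
    using r by (cases k) (simp_all add: field_simps)
  ultimately show ?thesis by simp
qed

lemma continuous_divide_power:
  fixes \<psi> :: "real \<Rightarrow> real"
  assumes "continuous_on UNIV \<psi>" "\<And>r. r \<notin> {L..R} \<Longrightarrow> \<psi> r = 0" "0 < L"
  shows "continuous_on UNIV (\<lambda>r. \<psi> r / r ^ k)"
proof -
  have "continuous_on UNIV (\<lambda>r. (1 / r ^ k) * \<psi> r)"
    by (rule continuous_on_mult_cutoff[OF assms(1), of "{L..R}" "{0<..}"]) (use assms in \<open>auto intro!: continuous_intros\<close>)
  then show ?thesis by simp
qed

context shell begin

abbreviation "Fs \<equiv> lapse_star M1 M2 R1 R2"
abbreviation "\<beta> \<equiv> (M2 - M1) * H"

lemma P_global_mono:
  assumes "u \<in> A_BV R1 R2" shows "mono (P u)"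
proof (rule monoI)
  fix r s :: real assume rs: "r \<le> s"
  show "P u r \<le> P u s"
  proof (cases "r \<le> R1 \<or> R2 \<le> s")
    case True
    have "P u r = 0" if "r \<le> R1" using that by (simp add: enclosed_def)
    moreover have "P u s = 1" if "R2 \<le> s" using that R12 by (simp add: enclosed_def)
    ultimately show ?thesis using True P_bounds[OF assms, of r] P_bounds[OF assms, of s] by auto
  next
    case False
    then show ?thesis using P_mono[OF assms _ rs] by auto
  qed
qed

lemma F_borel:
  assumes "u \<in> A_BV R1 R2"
  shows "F u \<in> borel_measurable borel" "(\<lambda>x :: event. F u (rad x)) \<in> borel_measurable borel"
proof -
  have [measurable]: "P u \<in> borel_measurable borel" by (rule borel_measurable_mono[OF P_global_mono[OF assms]])
  show m: "F u \<in> borel_measurable borel" unfolding lapse_def[abs_def] mass_def[abs_def] by measurable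
  have "(rad :: event \<Rightarrow> real) \<in> borel_measurable borel" by (intro borel_measurable_continuous_onI continuous_intros)
  from measurable_compose[OF this m] show "(\<lambda>x :: event. F u (rad x)) \<in> borel_measurable borel" .
qed

lemma F_unit_bounds:
  assumes "u \<in> A_BV R1 R2" "2 * M1 < r"
  shows "0 < F u r" "F u r \<le> 1"
proof -
  have r: "0 < r" using assms M1 by simp
  have "0 \<le> mass M1 M2 R1 R2 u r" using P_bounds(1)[OF assms(1), of r] M1 M12 by (simp add: mass_def)
  then show "F u r \<le> 1" using r by (simp add: lapse_def)
  show "0 < F u r"
  proof (cases "R1 \<le> r")
    case True then show ?thesis by (rule F_pos[OF assms(1)])
  next
    case False
    then have "F u r = 1 - 2 * M1 / r" by (simp add: lapse_def mass_def enclosed_def)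
    then show ?thesis using assms r by simp
  qed
qed

lemma Fs_eq: "Fs = F us" by (simp add: lapse_star_def)

text \<open>The enclosed fraction of \<open>u_star\<close> between its jumps, continued as a cubic
  to the whole line so that it can be differentiated at the jumps too.\<close>

definition "inner_P r = H * (r^3 - a^3) / 3"

lemma inner_P_ends: "inner_P a = 0" "inner_P R2 = 1"
  using A_pos[OF a_facts(1,2)] by (simp_all add: inner_P_def H_star_def A_weight_def)

lemma inner_P_DERIV: "(inner_P has_real_derivative H * r\<^sup>2) (at r)"
  unfolding inner_P_def[abs_def] by (auto intro!: derivative_eq_intros)

lemma P_us: "P us r = (if r \<le> a then 0 else if R2 \<le> r then 1 else inner_P r)"
proof (cases "r \<le> R1 \<or> R2 \<le> r")
  case True
  then show ?thesis using a_facts by (auto simp: enclosed_def)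
next
  case False
  then have r: "r \<in> {R1..R2}" "r < R2" by auto
  have P: "P us r = (LINT s|lborel. indicator {R1..r} s *\<^sub>R (s\<^sup>2 * us s))" using P_eq[OF us_A_BV(1) r(1)] by (simp add: set_lebesgue_integral_def)
  show ?thesis
  proof (cases "r \<le> a")
    case True
    then have "(\<lambda>s. indicator {R1..r} s *\<^sub>R (s\<^sup>2 * us s)) = (\<lambda>s. 0)" by (auto simp: u_star_def indicator_def)
    then show ?thesis using True P by simp
  next
    case ar: False
    have d: "((\<lambda>s. H * s^3 / 3) has_real_derivative H * s\<^sup>2) (at s)" for s by (auto intro!: derivative_eq_intros)
    have c: "continuous_on {a..r} (\<lambda>s. H * s\<^sup>2)" by (intro continuous_intros)
    have "(LINT s|lborel. indicator {R1..r} s *\<^sub>R (s\<^sup>2 * us s)) = (LINT s|lborel. indicator {a<..<r} s * (H * s\<^sup>2))"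
    proof (rule integral_cong_AE)
      have [measurable]: "us \<in> borel_measurable borel" using A_BV_integrable[OF us_A_BV(1)] by simp
      show "(\<lambda>s. indicator {R1..r} s *\<^sub>R (s\<^sup>2 * us s)) \<in> borel_measurable lborel" by measurable
      show "(\<lambda>s. indicator {a<..<r} s * (H * s\<^sup>2)) \<in> borel_measurable lborel" by measurable
      show "AE s in lborel. indicator {R1..r} s *\<^sub>R (s\<^sup>2 * us s) = indicator {a<..<r} s * (H * s\<^sup>2)"
        using AE_lborel_singleton[of r] by eventually_elim (use a_facts r in \<open>auto simp: u_star_def indicator_def\<close>)
    qed
    also have "\<dots> = H * r^3 / 3 - H * a^3 / 3" by (rule integral_open_interval_deriv(1)[OF _ d c]) (use ar in simp)
    finally show ?thesis using P ar r by (simp add: inner_P_def right_diff_distrib diff_divide_distrib)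
  qed
qed

text \<open>The enclosed fraction of \<open>u_star\<close> is continuous, with derivative H r^2 on
  (a, R2) and locally constant outside. Integrating over (a, R2) and (R2, K) separately produces
  boundary values at R2 that cancel.\<close>

lemma P_us_by_parts:
  fixes \<eta> \<eta>' :: "real \<Rightarrow> real"
  assumes \<eta>: "\<And>r. (\<eta> has_real_derivative \<eta>' r) (at r)" "continuous_on UNIV \<eta>'" "\<And>r. r \<notin> {L..R} \<Longrightarrow> \<eta> r = 0" "\<And>r. r \<notin> {L..R} \<Longrightarrow> \<eta>' r = 0"
  shows "(LINT r|lborel. P us r * \<eta>' r) = - H * (LINT r|lborel. indicator {a<..<R2} r * (r\<^sup>2 * \<eta> r))"
    "integrable lborel (\<lambda>r. P us r * \<eta>' r)"
proof -
  define K where "K = max R2 R + 1"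
  have K: "R2 \<le> K" "\<eta> K = 0" "\<And>r. K \<le> r \<Longrightarrow> \<eta>' r = 0" by (auto simp: K_def intro!: \<eta>(3,4))
  have c\<eta>: "continuous_on S \<eta>" for S by (intro continuous_at_imp_continuous_on ballI DERIV_isCont[OF \<eta>(1)])
  have c\<eta>': "continuous_on S \<eta>'" for S using \<eta>(2) continuous_on_subset by blast
  have cP: "continuous_on S inner_P" for S by (intro continuous_at_imp_continuous_on ballI DERIV_isCont[OF inner_P_DERIV])
  have i0: "integrable lborel (\<lambda>r. indicator {a<..<R2} r * f r)" if "continuous_on UNIV f" for f :: "real \<Rightarrow> real"
  proof -
    have "compact (f ` {a..R2})" by (intro compact_continuous_image continuous_on_subset[OF that]) auto
    then obtain B where B: "\<forall>x\<in>{a..R2}. \<bar>f x\<bar> \<le> B" using compact_imp_bounded[of "f ` {a..R2}"] unfolding bounded_pos by auto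
    show ?thesis
    proof (rule Bochner_Integration.integrable_bound)
    show "integrable lborel (\<lambda>r. B * indicator {a<..<R2} r)"
      by (intro integrable_mult_right integrable_real_indicator) (use a_facts in \<open>auto simp: emeasure_lborel_Ioo\<close>)
    have [measurable]: "f \<in> borel_measurable borel" using that by (rule borel_measurable_continuous_onI)
    show "(\<lambda>r. indicator {a<..<R2} r * f r) \<in> borel_measurable lborel" by measurable
    show "AE x in lborel. norm (indicator {a<..<R2} x * f x) \<le> norm (B * indicator {a<..<R2} x)"
    proof (rule AE_I2)
      fix x show "norm (indicator {a<..<R2} x * f x) \<le> norm (B * indicator {a<..<R2} x)"
        using B[rule_format, of x] by (auto simp: indicator_def)
    qed
    qed
  qed
  note p1 = integral_open_interval_deriv[of a R2 "\<lambda>r. inner_P r * \<eta> r" "\<lambda>r. H * r\<^sup>2 * \<eta> r + \<eta>' r * inner_P r"]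
  have d1: "((\<lambda>r. inner_P r * \<eta> r) has_real_derivative H * r\<^sup>2 * \<eta> r + \<eta>' r * inner_P r) (at r)" for r
    using DERIV_mult[OF inner_P_DERIV \<eta>(1)] by simp
  have cc: "continuous_on S (\<lambda>r. H * r\<^sup>2 * \<eta> r + \<eta>' r * inner_P r)" for S by (intro continuous_intros c\<eta> c\<eta>' cP)
  have q1: "(LINT r|lborel. indicator {a<..<R2} r * (H * r\<^sup>2 * \<eta> r + \<eta>' r * inner_P r)) = \<eta> R2"
    using integral_open_interval_deriv(1)[OF less_imp_le[OF a_facts(2)] d1 cc] by (simp add: inner_P_ends)
  have q2: "(LINT r|lborel. indicator {R2<..<K} r * \<eta>' r) = - \<eta> R2" "integrable lborel (\<lambda>r. indicator {R2<..<K} r * \<eta>' r)"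
    using integral_open_interval_deriv[OF K(1) \<eta>(1) c\<eta>'] K(2) by auto
  have iA: "integrable lborel (\<lambda>r. indicator {a<..<R2} r * (\<eta>' r * inner_P r))" by (intro i0 continuous_intros c\<eta>' cP)
  have iB: "integrable lborel (\<lambda>r. indicator {a<..<R2} r * (H * r\<^sup>2 * \<eta> r))" by (intro i0 continuous_intros c\<eta>)
  have q1': "(LINT r|lborel. indicator {a<..<R2} r * (\<eta>' r * inner_P r)) = \<eta> R2 - (LINT r|lborel. indicator {a<..<R2} r * (H * r\<^sup>2 * \<eta> r))"
    using q1 Bochner_Integration.integral_add[OF iB iA] by (simp only: distrib_left)
  have Pm: "P us \<in> borel_measurable borel" by (rule borel_measurable_mono[OF P_global_mono[OF us_A_BV(1)]])
  have [measurable]: "\<eta>' \<in> borel_measurable borel" using \<eta>(2) by (rule borel_measurable_continuous_onI)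
  have ae: "AE r in lborel. indicator {a<..<R2} r * (\<eta>' r * inner_P r) + indicator {R2<..<K} r * \<eta>' r = P us r * \<eta>' r"
    using AE_lborel_singleton[of R2]
  proof eventually_elim
    case (elim r)
    consider "r \<le> a" | "a < r" "r < R2" | "R2 < r" "r < K" | "K \<le> r" using elim by linarith
    then show ?case using a_facts K by cases (auto simp: P_us indicator_def)
  qed
  have iS: "integrable lborel (\<lambda>r. indicator {a<..<R2} r * (\<eta>' r * inner_P r) + indicator {R2<..<K} r * \<eta>' r)"
    by (rule Bochner_Integration.integrable_add[OF iA q2(2)])
  have Pc: "(\<lambda>r. P us r * \<eta>' r) \<in> borel_measurable lborel" using Pm by measurable
  show "integrable lborel (\<lambda>r. P us r * \<eta>' r)" by (rule integrable_cong_AE_imp[OF iS Pc]) (use ae in \<open>auto elim: eventually_mono\<close>)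
  have "(LINT r|lborel. P us r * \<eta>' r) = (LINT r|lborel. indicator {a<..<R2} r * (\<eta>' r * inner_P r) + indicator {R2<..<K} r * \<eta>' r)"
    by (rule integral_cong_AE[OF Pc borel_measurable_integrable[OF iS]]) (use ae in \<open>auto elim: eventually_mono\<close>)
  also have "\<dots> = - (LINT r|lborel. indicator {a<..<R2} r * (H * r\<^sup>2 * \<eta> r))"
    using Bochner_Integration.integral_add[OF iA q2(2)] q1' q2(1) by simp
  also have "(LINT r|lborel. indicator {a<..<R2} r * (H * r\<^sup>2 * \<eta> r)) = H * (LINT r|lborel. indicator {a<..<R2} r * (r\<^sup>2 * \<eta> r))"
    by (subst integral_mult_right_zero[symmetric]) (intro Bochner_Integration.integral_cong; simp add: mult_ac)
  finally show "(LINT r|lborel. P us r * \<eta>' r) = - H * (LINT r|lborel. indicator {a<..<R2} r * (r\<^sup>2 * \<eta> r))" by simp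
qed

lemma mass_us_by_parts:
  fixes \<eta> \<eta>' :: "real \<Rightarrow> real"
  assumes \<eta>: "\<And>r. (\<eta> has_real_derivative \<eta>' r) (at r)" "continuous_on UNIV \<eta>'" "\<And>r. r \<notin> {L..R} \<Longrightarrow> \<eta> r = 0" "\<And>r. r \<notin> {L..R} \<Longrightarrow> \<eta>' r = 0"
  shows "(LINT r|lborel. mass M1 M2 R1 R2 us r * \<eta>' r) = - \<beta> * (LINT r|lborel. indicator {a<..<R2} r * (r\<^sup>2 * \<eta> r))"
    "integrable lborel (\<lambda>r. mass M1 M2 R1 R2 us r * \<eta>' r)"
proof -
  note b = P_us_by_parts[OF \<eta>]
  have i: "integrable lborel \<eta>'" by (rule integrable_continuous_interval_support[OF \<eta>(2,4)])
  have z: "(LINT r|lborel. \<eta>' r) = 0" by (rule integral_deriv_compact_support[OF \<eta>])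
  have e: "mass M1 M2 R1 R2 us r * \<eta>' r = M1 * \<eta>' r + (M2 - M1) * (P us r * \<eta>' r)" for r by (simp add: mass_def algebra_simps)
  show "integrable lborel (\<lambda>r. mass M1 M2 R1 R2 us r * \<eta>' r)" unfolding e by (intro Bochner_Integration.integrable_add integrable_mult_right i b)
  have "(LINT r|lborel. mass M1 M2 R1 R2 us r * \<eta>' r) = M1 * (LINT r|lborel. \<eta>' r) + (M2 - M1) * (LINT r|lborel. P us r * \<eta>' r)"
    unfolding e using Bochner_Integration.integral_add[OF integrable_mult_right[OF i, of M1] integrable_mult_right[OF b(2), of "M2 - M1"]] by simp
  then show "(LINT r|lborel. mass M1 M2 R1 R2 us r * \<eta>' r) = - \<beta> * (LINT r|lborel. indicator {a<..<R2} r * (r\<^sup>2 * \<eta> r))"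
    using z b(1) by simp
qed

text \<open>Written with \<open>Fs r = 1 - 2 * m r / r\<close>, the two radial pairings are, up to exact derivatives,
  integrals of the mass function against a derivative.\<close>

lemma slice_t:
  fixes \<psi> \<psi>' :: "real \<Rightarrow> real"
  assumes \<psi>: "\<And>r. (\<psi> has_real_derivative \<psi>' r) (at r)" "continuous_on UNIV \<psi>'" "\<And>r. r \<notin> {L..R} \<Longrightarrow> \<psi> r = 0" "\<And>r. r \<notin> {L..R} \<Longrightarrow> \<psi>' r = 0" "0 < L"
  shows "(LINT r|lborel. Fs r * (2 / r^2 * \<psi> r - 1 / r * \<psi>' r) - 1 / r^2 * \<psi> r) = - 2 * \<beta> * (LINT r|lborel. indicator {a<..<R2} r * \<psi> r)"
proof -
  have c: "continuous_on UNIV \<psi>" by (intro continuous_at_imp_continuous_on ballI DERIV_isCont[OF \<psi>(1)])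
  note cp = continuous_divide_power[OF c \<psi>(3,5)] continuous_divide_power[OF \<psi>(2,4,5)]
  have ck: "continuous_on UNIV (\<lambda>r. \<psi>' r / r ^ k - real k * \<psi> r / r ^ Suc k)" for k
  proof -
    have "continuous_on UNIV (\<lambda>r. \<psi>' r / r ^ k - real k * (\<psi> r / r ^ Suc k))" by (intro continuous_intros cp)
    then show ?thesis by simp
  qed
  define d where "d k r = \<psi>' r / r ^ k - real k * \<psi> r / r ^ Suc k" for k r
  have D: "((\<lambda>r. \<psi> r / r ^ k) has_real_derivative d k r) (at r)" for k r
    unfolding d_def by (rule DERIV_divide_power[OF \<psi>(1,3,4,5)])
  have cd: "continuous_on UNIV (d k)" for k unfolding d_def[abs_def] by (rule ck)
  have z: "\<And>r. r \<notin> {L..R} \<Longrightarrow> \<psi> r / r ^ k = 0" "\<And>r. r \<notin> {L..R} \<Longrightarrow> d k r = 0" for k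
    using \<psi>(3,4) by (auto simp: d_def)
  note mb = mass_us_by_parts[of "\<lambda>r. \<psi> r / r ^ 2" "d 2", OF D cd z]
  have i1: "integrable lborel (d 1)" by (rule integrable_continuous_interval_support[OF cd z(2)])
  have e: "Fs r * (2 / r^2 * \<psi> r - 1 / r * \<psi>' r) - 1 / r^2 * \<psi> r = 2 * (mass M1 M2 R1 R2 us r * d 2 r) - d 1 r" for r
  proof (cases "r = 0")
    case False
    then show ?thesis unfolding Fs_eq lapse_def d_def by (simp add: field_simps power2_eq_square power3_eq_cube)
  qed (use \<psi>(3)[of r] \<psi>(4)[of r] \<psi>(5) in \<open>simp add: d_def\<close>)
  have "(LINT r|lborel. Fs r * (2 / r^2 * \<psi> r - 1 / r * \<psi>' r) - 1 / r^2 * \<psi> r) = 2 * (LINT r|lborel. mass M1 M2 R1 R2 us r * d 2 r) - (LINT r|lborel. d 1 r)"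
    unfolding e using Bochner_Integration.integral_diff[OF integrable_mult_right[OF mb(2)] i1] by simp
  also have "(LINT r|lborel. d 1 r) = 0" by (rule integral_deriv_compact_support[OF D cd z])
  also have "(LINT r|lborel. mass M1 M2 R1 R2 us r * d 2 r) = - \<beta> * (LINT r|lborel. indicator {a<..<R2} r * (r\<^sup>2 * (\<psi> r / r ^ 2)))"
    by (rule mb(1))
  also have "(LINT r|lborel. indicator {a<..<R2} r * (r\<^sup>2 * (\<psi> r / r ^ 2))) = (LINT r|lborel. indicator {a<..<R2} r * \<psi> r)"
    using a_facts by (intro Bochner_Integration.integral_cong) (auto simp: indicator_def)
  finally show ?thesis by simp
qed

text \<open>Here \<eta> is the derivative of \<psi> / r, and r^2 \<eta> is the derivative of r
  \<psi> minus 2 \<psi>. Integrated over (a, R2), the exact derivative leaves the values of r \<psi>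
  at the two ends, which are the Dirac terms.\<close>

lemma slice_s:
  fixes \<psi> \<psi>' \<psi>'' :: "real \<Rightarrow> real"
  assumes \<psi>: "\<And>r. (\<psi> has_real_derivative \<psi>' r) (at r)" "\<And>r. (\<psi>' has_real_derivative \<psi>'' r) (at r)" "continuous_on UNIV \<psi>''"
    and z: "\<And>r. r \<notin> {L..R} \<Longrightarrow> \<psi> r = 0" "\<And>r. r \<notin> {L..R} \<Longrightarrow> \<psi>' r = 0" "\<And>r. r \<notin> {L..R} \<Longrightarrow> \<psi>'' r = 0" "0 < L"
  shows "(LINT r|lborel. Fs r * (1 / 2 * \<psi>'' r + 1 / r^2 * \<psi> r - 1 / r * \<psi>' r))
    = - 2 * \<beta> * (LINT r|lborel. indicator {a<..<R2} r * \<psi> r) - \<beta> * a * \<psi> a + \<beta> * R2 * \<psi> R2"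
proof -
  have c: "continuous_on S \<psi>" "continuous_on S \<psi>'" for S
    by (intro continuous_at_imp_continuous_on ballI DERIV_isCont[OF \<psi>(1)] DERIV_isCont[OF \<psi>(2)])+
  have cp: "continuous_on UNIV (\<lambda>r. \<psi> r / r ^ k)" "continuous_on UNIV (\<lambda>r. \<psi>' r / r ^ k)" "continuous_on UNIV (\<lambda>r. \<psi>'' r / r ^ k)" for k
    by (rule continuous_divide_power[OF c(1) z(1,4)] continuous_divide_power[OF c(2) z(2,4)] continuous_divide_power[OF \<psi>(3) z(3,4)]; assumption)+
  have D1: "((\<lambda>r. \<psi> r / r ^ k) has_real_derivative \<psi>' r / r ^ k - real k * \<psi> r / r ^ Suc k) (at r)" for k r
    by (rule DERIV_divide_power[OF \<psi>(1) z(1,2,4)])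
  have D2: "((\<lambda>r. \<psi>' r / r ^ k) has_real_derivative \<psi>'' r / r ^ k - real k * \<psi>' r / r ^ Suc k) (at r)" for k r
    by (rule DERIV_divide_power[OF \<psi>(2) z(2,3,4)])
  define \<eta> where "\<eta> r = \<psi>' r / r ^ 1 - \<psi> r / r ^ 2" for r
  define \<eta>' where "\<eta>' r = (\<psi>'' r / r ^ 1 - \<psi>' r / r ^ 2) - (\<psi>' r / r ^ 2 - 2 * (\<psi> r / r ^ 3))" for r
  have D\<eta>: "(\<eta> has_real_derivative \<eta>' r) (at r)" for r
  proof -
    have "(\<eta> has_real_derivative (\<psi>'' r / r ^ 1 - real 1 * \<psi>' r / r ^ Suc 1) - (\<psi>' r / r ^ 2 - real 2 * \<psi> r / r ^ Suc 2)) (at r)"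
      unfolding \<eta>_def[abs_def] by (intro DERIV_diff D1 D2)
    then show ?thesis by (simp add: \<eta>'_def numeral_2_eq_2 numeral_3_eq_3)
  qed
  have c\<eta>: "continuous_on UNIV \<eta>" "continuous_on UNIV \<eta>'"
    unfolding \<eta>_def[abs_def] \<eta>'_def[abs_def] by (intro continuous_on_diff continuous_on_mult continuous_on_const cp)+
  have z\<eta>: "\<And>r. r \<notin> {L..R} \<Longrightarrow> \<eta> r = 0" "\<And>r. r \<notin> {L..R} \<Longrightarrow> \<eta>' r = 0" using z by (auto simp: \<eta>_def \<eta>'_def)
  have D1': "((\<lambda>r. \<psi> r / r ^ 1) has_real_derivative \<eta> r) (at r)" for r using D1[of 1 r] by (simp add: \<eta>_def numeral_2_eq_2)
  have i1: "integrable lborel (\<lambda>r. 1 / 2 * \<psi>'' r)" by (intro integrable_mult_right integrable_continuous_interval_support[OF \<psi>(3) z(3)])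
  have i2: "integrable lborel \<eta>" by (rule integrable_continuous_interval_support[OF c\<eta>(1) z\<eta>(1)])
  note mb = mass_us_by_parts[OF D\<eta> c\<eta>(2) z\<eta>]
  have e: "Fs r * (1 / 2 * \<psi>'' r + 1 / r^2 * \<psi> r - 1 / r * \<psi>' r) = (1 / 2 * \<psi>'' r - \<eta> r) - mass M1 M2 R1 R2 us r * \<eta>' r" for r
  proof (cases "r = 0")
    case False
    then show ?thesis unfolding Fs_eq lapse_def \<eta>_def \<eta>'_def by (simp add: field_simps power2_eq_square power3_eq_cube)
  qed (use z(1)[of r] z(2)[of r] z(3)[of r] z(4) in \<open>simp add: \<eta>_def \<eta>'_def\<close>)
  have "(LINT r|lborel. Fs r * (1 / 2 * \<psi>'' r + 1 / r^2 * \<psi> r - 1 / r * \<psi>' r)) = ((LINT r|lborel. 1 / 2 * \<psi>'' r) - (LINT r|lborel. \<eta> r)) - (LINT r|lborel. mass M1 M2 R1 R2 us r * \<eta>' r)"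
    unfolding e using Bochner_Integration.integral_diff[OF Bochner_Integration.integrable_diff[OF i1 i2] mb(2)] Bochner_Integration.integral_diff[OF i1 i2] by simp
  also have "(LINT r|lborel. 1 / 2 * \<psi>'' r) = 0" using integral_deriv_compact_support[OF \<psi>(2,3) z(2,3)] by simp
  also have "(LINT r|lborel. \<eta> r) = 0" by (rule integral_deriv_compact_support[OF D1' c\<eta>(1) _ z\<eta>(1), of L R]) (use z in auto)
  also have "(LINT r|lborel. mass M1 M2 R1 R2 us r * \<eta>' r) = - \<beta> * (LINT r|lborel. indicator {a<..<R2} r * (r\<^sup>2 * \<eta> r))" by (rule mb(1))
  also have "(LINT r|lborel. indicator {a<..<R2} r * (r\<^sup>2 * \<eta> r)) = (R2 * \<psi> R2 - a * \<psi> a) - 2 * (LINT r|lborel. indicator {a<..<R2} r * \<psi> r)"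
  proof -
    have d: "((\<lambda>r. r * \<psi> r) has_real_derivative 1 * \<psi> r + \<psi>' r * r) (at r)" for r by (rule DERIV_mult[OF DERIV_ident \<psi>(1)])
    have cd: "continuous_on S (\<lambda>r. 1 * \<psi> r + \<psi>' r * r)" for S by (intro continuous_intros c)
    note o = integral_open_interval_deriv[OF less_imp_le[OF a_facts(2)] d cd]
    have ci: "integrable lborel (\<lambda>r. 2 * (indicator {a<..<R2} r * \<psi> r))"
    proof -
      have "integrable lborel (\<lambda>r. \<psi> r * indicator {a<..<R2} r)"
        by (rule integrable_real_mult_indicator[OF _ integrable_continuous_interval_support[OF c(1) z(1)]]) simp
      then have "integrable lborel (\<lambda>r. indicator {a<..<R2} r * \<psi> r)" by (simp only: mult.commute)
      then show ?thesis by (rule integrable_mult_right)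
    qed
    have "indicator {a<..<R2} r * (r\<^sup>2 * \<eta> r) = indicator {a<..<R2} r * (1 * \<psi> r + \<psi>' r * r) - 2 * (indicator {a<..<R2} r * \<psi> r)" for r
      using a_facts by (auto simp: indicator_def \<eta>_def field_simps power2_eq_square)
    then have "(LINT r|lborel. indicator {a<..<R2} r * (r\<^sup>2 * \<eta> r)) = (LINT r|lborel. indicator {a<..<R2} r * (1 * \<psi> r + \<psi>' r * r) - 2 * (indicator {a<..<R2} r * \<psi> r))"
      by presburger
    also have "\<dots> = (R2 * \<psi> R2 - a * \<psi> a) - (LINT r|lborel. 2 * (indicator {a<..<R2} r * \<psi> r))"
      by (subst Bochner_Integration.integral_diff[OF o(2) ci]) (simp only: o(1))
    finally show ?thesis by simp
  qed
  finally show ?thesis by (simp add: algebra_simps)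
qed

end

section \<open>From radial slices back to the chart\<close>

locale shell_test = shell + event_test I \<phi> for I \<phi> +
  assumes I2: "I \<subseteq> {2 * M1<..}"
begin

lemma F_bounds_I: "u \<in> A_BV R1 R2 \<Longrightarrow> \<forall>r\<in>I. \<bar>F u r\<bar> \<le> 1"
proof
  fix r assume u: "u \<in> A_BV R1 R2" and "r \<in> I"
  then have "2 * M1 < r" using I2 by auto
  from F_unit_bounds[OF u this] show "\<bar>F u r\<bar> \<le> 1" by simp
qed

lemma slice_facts:
  obtains L R where "0 < L" "\<And>y r. ((\<lambda>r. \<phi> (fst y, r, snd y)) has_real_derivative D (fst y, r, snd y)) (at r)"
    "\<And>y r. ((\<lambda>r. D (fst y, r, snd y)) has_real_derivative DD (fst y, r, snd y)) (at r)"
    "\<And>y. continuous_on UNIV (\<lambda>r. D (fst y, r, snd y))" "\<And>y. continuous_on UNIV (\<lambda>r. DD (fst y, r, snd y))"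
    "\<And>y r. r \<notin> {L..R} \<Longrightarrow> \<phi> (fst y, r, snd y) = 0" "\<And>y r. r \<notin> {L..R} \<Longrightarrow> D (fst y, r, snd y) = 0" "\<And>y r. r \<notin> {L..R} \<Longrightarrow> DD (fst y, r, snd y) = 0"
proof (rule slice)
  fix L R assume L: "0 < L" "\<And>y r. r \<notin> {L..R} \<Longrightarrow> (fst y, r, snd y) \<notin> S"
  show thesis
  proof (rule that[OF L(1)])
    show "((\<lambda>r. \<phi> (fst y, r, snd y)) has_real_derivative D (fst y, r, snd y)) (at r)" for y r
      by (rule has_derivative_slice[OF smooth_facts(1)])
    show "((\<lambda>r. D (fst y, r, snd y)) has_real_derivative DD (fst y, r, snd y)) (at r)" for y r
      by (rule has_derivative_slice[OF smooth_facts(2)])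
    show "continuous_on UNIV (\<lambda>r. D (fst y, r, snd y))" for y
      by (rule continuous_on_compose2[OF smooth_facts(4)[of UNIV]]) (auto intro!: continuous_intros)
    show "continuous_on UNIV (\<lambda>r. DD (fst y, r, snd y))" for y
      by (rule continuous_on_compose2[OF smooth_facts(5)[of UNIV]]) (auto intro!: continuous_intros)
  qed (use L(2) zero in blast)+
qed

lemma indicator_integrable: "integrable lborel (\<lambda>x. indicator {a<..<R2} (rad x) * \<phi> x)"
proof (rule integrable_bounded_mult[of _ 1])
  have "(rad :: event \<Rightarrow> real) \<in> borel_measurable borel" by (intro borel_measurable_continuous_onI continuous_intros)
  then show "(\<lambda>x :: event. indicat_real {a<..<R2} (rad x)) \<in> borel_measurable borel" by measurable
  show "integrable lborel \<phi>" by (rule integrable_continuous_compact_support[OF smooth_facts(3) S(1) zero(1)])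
qed (auto simp: zero indicator_def)

lemma delta_integrable: "integrable lborel (\<lambda>y. \<phi> (fst y, c, snd y))"
proof (rule integrable_continuous_compact_support[of _ "(\<lambda>x. (fst x, snd (snd x))) ` S"])
  show "continuous_on UNIV (\<lambda>y. \<phi> (fst y, c, snd y))"
    by (rule continuous_on_compose2[OF smooth_facts(3)[of UNIV]]) (auto intro!: continuous_intros)
  show "compact ((\<lambda>x. (fst x, snd (snd x))) ` S)" by (intro compact_continuous_image S continuous_intros)
  fix y assume y: "y \<notin> (\<lambda>x. (fst x, snd (snd x))) ` S"
  have "(fst y, c, snd y) \<notin> S"
  proof
    assume "(fst y, c, snd y) \<in> S"
    then have "(fst y, snd y) \<in> (\<lambda>x. (fst x, snd (snd x))) ` S" by (force intro: rev_image_eqI)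
    then show False using y by simp
  qed
  then show "\<phi> (fst y, c, snd y) = 0" by (rule zero(1))
qed

lemma fun_distrib_slices:
  "fun_distrib (\<lambda>x. indicator {a<..<R2} (rad x)) \<phi> = (LINT y|lborel. LINT r|lborel. indicator {a<..<R2} r * \<phi> (fst y, r, snd y))"
  "integrable lborel (\<lambda>y. LINT r|lborel. indicator {a<..<R2} r * \<phi> (fst y, r, snd y))"
  using integral_event_slices[OF indicator_integrable] by (simp_all add: fun_distrib_def)

lemma einstein_star:
  "m \<in> {Ct, Cr} \<Longrightarrow> einstein Fs m m \<phi> = - 2 * \<beta> * fun_distrib (\<lambda>x. indicator {a<..<R2} (rad x)) \<phi>"
  "m \<in> {Cth, Cph} \<Longrightarrow> einstein Fs m m \<phi> = - 2 * \<beta> * fun_distrib (\<lambda>x. indicator {a<..<R2} (rad x)) \<phi> - \<beta> * a * delta_r a \<phi> + \<beta> * R2 * delta_r R2 \<phi>"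
  "m \<noteq> n \<Longrightarrow> einstein Fs m n \<phi> = 0"
proof -
  have Fm: "(\<lambda>x :: event. Fs (rad x)) \<in> borel_measurable borel" "\<forall>r\<in>I. \<bar>Fs r\<bar> \<le> 1"
    unfolding Fs_eq using F_borel(2)[OF us_A_BV(1)] F_bounds_I[OF us_A_BV(1)] by auto
  note E = einstein_eq[OF Fm]
  obtain L R where s: "0 < L" "\<And>y r. ((\<lambda>r. \<phi> (fst y, r, snd y)) has_real_derivative D (fst y, r, snd y)) (at r)"
    "\<And>y r. ((\<lambda>r. D (fst y, r, snd y)) has_real_derivative DD (fst y, r, snd y)) (at r)"
    "\<And>y. continuous_on UNIV (\<lambda>r. D (fst y, r, snd y))" "\<And>y. continuous_on UNIV (\<lambda>r. DD (fst y, r, snd y))"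
    "\<And>y r. r \<notin> {L..R} \<Longrightarrow> \<phi> (fst y, r, snd y) = 0" "\<And>y r. r \<notin> {L..R} \<Longrightarrow> D (fst y, r, snd y) = 0" "\<And>y r. r \<notin> {L..R} \<Longrightarrow> DD (fst y, r, snd y) = 0"
    by (rule slice_facts) blast
  show "einstein Fs m n \<phi> = 0" if "m \<noteq> n" by (rule E(3)[OF that])
  have it: "integrable lborel (\<lambda>x. Fs (rad x) * \<Theta>t x)" "integrable lborel (\<lambda>x. Fs (rad x) * \<Theta>s x)"
    by (rule integrable_bounded_mult[OF Fm \<Theta>_facts(1)] integrable_bounded_mult[OF Fm \<Theta>_facts(2)]; simp add: \<Theta>_facts)+
  show "einstein Fs m m \<phi> = - 2 * \<beta> * fun_distrib (\<lambda>x. indicator {a<..<R2} (rad x)) \<phi>" if "m \<in> {Ct, Cr}"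
  proof -
    have i: "integrable lborel (\<lambda>x. Fs (rad x) * \<Theta>t x - 1 / (rad x)^2 * \<phi> x)" by (rule Bochner_Integration.integrable_diff[OF it(1) \<Theta>_facts(5)])
    have "einstein Fs m m \<phi> = (LINT x|lborel. Fs (rad x) * \<Theta>t x - 1 / (rad x)^2 * \<phi> x)"
      unfolding E(1)[OF that] by (rule Bochner_Integration.integral_diff[symmetric, OF it(1) \<Theta>_facts(5)])
    also have "\<dots> = (LINT y|lborel. LINT r|lborel. Fs r * (2 / r^2 * \<phi> (fst y, r, snd y) - 1 / r * D (fst y, r, snd y)) - 1 / r^2 * \<phi> (fst y, r, snd y))"
      unfolding integral_event_slices(1)[OF i] by (simp only: \<Theta>t_def fst_conv snd_conv)
    also have "\<dots> = (LINT y|lborel. - 2 * \<beta> * (LINT r|lborel. indicator {a<..<R2} r * \<phi> (fst y, r, snd y)))"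
      by (intro Bochner_Integration.integral_cong refl slice_t[OF s(2,4,6,7,1)])
    also have "\<dots> = - 2 * \<beta> * fun_distrib (\<lambda>x. indicator {a<..<R2} (rad x)) \<phi>"
      unfolding fun_distrib_slices(1) by (rule integral_mult_right_zero)
    finally show ?thesis .
  qed
  show "einstein Fs m m \<phi> = - 2 * \<beta> * fun_distrib (\<lambda>x. indicator {a<..<R2} (rad x)) \<phi> - \<beta> * a * delta_r a \<phi> + \<beta> * R2 * delta_r R2 \<phi>" if "m \<in> {Cth, Cph}"
  proof -
    have "einstein Fs m m \<phi> = (LINT y|lborel. LINT r|lborel. Fs r * (1 / 2 * DD (fst y, r, snd y) + 1 / r^2 * \<phi> (fst y, r, snd y) - 1 / r * D (fst y, r, snd y)))"
      unfolding E(2)[OF that] integral_event_slices(1)[OF it(2)] by (simp only: \<Theta>s_def fst_conv snd_conv)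
    also have "\<dots> = (LINT y|lborel. - 2 * \<beta> * (LINT r|lborel. indicator {a<..<R2} r * \<phi> (fst y, r, snd y)) - \<beta> * a * \<phi> (fst y, a, snd y) + \<beta> * R2 * \<phi> (fst y, R2, snd y))"
      by (intro Bochner_Integration.integral_cong refl slice_s[OF s(2,3,5,6,7,8,1)])
    also have "\<dots> = (LINT y|lborel. - 2 * \<beta> * (LINT r|lborel. indicator {a<..<R2} r * \<phi> (fst y, r, snd y)) - \<beta> * a * \<phi> (fst y, a, snd y)) + (LINT y|lborel. \<beta> * R2 * \<phi> (fst y, R2, snd y))"
      by (intro Bochner_Integration.integral_add Bochner_Integration.integrable_diff integrable_mult_right fun_distrib_slices delta_integrable)
    also have "(LINT y|lborel. - 2 * \<beta> * (LINT r|lborel. indicator {a<..<R2} r * \<phi> (fst y, r, snd y)) - \<beta> * a * \<phi> (fst y, a, snd y)) = (LINT y|lborel. - 2 * \<beta> * (LINT r|lborel. indicator {a<..<R2} r * \<phi> (fst y, r, snd y))) - (LINT y|lborel. \<beta> * a * \<phi> (fst y, a, snd y))"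
      by (intro Bochner_Integration.integral_diff integrable_mult_right fun_distrib_slices delta_integrable)
    finally show ?thesis unfolding fun_distrib_slices(1) delta_r_def by (simp only: integral_mult_right_zero)
  qed
qed

end


section \<open>Convergence of the metrics\<close>

lemma uniform_limit_bound:
  fixes f :: "nat \<Rightarrow> 'a \<Rightarrow> real"
  assumes "\<And>n x. x \<in> S \<Longrightarrow> \<bar>f n x - l x\<bar> \<le> c n" "c \<longlonglongrightarrow> 0"
  shows "uniform_limit S f l sequentially"
proof (rule uniform_limitI)
  fix e :: real assume "0 < e"
  with assms(2) have "eventually (\<lambda>n. c n < e) sequentially" by (rule order_tendstoD(2))
  then show "eventually (\<lambda>n. \<forall>x\<in>S. dist (f n x) (l x) < e) sequentially"
    by eventually_elim (auto simp: dist_real_def intro: le_less_trans[OF assms(1)])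
qed

lemma loc_lipschitzI:
  assumes "\<And>x. x \<in> U \<Longrightarrow> \<exists>e>0. \<exists>L. \<forall>y\<in>U \<inter> ball x e. \<forall>z\<in>U \<inter> ball x e. \<bar>f y - f z\<bar> \<le> L * dist y z"
  shows "loc_lipschitz U f"
  unfolding loc_lipschitz_def
proof
  fix x assume "x \<in> U"
  then obtain e L where e: "0 < e" and L: "\<forall>y\<in>U \<inter> ball x e. \<forall>z\<in>U \<inter> ball x e. \<bar>f y - f z\<bar> \<le> L * dist y z" using assms by blast
  have "\<bar>L\<bar>-lipschitz_on (U \<inter> ball x e) f"
  proof (rule lipschitz_onI)
    fix y z assume "y \<in> U \<inter> ball x e" "z \<in> U \<inter> ball x e"
    then have "\<bar>f y - f z\<bar> \<le> L * dist y z" using L by blast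
    also have "\<dots> \<le> \<bar>L\<bar> * dist y z" by (intro mult_right_mono) auto
    finally show "dist (f y) (f z) \<le> \<bar>L\<bar> * dist y z" by (simp add: dist_real_def)
  qed simp
  then show "\<exists>e>0. \<exists>L. L-lipschitz_on (U \<inter> ball x e) f" using e by blast
qed

lemma rad_dist: "\<bar>rad y - rad z\<bar> \<le> dist y z" and polar_dist: "\<bar>polar y - polar z\<bar> \<le> dist y z"
proof -
  have "dist (rad y) (rad z) \<le> dist (snd y) (snd z)" by (rule dist_fst_le)
  also have "\<dots> \<le> dist y z" by (rule dist_snd_le)
  finally show "\<bar>rad y - rad z\<bar> \<le> dist y z" by (simp add: dist_real_def)
  have "dist (polar y) (polar z) \<le> dist (snd (snd y)) (snd (snd z))" by (rule dist_fst_le)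
  also have "\<dots> \<le> dist (snd y) (snd z)" by (rule dist_snd_le)
  also have "\<dots> \<le> dist y z" by (rule dist_snd_le)
  finally show "\<bar>polar y - polar z\<bar> \<le> dist y z" by (simp add: dist_real_def)
qed

lemma square_lipschitz:
  fixes y z :: real assumes "\<bar>y\<bar> \<le> B" "\<bar>z\<bar> \<le> B" shows "\<bar>y\<^sup>2 - z\<^sup>2\<bar> \<le> 2 * B * \<bar>y - z\<bar>"
proof -
  have "\<bar>y\<^sup>2 - z\<^sup>2\<bar> = \<bar>y + z\<bar> * \<bar>y - z\<bar>" unfolding power2_eq_square square_diff_square_factored abs_mult ..
  also have "\<dots> \<le> (2 * B) * \<bar>y - z\<bar>" using assms by (intro mult_right_mono) auto
  finally show ?thesis .
qed

lemma sin_lipschitz: "\<bar>sin x - sin y\<bar> \<le> \<bar>x - y\<bar>" for x y :: real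
proof -
  have "\<bar>sin x - sin y\<bar> = 2 * \<bar>sin ((x - y) / 2)\<bar> * \<bar>cos ((x + y) / 2)\<bar>" by (simp add: sin_diff_sin abs_mult)
  also have "\<dots> \<le> 2 * \<bar>(x - y) / 2\<bar> * 1"
    by (intro mult_mono abs_sin_x_le_abs_x order_refl abs_cos_le_one) auto
  finally show ?thesis by simp
qed

lemma loc_lipschitz_angular: "loc_lipschitz (chart I) (\<lambda>x. (rad x)\<^sup>2)" "loc_lipschitz (chart I) (\<lambda>x. (rad x)\<^sup>2 * (sin (polar x))\<^sup>2)"
proof -
  have b: "\<bar>rad y\<bar> \<le> \<bar>rad x\<bar> + 1" if "y \<in> ball x 1" for x y :: event
    using that rad_dist[of x y] by (simp only: mem_ball; linarith)
  have r: "\<bar>(rad y)\<^sup>2 - (rad z)\<^sup>2\<bar> \<le> 2 * (\<bar>rad x\<bar> + 1) * dist y z" if "y \<in> ball x 1" "z \<in> ball x 1" for x y z :: event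
    using square_lipschitz[OF b[OF that(1)] b[OF that(2)]] mult_left_mono[OF rad_dist[of y z], of "2 * (\<bar>rad x\<bar> + 1)"] by simp
  show "loc_lipschitz (chart I) (\<lambda>x. (rad x)\<^sup>2)"
    by (rule loc_lipschitzI) (use r in \<open>blast intro: zero_less_one\<close>)
  have s: "\<bar>(sin (polar y))\<^sup>2 - (sin (polar z))\<^sup>2\<bar> \<le> 2 * dist y z" for y z :: event
    using square_lipschitz[of "sin (polar y)" 1 "sin (polar z)"] sin_lipschitz[of "polar y" "polar z"] polar_dist[of y z] by simp
  have "\<bar>(rad y)\<^sup>2 * (sin (polar y))\<^sup>2 - (rad z)\<^sup>2 * (sin (polar z))\<^sup>2\<bar> \<le> (2 * (\<bar>rad x\<bar> + 1) + (\<bar>rad x\<bar> + 1)\<^sup>2 * 2) * dist y z"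
    if "y \<in> ball x 1" "z \<in> ball x 1" for x y z :: event
  proof -
    have 1: "(rad y)\<^sup>2 * (sin (polar y))\<^sup>2 - (rad z)\<^sup>2 * (sin (polar z))\<^sup>2
      = ((rad y)\<^sup>2 - (rad z)\<^sup>2) * (sin (polar y))\<^sup>2 + (rad z)\<^sup>2 * ((sin (polar y))\<^sup>2 - (sin (polar z))\<^sup>2)" by (simp add: algebra_simps)
    have 2: "\<bar>((rad y)\<^sup>2 - (rad z)\<^sup>2) * (sin (polar y))\<^sup>2\<bar> \<le> \<bar>(rad y)\<^sup>2 - (rad z)\<^sup>2\<bar> * 1"
      unfolding abs_mult by (intro mult_left_mono) (auto simp: abs_square_le_1)
    have 3: "\<bar>(rad z)\<^sup>2 * ((sin (polar y))\<^sup>2 - (sin (polar z))\<^sup>2)\<bar> \<le> (\<bar>rad x\<bar> + 1)\<^sup>2 * (2 * dist y z)"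
      unfolding abs_mult using b[OF that(2)] by (intro mult_mono s) (auto simp: abs_le_square_iff[symmetric])
    have tri: "\<bar>X\<bar> \<le> p + q" if "X = Y + Z" "\<bar>Y\<bar> \<le> p" "\<bar>Z\<bar> \<le> q" for X Y Z p q :: real using that by linarith
    have "\<bar>(rad y)\<^sup>2 * (sin (polar y))\<^sup>2 - (rad z)\<^sup>2 * (sin (polar z))\<^sup>2\<bar> \<le> 2 * (\<bar>rad x\<bar> + 1) * dist y z + (\<bar>rad x\<bar> + 1)\<^sup>2 * (2 * dist y z)"
      by (rule tri[OF 1 order_trans[OF 2[unfolded mult_1_right] r[OF that]] 3])
    then show ?thesis by (simp add: distrib_right)
  qed
  then show "loc_lipschitz (chart I) (\<lambda>x. (rad x)\<^sup>2 * (sin (polar x))\<^sup>2)"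
    by (intro loc_lipschitzI) (meson IntD2 zero_less_one)
qed

lemma loc_lipschitz_shell_metric:
  assumes K: "\<And>r s. r \<in> I \<Longrightarrow> s \<in> I \<Longrightarrow> \<bar>f r - f s\<bar> \<le> K * \<bar>r - s\<bar>" and pos: "\<And>r. r \<in> I \<Longrightarrow> 0 < f r" and "0 \<le> K"
  shows "loc_lipschitz (chart I) (\<lambda>x. shell_metric f x m n)"
proof -
  have k: "\<bar>f (rad y) - f (rad z)\<bar> \<le> K * dist y z" if "y \<in> chart I" "z \<in> chart I" for y z
    using K[of "rad y" "rad z"] mult_left_mono[OF rad_dist[of y z] \<open>0 \<le> K\<close>] that by (auto simp: chart_def)
  have t: "loc_lipschitz (chart I) (\<lambda>x. - f (rad x))"
  proof (rule loc_lipschitzI)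
    have "\<bar>- f (rad y) - - f (rad z)\<bar> \<le> K * dist y z" if "y \<in> chart I" "z \<in> chart I" for y z
      using k[OF that] by simp
    then show "\<exists>e>0. \<exists>L. \<forall>y\<in>chart I \<inter> ball x e. \<forall>z\<in>chart I \<inter> ball x e. \<bar>- f (rad y) - - f (rad z)\<bar> \<le> L * dist y z" for x
      by (meson IntD1 zero_less_one)
  qed
  have r: "loc_lipschitz (chart I) (\<lambda>x. inverse (f (rad x)))"
  proof (rule loc_lipschitzI)
    fix x assume x: "x \<in> chart I"
    \<comment> \<open>On the ball of radius e defined next the function drops by at most K e \<le>
      c, so it stays above half its central value; the divisor K + 1 is positive even for K =
      0.\<close>
    define c where "c = f (rad x) / 2"
    define e where "e = c / (K + 1)"
    have c: "0 < c" "f (rad x) = 2 * c" using pos[of "rad x"] x by (auto simp: c_def chart_def)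
    have e: "0 < e" "K * e \<le> c" using c(1) \<open>0 \<le> K\<close> by (auto simp: e_def field_simps)
    have l: "c \<le> f (rad y)" if y: "y \<in> chart I \<inter> ball x e" for y
    proof -
      have "\<bar>f (rad x) - f (rad y)\<bar> \<le> K * dist x y" using k x y by auto
      also have "\<dots> \<le> K * e" using y \<open>0 \<le> K\<close> by (intro mult_left_mono) auto
      finally show ?thesis using e(2) c(2) by linarith
    qed
    have "\<bar>inverse (f (rad y)) - inverse (f (rad z))\<bar> \<le> K / c\<^sup>2 * dist y z" if y: "y \<in> chart I \<inter> ball x e" and z: "z \<in> chart I \<inter> ball x e" for y z
    proof -
      have p: "0 < f (rad y)" "0 < f (rad z)" using l[OF y] l[OF z] c(1) by linarith+
      then have "inverse (f (rad y)) - inverse (f (rad z)) = (f (rad z) - f (rad y)) / (f (rad y) * f (rad z))" by (simp add: field_simps)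
      then have "\<bar>inverse (f (rad y)) - inverse (f (rad z))\<bar> = \<bar>f (rad z) - f (rad y)\<bar> / (f (rad y) * f (rad z))"
        using p by (simp add: abs_mult)
      also have "\<dots> \<le> (K * dist y z) / (c * c)"
        using k[of z y] y z l[OF y] l[OF z] c(1) p by (intro frac_le mult_mono) (auto simp: dist_commute)
      finally show ?thesis by (simp add: power2_eq_square)
    qed
    then show "\<exists>e>0. \<exists>L. \<forall>y\<in>chart I \<inter> ball x e. \<forall>z\<in>chart I \<inter> ball x e. \<bar>inverse (f (rad y)) - inverse (f (rad z))\<bar> \<le> L * dist y z"
      using e(1) by blast
  qed
  have "loc_lipschitz (chart I) (\<lambda>x. 0)" by (rule loc_lipschitzI) (auto intro!: exI[of _ 1])
  then show ?thesis using t r loc_lipschitz_angular[of I] by (cases "m = n"; cases m) (simp_all add: shell_metric_def)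
qed

context shell begin

lemma F_outside: "r \<notin> {R1..R2} \<Longrightarrow> F u r = F v r"
  by (auto simp: lapse_def mass_def enclosed_def)

lemma shell_metric_diff:
  assumes "u \<in> A_BV R1 R2"
  shows "\<bar>shell_metric (F u) x m n - shell_metric Fs x m n\<bar> \<le> (KF + KF / F0\<^sup>2) * L1_dist u us"
proof -
  have nn: "0 \<le> KF * L1_dist u us" "0 \<le> KF / F0\<^sup>2 * L1_dist u us" using KF_nonneg L1_dist_nonneg by simp_all
  have b1: "\<bar>- F u r - - Fs r\<bar> \<le> KF * L1_dist u us" for r
    using F_diff[OF assms us_A_BV(1), of r] by (simp add: Fs_eq KF_def abs_minus_commute)
  have b2: "\<bar>inverse (F u r) - inverse (Fs r)\<bar> \<le> KF / F0\<^sup>2 * L1_dist u us" for r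
  proof (cases "r \<in> {R1..R2}")
    case True
    then show ?thesis using F_inverse_diff[OF assms us_A_BV(1)] by (simp add: Fs_eq)
  next
    case False
    then show ?thesis using F_outside[of r u us] nn by (simp add: Fs_eq)
  qed
  have "\<bar>shell_metric (F u) x m n - shell_metric Fs x m n\<bar> \<le> KF * L1_dist u us + KF / F0\<^sup>2 * L1_dist u us"
    using nn b1[of "rad x"] b2[of "rad x"] by (cases "m = n"; cases m) (simp_all add: shell_metric_def)
  then show ?thesis by (simp add: distrib_right)
qed

lemma minimizing_metric_limit:
  assumes "minimizing u"
  shows "uniform_limit (chart I) (\<lambda>k x. shell_metric (F (u k)) x m n) (\<lambda>x. shell_metric Fs x m n) sequentially"
proof (rule uniform_limit_bound)
  note L = minimizing_limits[OF assms]
  show "\<bar>shell_metric (F (u k)) x m n - shell_metric Fs x m n\<bar> \<le> (KF + KF / F0\<^sup>2) * L1_dist (u k) us" for k x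
    by (rule shell_metric_diff[OF L(1)])
  have "(\<lambda>k. (KF + KF / F0\<^sup>2) * L1_dist (u k) us) \<longlonglongrightarrow> (KF + KF / F0\<^sup>2) * 0"
    by (rule tendsto_mult_left) (use L(2) in \<open>simp add: L1_conv_def\<close>)
  then show "(\<lambda>k. (KF + KF / F0\<^sup>2) * L1_dist (u k) us) \<longlonglongrightarrow> 0" by simp
qed

lemma P_us_lipschitz: "\<bar>P us r - P us s\<bar> \<le> H * R2\<^sup>2 * \<bar>r - s\<bar>"
proof -
  \<comment> \<open>Clamping r to [a, R2] is 1-Lipschitz and turns the three cases of
    \<open>P_us\<close> into one cubic.\<close>
  define c where "c r = max a (min R2 r)" for r
  have e: "P us r = inner_P (c r)" for r using a_facts inner_P_ends by (auto simp: P_us c_def)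
  have c: "0 \<le> c r" "c r \<le> R2" for r using a_facts by (auto simp: c_def)
  have d: "\<bar>c r - c s\<bar> \<le> \<bar>r - s\<bar>" by (auto simp: c_def max_def min_def)
  have "inner_P x - inner_P y = H * (x - y) * (x\<^sup>2 + x * y + y\<^sup>2) / 3" for x y
    by (simp add: inner_P_def field_simps power2_eq_square power3_eq_cube)
  then have "\<bar>P us r - P us s\<bar> = \<bar>H * (c r - c s) * ((c r)\<^sup>2 + c r * c s + (c s)\<^sup>2) / 3\<bar>" by (simp only: e)
  also have "\<dots> = H * \<bar>c r - c s\<bar> * ((c r)\<^sup>2 + c r * c s + (c s)\<^sup>2) / 3"
    unfolding abs_mult abs_divide using H_pos c(1)[of r] c(1)[of s] by simp
  also have "\<dots> \<le> H * \<bar>r - s\<bar> * (R2\<^sup>2 + R2 * R2 + R2\<^sup>2) / 3"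
    using c d H_pos R12 R1_pos by (intro divide_right_mono mult_mono add_mono power_mono) auto
  finally show ?thesis by (simp add: power2_eq_square mult_ac)
qed

text \<open>On r > 2 M1 the quotient of mass and radius is Lipschitz: the mass is bounded by M2 and
  Lipschitz, and 1/r is bounded by 1 / (2 M1).\<close>

lemma Fs_lipschitz:
  assumes "2 * M1 < r" "2 * M1 < s"
  shows "\<bar>Fs r - Fs s\<bar> \<le> ((M2 - M1) * (H * R2\<^sup>2) / M1 + M2 / (2 * M1\<^sup>2)) * \<bar>r - s\<bar>"
proof -
  let ?m = "mass M1 M2 R1 R2 us"
  have p: "0 < r" "0 < s" using assms M1 by linarith+
  have m: "\<bar>?m r - ?m s\<bar> \<le> (M2 - M1) * (H * R2\<^sup>2 * \<bar>r - s\<bar>)"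
  proof -
    have "?m r - ?m s = (M2 - M1) * (P us r - P us s)" by (simp add: mass_def algebra_simps)
    then have "\<bar>?m r - ?m s\<bar> = (M2 - M1) * \<bar>P us r - P us s\<bar>" using M12 by (simp add: abs_mult)
    also have "\<dots> \<le> (M2 - M1) * (H * R2\<^sup>2 * \<bar>r - s\<bar>)" using M12 P_us_lipschitz by (intro mult_left_mono) auto
    finally show ?thesis .
  qed
  have ms: "0 \<le> ?m s" "?m s \<le> M2"
  proof -
    have "0 \<le> (M2 - M1) * P us s" "(M2 - M1) * P us s \<le> (M2 - M1) * 1"
      using P_bounds[OF us_A_BV(1), of s] M12 by (auto intro!: mult_left_mono)
    then show "0 \<le> ?m s" "?m s \<le> M2" using M1 by (auto simp: mass_def)
  qed
  have "Fs r - Fs s = - 2 * ((?m r - ?m s) / r) - 2 * (?m s * (s - r) / (r * s))"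
    using p by (simp add: Fs_eq lapse_def field_simps)
  moreover have "\<bar>(?m r - ?m s) / r\<bar> \<le> (M2 - M1) * (H * R2\<^sup>2 * \<bar>r - s\<bar>) / (2 * M1)"
    unfolding abs_divide using m assms M1 p by (intro frac_le) auto
  moreover have "\<bar>?m s * (s - r) / (r * s)\<bar> \<le> (M2 * \<bar>r - s\<bar>) / ((2 * M1) * (2 * M1))"
    unfolding abs_divide abs_mult using ms assms M1 p by (intro frac_le mult_mono) auto
  ultimately have "\<bar>Fs r - Fs s\<bar> \<le> 2 * ((M2 - M1) * (H * R2\<^sup>2 * \<bar>r - s\<bar>) / (2 * M1)) + 2 * ((M2 * \<bar>r - s\<bar>) / ((2 * M1) * (2 * M1)))"
    by linarith
  also have "\<dots> = ((M2 - M1) * (H * R2\<^sup>2) / M1 + M2 / (2 * M1\<^sup>2)) * \<bar>r - s\<bar>" using M1 by (simp add: field_simps power2_eq_square)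
  finally show ?thesis .
qed

lemma Fs_metric_lipschitz:
  assumes "I \<subseteq> {2 * M1<..}"
  shows "loc_lipschitz (chart I) (\<lambda>x. shell_metric Fs x m n)"
proof (rule loc_lipschitz_shell_metric)
  show "\<bar>Fs r - Fs s\<bar> \<le> ((M2 - M1) * (H * R2\<^sup>2) / M1 + M2 / (2 * M1\<^sup>2)) * \<bar>r - s\<bar>" if "r \<in> I" "s \<in> I" for r s
    using that assms by (intro Fs_lipschitz) auto
  show "0 < Fs r" if "r \<in> I" for r using F_unit_bounds(1)[OF us_A_BV(1), of r] that assms by (auto simp: Fs_eq)
  show "0 \<le> (M2 - M1) * (H * R2\<^sup>2) / M1 + M2 / (2 * M1\<^sup>2)" using M1 M12 H_pos by (intro add_nonneg_nonneg divide_nonneg_nonneg mult_nonneg_nonneg) auto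
qed

end

context shell_test begin

lemma minimizing_einstein_limit:
  assumes "minimizing u"
  shows "(\<lambda>k. einstein (F (u k)) m n \<phi>) \<longlonglongrightarrow> einstein Fs m n \<phi>"
proof -
  note L = minimizing_limits[OF assms]
  have "(\<lambda>k. KF * L1_dist (u k) us) \<longlonglongrightarrow> KF * 0"
    by (rule tendsto_mult_left) (use L(2) in \<open>simp add: L1_conv_def\<close>)
  then have c: "(\<lambda>k. KF * L1_dist (u k) us) \<longlonglongrightarrow> 0" by simp
  show ?thesis unfolding Fs_eq
    by (rule einstein_tendsto[OF F_borel(2)[OF L(1)] F_bounds_I[OF L(1)] F_borel(2)[OF us_A_BV(1)] F_bounds_I[OF us_A_BV(1)] _ c])
      (use F_diff[OF L(1) us_A_BV(1)] in \<open>simp add: KF_def\<close>)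
qed

end


section \<open>Surface layers\<close>

text \<open>Represents k times \<open>delta_r c\<close> as a positive Radon measure, for k \<ge> 0:
  k times the coordinate Lebesgue measure carried by the hypersurface r = c.\<close>

definition layer_measure :: "real \<Rightarrow> real \<Rightarrow> event measure" where
  "layer_measure k c = density (distr lborel borel (\<lambda>y. (fst y, c, snd y))) (\<lambda>_. ennreal k)"

lemma layer_map_measurable: "(\<lambda>y. (fst y, c, snd y)) \<in> (lborel :: (real \<times> real \<times> real) measure) \<rightarrow>\<^sub>M (borel :: event measure)"
proof -
  have "(\<lambda>y. (fst y, c, snd y)) \<in> (borel :: (real \<times> real \<times> real) measure) \<rightarrow>\<^sub>M (borel :: event measure)"
    by (intro borel_measurable_continuous_onI continuous_intros)
  then show ?thesis by simp
qed

lemma emeasure_layer_measure: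
  assumes "X \<in> sets borel"
  shows "emeasure (layer_measure k c) X = ennreal k * emeasure lborel {y. (fst y, c, snd y) \<in> X}"
proof -
  have "emeasure (layer_measure k c) X = ennreal k * emeasure (distr lborel borel (\<lambda>y. (fst y, c, snd y))) X"
    unfolding layer_measure_def by (rule emeasure_density_const) (use assms in simp)
  also have "emeasure (distr lborel borel (\<lambda>y. (fst y, c, snd y))) X = emeasure lborel {y. (fst y, c, snd y) \<in> X}"
    by (subst emeasure_distr[OF layer_map_measurable assms]) (simp add: vimage_def)
  finally show ?thesis .
qed

lemma radon_layer_measure: "radon_on U (layer_measure k c)"
  unfolding radon_on_def
proof (intro conjI allI impI)
  show "sets (layer_measure k c) = sets borel" by (simp add: layer_measure_def)
  fix K assume "compact K \<and> K \<subseteq> U"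
  then have K: "compact K" by simp
  let ?p = "\<lambda>x :: event. (fst x, snd (snd x))"
  have c: "compact (?p ` K)" by (intro compact_continuous_image K continuous_intros)
  have "{y. (fst y, c, snd y) \<in> K} \<subseteq> ?p ` K" by (force intro: rev_image_eqI)
  then have "emeasure lborel {y. (fst y, c, snd y) \<in> K} \<le> emeasure lborel (?p ` K)"
    by (rule emeasure_mono) (use c in \<open>simp add: compact_imp_closed borel_closed\<close>)
  also have "\<dots> < \<infinity>" by (rule emeasure_bounded_finite[OF compact_imp_bounded[OF c]])
  finally show "emeasure (layer_measure k c) K < \<infinity>"
    using K by (subst emeasure_layer_measure) (auto simp: compact_imp_closed ennreal_mult_less_top)
qed

text \<open>The free predicate \<open>Q\<close> lets two layers share one exceptional set. For
  arbitrary \<open>U\<close> the set may fail to be measurable, in which case its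
  \<open>emeasure\<close> is 0 by definition.\<close>

lemma layer_measure_off: "emeasure (layer_measure k c) (U - {x. rad x = c \<or> Q x}) = 0"
proof (cases "U - {x. rad x = c \<or> Q x} \<in> sets borel")
  case True
  then show ?thesis by (simp add: emeasure_layer_measure)
next
  case False
  then show ?thesis by (intro emeasure_notin_sets) (simp add: layer_measure_def)
qed

lemma rad_level_null: "{x :: event. rad x = c} \<in> null_sets lborel"
proof -
  have "{x :: event. rad x = c} = {x. x \<bullet> (0, 1, 0, 0) = c}" by (auto simp: inner_prod_def)
  moreover have "(0, 1, 0, 0) \<in> (Basis :: event set)" by (auto simp: Basis_prod_def zero_prod_def)
  ultimately have "{x :: event. rad x = c} \<in> null_sets lebesgue" using negligible_standard_hyperplane negligible_iff_null_sets by metis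
  moreover have "closed {x :: event. rad x = c}" by (intro closed_Collect_eq continuous_intros)
  ultimately show ?thesis by (subst (asm) null_sets_completion_iff) (auto simp: borel_closed)
qed

lemma integral_layer_measure:
  assumes "\<phi> \<in> borel_measurable borel" "0 \<le> k"
  shows "(LINT x|layer_measure k c. \<phi> x) = k * delta_r c \<phi>"
proof -
  have "(LINT x|layer_measure k c. \<phi> x) = (LINT x|distr lborel borel (\<lambda>y. (fst y, c, snd y)). k *\<^sub>R \<phi> x)"
    unfolding layer_measure_def by (rule integral_density) (use assms in auto)
  also have "\<dots> = (LINT y|lborel. k *\<^sub>R \<phi> (fst y, c, snd y))"
    by (rule integral_distr[OF layer_map_measurable]) (use assms in auto)
  finally show ?thesis by (simp add: delta_r_def)
qed

lemma singular_layers: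
  assumes "\<And>\<phi>. test_fun U \<phi> \<Longrightarrow> T \<phi> = k * delta_r c \<phi> - l * delta_r d \<phi>" "0 \<le> k" "0 \<le> l"
  shows "singular_distrib U T"
  unfolding singular_distrib_def
proof (intro exI conjI allI impI)
  show "radon_on U (layer_measure k c)" "radon_on U (layer_measure l d)" by (rule radon_layer_measure)+
  have "{x :: event. rad x = c} \<union> {x. rad x = d} \<in> null_sets lborel" by (intro null_sets.Un rad_level_null)
  then show "{x :: event. rad x = c \<or> rad x = d} \<in> null_sets lborel" by (simp add: Collect_disj_eq)
  show "emeasure (layer_measure k c) (U - {x. rad x = c \<or> rad x = d}) = 0" by (rule layer_measure_off)
  show "emeasure (layer_measure l d) (U - {x. rad x = c \<or> rad x = d}) = 0"
    using layer_measure_off[of l d U "\<lambda>x. rad x = c"] by (simp only: disj_commute)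
  fix \<phi> assume t: "test_fun U \<phi>"
  then have "smooth \<phi>" by (simp add: test_fun_def)
  then have "Ck 0 \<phi>" unfolding smooth_def by blast
  then have "\<phi> \<in> borel_measurable borel" by (intro borel_measurable_continuous_onI) simp
  then show "T \<phi> = (LINT x|layer_measure k c. \<phi> x) - (LINT x|layer_measure l d. \<phi> x)"
    using assms t by (simp add: integral_layer_measure)
qed

lemma regular_indicator:
  assumes "\<And>\<phi>. test_fun (U :: event set) \<phi> \<Longrightarrow> T \<phi> = k * fun_distrib (\<lambda>x. indicator {c<..<d} (rad x)) \<phi>"
  shows "regular_distrib U T"
  unfolding regular_distrib_def
proof (intro exI[of _ "\<lambda>x. k * indicator {c<..<d} (rad x)"] conjI allI impI)
  fix K :: "event set" assume "compact K \<and> K \<subseteq> U"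
  then have K: "compact K" by simp
  have "(rad :: event \<Rightarrow> real) \<in> borel_measurable borel" by (intro borel_measurable_continuous_onI continuous_intros)
  then have [measurable]: "(\<lambda>x :: event. indicat_real {c<..<d} (rad x)) \<in> borel_measurable borel" by measurable
  have [measurable]: "K \<in> sets borel" using K by (simp add: compact_imp_closed borel_closed)
  show "set_integrable lborel K (\<lambda>x. k * indicator {c<..<d} (rad x))"
    unfolding set_integrable_def
  proof (rule Bochner_Integration.integrable_bound)
    show "integrable lborel (\<lambda>x. k * indicat_real K x)"
      by (intro integrable_mult_right integrable_real_indicator emeasure_bounded_finite compact_imp_bounded K) simp
    show "(\<lambda>x. indicat_real K x *\<^sub>R (k * indicat_real {c<..<d} (rad x))) \<in> borel_measurable lborel" by measurable
  qed (auto simp: indicator_def)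
next
  fix \<phi> :: "event \<Rightarrow> real" assume "test_fun U \<phi>"
  then show "T \<phi> = fun_distrib (\<lambda>x. k * indicator {c<..<d} (rad x)) \<phi>" by (simp add: assms fun_distrib_def mult.assoc)
qed

section \<open>Densities and extrinsic curvature of the hypersurfaces r = const\<close>

lemma UNIV_coord_sum: "(\<Sum>m\<in>UNIV. f m) = f Ct + f Cr + f Cth + f Cph" for f :: "coord \<Rightarrow> real"
  by (simp add: UNIV_coord)

lemma tang_sum: "(\<Sum>m\<in>tang. f m) = f Ct + f Cth + f Cph" for f :: "coord \<Rightarrow> real"
  by (simp add: tang_def)

lemma spacetime_perfect_layer:
  "spacetime_tensor F c (perfect_layer 0 p) m n = (if m = n \<and> m \<in> {Cth, Cph} then p else 0)"
  by (cases m; cases n) (simp_all add: spacetime_tensor_def tang_sum frame_def coframe_def perfect_layer_def)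

text \<open>In the volume density F and 1/F cancel, leaving c^2 sin \<theta>; on the hypersurface
  the factor from 1/F is missing, whence sqrt F.\<close>

lemma density_quotient:
  assumes "0 < F c" "0 < c" "0 < \<theta>" "\<theta> < pi"
  shows "surf_density F (t, c, \<theta>, p) = sqrt (F c) * vol_density F (t, c, \<theta>, p)" "0 < vol_density F (t, c, \<theta>, p)"
proof -
  have s: "0 < sin \<theta>" using assms by (intro sin_gt_zero)
  have "\<bar>\<Prod>m\<in>UNIV. shell_metric F (t, c, \<theta>, p) m m\<bar> = (c\<^sup>2 * sin \<theta>)\<^sup>2"
    using assms s by (simp add: UNIV_coord shell_metric_def abs_mult power2_eq_square)
  then have v: "vol_density F (t, c, \<theta>, p) = c\<^sup>2 * sin \<theta>" using s by (simp add: vol_density_def)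
  have "\<bar>\<Prod>m\<in>tang. shell_metric F (t, c, \<theta>, p) m m\<bar> = F c * (c\<^sup>2 * sin \<theta>)\<^sup>2"
    using assms s by (simp add: tang_def shell_metric_def abs_mult power2_eq_square)
  then show "surf_density F (t, c, \<theta>, p) = sqrt (F c) * vol_density F (t, c, \<theta>, p)"
    unfolding v using s by (simp add: surf_density_def real_sqrt_mult)
  show "0 < vol_density F (t, c, \<theta>, p)" unfolding v using s assms by simp
qed

lemma (in event_test) delta_Sigma_eq:
  assumes "0 < F c" "0 < c"
  shows "delta_Sigma F c \<phi> = sqrt (F c) * delta_r c \<phi>"
proof -
  have "\<phi> (t, c, \<theta>, p) / vol_density F (t, c, \<theta>, p) * surf_density F (t, c, \<theta>, p) = sqrt (F c) * \<phi> (t, c, \<theta>, p)" for t \<theta> p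
  \<comment> \<open>Off the chart \<open>vol_density\<close> may vanish, but there \<phi> is 0 and
    so are both sides.\<close>
  proof (cases "(t, c, \<theta>, p) \<in> S")
    case True
    then have "0 < \<theta>" "\<theta> < pi" using S(3) by (auto simp: chart_def)
    from density_quotient[where F = F and c = c, OF assms this, of t p] show ?thesis by simp
  qed (simp add: zero)
  then have "\<phi> (fst y, c, snd y) / vol_density F (fst y, c, snd y) * surf_density F (fst y, c, snd y) = sqrt (F c) * \<phi> (fst y, c, snd y)" for y
    by (metis prod.collapse)
  then show ?thesis unfolding delta_Sigma_def delta_r_def by simp
qed

lemma pd_const: "pd m (\<lambda>y. c) x = 0"
  using pd_eqI[OF has_derivative_const] .

text \<open>The unit normal has only a radial component and the metric is diagonal, so for
  tangential indices only the Christoffel symbols with upper index r contribute. The covariant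
  derivative of the normal is then half of sqrt F times the radial derivative of the metric.\<close>

lemma ext_curv_mixed_eq:
  assumes F: "(F has_real_derivative F') (at r)" "0 < F r" and r: "0 < r" and \<theta>: "0 < \<theta>" "\<theta> < pi" and AB: "A \<in> tang" "B \<in> tang"
  shows "ext_curv_mixed F (t, r, \<theta>, p) A B = (if A \<noteq> B then 0 else if A = Ct then F' / (2 * sqrt (F r)) else sqrt (F r) / r)"
proof -
  let ?x = "(t, r, \<theta>, p)"
  have s: "0 < sin \<theta>" using \<theta> by (intro sin_gt_zero)
  have rd: "(rad has_derivative (\<lambda>v. fst (snd v))) (at ?x)" by (auto intro!: derivative_eq_intros)
  have sd: "((\<lambda>y. (sin (polar y))\<^sup>2) has_derivative (\<lambda>v. 2 * sin \<theta> * (cos \<theta> * fst (snd (snd v))))) (at ?x)"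
    by (auto intro!: derivative_eq_intros)
  have Fd: "((\<lambda>y. F (rad y)) has_derivative (\<lambda>v. F' * fst (snd v))) (at ?x)"
    using has_derivative_compose[OF rd, of F "\<lambda>h. F' * h"] F(1) by (simp add: has_field_derivative_def)
  have d1: "pd Cr (\<lambda>y. - F (rad y)) ?x = - F'" using pd_eqI[OF has_derivative_minus[OF Fd], of Cr] by simp
  have rd2: "((\<lambda>y. (rad y)\<^sup>2) has_derivative (\<lambda>v. 2 * r * fst (snd v))) (at ?x)"
    by (auto intro!: derivative_eq_intros)
  have d2: "pd Cr (\<lambda>y. (rad y)\<^sup>2) ?x = 2 * r" using pd_eqI[OF rd2, of Cr] by simp
  have d3: "pd Cr (\<lambda>y. (rad y)\<^sup>2 * (sin (polar y))\<^sup>2) ?x = 2 * r * (sin \<theta>)\<^sup>2"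
    using pd_eqI[OF has_derivative_mult[OF rd2 sd], of Cr] by simp
  have nf: "normal_form F y n = (if n = Cr then inverse (F (rad y)) * sqrt (F (rad y)) else 0)" for y n
    by (cases n) (simp_all add: normal_form_def UNIV_coord_sum normal_vec_def shell_metric_def)
  have nab: "nabla_normal F ?x m n = 1 / 2 * sqrt (F r) * pd Cr (\<lambda>y. shell_metric F y m n) ?x" if "m \<in> tang" "n \<in> tang" for m n
  proof -
    have mn: "m \<noteq> Cr" "n \<noteq> Cr" using that by (auto simp: tang_def)
    have "christoffel (shell_metric F) ?x Cr m n = - 1 / 2 * F r * pd Cr (\<lambda>y. shell_metric F y m n) ?x"
      using mn F(2) by (simp add: christoffel_def UNIV_coord_sum inv_diag_def shell_metric_def pd_const) (simp only: divide_inverse inverse_inverse_eq mult.commute)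
    then show ?thesis using mn F(2) by (simp add: nabla_normal_def nf UNIV_coord_sum pd_const)
  qed
  have ext: "ext_curv F ?x m n = (if m = Ct then 1 / sqrt (F r) else 1) * (if n = Ct then 1 / sqrt (F r) else 1) * nabla_normal F ?x m n" if "m \<in> tang" "n \<in> tang" for m n
    using that by (auto simp: ext_curv_def UNIV_coord_sum frame_def tang_def)
  have ind: "induced_metric F ?x A A = (if A = Ct then -1 else shell_metric F ?x A A)"
    using AB F(2) by (auto simp: induced_metric_def UNIV_coord_sum frame_def tang_def shell_metric_def)
  have "ext_curv_mixed F ?x A B = 1 / induced_metric F ?x A A * ext_curv F ?x A B"
    using AB by (auto simp: ext_curv_mixed_def tang_sum inv_diag_def tang_def)
  also have "\<dots> = (if A \<noteq> B then 0 else if A = Ct then F' / (2 * sqrt (F r)) else sqrt (F r) / r)"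
  proof -
    have h: "sqrt (F r) * F' / (F r * 2) = F' / (2 * sqrt (F r))"
      by (subst real_sqrt_mult_self[of "F r", unfolded abs_of_pos[OF F(2)], symmetric]) (use F(2) in \<open>simp add: field_simps\<close>)
    have h2: "sqrt (F r) * r / r\<^sup>2 = sqrt (F r) / r" using r by (simp add: power2_eq_square)
    show ?thesis
      unfolding ind ext[OF AB] nab[OF AB] using AB F(2) r s
      by (cases "A = B"; cases A) (simp_all add: shell_metric_def pd_const d1 d2 d3 tang_def h h2)
  qed
  finally show ?thesis .
qed

lemma ext_curv_tendsto:
  assumes "eventually (\<lambda>r. (F has_real_derivative G' r) (at r) \<and> F r = G r) FF"
    and "(G \<longlongrightarrow> f) FF" "(G' \<longlongrightarrow> f') FF" "((\<lambda>r. r) \<longlongrightarrow> c) FF" "0 < f" "0 < c"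
    and "0 < \<theta>" "\<theta> < pi" "A \<in> tang" "B \<in> tang"
  shows "((\<lambda>r. ext_curv_mixed F (t, r, \<theta>, p) A B) \<longlongrightarrow> (if A \<noteq> B then 0 else if A = Ct then f' / (2 * sqrt f) else sqrt f / c)) FF"
proof -
  let ?K = "\<lambda>r. if A \<noteq> B then 0 else if A = Ct then G' r / (2 * sqrt (G r)) else sqrt (G r) / r"
  have "eventually (\<lambda>r. 0 < G r) FF" "eventually (\<lambda>r. 0 < r) FF"
    using order_tendstoD(1)[OF assms(2,5)] order_tendstoD(1)[OF assms(4,6)] by auto
  with assms(1) have "eventually (\<lambda>r. ?K r = ext_curv_mixed F (t, r, \<theta>, p) A B) FF"
  proof eventually_elim
    case (elim r)
    then have d: "(F has_real_derivative G' r) (at r)" "F r = G r" "0 < F r" "0 < r" by auto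
    show ?case unfolding ext_curv_mixed_eq[OF d(1,3,4) assms(7-10)] d(2) ..
  qed
  moreover have "(?K \<longlongrightarrow> (if A \<noteq> B then 0 else if A = Ct then f' / (2 * sqrt f) else sqrt f / c)) FF"
    using assms(5,6) by (cases "A = B"; cases "A = Ct") (auto intro!: tendsto_eq_intros assms(2-4))
  ultimately show ?thesis by (rule Lim_transform_eventually[rotated])
qed

lemma has_jump_add: "has_jump f c j \<Longrightarrow> has_jump g c k \<Longrightarrow> has_jump (\<lambda>r. f r + g r) c (j + k)"
  unfolding has_jump_def
proof (elim exE conjE)
  fix fl fr gl gr assume "(f \<longlongrightarrow> fl) (at_left c)" "(f \<longlongrightarrow> fr) (at_right c)" "j = fr - fl" "(g \<longlongrightarrow> gl) (at_left c)" "(g \<longlongrightarrow> gr) (at_right c)" "k = gr - gl"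
  then show "\<exists>ql qr. ((\<lambda>r. f r + g r) \<longlongrightarrow> ql) (at_left c) \<and> ((\<lambda>r. f r + g r) \<longlongrightarrow> qr) (at_right c) \<and> j + k = qr - ql"
    by (intro exI[of _ "fl + gl"] exI[of _ "fr + gr"]) (auto intro: tendsto_add)
qed

text \<open>A kink of F changes only the \<tau>\<tau> component, by the jump of F' over 2 sqrt F;
  the angular ones sqrt F / r are continuous. The trace therefore jumps exactly as much as that
  component: the surface density cancels, and this jump divided by 8 \<pi> remains as
  pressure.\<close>

lemma israel_tensor_kink:
  assumes l: "eventually (\<lambda>r. (F has_real_derivative Gl r) (at r)) (at_left c)" "(Gl \<longlongrightarrow> dl) (at_left c)"
    and r: "eventually (\<lambda>r. (F has_real_derivative Gr r) (at r)) (at_right c)" "(Gr \<longlongrightarrow> dr) (at_right c)"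
    and F: "isCont F c" "0 < F c" and c: "0 < c"
  shows "is_israel_tensor F c (perfect_layer 0 ((dr - dl) / (16 * pi * sqrt (F c))))"
  unfolding is_israel_tensor_def
proof (intro conjI allI impI)
  fix A B assume "A \<notin> tang \<or> B \<notin> tang"
  then show "perfect_layer 0 ((dr - dl) / (16 * pi * sqrt (F c))) A B = 0"
    by (cases A; cases B) (auto simp: tang_def perfect_layer_def)
next
  fix t \<theta> p :: real assume "0 < \<theta> \<and> \<theta> < pi"
  then have \<theta>: "0 < \<theta>" "\<theta> < pi" by auto
  define J where "J A B = (if A = Ct \<and> B = Ct then (dr - dl) / (2 * sqrt (F c)) else 0)" for A B
  have FF: "(F \<longlongrightarrow> F c) (at_left c)" "(F \<longlongrightarrow> F c) (at_right c)" using F(1) unfolding isCont_def by (auto simp: filterlim_at_split)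
  have j: "has_jump (\<lambda>r. ext_curv_mixed F (t, r, \<theta>, p) A B) c (J A B)" if "A \<in> tang" "B \<in> tang" for A B
    unfolding has_jump_def
  proof (intro exI conjI)
    show "((\<lambda>r. ext_curv_mixed F (t, r, \<theta>, p) A B) \<longlongrightarrow> (if A \<noteq> B then 0 else if A = Ct then dl / (2 * sqrt (F c)) else sqrt (F c) / c)) (at_left c)"
      by (rule ext_curv_tendsto[of F Gl F _ "F c" dl]) (use l FF F c \<theta> that in \<open>auto intro: tendsto_ident_at\<close>)
    show "((\<lambda>r. ext_curv_mixed F (t, r, \<theta>, p) A B) \<longlongrightarrow> (if A \<noteq> B then 0 else if A = Ct then dr / (2 * sqrt (F c)) else sqrt (F c) / c)) (at_right c)"
      by (rule ext_curv_tendsto[of F Gr F _ "F c" dr]) (use r FF F c \<theta> that in \<open>auto intro: tendsto_ident_at\<close>)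
  qed (auto simp: J_def diff_divide_distrib)
  have "has_jump (\<lambda>r. \<Sum>A\<in>tang. ext_curv_mixed F (t, r, \<theta>, p) A A) c (J Ct Ct + J Cth Cth + J Cph Cph)"
    unfolding tang_sum by (intro has_jump_add j) (auto simp: tang_def)
  moreover have "perfect_layer 0 ((dr - dl) / (16 * pi * sqrt (F c))) A B = - 1 / (8 * pi) * (J A B - (if A = B then 1 else 0) * (J Ct Ct + J Cth Cth + J Cph Cph))"
    if "A \<in> tang" "B \<in> tang" for A B
    using that by (cases A; cases B) (auto simp: tang_def perfect_layer_def J_def field_simps)
  ultimately show "\<exists>J Jtr.
          (\<forall>A\<in>tang. \<forall>B\<in>tang. has_jump (\<lambda>r. ext_curv_mixed F (t, r, \<theta>, p) A B) c (J A B)) \<and>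
          has_jump (\<lambda>r. \<Sum>A\<in>tang. ext_curv_mixed F (t, r, \<theta>, p) A A) c Jtr \<and>
          (\<forall>A\<in>tang. \<forall>B\<in>tang. perfect_layer 0 ((dr - dl) / (16 * pi * sqrt (F c))) A B = - 1 / (8 * pi) * (J A B - (if A = B then 1 else 0) * Jtr))"
    using j by blast
qed

section \<open>The two layers of the optimal metric\<close>

context shell begin

lemma Fs_values: "Fs a = 1 - 2 * M1 / a" "Fs R2 = 1 - 2 * M2 / R2" "0 < Fs a" "0 < Fs R2"
proof -
  have "P us a = 0" "P us R2 = 1" using a_facts by (simp_all add: P_us)
  then show "Fs a = 1 - 2 * M1 / a" "Fs R2 = 1 - 2 * M2 / R2" by (simp_all add: Fs_eq lapse_def mass_def)
  show "0 < Fs a" "0 < Fs R2" using F_pos[OF us_A_BV(1), of a] F_pos[OF us_A_BV(1), of R2] a_facts R12 by (simp_all add: Fs_eq)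
qed

lemma Fs_isCont: "2 * M1 < c \<Longrightarrow> isCont Fs c"
proof -
  assume c: "2 * M1 < c"
  let ?K = "(M2 - M1) * (H * R2\<^sup>2) / M1 + M2 / (2 * M1\<^sup>2)"
  have "continuous_on {2 * M1<..} Fs"
    unfolding continuous_on_def
  proof
    fix x assume x: "x \<in> {2 * M1<..}"
    show "(Fs \<longlongrightarrow> Fs x) (at x within {2 * M1<..})"
    proof (rule LIM_zero_cancel, rule Lim_null_comparison)
      show "eventually (\<lambda>r. norm (Fs r - Fs x) \<le> ?K * \<bar>r - x\<bar>) (at x within {2 * M1<..})"
        unfolding eventually_at_filter using Fs_lipschitz x by (intro always_eventually) auto
      have "((\<lambda>r. ?K * \<bar>r - x\<bar>) \<longlongrightarrow> ?K * \<bar>x - x\<bar>) (at x within {2 * M1<..})" by (intro tendsto_intros)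
      then show "((\<lambda>r. ?K * \<bar>r - x\<bar>) \<longlongrightarrow> 0) (at x within {2 * M1<..})" by simp
    qed
  qed
  then show ?thesis using c by (simp add: continuous_on_eq_continuous_at)
qed

lemma Fs_DERIV:
  "0 < r \<Longrightarrow> r < a \<Longrightarrow> (Fs has_real_derivative 2 * M1 / r\<^sup>2) (at r)"
  "a < r \<Longrightarrow> r < R2 \<Longrightarrow> (Fs has_real_derivative 2 * (M1 + (M2 - M1) * inner_P r) / r\<^sup>2 - 2 * \<beta> * r) (at r)"
  "R2 < r \<Longrightarrow> (Fs has_real_derivative 2 * M2 / r\<^sup>2) (at r)"
proof -
  note p = P_us
  have d: "((\<lambda>r. 1 - 2 * m / r) has_real_derivative 2 * m / r\<^sup>2) (at r)" if "0 < r" for m r :: real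
    using that by (auto intro!: derivative_eq_intros simp: power2_eq_square)
  show "(Fs has_real_derivative 2 * M1 / r\<^sup>2) (at r)" if "0 < r" "r < a"
    by (rule has_field_derivative_transform_within_open[OF d[OF that(1)], of "{..<a}"])
      (use that in \<open>auto simp: Fs_eq lapse_def mass_def p\<close>)
  show "(Fs has_real_derivative 2 * M2 / r\<^sup>2) (at r)" if "R2 < r"
    by (rule has_field_derivative_transform_within_open[OF d, of r "{R2<..}"])
      (use that a_facts in \<open>auto simp: Fs_eq lapse_def mass_def p\<close>)
  show "(Fs has_real_derivative 2 * (M1 + (M2 - M1) * inner_P r) / r\<^sup>2 - 2 * \<beta> * r) (at r)" if "a < r" "r < R2"
  proof (rule has_field_derivative_transform_within_open[of "\<lambda>r. 1 - 2 * (M1 + (M2 - M1) * inner_P r) / r" _ _ "{a<..<R2}"])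
    show "((\<lambda>r. 1 - 2 * (M1 + (M2 - M1) * inner_P r) / r) has_real_derivative 2 * (M1 + (M2 - M1) * inner_P r) / r\<^sup>2 - 2 * \<beta> * r) (at r)"
      using that a_facts by (auto intro!: derivative_eq_intros inner_P_DERIV simp: field_simps power2_eq_square)
  qed (use that a_facts in \<open>auto simp: Fs_eq lapse_def mass_def p\<close>)
qed

text \<open>Across \<open>a\<close> and R2 the mass is continuous, so F' jumps only through its term
  -2 \<beta> r: by -2 \<beta> a where the term sets in and by 2 \<beta> R2 where it ends.\<close>

lemma israel_star:
  "is_israel_tensor Fs a (perfect_layer 0 (- (\<beta> * a) / (8 * pi * sqrt (1 - 2 * M1 / a))))"
  "is_israel_tensor Fs R2 (perfect_layer 0 (\<beta> * R2 / (8 * pi * sqrt (1 - 2 * M2 / R2))))"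
proof -
  let ?G = "\<lambda>r. 2 * (M1 + (M2 - M1) * inner_P r) / r\<^sup>2 - 2 * \<beta> * r"
  have iP: "isCont inner_P r" for r by (rule DERIV_isCont[OF inner_P_DERIV])
  have G: "(?G \<longlongrightarrow> ?G c) (at c within X)" "((\<lambda>r. 2 * m / r\<^sup>2) \<longlongrightarrow> 2 * m / c\<^sup>2) (at c within X)" if "0 < c" for c m :: real and X
  proof -
    have "isCont ?G c" using that by (intro continuous_intros iP) auto
    then show "(?G \<longlongrightarrow> ?G c) (at c within X)" using continuous_at_imp_continuous_at_within continuous_within by blast
    have "isCont (\<lambda>r. 2 * m / r\<^sup>2) c" using that by (intro continuous_intros) auto
    then show "((\<lambda>r. 2 * m / r\<^sup>2) \<longlongrightarrow> 2 * m / c\<^sup>2) (at c within X)" using continuous_at_imp_continuous_at_within continuous_within by blast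
  qed
  have half: "(2 * x) / (16 * y) = x / (8 * y)" for x y :: real by (cases "y = 0") (auto simp: field_simps)
  have e: "eventually (\<lambda>r. Q r) (at_left c)" if "d < c" "\<And>r. d < r \<Longrightarrow> r < c \<Longrightarrow> Q r" for Q c and d :: real
    using eventually_at_leftI[of d c Q] that by simp
  have e': "eventually (\<lambda>r. Q r) (at_right c)" if "c < d" "\<And>r. c < r \<Longrightarrow> r < d \<Longrightarrow> Q r" for Q c and d :: real
    using eventually_at_rightI[of c d Q] that by simp
  have "is_israel_tensor Fs a (perfect_layer 0 ((?G a - 2 * M1 / a\<^sup>2) / (16 * pi * sqrt (Fs a))))"
    using a_facts by (intro israel_tensor_kink[OF e[of 0] G(2) e'[of _ R2] G(1) Fs_isCont Fs_values(3)] Fs_DERIV) auto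
  moreover have "(?G a - 2 * M1 / a\<^sup>2) / (16 * pi * sqrt (Fs a)) = - (\<beta> * a) / (8 * pi * sqrt (1 - 2 * M1 / a))"
    using half[of "- (\<beta> * a)" "pi * sqrt (1 - 2 * M1 / a)"] unfolding Fs_values by (simp add: inner_P_ends mult_ac)
  ultimately show "is_israel_tensor Fs a (perfect_layer 0 (- (\<beta> * a) / (8 * pi * sqrt (1 - 2 * M1 / a))))" by (simp only:)
  have "is_israel_tensor Fs R2 (perfect_layer 0 ((2 * M2 / R2\<^sup>2 - ?G R2) / (16 * pi * sqrt (Fs R2))))"
    using a_facts M1R2 by (intro israel_tensor_kink[OF e[of a] G(1) e'[of _ "R2 + 1"] G(2) Fs_isCont Fs_values(4)] Fs_DERIV) auto
  moreover have "(2 * M2 / R2\<^sup>2 - ?G R2) / (16 * pi * sqrt (Fs R2)) = \<beta> * R2 / (8 * pi * sqrt (1 - 2 * M2 / R2))"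
    using half[of "\<beta> * R2" "pi * sqrt (1 - 2 * M2 / R2)"] unfolding Fs_values by (simp add: inner_P_ends mult_ac)
  ultimately show "is_israel_tensor Fs R2 (perfect_layer 0 (\<beta> * R2 / (8 * pi * sqrt (1 - 2 * M2 / R2))))" by (simp only:)
qed

lemma singular_part_star:
  assumes I: "open I" "I \<subseteq> {2 * M1<..}"
  shows "has_singular_part (chart I) (einstein Fs m n)
    (\<lambda>\<phi>. 8 * pi * (spacetime_tensor Fs a (perfect_layer 0 (- (\<beta> * a) / (8 * pi * sqrt (1 - 2 * M1 / a)))) m n * delta_Sigma Fs a \<phi>
                   + spacetime_tensor Fs R2 (perfect_layer 0 (\<beta> * R2 / (8 * pi * sqrt (1 - 2 * M2 / R2)))) m n * delta_Sigma Fs R2 \<phi>))"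
    (is "has_singular_part _ _ ?S")
proof -
  \<comment> \<open>As \<beta> is nonnegative, the layer at R2 enters with a positive and the layer
    at \<open>a\<close> with a negative sign, so they form the two parts of a signed
    measure.\<close>
  define k l where "k = (if m = n \<and> m \<in> {Cth, Cph} then \<beta> * R2 else 0)" and "l = (if m = n \<and> m \<in> {Cth, Cph} then \<beta> * a else 0)"
  define b where "b = (if m = n then - 2 * \<beta> else 0)"
  have S: "?S \<phi> = k * delta_r R2 \<phi> - l * delta_r a \<phi>" and R: "einstein Fs m n \<phi> - ?S \<phi> = b * fun_distrib (\<lambda>x. indicator {a<..<R2} (rad x)) \<phi>"
    if "test_fun (chart I) \<phi>" for \<phi>
  proof -
    interpret shell_test M1 M2 R1 R2 I \<phi> by unfold_locales (use I that M1 in auto)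
    have s: "sqrt (Fs a) \<noteq> 0" "sqrt (Fs R2) \<noteq> 0" using Fs_values(3,4) by auto
    have d: "delta_Sigma Fs a \<phi> = sqrt (Fs a) * delta_r a \<phi>" "delta_Sigma Fs R2 \<phi> = sqrt (Fs R2) * delta_r R2 \<phi>"
      using delta_Sigma_eq[of Fs] Fs_values(3,4) a_facts by auto
    show S: "?S \<phi> = k * delta_r R2 \<phi> - l * delta_r a \<phi>"
      unfolding spacetime_perfect_layer d k_def l_def Fs_values(1,2)[symmetric] using s by (auto simp: field_simps)
    show "einstein Fs m n \<phi> - ?S \<phi> = b * fun_distrib (\<lambda>x. indicator {a<..<R2} (rad x)) \<phi>"
      unfolding S by (cases "m = n"; cases m) (simp_all add: einstein_star k_def l_def b_def)
  qed
  have "0 \<le> \<beta>" using M12 H_pos by simp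
  then have "0 \<le> k" "0 \<le> l" using a_facts by (auto simp: k_def l_def)
  then show ?thesis unfolding has_singular_part_def
    using singular_layers[of "chart I" ?S, OF S] regular_indicator[of "chart I" "\<lambda>\<phi>. einstein Fs m n \<phi> - ?S \<phi>", OF R] by blast
qed

end


section \<open>Thin shells and the main theorem\<close>

text \<open>As L tends to 0 the cubic at R1 tends to 3 R1^3 (R1 - 2 M1) > 0, so thin shells are in
  the boundary case and the value is \<open>Psi\<close> at R1. Factoring A as L (R1^2 + R1 L + L^2 /
  3) isolates the pole, and the rest is bounded.\<close>

lemma lambda_star_thin_shell:
  assumes "0 < M1" "2 * M1 < R1"
  shows "(\<lambda>L. lambda_star M1 R1 (R1 + L) - R1 powr (3/2) / sqrt (R1 - 2 * M1) * (1 / L)) \<in> O[at_right 0](\<lambda>_. 1)"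
proof -
  define K where "K = R1 powr (3/2) / sqrt (R1 - 2 * M1)"
  have R: "0 < R1" and K: "0 < K" using assms by (auto simp: K_def)
  have q: "q_weight M1 R1 = R1\<^sup>2 * K"
  proof -
    have "R1 powr (7/2) = R1 powr 2 * R1 powr (3/2)" by (subst powr_add[symmetric]) simp
    then show ?thesis using R by (simp add: q_weight_def K_def)
  qed
  let ?g = "\<lambda>L. M1 * R1 ^ 3 + 3 * (R1 + L) ^ 3 * R1 - 7 * M1 * (R1 + L) ^ 3"
  have "(?g \<longlongrightarrow> ?g 0) (at_right 0)" by (intro tendsto_intros)
  moreover have "?g 0 = 3 * R1 ^ 3 * (R1 - 2 * M1)" by (simp add: algebra_simps)
  then have "0 < ?g 0" using R assms by simp
  ultimately have "eventually (\<lambda>L. 0 < ?g L) (at_right 0)" by (rule order_tendstoD(1))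
  moreover have "eventually (\<lambda>L. 0 < L \<and> L < 1) (at_right (0::real))"
    by (rule eventually_at_rightI[of 0 1]) auto
  ultimately have "eventually (\<lambda>L. norm (lambda_star M1 R1 (R1 + L) - K * (1 / L)) \<le> K * (R1 + 1) / R1\<^sup>2 * norm (1::real)) (at_right 0)"
  proof eventually_elim
    case (elim L)
    then have L: "0 < L" "L < 1" by auto
    have "x0 M1 (R1 + L) < R1" using x0_less_iff[of M1 "R1 + L" R1] assms R L elim(1) by simp
    then have "lambda_star M1 R1 (R1 + L) = R1\<^sup>2 * K / A_weight (R1 + L) R1"
      by (simp add: lambda_star_def Psi_def rising_radius_def q)
    also have "A_weight (R1 + L) R1 = L * (R1\<^sup>2 + R1 * L + L\<^sup>2 / 3)"
      by (simp add: A_weight_def field_simps power2_eq_square power3_eq_cube)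
    finally have e: "lambda_star M1 R1 (R1 + L) = R1\<^sup>2 * K / (L * (R1\<^sup>2 + R1 * L + L\<^sup>2 / 3))" .
    define Q where "Q = R1\<^sup>2 + R1 * L + L\<^sup>2 / 3"
    have Q: "R1\<^sup>2 \<le> Q" "0 < Q" using R L by (auto simp: Q_def intro!: add_pos_nonneg)
    have "lambda_star M1 R1 (R1 + L) - K * (1 / L) = K * (R1\<^sup>2 - Q) / (L * Q)"
      unfolding e Q_def[symmetric] using L Q by (simp add: field_simps)
    also have "R1\<^sup>2 - Q = - (L * (R1 + L / 3))" by (simp add: Q_def field_simps power2_eq_square)
    also have "K * - (L * (R1 + L / 3)) / (L * Q) = - (K * (R1 + L / 3) / Q)" using L by simp
    finally have "norm (lambda_star M1 R1 (R1 + L) - K * (1 / L)) = K * (R1 + L / 3) / Q" using K R L Q by simp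
    also have "\<dots> \<le> K * (R1 + 1) / R1\<^sup>2" using K R L Q by (intro frac_le mult_mono) auto
    finally show ?case by simp
  qed
  then show ?thesis unfolding K_def[symmetric] by (rule bigoI)
qed

lemma (in shell) tangential_pressure:
  "4 * pi * a^2 * (- (- (\<beta> * a) / (8 * pi * sqrt (1 - 2 * M1 / a)))) = (M2 - M1) / 2 * lam"
proof -
  define d where "d = sqrt (1 - 2 * M1 / a)"
  have "0 < d" using real_sqrt_gt_zero[OF Fs_values(3)] unfolding d_def Fs_values(1) .
  then have s: "d \<noteq> 0" by simp
  have "q a = a ^ 3 / d" unfolding d_def using a_facts M1 by (intro q_weight_alt) auto
  then have "lam = a ^ 3 / d * H" by (simp only: lam_eq)
  then show ?thesis unfolding d_def[symmetric] using s by (simp add: power2_eq_square power3_eq_cube)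
qed

theorem theorem1p1:
  fixes M1 M2 R1 R2 :: real
  assumes "0 < M1" and "M1 < M2" and "2 * M2 < R1" and "R1 < R2"
  shows
   "let \<Delta> = M2 - M1;
        a = rising_radius M1 R1 R2;
        lam = lambda_star M1 R1 R2;
        H = H_star M1 R1 R2;
        us = u_star M1 R1 R2;
        Fs = lapse_star M1 M2 R1 R2;
        \<beta> = \<Delta> * H;
        pa = - (\<beta> * a) / (8 * pi * sqrt (1 - 2 * M1 / a));
        pR = \<beta> * R2 / (8 * pi * sqrt (1 - 2 * M2 / R2));
        \<I> = I_fun M1 M2 R1 R2;
        \<J> = J_fun M1 M2 R1 R2;
        \<delta> = deficit M1 M2 R1 R2;
        dev = deviation M1 M2 R1 R2;
        minimizing = (\<lambda>u :: nat \<Rightarrow> real \<Rightarrow> real.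
          (\<forall>n. u n \<in> A_smooth R1 R2) \<and> (\<lambda>n. \<I> (u n)) \<longlonglongrightarrow> lam);
        radial_interval = (\<lambda>I :: real set.
          open I \<and> is_interval I \<and> {R1..R2} \<subseteq> I \<and> I \<subseteq> {2 * M1<..})
    in
    \<comment> \<open>(i)\<close>
    ((\<forall>u\<in>A_BV R1 R2. I_rel M1 M2 R1 R2 u = ereal (\<J> u)) \<and>
     us \<in> A_BV R1 R2 \<and> \<J> us = lam \<and> (\<forall>u\<in>A_BV R1 R2. lam \<le> \<J> u) \<and>
     (INF u\<in>A_smooth R1 R2. ereal (\<I> u)) = ereal lam \<and>
     (\<forall>u\<in>A_BV R1 R2. (\<forall>v\<in>A_BV R1 R2. \<J> u \<le> \<J> v) \<longleftrightarrow> (AE r in lborel. u r = us r)) \<and>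
     (\<forall>u\<in>A_smooth R1 R2. ereal (\<I> u) \<noteq> (INF v\<in>A_smooth R1 R2. ereal (\<I> v)))) \<and>
    \<comment> \<open>(ii)\<close>
    (\<forall>u. minimizing u \<longrightarrow>
       L1_conv u us \<and>
       weak_star (\<lambda>n. pos_deriv_measure (u n)) (dirac H a) \<and>
       weak_star (\<lambda>n. neg_deriv_measure (u n)) (dirac H R2) \<and>
       strict_BV_conv u us) \<and>
    \<comment> \<open>(iii)\<close>
    ((\<exists>C. \<forall>u\<in>A_BV R1 R2. \<delta> u \<le> 1 \<longrightarrow>
        (a = x0 M1 R2 \<longrightarrow> dev u \<le> C * sqrt (\<delta> u)) \<and>
        (a = R1 \<and> R1 > x0 M1 R2 \<longrightarrow> dev u \<le> C * \<delta> u)) \<and>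
     (a = x0 M1 R2 \<longrightarrow>
        (\<forall>p>1/2. \<not> (\<exists>C. \<forall>u\<in>A_BV R1 R2. \<delta> u \<le> 1 \<longrightarrow> dev u \<le> C * \<delta> u powr p))) \<and>
     (a = R1 \<and> R1 > x0 M1 R2 \<longrightarrow>
        (\<forall>p>1. \<not> (\<exists>C. \<forall>u\<in>A_BV R1 R2. \<delta> u \<le> 1 \<longrightarrow> dev u \<le> C * \<delta> u powr p)))) \<and>
    \<comment> \<open>(iv)\<close>
    ((\<forall>R\<in>{2 * M2<..<R2}.
        (R \<le> x0 M1 R2 \<longrightarrow> rising_radius M1 R R2 = x0 M1 R2 \<and>
           (INF u\<in>A_smooth R R2. ereal (I_fun M1 M2 R R2 u)) = ereal (Psi M1 R2 (x0 M1 R2))) \<and>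
        (R > x0 M1 R2 \<longrightarrow> rising_radius M1 R R2 = R \<and>
           (INF u\<in>A_smooth R R2. ereal (I_fun M1 M2 R R2 u)) = ereal (Psi M1 R2 R))) \<and>
     (\<lambda>L. lambda_star M1 R1 (R1 + L) - R1 powr (3/2) / sqrt (R1 - 2 * M1) * (1 / L))
        \<in> O[at_right 0](\<lambda>_. 1) \<and>
     (\<forall>R\<in>{2 * M2<..<R2}. R \<le> x0 M1 R2 \<longrightarrow> x0 M1 R2 > 2 * M2) \<and>
     x0 M1 R2 < 7 * M1 / 3 \<and>
     (x0 M1 R2 > 2 * M2 \<longrightarrow> \<Delta> / M1 < 1/6) \<and>
     (\<Delta> / M1 \<ge> 1/6 \<longrightarrow>
        (\<forall>R\<in>{2 * M2<..<R2}. rising_radius M1 R R2 = R \<and> R > x0 M1 R2))) \<and>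
    \<comment> \<open>(v)\<close>
    (\<forall>I. radial_interval I \<longrightarrow>
       (\<forall>m n. loc_lipschitz (chart I) (\<lambda>x. shell_metric Fs x m n)) \<and>
       (\<forall>u. minimizing u \<longrightarrow>
          (\<forall>m n. uniform_limit (chart I)
             (\<lambda>k x. shell_metric (lapse M1 M2 R1 R2 (u k)) x m n) (\<lambda>x. shell_metric Fs x m n) sequentially) \<and>
          (\<forall>m n \<phi>. test_fun (chart I) \<phi> \<longrightarrow>
             (\<lambda>k. einstein (lapse M1 M2 R1 R2 (u k)) m n \<phi>) \<longlonglongrightarrow> einstein Fs m n \<phi>)) \<and>
       (\<forall>\<phi>. test_fun (chart I) \<phi> \<longrightarrow>
          (\<forall>m\<in>{Ct, Cr}. einstein Fs m m \<phi> =
             - 2 * \<beta> * fun_distrib (\<lambda>x. indicator {a<..<R2} (rad x)) \<phi>) \<and>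
          (\<forall>m\<in>{Cth, Cph}. einstein Fs m m \<phi> =
             - 2 * \<beta> * fun_distrib (\<lambda>x. indicator {a<..<R2} (rad x)) \<phi>
             - \<beta> * a * delta_r a \<phi> + \<beta> * R2 * delta_r R2 \<phi>) \<and>
          (\<forall>m n. m \<noteq> n \<longrightarrow> einstein Fs m n \<phi> = 0))) \<and>
    \<comment> \<open>(vi)\<close>
    ((\<exists>Sa SR.
        is_israel_tensor Fs a Sa \<and> is_israel_tensor Fs R2 SR \<and>
        (\<forall>I. radial_interval I \<longrightarrow>
          (\<forall>m n. has_singular_part (chart I) (einstein Fs m n)
            (\<lambda>\<phi>. 8 * pi * (spacetime_tensor Fs a Sa m n * delta_Sigma Fs a \<phi>
                           + spacetime_tensor Fs R2 SR m n * delta_Sigma Fs R2 \<phi>)))) \<and>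
        Sa = perfect_layer 0 pa \<and> SR = perfect_layer 0 pR) \<and>
     (\<forall>u. minimizing u \<longrightarrow>
        (\<exists>\<kappa>>0. weak_star (\<lambda>n. NEC_measure M1 M2 R1 R2 (u n)) (dirac \<kappa> a))) \<and>
     4 * pi * a^2 * (- pa) = \<Delta> / 2 * lam)"
proof -
  interpret shell M1 M2 R1 R2 by unfold_locales (fact assms)+
  have min: "minimizing u" if "(\<forall>n. u n \<in> A_smooth R1 R2) \<and> (\<lambda>n. I_fun M1 M2 R1 R2 (u n)) \<longlonglongrightarrow> lam" for u
    using that by (simp add: minimizing_def)
  have test: "shell_test M1 M2 R1 R2 I \<phi>" if "open I \<and> is_interval I \<and> {R1..R2} \<subseteq> I \<and> I \<subseteq> {2 * M1<..}" "test_fun (chart I) \<phi>" for I \<phi>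
    using that M1 by unfold_locales auto
  note x0 = x0_facts[OF M1 M1R2]
  show ?thesis
    unfolding Let_def
  \<comment> \<open>Goals 1 to 7 make up (i), 8 is (ii), 9 to 11 are (iii), 12 to 17 are (iv), 18 is
    (v) and 19 to 21 are (vi).\<close>
  proof ((intro conjI; (intro ballI allI impI)?), goal_cases)
    case (1 u) then show ?case by (rule relaxation)
  next
    case 2 show ?case by (rule us_A_BV)
  next
    case 3 show ?case by (rule us_A_BV)
  next
    case (4 u) then show ?case using deficit_nonneg(1) by (simp add: deficit_def)
  next
    case 5 show ?case by (rule INF_I)
  next
    case (6 u) then show ?case by (rule minimizer_iff)
  next
    case (7 u) then show ?case unfolding INF_I using smooth_deficit_pos by simp
  next
    case (8 u)
    note m = min[OF 8]
    show ?case using minimizing_limits(2)[OF m] minimizing_weak_star[OF m] by blast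
  next
    case 9 show ?case by (rule stability)
  next
    case (10 p) then show ?case by (intro optimal_interior)
  next
    case (11 p) then show ?case by (intro optimal_boundary) auto
  next
    case (12 R)
    \<comment> \<open>The inner radius is the variable here, so the whole development is
      instantiated at R.\<close>
    then interpret R: shell M1 M2 R R2 by unfold_locales (use assms in auto)
    show ?case using R.INF_I by (auto simp: rising_radius_def lambda_star_def)
  next
    case 13 show ?case by (rule lambda_star_thin_shell[OF M1 M1R1])
  next
    case (14 R) then show ?case by simp
  next
    case 15 show ?case by (rule x0)
  next
    \<comment> \<open>From 2 M2 < x0 < 7 M1 / 3 follows M2 / M1 < 7/6.\<close>
    case 16 then show ?case using x0 M1 by (simp add: field_simps)
  next
    case (17 R)
    then have "x0 M1 R2 < R" using x0 M1 by (simp add: field_simps)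
    then show ?case by (simp add: rising_radius_def)
  next
    case (18 I) show ?case
    proof (intro conjI allI impI)
      fix m n show "loc_lipschitz (chart I) (\<lambda>x. shell_metric Fs x m n)" using 18 by (intro Fs_metric_lipschitz) simp
    next
      fix u m n assume "(\<forall>n. u n \<in> A_smooth R1 R2) \<and> (\<lambda>n. I_fun M1 M2 R1 R2 (u n)) \<longlonglongrightarrow> lam"
      from min[OF this] show "uniform_limit (chart I) (\<lambda>k x. shell_metric (F (u k)) x m n) (\<lambda>x. shell_metric Fs x m n) sequentially"
        by (rule minimizing_metric_limit)
    next
      fix u m n \<phi> assume "(\<forall>n. u n \<in> A_smooth R1 R2) \<and> (\<lambda>n. I_fun M1 M2 R1 R2 (u n)) \<longlonglongrightarrow> lam" "test_fun (chart I) \<phi>"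
      then show "(\<lambda>k. einstein (F (u k)) m n \<phi>) \<longlonglongrightarrow> einstein Fs m n \<phi>"
        by (intro shell_test.minimizing_einstein_limit[OF test[OF 18]] min)
    qed (use shell_test.einstein_star[OF test[OF 18]] in blast)+
  next
    case 19 show ?case
      by (rule exI, rule exI, rule conjI[OF israel_star(1)], rule conjI[OF israel_star(2)])
        (intro conjI allI impI singular_part_star refl; simp)
  next
    case (20 u)
    have "0 < (M2 - M1) / 2 * lam" using M12 lam_pos by simp
    then show ?case using NEC_weak_star[OF min[OF 20]] by blast
  next
    case 21 show ?case by (rule tangential_pressure)
  qed
qed

end
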